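(* Let $L$ be a smashing localisation of a big tensor-triangulated category $\mathsf{T}$, and let $\mathcal{D}$ be a definable subcategory of $\mathsf{T}$. Then $L\mathcal{D}$ is a definable subcategory of $L\mathsf{T}$; moreover, $(L\mathcal{D})^{d}=L(\mathcal{D}^{d})$.
   Context: A big tensor-triangulated category is a compactly generated triangulated category $\mathsf{T}$ with a compatible closed symmetric monoidal structure (product $\otimes$, unit $\mathbb{1}$, internal hom $F$) whose compact objects $\mathsf{T}^{\mathrm{c}}$ coincide with its rigid objects ($X$ is rigid if $F(X,\mathbb{1})\otimes Y\to F(X,Y)$ is an isomorphism for all $Y$). A localisation is an exact functor $L\colon\mathsf{T}\to\mathsf{T}$ with a natural transformation $\eta\colon\mathrm{Id}\to L$ such that $L\eta$ is invertible, $L\eta=\eta L$, and $\ker(L)$ is a $\otimes$-ideal; it is smashing if it preserves coproducts (equivalently $L\mathbb{1}\otimes X\to LX$ is an isomorphism for all $X$). $X$ is $L$-local if $\eta_X$ is an isomorphism; $L\mathsf{T}$ is the full subcategory of $L$-local objects. For $L$ smashing, $L\mathsf{T}$ is again a big tensor-triangulated category, with the same product and internal hom as $\mathsf{T}$ and unit $L\mathbb{1}$. For a class $\mathsf{A}\subseteq\mathsf{T}$, $L\mathsf{A}$ denotes the class of objects $X$ such that $X$ is $L$-local and $X\in\mathsf{A}$. For a big tensor-triangulated category $\mathsf{S}$ with unit $\mathbb{1}_{\mathsf{S}}$: a class $\mathcal{D}\subseteq\mathsf{S}$ is definable if there is a set of maps $f_i$ in $\mathsf{S}^{\mathrm{c}}$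 with $\mathcal{D}=\{X:\mathrm{Hom}_{\mathsf{S}}(f_i,X)\text{ is surjective for all }i\}$. $(\mathsf{S}^{\mathrm{c}},\mathbf{Ab})^{\mathrm{fp}}$ is the category of finitely presented functors $G=\mathrm{coker}(\mathrm{Hom}_{\mathsf{S}}(f,-)|_{\mathsf{S}^{\mathrm{c}}})$, $f$ a map in $\mathsf{S}^{\mathrm{c}}$; $\widetilde{G}\colon\mathsf{S}\to\mathbf{Ab}$ is the same cokernel computed on $\mathsf{S}$. With $D=F(-,\mathbb{1}_{\mathsf{S}})$, put $\mathcal{S}_{\mathcal{D}}=\{G:\widetilde{G}(X)=0\ \forall X\in\mathcal{D}\}$ and $(\delta G)(Y)=\mathrm{Hom}_{(\mathsf{S}^{\mathrm{c}},\mathbf{Ab})}(G,\mathrm{Hom}_{\mathsf{S}}(DY,-))$, an exact contravariant autoequivalence of $(\mathsf{S}^{\mathrm{c}},\mathbf{Ab})^{\mathrm{fp}}$. The dual definable category of $\mathcal{D}$ in $\mathsf{S}$ is $\mathcal{D}^{d}=\{Y\in\mathsf{S}:\widetilde{H}(Y)=0\ \forall H\in\delta\mathcal{S}_{\mathcal{D}}\}$. In the claim, $\mathcal{D}^d$ is formed in $\mathsf{S}=\mathsf{T}$ and $(L\mathcal{D})^d$ in $\mathsf{S}=L\mathsf{T}$. *)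

theory Defs
  imports "HOL-Algebra.Product_Groups" "HOL-Algebra.Free_Abelian_Groups"
begin

unbundle cardinal_syntax

section \<open>Size\<close>

text \<open>
  A type \<open>'u\<close> of inaccessible cardinality plays the role of a universe: ``set'' means a
  collection of cardinality less than that of \<open>'u\<close>, and arbitrary sets of objects or arrows
  are ``classes''. Without such a bound no category other than a preorder would have coproducts
  indexed by all sets.
\<close>

definition universe :: "'u itself \<Rightarrow> bool" where
  "universe U \<longleftrightarrow>
     natLeq <o |UNIV :: 'u set| \<and>
     regularCard |UNIV :: 'u set| \<and>
     (\<forall>A :: 'u set. |A| <o |UNIV :: 'u set| \<longrightarrow> |Pow A| <o |UNIV :: 'u set| )"

definition small :: "'u itself \<Rightarrow> 'a set \<Rightarrow> bool" where
  "small U A \<longleftrightarrow> |A| <o |UNIV :: 'u set|"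


section \<open>Categories, functors and natural transformations\<close>

record ('o, 'm) category =
  Obj :: "'o set"
  Arr :: "'m set"
  Dom :: "'m \<Rightarrow> 'o"
  Cod :: "'m \<Rightarrow> 'o"
  Id :: "'o \<Rightarrow> 'm"
  Comp :: "'m \<Rightarrow> 'm \<Rightarrow> 'm"  (infixr \<open>\<cdot>\<index>\<close> 70)

definition homset :: "('o, 'm, 'z) category_scheme \<Rightarrow> 'o \<Rightarrow> 'o \<Rightarrow> 'm set" where
  "homset C X Y = {f \<in> Arr C. Dom C f = X \<and> Cod C f = Y}"

locale category =
  fixes C :: "('o, 'm, 'z) category_scheme" (structure)
  assumes dom_cod: "f \<in> Arr C \<Longrightarrow> Dom C f \<in> Obj C \<and> Cod C f \<in> Obj C"
    and id_arr: "X \<in> Obj C \<Longrightarrow> Id C X \<in> homset C X X"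
    and comp_arr: "\<lbrakk>f \<in> homset C X Y; g \<in> homset C Y Z\<rbrakk> \<Longrightarrow> g \<cdot> f \<in> homset C X Z"
    and id_left: "f \<in> homset C X Y \<Longrightarrow> Id C Y \<cdot> f = f"
    and id_right: "f \<in> homset C X Y \<Longrightarrow> f \<cdot> Id C X = f"
    and comp_assoc: "\<lbrakk>f \<in> homset C W X; g \<in> homset C X Y; h \<in> homset C Y Z\<rbrakk>
      \<Longrightarrow> (h \<cdot> g) \<cdot> f = h \<cdot> (g \<cdot> f)"

definition is_inverse :: "('o, 'm, 'z) category_scheme \<Rightarrow> 'm \<Rightarrow> 'm \<Rightarrow> bool" where
  "is_inverse C f g \<longleftrightarrow>
     g \<in> homset C (Cod C f) (Dom C f) \<and>
     g \<cdot>\<^bsub>C\<^esub> f = Id C (Dom C f) \<and> f \<cdot>\<^bsub>C\<^esub> g = Id C (Cod C f)"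

definition iso_arr :: "('o, 'm, 'z) category_scheme \<Rightarrow> 'm \<Rightarrow> bool" where
  "iso_arr C f \<longleftrightarrow> f \<in> Arr C \<and> (\<exists>g. is_inverse C f g)"

definition inv_arr :: "('o, 'm, 'z) category_scheme \<Rightarrow> 'm \<Rightarrow> 'm" where
  "inv_arr C f = (THE g. is_inverse C f g)"

definition is_coproduct ::
  "('o, 'm, 'z) category_scheme \<Rightarrow> 'i set \<Rightarrow> ('i \<Rightarrow> 'o) \<Rightarrow> 'o \<Rightarrow> ('i \<Rightarrow> 'm) \<Rightarrow> bool" where
  "is_coproduct C I X P \<iota> \<longleftrightarrow>
     P \<in> Obj C \<and> (\<forall>i\<in>I. \<iota> i \<in> homset C (X i) P) \<and>
     (\<forall>Z\<in>Obj C. \<forall>f. (\<forall>i\<in>I. f i \<in> homset C (X i) Z) \<longrightarrow>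
        (\<exists>!u. u \<in> homset C P Z \<and> (\<forall>i\<in>I. u \<cdot>\<^bsub>C\<^esub> \<iota> i = f i)))"

record ('o, 'm, 'p, 'n) cat_functor =
  fobj :: "'o \<Rightarrow> 'p"
  farr :: "'m \<Rightarrow> 'n"

definition id_functor :: "('o, 'm, 'o, 'm) cat_functor" where
  "id_functor = \<lparr>fobj = id, farr = id\<rparr>"

definition comp_functor ::
  "('p, 'n, 'q, 'k) cat_functor \<Rightarrow> ('o, 'm, 'p, 'n) cat_functor \<Rightarrow> ('o, 'm, 'q, 'k) cat_functor"
  where "comp_functor G F = \<lparr>fobj = fobj G \<circ> fobj F, farr = farr G \<circ> farr F\<rparr>"

definition is_functor ::
  "('o, 'm, 'z) category_scheme \<Rightarrow> ('p, 'n, 'y) category_scheme \<Rightarrow>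
   ('o, 'm, 'p, 'n) cat_functor \<Rightarrow> bool" where
  "is_functor C D F \<longleftrightarrow>
     (\<forall>X\<in>Obj C. fobj F X \<in> Obj D) \<and>
     (\<forall>f\<in>Arr C. farr F f \<in> homset D (fobj F (Dom C f)) (fobj F (Cod C f))) \<and>
     (\<forall>X\<in>Obj C. farr F (Id C X) = Id D (fobj F X)) \<and>
     (\<forall>f\<in>Arr C. \<forall>g\<in>Arr C. Cod C f = Dom C g \<longrightarrow>
        farr F (g \<cdot>\<^bsub>C\<^esub> f) = farr F g \<cdot>\<^bsub>D\<^esub> farr F f)"

definition is_equivalence ::
  "('o, 'm, 'z) category_scheme \<Rightarrow> ('p, 'n, 'y) category_scheme \<Rightarrow>
   ('o, 'm, 'p, 'n) cat_functor \<Rightarrow> bool" where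
  "is_equivalence C D F \<longleftrightarrow>
     is_functor C D F \<and>
     (\<forall>X\<in>Obj C. \<forall>Y\<in>Obj C. bij_betw (farr F) (homset C X Y) (homset D (fobj F X) (fobj F Y))) \<and>
     (\<forall>Z\<in>Obj D. \<exists>X\<in>Obj C. \<exists>f\<in>homset D (fobj F X) Z. iso_arr D f)"

definition nat_trans ::
  "('o, 'm, 'z) category_scheme \<Rightarrow> ('p, 'n, 'y) category_scheme \<Rightarrow>
   ('o, 'm, 'p, 'n) cat_functor \<Rightarrow> ('o, 'm, 'p, 'n) cat_functor \<Rightarrow> ('o \<Rightarrow> 'n) \<Rightarrow> bool" where
  "nat_trans C D F G \<theta> \<longleftrightarrow>
     (\<forall>X\<in>Obj C. \<theta> X \<in> homset D (fobj F X) (fobj G X)) \<and>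
     (\<forall>f\<in>Arr C. farr G f \<cdot>\<^bsub>D\<^esub> \<theta> (Dom C f) = \<theta> (Cod C f) \<cdot>\<^bsub>D\<^esub> farr F f)"

definition nat_iso ::
  "('o, 'm, 'z) category_scheme \<Rightarrow> ('p, 'n, 'y) category_scheme \<Rightarrow>
   ('o, 'm, 'p, 'n) cat_functor \<Rightarrow> ('o, 'm, 'p, 'n) cat_functor \<Rightarrow> ('o \<Rightarrow> 'n) \<Rightarrow> bool" where
  "nat_iso C D F G \<theta> \<longleftrightarrow> nat_trans C D F G \<theta> \<and> (\<forall>X\<in>Obj C. iso_arr D (\<theta> X))"


section \<open>Additive categories\<close>

record ('o, 'm) additive_category = "('o, 'm) category" +
  Add :: "'m \<Rightarrow> 'm \<Rightarrow> 'm"  (infixl \<open>\<boxplus>\<index>\<close> 65)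
  Zero :: "'o \<Rightarrow> 'o \<Rightarrow> 'm"

definition hom_group :: "('o, 'm, 'z) additive_category_scheme \<Rightarrow> 'o \<Rightarrow> 'o \<Rightarrow> 'm monoid" where
  "hom_group C X Y = \<lparr>carrier = homset C X Y, mult = Add C, one = Zero C X Y\<rparr>"

definition neg_arr :: "('o, 'm, 'z) additive_category_scheme \<Rightarrow> 'm \<Rightarrow> 'm" where
  "neg_arr C f = inv\<^bsub>hom_group C (Dom C f) (Cod C f)\<^esub> f"

definition zero_object :: "('o, 'm, 'z) additive_category_scheme \<Rightarrow> 'o \<Rightarrow> bool" where
  "zero_object C Z \<longleftrightarrow>
     Z \<in> Obj C \<and> (\<forall>X\<in>Obj C. homset C Z X = {Zero C Z X} \<and> homset C X Z = {Zero C X Z})"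

text \<open>In a preadditive category a binary coproduct is a biproduct.\<close>

locale additive_category = category C
  for C :: "('o, 'm, 'z) additive_category_scheme" (structure) +
  assumes hom_comm_group: "\<lbrakk>X \<in> Obj C; Y \<in> Obj C\<rbrakk> \<Longrightarrow> comm_group (hom_group C X Y)"
    and comp_add_left: "\<lbrakk>f \<in> homset C X Y; g \<in> homset C Y Z; h \<in> homset C Y Z\<rbrakk>
      \<Longrightarrow> (g \<boxplus> h) \<cdot> f = g \<cdot> f \<boxplus> h \<cdot> f"
    and comp_add_right: "\<lbrakk>f \<in> homset C X Y; g \<in> homset C X Y; h \<in> homset C Y Z\<rbrakk>
      \<Longrightarrow> h \<cdot> (f \<boxplus> g) = h \<cdot> f \<boxplus> h \<cdot> g"
    and zero_object_exists: "\<exists>Z. zero_object C Z"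
    and binary_coproducts: "\<forall>b. Xs b \<in> Obj C \<Longrightarrow> \<exists>P \<iota>. is_coproduct C (UNIV :: bool set) Xs P \<iota>"

definition additive_functor ::
  "('o, 'm, 'z) additive_category_scheme \<Rightarrow> ('p, 'n, 'y) additive_category_scheme \<Rightarrow>
   ('o, 'm, 'p, 'n) cat_functor \<Rightarrow> bool" where
  "additive_functor C D F \<longleftrightarrow>
     is_functor C D F \<and>
     (\<forall>X\<in>Obj C. \<forall>Y\<in>Obj C. farr F \<in> hom (hom_group C X Y) (hom_group D (fobj F X) (fobj F Y)))"


section \<open>Triangulated categories\<close>

record ('o, 'm) triangulated_category = "('o, 'm) additive_category" +
  Susp :: "('o, 'm, 'o, 'm) cat_functor"
  Tri :: "('m \<times> 'm \<times> 'm) set"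

definition candidate_triangle ::
  "('o, 'm, 'z) triangulated_category_scheme \<Rightarrow> 'm \<times> 'm \<times> 'm \<Rightarrow> bool" where
  "candidate_triangle C = (\<lambda>(f, g, h).
     f \<in> Arr C \<and> g \<in> homset C (Cod C f) (Dom C h) \<and>
     h \<in> homset C (Cod C g) (fobj (Susp C) (Dom C f)))"

definition triangle_map ::
  "('o, 'm, 'z) triangulated_category_scheme \<Rightarrow> 'm \<times> 'm \<times> 'm \<Rightarrow> 'm \<times> 'm \<times> 'm \<Rightarrow>
   'm \<Rightarrow> 'm \<Rightarrow> 'm \<Rightarrow> bool" where
  "triangle_map C = (\<lambda>(f, g, h) (f', g', h') a b c.
     a \<in> homset C (Dom C f) (Dom C f') \<and>
     b \<in> homset C (Dom C g) (Dom C g') \<and>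
     c \<in> homset C (Dom C h) (Dom C h') \<and>
     b \<cdot>\<^bsub>C\<^esub> f = f' \<cdot>\<^bsub>C\<^esub> a \<and> c \<cdot>\<^bsub>C\<^esub> g = g' \<cdot>\<^bsub>C\<^esub> b \<and>
     farr (Susp C) a \<cdot>\<^bsub>C\<^esub> h = h' \<cdot>\<^bsub>C\<^esub> c)"

locale triangulated_category = additive_category C
  for C :: "('o, 'm, 'z) triangulated_category_scheme" (structure) +
  assumes susp_additive: "additive_functor C C (Susp C)"
    and susp_equivalence: "is_equivalence C C (Susp C)"
    and tri_candidate: "t \<in> Tri C \<Longrightarrow> candidate_triangle C t"
    and tri_iso_closed: "\<lbrakk>t \<in> Tri C; candidate_triangle C t'; triangle_map C t t' a b c;
      iso_arr C a; iso_arr C b; iso_arr C c\<rbrakk> \<Longrightarrow> t' \<in> Tri C"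
    and tri_id: "\<lbrakk>X \<in> Obj C; zero_object C Z\<rbrakk>
      \<Longrightarrow> (Id C X, Zero C X Z, Zero C Z (fobj (Susp C) X)) \<in> Tri C"
    and tri_exists: "f \<in> Arr C \<Longrightarrow> \<exists>g h. (f, g, h) \<in> Tri C"
    and tri_rotate: "candidate_triangle C (f, g, h)
      \<Longrightarrow> (f, g, h) \<in> Tri C \<longleftrightarrow> (g, h, neg_arr C (farr (Susp C) f)) \<in> Tri C"
    and tri_complete: "\<lbrakk>(f, g, h) \<in> Tri C; (f', g', h') \<in> Tri C;
      a \<in> homset C (Dom C f) (Dom C f'); b \<in> homset C (Cod C f) (Cod C f'); b \<cdot> f = f' \<cdot> a\<rbrakk>
      \<Longrightarrow> \<exists>c. triangle_map C (f, g, h) (f', g', h') a b c"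
    and octahedral: "\<lbrakk>Cod C f = Dom C g; (f, f1, f2) \<in> Tri C; (g, g1, g2) \<in> Tri C;
      (g \<cdot> f, k1, k2) \<in> Tri C\<rbrakk>
      \<Longrightarrow> \<exists>u v. u \<in> homset C (Cod C f1) (Cod C k1) \<and> v \<in> homset C (Cod C k1) (Cod C g1) \<and>
            (u, v, farr (Susp C) f1 \<cdot> g2) \<in> Tri C \<and>
            u \<cdot> f1 = k1 \<cdot> g \<and> k2 \<cdot> u = f2 \<and> v \<cdot> k1 = g1 \<and>
            g2 \<cdot> v = farr (Susp C) f \<cdot> k2"

definition exact_functor ::
  "('o, 'm, 'z) triangulated_category_scheme \<Rightarrow> ('p, 'n, 'y) triangulated_category_scheme \<Rightarrow>
   ('o, 'm, 'p, 'n) cat_functor \<Rightarrow> bool" where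
  "exact_functor C D F \<longleftrightarrow>
     additive_functor C D F \<and>
     (\<exists>\<phi>. nat_iso C D (comp_functor F (Susp C)) (comp_functor (Susp D) F) \<phi> \<and>
        (\<forall>(f, g, h)\<in>Tri C. (farr F f, farr F g, \<phi> (Dom C f) \<cdot>\<^bsub>D\<^esub> farr F h) \<in> Tri D))"

text \<open>
  An object is compact if the canonical map from the direct sum of the groups
  \<open>Hom(X, Y i)\<close> to \<open>Hom(X, P)\<close> is an isomorphism for every small coproduct \<open>P\<close> of the \<open>Y i\<close>.
\<close>

definition compact_obj :: "'u itself \<Rightarrow> ('o, 'm, 'z) additive_category_scheme \<Rightarrow> 'o \<Rightarrow> bool" where
  "compact_obj U C X \<longleftrightarrow>
     X \<in> Obj C \<and>
     (\<forall>(I :: 'u set) Y P \<iota>. small U I \<and> Y \<in> I \<rightarrow> Obj C \<and> is_coproduct C I Y P \<iota> \<longrightarrow>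
        (\<lambda>x. gfinprod (hom_group C X P) (\<lambda>i. \<iota> i \<cdot>\<^bsub>C\<^esub> x i) I)
          \<in> iso (sum_group I (\<lambda>i. hom_group C X (Y i))) (hom_group C X P))"

definition compact_arrs :: "'u itself \<Rightarrow> ('o, 'm, 'z) additive_category_scheme \<Rightarrow> 'm set" where
  "compact_arrs U C = {f \<in> Arr C. compact_obj U C (Dom C f) \<and> compact_obj U C (Cod C f)}"

locale compactly_generated = triangulated_category C
  for U :: "'u itself" and C :: "('o, 'm, 'z) triangulated_category_scheme" (structure) +
  assumes locally_small: "\<lbrakk>X \<in> Obj C; Y \<in> Obj C\<rbrakk> \<Longrightarrow> small U (homset C X Y)"
    and coproducts: "\<lbrakk>small U (I :: 'u set); Xi \<in> I \<rightarrow> Obj C\<rbrakk> \<Longrightarrow> \<exists>P \<iota>. is_coproduct C I Xi P \<iota>"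
    and generators: "\<exists>G. small U G \<and> (\<forall>A\<in>G. compact_obj U C A) \<and>
      (\<forall>X\<in>Obj C. (\<forall>A\<in>G. homset C A X = {Zero C A X}) \<longrightarrow> zero_object C X)"


section \<open>Big tensor-triangulated categories\<close>

record ('o, 'm) tt_category = "('o, 'm) triangulated_category" +
  Tensor :: "'o \<Rightarrow> 'o \<Rightarrow> 'o"  (infixl \<open>\<boxtimes>\<index>\<close> 75)
  TensorArr :: "'m \<Rightarrow> 'm \<Rightarrow> 'm"  (infixl \<open>\<diamondop>\<index>\<close> 75)
  Unit :: 'o
  Assoc :: "'o \<Rightarrow> 'o \<Rightarrow> 'o \<Rightarrow> 'm"
  LUnit :: "'o \<Rightarrow> 'm"
  RUnit :: "'o \<Rightarrow> 'm"
  Braid :: "'o \<Rightarrow> 'o \<Rightarrow> 'm"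
  IHom :: "'o \<Rightarrow> 'o \<Rightarrow> 'o"
  Ev :: "'o \<Rightarrow> 'o \<Rightarrow> 'm"

locale closed_symmetric_monoidal = category C
  for C :: "('o, 'm, 'z) tt_category_scheme" (structure) +
  assumes tensor_obj: "\<lbrakk>X \<in> Obj C; Y \<in> Obj C\<rbrakk> \<Longrightarrow> X \<boxtimes> Y \<in> Obj C"
    and tensor_arr: "\<lbrakk>f \<in> homset C X X'; g \<in> homset C Y Y'\<rbrakk>
      \<Longrightarrow> f \<diamondop> g \<in> homset C (X \<boxtimes> Y) (X' \<boxtimes> Y')"
    and tensor_id: "\<lbrakk>X \<in> Obj C; Y \<in> Obj C\<rbrakk> \<Longrightarrow> Id C X \<diamondop> Id C Y = Id C (X \<boxtimes> Y)"
    and tensor_comp: "\<lbrakk>f \<in> homset C X X'; f' \<in> homset C X' X''; g \<in> homset C Y Y';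
      g' \<in> homset C Y' Y''\<rbrakk> \<Longrightarrow> (f' \<cdot> f) \<diamondop> (g' \<cdot> g) = (f' \<diamondop> g') \<cdot> (f \<diamondop> g)"
    and unit_obj: "Unit C \<in> Obj C"
    and assoc_iso: "\<lbrakk>X \<in> Obj C; Y \<in> Obj C; Z \<in> Obj C\<rbrakk>
      \<Longrightarrow> Assoc C X Y Z \<in> homset C ((X \<boxtimes> Y) \<boxtimes> Z) (X \<boxtimes> (Y \<boxtimes> Z)) \<and> iso_arr C (Assoc C X Y Z)"
    and assoc_natural: "\<lbrakk>f \<in> homset C X X'; g \<in> homset C Y Y'; h \<in> homset C Z Z'\<rbrakk>
      \<Longrightarrow> Assoc C X' Y' Z' \<cdot> ((f \<diamondop> g) \<diamondop> h) = (f \<diamondop> (g \<diamondop> h)) \<cdot> Assoc C X Y Z"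
    and lunit_iso: "X \<in> Obj C \<Longrightarrow> LUnit C X \<in> homset C (Unit C \<boxtimes> X) X \<and> iso_arr C (LUnit C X)"
    and lunit_natural: "f \<in> homset C X Y
      \<Longrightarrow> LUnit C Y \<cdot> (Id C (Unit C) \<diamondop> f) = f \<cdot> LUnit C X"
    and runit_iso: "X \<in> Obj C \<Longrightarrow> RUnit C X \<in> homset C (X \<boxtimes> Unit C) X \<and> iso_arr C (RUnit C X)"
    and runit_natural: "f \<in> homset C X Y
      \<Longrightarrow> RUnit C Y \<cdot> (f \<diamondop> Id C (Unit C)) = f \<cdot> RUnit C X"
    and braid_arr: "\<lbrakk>X \<in> Obj C; Y \<in> Obj C\<rbrakk> \<Longrightarrow> Braid C X Y \<in> homset C (X \<boxtimes> Y) (Y \<boxtimes> X)"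
    and braid_natural: "\<lbrakk>f \<in> homset C X X'; g \<in> homset C Y Y'\<rbrakk>
      \<Longrightarrow> Braid C X' Y' \<cdot> (f \<diamondop> g) = (g \<diamondop> f) \<cdot> Braid C X Y"
    and braid_symmetric: "\<lbrakk>X \<in> Obj C; Y \<in> Obj C\<rbrakk>
      \<Longrightarrow> Braid C Y X \<cdot> Braid C X Y = Id C (X \<boxtimes> Y)"
    and pentagon: "\<lbrakk>W \<in> Obj C; X \<in> Obj C; Y \<in> Obj C; Z \<in> Obj C\<rbrakk>
      \<Longrightarrow> Assoc C W X (Y \<boxtimes> Z) \<cdot> Assoc C (W \<boxtimes> X) Y Z =
          (Id C W \<diamondop> Assoc C X Y Z) \<cdot> Assoc C W (X \<boxtimes> Y) Z \<cdot> (Assoc C W X Y \<diamondop> Id C Z)"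
    and triangle: "\<lbrakk>X \<in> Obj C; Y \<in> Obj C\<rbrakk>
      \<Longrightarrow> (Id C X \<diamondop> LUnit C Y) \<cdot> Assoc C X (Unit C) Y = RUnit C X \<diamondop> Id C Y"
    and hexagon: "\<lbrakk>X \<in> Obj C; Y \<in> Obj C; Z \<in> Obj C\<rbrakk>
      \<Longrightarrow> Assoc C Y Z X \<cdot> Braid C X (Y \<boxtimes> Z) \<cdot> Assoc C X Y Z =
          (Id C Y \<diamondop> Braid C X Z) \<cdot> Assoc C Y X Z \<cdot> (Braid C X Y \<diamondop> Id C Z)"
    and ev_arr: "\<lbrakk>X \<in> Obj C; Y \<in> Obj C\<rbrakk>
      \<Longrightarrow> IHom C X Y \<in> Obj C \<and> Ev C X Y \<in> homset C (IHom C X Y \<boxtimes> X) Y"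
    and ev_universal: "\<lbrakk>X \<in> Obj C; Y \<in> Obj C; Z \<in> Obj C; f \<in> homset C (Z \<boxtimes> X) Y\<rbrakk>
      \<Longrightarrow> \<exists>!g. g \<in> homset C Z (IHom C X Y) \<and> Ev C X Y \<cdot> (g \<diamondop> Id C X) = f"

definition hom_transpose :: "('o, 'm, 'z) tt_category_scheme \<Rightarrow> 'o \<Rightarrow> 'o \<Rightarrow> 'o \<Rightarrow> 'm \<Rightarrow> 'm" where
  "hom_transpose C Z X Y f =
     (THE g. g \<in> homset C Z (IHom C X Y) \<and> Ev C X Y \<cdot>\<^bsub>C\<^esub> (g \<diamondop>\<^bsub>C\<^esub> Id C X) = f)"

text \<open>
  The canonical map \<open>F(X,1) \<otimes> Y \<rightarrow> F(X,Y)\<close>, the transpose of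
  \<open>(F(X,1) \<otimes> Y) \<otimes> X \<cong> (F(X,1) \<otimes> X) \<otimes> Y \<rightarrow> 1 \<otimes> Y \<cong> Y\<close>.
\<close>

definition rigid_map :: "('o, 'm, 'z) tt_category_scheme \<Rightarrow> 'o \<Rightarrow> 'o \<Rightarrow> 'm" where
  "rigid_map C X Y =
     (let DX = IHom C X (Unit C) in
      hom_transpose C (DX \<boxtimes>\<^bsub>C\<^esub> Y) X Y
        (LUnit C Y \<cdot>\<^bsub>C\<^esub> (Ev C X (Unit C) \<diamondop>\<^bsub>C\<^esub> Id C Y) \<cdot>\<^bsub>C\<^esub> inv_arr C (Assoc C DX X Y) \<cdot>\<^bsub>C\<^esub>
         (Id C DX \<diamondop>\<^bsub>C\<^esub> Braid C Y X) \<cdot>\<^bsub>C\<^esub> Assoc C DX Y X))"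

definition rigid :: "('o, 'm, 'z) tt_category_scheme \<Rightarrow> 'o \<Rightarrow> bool" where
  "rigid C X \<longleftrightarrow> X \<in> Obj C \<and> (\<forall>Y\<in>Obj C. iso_arr C (rigid_map C X Y))"

text \<open>
  Compatibility of the monoidal structure with the triangulation means that the tensor product
  is exact in each variable.
\<close>

locale big_tt_category = compactly_generated U C + closed_symmetric_monoidal C
  for U :: "'u itself" and C :: "('o, 'm, 'z) tt_category_scheme" (structure) +
  assumes tensor_exact_left: "Y \<in> Obj C
      \<Longrightarrow> exact_functor C C \<lparr>fobj = (\<lambda>X. X \<boxtimes> Y), farr = (\<lambda>f. f \<diamondop> Id C Y)\<rparr>"
    and tensor_exact_right: "X \<in> Obj C
      \<Longrightarrow> exact_functor C C \<lparr>fobj = (\<lambda>Y. X \<boxtimes> Y), farr = (\<lambda>f. Id C X \<diamondop> f)\<rparr>"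
    and compact_iff_rigid: "compact_obj U C X \<longleftrightarrow> rigid C X"


section \<open>Smashing localisations\<close>

locale localisation =
  fixes C :: "('o, 'm, 'z) tt_category_scheme" (structure)
    and L :: "('o, 'm, 'o, 'm) cat_functor"
    and \<eta> :: "'o \<Rightarrow> 'm"
  assumes exact: "exact_functor C C L"
    and eta_natural: "nat_trans C C id_functor L \<eta>"
    and L_eta_iso: "X \<in> Obj C \<Longrightarrow> iso_arr C (farr L (\<eta> X))"
    and L_eta: "X \<in> Obj C \<Longrightarrow> farr L (\<eta> X) = \<eta> (fobj L X)"
    and kernel_ideal: "\<lbrakk>X \<in> Obj C; zero_object C (fobj L X); Y \<in> Obj C\<rbrakk>
      \<Longrightarrow> zero_object C (fobj L (X \<boxtimes> Y))"

locale smashing_localisation = localisation C L \<eta>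
  for U :: "'u itself" and C :: "('o, 'm, 'z) tt_category_scheme" (structure) and L \<eta> +
  assumes preserves_coproducts:
    "\<lbrakk>small U (I :: 'u set); Xi \<in> I \<rightarrow> Obj C; is_coproduct C I Xi P \<iota>\<rbrakk>
      \<Longrightarrow> is_coproduct C I (fobj L \<circ> Xi) (fobj L P) (farr L \<circ> \<iota>)"

definition is_local :: "('o, 'm, 'z) category_scheme \<Rightarrow> ('o \<Rightarrow> 'm) \<Rightarrow> 'o \<Rightarrow> bool" where
  "is_local C \<eta> X \<longleftrightarrow> X \<in> Obj C \<and> iso_arr C (\<eta> X)"

definition local_part :: "('o, 'm, 'z) category_scheme \<Rightarrow> ('o \<Rightarrow> 'm) \<Rightarrow> 'o set \<Rightarrow> 'o set" where
  "local_part C \<eta> A = {X. is_local C \<eta> X \<and> X \<in> A}"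

text \<open>
  The full subcategory of local objects with its induced structure. All the structure is
  inherited except for the unit \<open>L 1\<close>, whose unitors are those of \<open>1\<close> precomposed with the
  inverse of \<open>\<eta> 1 \<otimes> X\<close> (which is invertible for \<open>X\<close> local and \<open>L\<close> smashing).
\<close>

definition local_category ::
  "('o, 'm, 'z) tt_category_scheme \<Rightarrow> ('o, 'm, 'o, 'm) cat_functor \<Rightarrow> ('o \<Rightarrow> 'm) \<Rightarrow>
   ('o, 'm, 'z) tt_category_scheme" where
  "local_category C L \<eta> = C\<lparr>
     Obj := {X. is_local C \<eta> X},
     Arr := {f \<in> Arr C. is_local C \<eta> (Dom C f) \<and> is_local C \<eta> (Cod C f)},
     Tri := {(f, g, h) \<in> Tri C.
       is_local C \<eta> (Dom C f) \<and> is_local C \<eta> (Dom C g) \<and> is_local C \<eta> (Dom C h)},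
     Unit := fobj L (Unit C),
     LUnit := (\<lambda>X. LUnit C X \<cdot>\<^bsub>C\<^esub> inv_arr C (\<eta> (Unit C) \<diamondop>\<^bsub>C\<^esub> Id C X)),
     RUnit := (\<lambda>X. RUnit C X \<cdot>\<^bsub>C\<^esub> inv_arr C (Id C X \<diamondop>\<^bsub>C\<^esub> \<eta> (Unit C)))\<rparr>"


section \<open>Definable subcategories\<close>

definition hom_image :: "('o, 'm, 'z) additive_category_scheme \<Rightarrow> 'm \<Rightarrow> 'o \<Rightarrow> 'm set" where
  "hom_image C f X = (\<lambda>u. u \<cdot>\<^bsub>C\<^esub> f) ` homset C (Cod C f) X"

definition definable ::
  "'u itself \<Rightarrow> ('o, 'm, 'z) additive_category_scheme \<Rightarrow> 'o set \<Rightarrow> bool" where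
  "definable U C D \<longleftrightarrow>
     (\<exists>\<Phi>. small U \<Phi> \<and> \<Phi> \<subseteq> compact_arrs U C \<and>
        D = {X \<in> Obj C. \<forall>f\<in>\<Phi>. hom_image C f X = homset C (Dom C f) X})"


section \<open>Functors with values in abelian groups\<close>

record ('o, 'm, 'x) ab_functor =
  val :: "'o \<Rightarrow> 'x monoid"
  act :: "'m \<Rightarrow> 'x \<Rightarrow> 'x"

definition hom_functor ::
  "('o, 'm, 'z) additive_category_scheme \<Rightarrow> 'o \<Rightarrow> ('o, 'm, 'm) ab_functor" where
  "hom_functor C A = \<lparr>val = hom_group C A, act = Comp C\<rparr>"

text \<open>
  The cokernel of \<open>Hom(f,-)\<close>, on the whole category. For \<open>f\<close> between compact objects, its
  restriction to the compact objects is the finitely presented functor \<open>G\<close> presented by \<open>f\<close>,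
  and the functor itself is the extension of \<open>G\<close> to the whole category.
\<close>

definition coker_functor ::
  "('o, 'm, 'z) additive_category_scheme \<Rightarrow> 'm \<Rightarrow> ('o, 'm, 'm set) ab_functor" where
  "coker_functor C f =
     \<lparr>val = (\<lambda>X. hom_group C (Dom C f) X Mod hom_image C f X),
      act = (\<lambda>k c. \<Union>x\<in>c. hom_image C f (Cod C k) #>\<^bsub>hom_group C (Dom C f) (Cod C k)\<^esub> (k \<cdot>\<^bsub>C\<^esub> x))\<rparr>"

text \<open>
  Natural transformations between the restrictions of two functors to the compact objects; the
  components are extensional so that equality of transformations is equality of functions.
\<close>

definition ab_nat ::
  "'u itself \<Rightarrow> ('o, 'm, 'z) additive_category_scheme \<Rightarrow> ('o, 'm, 'x) ab_functor \<Rightarrow>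
   ('o, 'm, 'y) ab_functor \<Rightarrow> ('o \<Rightarrow> 'x \<Rightarrow> 'y) set" where
  "ab_nat U C G H =
     {\<theta> \<in> \<Pi>\<^sub>E X\<in>{X. compact_obj U C X}. hom (val G X) (val H X) \<inter> extensional (carrier (val G X)).
        \<forall>k\<in>compact_arrs U C. \<forall>x\<in>carrier (val G (Dom C k)).
          \<theta> (Cod C k) (act G k x) = act H k (\<theta> (Dom C k) x)}"

definition ab_nat_group ::
  "'u itself \<Rightarrow> ('o, 'm, 'z) additive_category_scheme \<Rightarrow> ('o, 'm, 'x) ab_functor \<Rightarrow>
   ('o, 'm, 'y) ab_functor \<Rightarrow> ('o \<Rightarrow> 'x \<Rightarrow> 'y) monoid" where
  "ab_nat_group U C G H =
     \<lparr>carrier = ab_nat U C G H,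
      mult = (\<lambda>\<theta> \<psi>. \<lambda>X\<in>{X. compact_obj U C X}. \<lambda>x\<in>carrier (val G X). \<theta> X x \<otimes>\<^bsub>val H X\<^esub> \<psi> X x),
      one = (\<lambda>X\<in>{X. compact_obj U C X}. \<lambda>x\<in>carrier (val G X). \<one>\<^bsub>val H X\<^esub>)\<rparr>"

definition ab_isomorphic ::
  "'u itself \<Rightarrow> ('o, 'm, 'z) additive_category_scheme \<Rightarrow> ('o, 'm, 'x) ab_functor \<Rightarrow>
   ('o, 'm, 'y) ab_functor \<Rightarrow> bool" where
  "ab_isomorphic U C G H \<longleftrightarrow>
     (\<exists>\<theta>\<in>ab_nat U C G H. \<forall>X. compact_obj U C X \<longrightarrow> \<theta> X \<in> iso (val G X) (val H X))"


section \<open>The dual definable category\<close>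

definition dual_obj :: "('o, 'm, 'z) tt_category_scheme \<Rightarrow> 'o \<Rightarrow> 'o" where
  "dual_obj C X = IHom C X (Unit C)"

text \<open>For \<open>f : X \<rightarrow> Y\<close>, the map \<open>D f : D Y \<rightarrow> D X\<close> is the transpose of \<open>D Y \<otimes> X \<rightarrow> D Y \<otimes> Y \<rightarrow> 1\<close>.\<close>

definition dual_arr :: "('o, 'm, 'z) tt_category_scheme \<Rightarrow> 'm \<Rightarrow> 'm" where
  "dual_arr C f =
     hom_transpose C (dual_obj C (Cod C f)) (Dom C f) (Unit C)
       (Ev C (Cod C f) (Unit C) \<cdot>\<^bsub>C\<^esub> (Id C (dual_obj C (Cod C f)) \<diamondop>\<^bsub>C\<^esub> f))"

definition delta ::
  "'u itself \<Rightarrow> ('o, 'm, 'z) tt_category_scheme \<Rightarrow> ('o, 'm, 'x) ab_functor \<Rightarrow>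
   ('o, 'm, 'o \<Rightarrow> 'x \<Rightarrow> 'm) ab_functor" where
  "delta U C G =
     \<lparr>val = (\<lambda>Y. ab_nat_group U C G (hom_functor C (dual_obj C Y))),
      act = (\<lambda>k \<theta>. \<lambda>X\<in>{X. compact_obj U C X}. \<lambda>x\<in>carrier (val G X). \<theta> X x \<cdot>\<^bsub>C\<^esub> dual_arr C k)\<rparr>"

text \<open>
  Classes of finitely presented functors are represented by the maps presenting their members.
  Thus \<open>annihilator\<close> consists of the \<open>f\<close> whose cokernel functor extends to one that vanishes on
  \<open>D\<close>, and \<open>delta_annihilator\<close> of the \<open>h\<close> presenting a functor isomorphic to \<open>\<delta> G\<close> for some \<open>G\<close>
  vanishing on \<open>D\<close>.
\<close>

definition annihilator ::
  "'u itself \<Rightarrow> ('o, 'm, 'z) additive_category_scheme \<Rightarrow> 'o set \<Rightarrow> 'm set" where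
  "annihilator U C D =
     {f \<in> compact_arrs U C. \<forall>X\<in>D. trivial_group (val (coker_functor C f) X)}"

definition delta_annihilator ::
  "'u itself \<Rightarrow> ('o, 'm, 'z) tt_category_scheme \<Rightarrow> 'o set \<Rightarrow> 'm set" where
  "delta_annihilator U C D =
     {h \<in> compact_arrs U C. \<exists>f\<in>annihilator U C D.
        ab_isomorphic U C (coker_functor C h) (delta U C (coker_functor C f))}"

definition dual_definable ::
  "'u itself \<Rightarrow> ('o, 'm, 'z) tt_category_scheme \<Rightarrow> 'o set \<Rightarrow> 'o set" where
  "dual_definable U C D =
     {Y \<in> Obj C. \<forall>h\<in>delta_annihilator U C D. trivial_group (val (coker_functor C h) Y)}"

end

theory Submission
  imports Defs
begin

text \<open>
  Under the dualities \<open>Hom(D A, Y) \<cong> Hom(1, A \<otimes> Y)\<close>, the dual definable category of \<open>D\<close> consists of the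
  \<open>Y\<close> for which \<open>Hom(1, f \<otimes> Y)\<close> is injective for every \<open>f\<close> in the annihilator of \<open>D\<close>. It suffices to
  test this on any set \<open>\<Phi>\<close> of maps defining \<open>D\<close>. Starting with the domain \<open>X\<^sub>0\<close> of such an \<open>f\<close>, let
  \<open>X\<^sub>n \<rightarrow> X\<^sub>n\<^sub>+\<^sub>1\<close> kill all maps that factor through the fibre \<open>F \<rightarrow> A\<close> of some \<open>\<phi> : A \<rightarrow> B\<close> in \<open>\<Phi>\<close>. The homotopy colimit
  lies in \<open>D\<close>, so the map from \<open>X\<^sub>0\<close> to it factors through \<open>f\<close>, while each \<open>Hom(1, X\<^sub>n \<otimes> Y) \<rightarrow> Hom(1, X\<^sub>n\<^sub>+\<^sub>1 \<otimes> Y)\<close> is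
  injective if the \<open>Hom(1, \<phi> \<otimes> Y)\<close> are, for \<open>\<phi>\<close> in \<open>\<Phi>\<close>. If \<open>\<Phi>\<close> defines \<open>D\<close> in \<open>T\<close>, then
  \<open>L \<Phi>\<close> defines the local part of \<open>D\<close> in \<open>L T\<close>, and \<open>Hom(L 1, L f \<otimes> Y) \<cong> Hom(1, f \<otimes> Y)\<close> for local \<open>Y\<close>.
  The criterion also applies in \<open>L T\<close> because compact objects are dualizable there: the objects \<open>L A\<close> with
  \<open>A\<close> compact in \<open>T\<close> are dualizable and generate, and \<open>Hom(1, - \<otimes> D W) \<rightarrow> Hom(W, -)\<close>, for \<open>W\<close> compact,
  is a transformation of finitary homological functors, so bijective as soon as it is so on generators.
\<close>

section \<open>Categories and coproducts\<close>

text \<open>The two dual categories are cut out by an annihilator in the ambient and one in the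
  local category, and these cannot be matched map by map: a compact object of the local category
  need not have the form \<open>Lo A\<close> with \<open>A\<close> compact, so a map between such
  objects need not be an \<open>La f\<close>. Only a defining set \<open>\<Phi>\<close> can be moved
  along \<open>L\<close>; this is why the criterion has to be freed from the full annihilator.
  Passing from \<open>\<Phi>\<close> to the annihilator is a closure property of Serre
  subcategories, and the tower replaces it by one explicit object of \<open>D\<close>. Countably
  many stages suffice since the maps in \<open>\<Phi>\<close> have compact domains, so every
  obstruction is visible, and removed, at a finite stage.

  The functors disappear once \<open>D f\<close> is completed to a triangle, because this presents
  \<open>\<delta> G\<close> and turns vanishing at \<open>Y\<close> into injectivity of one map of
  groups. Duals of compact objects enter here. In the ambient category they come with the assumption
  that compact and rigid objects coincide; in the local category they must be derived, without a
  description of its compact objects.\<close>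

lemma in_homset_iff [simp]:
  "f \<in> homset C X Y \<longleftrightarrow> f \<in> Arr C \<and> Dom C f = X \<and> Cod C f = Y"
  by (simp add: homset_def)

lemma hom_group_simps [simp]:
  "carrier (hom_group C X Y) = homset C X Y" "mult (hom_group C X Y) = Add C"
  "one (hom_group C X Y) = Zero C X Y"
  by (simp_all add: hom_group_def)

context category
begin

lemma dom_obj [simp]: "f \<in> Arr C \<Longrightarrow> Dom C f \<in> Obj C"
  and cod_obj [simp]: "f \<in> Arr C \<Longrightarrow> Cod C f \<in> Obj C"
  using dom_cod by auto

lemma homset_obj: "f \<in> homset C X Y \<Longrightarrow> X \<in> Obj C" "f \<in> homset C X Y \<Longrightarrow> Y \<in> Obj C"
  using dom_cod by auto

lemma id_simps [simp]:
  assumes "X \<in> Obj C"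
  shows "Id C X \<in> Arr C" "Dom C (Id C X) = X" "Cod C (Id C X) = X"
  using id_arr[OF assms] by auto

lemma comp_simps [simp]:
  assumes "f \<in> Arr C" "g \<in> Arr C" "Dom C g = Cod C f"
  shows "g \<cdot> f \<in> Arr C" "Dom C (g \<cdot> f) = Dom C f" "Cod C (g \<cdot> f) = Cod C g"
  using comp_arr[of f "Dom C f" "Cod C f" g "Cod C g"] assms by auto

lemma comp_id_left [simp]: "f \<in> Arr C \<Longrightarrow> Cod C f = X \<Longrightarrow> Id C X \<cdot> f = f"
  using id_left[of f "Dom C f" X] by simp

lemma comp_id_right [simp]: "f \<in> Arr C \<Longrightarrow> Dom C f = X \<Longrightarrow> f \<cdot> Id C X = f"
  using id_right[of f X "Cod C f"] by simp

lemma assoc [simp]: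
  "\<lbrakk>f \<in> Arr C; g \<in> Arr C; h \<in> Arr C; Dom C g = Cod C f; Dom C h = Cod C g\<rbrakk>
    \<Longrightarrow> (h \<cdot> g) \<cdot> f = h \<cdot> g \<cdot> f"
  using comp_assoc[of f "Dom C f" "Cod C f" g "Cod C g" h "Cod C h"] by simp

lemma comp_reassoc:
  "\<lbrakk>h \<cdot> g = k; f \<in> Arr C; g \<in> Arr C; h \<in> Arr C; Dom C g = Cod C f; Dom C h = Cod C g\<rbrakk>
    \<Longrightarrow> h \<cdot> g \<cdot> f = k \<cdot> f"
  using assoc[of f g h] by simp

lemma is_inverse_unique:
  assumes "f \<in> Arr C" "is_inverse C f g" "is_inverse C f g'"
  shows "g = g'"
proof -
  have "g = g \<cdot> f \<cdot> g'" using assms by (simp add: is_inverse_def)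
  also have "\<dots> = (g \<cdot> f) \<cdot> g'" by (rule assoc[symmetric]) (use assms in \<open>auto simp: is_inverse_def\<close>)
  also have "\<dots> = g'" using assms unfolding is_inverse_def by simp
  finally show ?thesis .
qed

lemma iso_inv:
  assumes "iso_arr C f"
  shows "is_inverse C f (inv_arr C f)"
proof -
  obtain g where "f \<in> Arr C" "is_inverse C f g" using assms by (auto simp: iso_arr_def)
  then show ?thesis
    unfolding inv_arr_def using is_inverse_unique by (metis theI)
qed

lemma iso_arrI:
  "\<lbrakk>f \<in> Arr C; g \<in> Arr C; Dom C g = Cod C f; Cod C g = Dom C f;
    g \<cdot> f = Id C (Dom C f); f \<cdot> g = Id C (Cod C f)\<rbrakk> \<Longrightarrow> iso_arr C f"
  by (auto simp: iso_arr_def is_inverse_def)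

lemma inv_simps [simp]:
  assumes "iso_arr C f"
  shows "f \<in> Arr C" "inv_arr C f \<in> Arr C" "Dom C (inv_arr C f) = Cod C f"
    "Cod C (inv_arr C f) = Dom C f"
    "inv_arr C f \<cdot> f = Id C (Dom C f)" "f \<cdot> inv_arr C f = Id C (Cod C f)"
  using iso_inv[OF assms] assms by (auto simp: is_inverse_def iso_arr_def)

lemma inv_cancel [simp]:
  assumes "iso_arr C f" "g \<in> Arr C"
  shows "Cod C g = Dom C f \<Longrightarrow> inv_arr C f \<cdot> f \<cdot> g = g"
    and "Cod C g = Cod C f \<Longrightarrow> f \<cdot> inv_arr C f \<cdot> g = g"
  using assms by (subst comp_reassoc[OF inv_simps(5)], auto) (subst comp_reassoc[OF inv_simps(6)], auto)

lemma iso_id [simp]: "X \<in> Obj C \<Longrightarrow> iso_arr C (Id C X)"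
  by (rule iso_arrI[of _ "Id C X"]) auto

lemma iso_inv_arr [simp]: "iso_arr C f \<Longrightarrow> iso_arr C (inv_arr C f)"
  by (rule iso_arrI[of _ f]) auto

lemma iso_comp [simp]:
  assumes "iso_arr C f" "iso_arr C g" "Dom C g = Cod C f"
  shows "iso_arr C (g \<cdot> f)"
  by (rule iso_arrI[of _ "inv_arr C f \<cdot> inv_arr C g"]) (use assms in auto)

lemma iso_left_cancel:
  assumes "iso_arr C h" "f \<in> Arr C" "g \<in> Arr C" "Cod C f = Dom C h" "Cod C g = Dom C h"
    "h \<cdot> f = h \<cdot> g"
  shows "f = g"
  by (metis assms inv_cancel(1))

lemma iso_right_cancel:
  assumes "iso_arr C h" "f \<in> Arr C" "g \<in> Arr C" "Dom C f = Cod C h" "Dom C g = Cod C h"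
    "f \<cdot> h = g \<cdot> h"
  shows "f = g"
proof -
  have "f = (f \<cdot> h) \<cdot> inv_arr C h" "g = (g \<cdot> h) \<cdot> inv_arr C h" using assms(1-5) by auto
  then show ?thesis using assms(6) by simp
qed

section \<open>Coproducts: uniqueness, transport along isomorphisms, change of index set\<close>

lemma coproduct_simps:
  assumes "is_coproduct C I X P \<iota>"
  shows "P \<in> Obj C" "i \<in> I \<Longrightarrow> \<iota> i \<in> Arr C" "i \<in> I \<Longrightarrow> Dom C (\<iota> i) = X i" "i \<in> I \<Longrightarrow> Cod C (\<iota> i) = P"
    "i \<in> I \<Longrightarrow> X i \<in> Obj C"
  using assms dom_obj[of "\<iota> i"] by (auto simp: is_coproduct_def)

lemma coproduct_map:
  assumes "is_coproduct C I X P \<iota>" "Z \<in> Obj C" "\<And>i. i \<in> I \<Longrightarrow> f i \<in> homset C (X i) Z"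
  obtains u where "u \<in> homset C P Z" "\<And>i. i \<in> I \<Longrightarrow> u \<cdot> \<iota> i = f i"
  using assms unfolding is_coproduct_def by (metis (no_types, lifting))

lemma coproduct_unique:
  assumes "is_coproduct C I X P \<iota>" "u \<in> homset C P Z" "v \<in> homset C P Z"
    "\<And>i. i \<in> I \<Longrightarrow> u \<cdot> \<iota> i = v \<cdot> \<iota> i"
  shows "u = v"
proof -
  have Z: "Z \<in> Obj C" using assms(2) by auto
  have v: "\<forall>i\<in>I. v \<cdot> \<iota> i \<in> homset C (X i) Z"
    using assms(3) coproduct_simps[OF assms(1)] by simp
  have "\<forall>f. (\<forall>i\<in>I. f i \<in> homset C (X i) Z) \<longrightarrow> (\<exists>!u. u \<in> homset C P Z \<and> (\<forall>i\<in>I. u \<cdot> \<iota> i = f i))"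
    using assms(1) Z unfolding is_coproduct_def by blast
  from this[THEN spec, THEN mp, OF v]
  have ex: "\<exists>!u. u \<in> homset C P Z \<and> (\<forall>i\<in>I. u \<cdot> \<iota> i = v \<cdot> \<iota> i)" .
  have "(THE u. u \<in> homset C P Z \<and> (\<forall>i\<in>I. u \<cdot> \<iota> i = v \<cdot> \<iota> i)) = u"
    using assms(2,4) by (intro the1_equality[OF ex] conjI ballI) blast+
  moreover have "(THE u. u \<in> homset C P Z \<and> (\<forall>i\<in>I. u \<cdot> \<iota> i = v \<cdot> \<iota> i)) = v"
    using assms(3) by (intro the1_equality[OF ex] conjI ballI) blast+
  ultimately show ?thesis by simp
qed

lemma is_coproductI:
  assumes "P \<in> Obj C" "\<And>i. i \<in> I \<Longrightarrow> \<iota> i \<in> homset C (X i) P"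
    "\<And>Z f. \<lbrakk>Z \<in> Obj C; \<And>i. i \<in> I \<Longrightarrow> f i \<in> homset C (X i) Z\<rbrakk>
      \<Longrightarrow> \<exists>u\<in>homset C P Z. \<forall>i\<in>I. u \<cdot> \<iota> i = f i"
    "\<And>Z u v. \<lbrakk>u \<in> homset C P Z; v \<in> homset C P Z; \<And>i. i \<in> I \<Longrightarrow> u \<cdot> \<iota> i = v \<cdot> \<iota> i\<rbrakk> \<Longrightarrow> u = v"
  shows "is_coproduct C I X P \<iota>"
  unfolding is_coproduct_def
proof (intro conjI ballI allI impI)
  fix Z f assume Z: "Z \<in> Obj C" and f: "\<forall>i\<in>I. f i \<in> homset C (X i) Z"
  obtain u where u: "u \<in> homset C P Z" "\<forall>i\<in>I. u \<cdot> \<iota> i = f i" using assms(3)[OF Z] f by blast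
  show "\<exists>!u. u \<in> homset C P Z \<and> (\<forall>i\<in>I. u \<cdot> \<iota> i = f i)"
  proof (rule ex1I)
    show "u \<in> homset C P Z \<and> (\<forall>i\<in>I. u \<cdot> \<iota> i = f i)" using u by blast
    fix v assume v: "v \<in> homset C P Z \<and> (\<forall>i\<in>I. v \<cdot> \<iota> i = f i)"
    show "v = u"
      by (rule assms(4)[of _ Z]) (use u v in auto)
  qed
qed (use assms in auto)

text \<open>Coproducts often appear with summands or vertex known only up to isomorphism: after
  desuspending, after exchanging tensor factors with the braiding, and when a coproduct of the local
  category is compared with one formed in the ambient category.\<close>

lemma coproduct_iso_transport:
  assumes co: "is_coproduct C I X P \<iota>" and e: "\<And>i. i \<in> I \<Longrightarrow> e i \<in> homset C (X' i) (X i)"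
    "\<And>i. i \<in> I \<Longrightarrow> iso_arr C (e i)" and \<psi>: "\<psi> \<in> homset C P P'" "iso_arr C \<psi>"
  shows "is_coproduct C I X' P' (\<lambda>i. \<psi> \<cdot> \<iota> i \<cdot> e i)"
proof (rule is_coproductI)
  note c = coproduct_simps[OF co]
  show "P' \<in> Obj C" using \<psi> by auto
  show "\<psi> \<cdot> \<iota> i \<cdot> e i \<in> homset C (X' i) P'" if "i \<in> I" for i
    using c(2,3,4)[OF that] e(1)[OF that] \<psi> by auto
  show "\<exists>u\<in>homset C P' Z. \<forall>i\<in>I. u \<cdot> \<psi> \<cdot> \<iota> i \<cdot> e i = f i"
    if Z: "Z \<in> Obj C" and f: "\<And>i. i \<in> I \<Longrightarrow> f i \<in> homset C (X' i) Z" for Z f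
  proof -
    have "f i \<cdot> inv_arr C (e i) \<in> homset C (X i) Z" if "i \<in> I" for i
      using f[OF that] e[OF that] by auto
    then obtain u where u: "u \<in> homset C P Z" "\<And>i. i \<in> I \<Longrightarrow> u \<cdot> \<iota> i = f i \<cdot> inv_arr C (e i)"
      using coproduct_map[OF co Z, of "\<lambda>i. f i \<cdot> inv_arr C (e i)"] by blast
    have "(u \<cdot> inv_arr C \<psi>) \<cdot> \<psi> \<cdot> \<iota> i \<cdot> e i = f i" if i: "i \<in> I" for i
    proof -
      have "(u \<cdot> inv_arr C \<psi>) \<cdot> \<psi> \<cdot> \<iota> i \<cdot> e i = (u \<cdot> \<iota> i) \<cdot> e i"
        using u(1) c(1) c(2-4)[OF i] e(1)[OF i] \<psi> by simp
      also have "\<dots> = f i" unfolding u(2)[OF i] using f[OF i] e[OF i] by simp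
      finally show ?thesis .
    qed
    moreover have "u \<cdot> inv_arr C \<psi> \<in> homset C P' Z" using u \<psi> by auto
    ultimately show ?thesis by blast
  qed
  show "u = v" if u: "u \<in> homset C P' Z" and v: "v \<in> homset C P' Z"
    and uv: "\<And>i. i \<in> I \<Longrightarrow> u \<cdot> \<psi> \<cdot> \<iota> i \<cdot> e i = v \<cdot> \<psi> \<cdot> \<iota> i \<cdot> e i" for Z u v
  proof -
    have "u \<cdot> \<psi> = v \<cdot> \<psi>"
    proof (rule coproduct_unique[OF co, of _ Z])
      fix i assume i: "i \<in> I"
      show "(u \<cdot> \<psi>) \<cdot> \<iota> i = (v \<cdot> \<psi>) \<cdot> \<iota> i"
        by (rule iso_right_cancel[OF e(2)[OF i]])
          (use u v \<psi> c(2-4)[OF i] e(1)[OF i] uv[OF i] in auto)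
    qed (use u v \<psi> in auto)
    then show ?thesis using iso_right_cancel[OF \<psi>(2), of u v] u v \<psi> by auto
  qed
qed

text \<open>Compactness, existence of coproducts and their preservation are assumed for index sets
  of type \<open>'u set\<close>, whereas the coproducts formed later are indexed by sets of arrows
  or by the natural numbers. A bijection with a copy of the index set inside \<open>'u\<close>
  mediates between the two.\<close>

lemma coproduct_reindex:
  assumes "bij_betw b J I"
  shows "is_coproduct C J (X \<circ> b) P (\<iota> \<circ> b) \<longleftrightarrow> is_coproduct C I X P \<iota>"
proof
  have im: "b ` J = I" using assms by (auto simp: bij_betw_def)
  let ?b = "inv_into J b"
  have binv: "\<And>i. i \<in> I \<Longrightarrow> b (?b i) = i" "\<And>j. j \<in> J \<Longrightarrow> ?b (b j) = j"
    "\<And>i. i \<in> I \<Longrightarrow> ?b i \<in> J" "\<And>j. j \<in> J \<Longrightarrow> b j \<in> I"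
    using assms by (auto simp: bij_betw_def f_inv_into_f inv_into_into)
  show "is_coproduct C I X P \<iota>" if co: "is_coproduct C J (X \<circ> b) P (\<iota> \<circ> b)"
  proof (rule is_coproductI)
    note c = coproduct_simps[OF co]
    show "P \<in> Obj C" by (rule c)
    show "\<iota> i \<in> homset C (X i) P" if "i \<in> I" for i
      using c(2-4)[of "?b i"] binv that by simp
    show "\<exists>u\<in>homset C P Z. \<forall>i\<in>I. u \<cdot> \<iota> i = f i"
      if Z: "Z \<in> Obj C" and f: "\<And>i. i \<in> I \<Longrightarrow> f i \<in> homset C (X i) Z" for Z f
    proof -
      have "(f \<circ> b) j \<in> homset C ((X \<circ> b) j) Z" if "j \<in> J" for j
        using f[of "b j"] binv that by simp
      then obtain u where u: "u \<in> homset C P Z" "\<And>j. j \<in> J \<Longrightarrow> u \<cdot> (\<iota> \<circ> b) j = (f \<circ> b) j"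
        using coproduct_map[OF co Z, of "f \<circ> b"] by blast
      then show ?thesis using binv by (intro bexI[of _ u]) (metis comp_apply, simp)
    qed
    show "u = v" if "u \<in> homset C P Z" "v \<in> homset C P Z" "\<And>i. i \<in> I \<Longrightarrow> u \<cdot> \<iota> i = v \<cdot> \<iota> i" for Z u v
      by (rule coproduct_unique[OF co that(1,2)]) (use binv that in auto)
  qed
  show "is_coproduct C J (X \<circ> b) P (\<iota> \<circ> b)" if co: "is_coproduct C I X P \<iota>"
  proof (rule is_coproductI)
    note c = coproduct_simps[OF co]
    show "P \<in> Obj C" by (rule c)
    show "(\<iota> \<circ> b) i \<in> homset C ((X \<circ> b) i) P" if "i \<in> J" for i
      using c(2-4)[of "b i"] binv that by simp
    show "\<exists>u\<in>homset C P Z. \<forall>i\<in>J. u \<cdot> (\<iota> \<circ> b) i = f i"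
      if Z: "Z \<in> Obj C" and f: "\<And>i. i \<in> J \<Longrightarrow> f i \<in> homset C ((X \<circ> b) i) Z" for Z f
    proof -
      have "(f \<circ> ?b) i \<in> homset C (X i) Z" if "i \<in> I" for i
        using f[of "?b i"] binv that by simp
      then obtain u where u: "u \<in> homset C P Z" "\<And>i. i \<in> I \<Longrightarrow> u \<cdot> \<iota> i = (f \<circ> ?b) i"
        using coproduct_map[OF co Z, of "f \<circ> ?b"] by blast
      then show ?thesis using binv by (intro bexI[of _ u]) auto
    qed
    show "u = v" if "u \<in> homset C P Z" "v \<in> homset C P Z" "\<And>i. i \<in> J \<Longrightarrow> u \<cdot> (\<iota> \<circ> b) i = v \<cdot> (\<iota> \<circ> b) i" for Z u v
      by (rule coproduct_unique[OF co that(1,2)]) (use binv that in \<open>metis comp_apply\<close>)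
  qed
qed

lemma coproduct_cong:
  assumes "is_coproduct C I X P \<iota>" "\<And>i. i \<in> I \<Longrightarrow> X i = X' i" "\<And>i. i \<in> I \<Longrightarrow> \<iota> i = \<iota>' i"
  shows "is_coproduct C I X' P \<iota>'"
  using assms unfolding is_coproduct_def by (simp cong: conj_cong)

lemma coproduct_iso:
  assumes "is_coproduct C I X P \<iota>" "is_coproduct C I X P' \<iota>'"
  obtains \<psi> where "\<psi> \<in> homset C P P'" "iso_arr C \<psi>" "\<And>i. i \<in> I \<Longrightarrow> \<psi> \<cdot> \<iota> i = \<iota>' i"
proof -
  note c = coproduct_simps[OF assms(1)] and c' = coproduct_simps[OF assms(2)]
  obtain u where u: "u \<in> homset C P P'" "\<And>i. i \<in> I \<Longrightarrow> u \<cdot> \<iota> i = \<iota>' i"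
    using coproduct_map[OF assms(1) c'(1), of \<iota>'] c' by auto
  obtain v where v: "v \<in> homset C P' P" "\<And>i. i \<in> I \<Longrightarrow> v \<cdot> \<iota>' i = \<iota> i"
    using coproduct_map[OF assms(2) c(1), of \<iota>] c by auto
  have "v \<cdot> u = Id C P"
    by (rule coproduct_unique[OF assms(1), of _ P]) (use u v c in auto)
  moreover have "u \<cdot> v = Id C P'"
    by (rule coproduct_unique[OF assms(2), of _ P']) (use u v c' in auto)
  ultimately have "iso_arr C u" using u(1) v(1) by (intro iso_arrI[of u v]) auto
  then show thesis using u that by blast
qed

end

section \<open>Additive categories and compact objects\<close>

context additive_category
begin

lemma add_simps [simp]:
  assumes "f \<in> Arr C" "g \<in> Arr C" "Dom C g = Dom C f" "Cod C g = Cod C f"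
  shows "f \<boxplus> g \<in> Arr C" "Dom C (f \<boxplus> g) = Dom C f" "Cod C (f \<boxplus> g) = Cod C f"
proof -
  interpret G: comm_group "hom_group C (Dom C f) (Cod C f)" by (rule hom_comm_group) (use assms in auto)
  have "f \<boxplus> g \<in> homset C (Dom C f) (Cod C f)"
    using G.m_closed[of f g] assms by simp
  then show "f \<boxplus> g \<in> Arr C" "Dom C (f \<boxplus> g) = Dom C f" "Cod C (f \<boxplus> g) = Cod C f" by auto
qed

lemma zero_simps [simp]:
  assumes "X \<in> Obj C" "Y \<in> Obj C"
  shows "Zero C X Y \<in> Arr C" "Dom C (Zero C X Y) = X" "Cod C (Zero C X Y) = Y"
proof -
  interpret G: comm_group "hom_group C X Y" by (rule hom_comm_group) (use assms in auto)
  have "Zero C X Y \<in> homset C X Y" using G.one_closed by simp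
  then show "Zero C X Y \<in> Arr C" "Dom C (Zero C X Y) = X" "Cod C (Zero C X Y) = Y" by auto
qed

lemma neg_simps [simp]:
  assumes "f \<in> Arr C"
  shows "neg_arr C f \<in> Arr C" "Dom C (neg_arr C f) = Dom C f" "Cod C (neg_arr C f) = Cod C f"
proof -
  interpret G: comm_group "hom_group C (Dom C f) (Cod C f)" by (rule hom_comm_group) (use assms in auto)
  have "neg_arr C f \<in> homset C (Dom C f) (Cod C f)"
    using G.inv_closed[of f] assms by (simp add: neg_arr_def )
  then show "neg_arr C f \<in> Arr C" "Dom C (neg_arr C f) = Dom C f" "Cod C (neg_arr C f) = Cod C f"
    by auto
qed

lemma add_zero [simp]:
  assumes "f \<in> Arr C" "Dom C f = X" "Cod C f = Y"
  shows "f \<boxplus> Zero C X Y = f" "Zero C X Y \<boxplus> f = f"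
proof -
  interpret G: comm_group "hom_group C X Y" by (rule hom_comm_group) (use assms in auto)
  show "f \<boxplus> Zero C X Y = f" "Zero C X Y \<boxplus> f = f"
    using G.r_one[of f] G.l_one[of f] assms by simp_all
qed

lemma add_neg [simp]:
  assumes "f \<in> Arr C"
  shows "f \<boxplus> neg_arr C f = Zero C (Dom C f) (Cod C f)"
    "neg_arr C f \<boxplus> f = Zero C (Dom C f) (Cod C f)"
proof -
  interpret G: comm_group "hom_group C (Dom C f) (Cod C f)" by (rule hom_comm_group) (use assms in auto)
  show "f \<boxplus> neg_arr C f = Zero C (Dom C f) (Cod C f)"
    "neg_arr C f \<boxplus> f = Zero C (Dom C f) (Cod C f)"
    using G.r_inv[of f] G.l_inv[of f] assms by (simp_all add: neg_arr_def )
qed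

lemma add_assoc:
  assumes "f \<in> Arr C" "g \<in> Arr C" "h \<in> Arr C"
    "Dom C g = Dom C f" "Cod C g = Cod C f" "Dom C h = Dom C f" "Cod C h = Cod C f"
  shows "f \<boxplus> g \<boxplus> h = f \<boxplus> (g \<boxplus> h)"
proof -
  interpret G: comm_group "hom_group C (Dom C f) (Cod C f)" by (rule hom_comm_group) (use assms in auto)
  show ?thesis using G.m_assoc[of f g h] assms by simp
qed

lemma add_commute:
  assumes "f \<in> Arr C" "g \<in> Arr C" "Dom C g = Dom C f" "Cod C g = Cod C f"
  shows "f \<boxplus> g = g \<boxplus> f"
proof -
  interpret G: comm_group "hom_group C (Dom C f) (Cod C f)" by (rule hom_comm_group) (use assms in auto)
  show ?thesis using G.m_comm[of f g] assms by simp
qed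

lemma comp_add [simp]:
  "\<lbrakk>f \<in> Arr C; g \<in> Arr C; h \<in> Arr C; Dom C g = Dom C f; Cod C g = Cod C f; Dom C h = Cod C f\<rbrakk>
    \<Longrightarrow> h \<cdot> (f \<boxplus> g) = h \<cdot> f \<boxplus> h \<cdot> g"
  "\<lbrakk>f \<in> Arr C; g \<in> Arr C; h \<in> Arr C; Dom C g = Dom C f; Cod C g = Cod C f; Cod C h = Dom C f\<rbrakk>
    \<Longrightarrow> (f \<boxplus> g) \<cdot> h = f \<cdot> h \<boxplus> g \<cdot> h"
  using comp_add_right[of f "Dom C f" "Cod C f" g h "Cod C h"]
    comp_add_left[of h "Dom C h" "Cod C h" f "Cod C f" g] by auto

lemma add_right_cancel:
  assumes "f \<boxplus> h = g \<boxplus> h" "f \<in> Arr C" "g \<in> Arr C" "h \<in> Arr C"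
    "Dom C f = Dom C h" "Cod C f = Cod C h" "Dom C g = Dom C h" "Cod C g = Cod C h"
  shows "f = g"
proof -
  have "f = f \<boxplus> h \<boxplus> neg_arr C h" "g = g \<boxplus> h \<boxplus> neg_arr C h" using assms(2-8) by (simp_all add: add_assoc)
  then show ?thesis using assms(1) by simp
qed

text \<open>An additive operation sends zero to a solution of x + x = x. Preservation of zero by
  composition, suspension, tensoring and additive functors is deduced from this each time.\<close>

lemma add_self_eq_zero:
  assumes "f \<boxplus> f = f" "f \<in> Arr C"
  shows "f = Zero C (Dom C f) (Cod C f)"
  by (rule add_right_cancel[of _ f]) (use assms in auto)

lemma comp_zero [simp]:
  "\<lbrakk>f \<in> Arr C; X \<in> Obj C; Dom C f = Y\<rbrakk> \<Longrightarrow> f \<cdot> Zero C X Y = Zero C X (Cod C f)"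
  "\<lbrakk>f \<in> Arr C; Y \<in> Obj C; Cod C f = X\<rbrakk> \<Longrightarrow> Zero C X Y \<cdot> f = Zero C (Dom C f) Y"
proof -
  show "f \<cdot> Zero C X Y = Zero C X (Cod C f)" if "f \<in> Arr C" "X \<in> Obj C" "Dom C f = Y"
    using add_self_eq_zero[of "f \<cdot> Zero C X Y"] comp_add(1)[of "Zero C X Y" "Zero C X Y" f] that
    by (auto simp del: comp_add)
  show "Zero C X Y \<cdot> f = Zero C (Dom C f) Y" if "f \<in> Arr C" "Y \<in> Obj C" "Cod C f = X"
    using add_self_eq_zero[of "Zero C X Y \<cdot> f"] comp_add(2)[of "Zero C X Y" "Zero C X Y" f] that
    by (auto simp del: comp_add)
qed

lemma neg_unique:
  assumes "f \<boxplus> g = Zero C (Dom C f) (Cod C f)" "f \<in> Arr C" "g \<in> Arr C"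
    "Dom C g = Dom C f" "Cod C g = Cod C f"
  shows "neg_arr C f = g"
  by (rule add_right_cancel[of _ f]) (use assms add_commute[of f g] in auto)

lemma comp_neg [simp]:
  assumes "f \<in> Arr C" "g \<in> Arr C" "Dom C g = Cod C f"
  shows "g \<cdot> neg_arr C f = neg_arr C (g \<cdot> f)" "neg_arr C g \<cdot> f = neg_arr C (g \<cdot> f)"
proof -
  show "g \<cdot> neg_arr C f = neg_arr C (g \<cdot> f)"
  proof (rule neg_unique[symmetric])
    have "g \<cdot> f \<boxplus> g \<cdot> neg_arr C f = g \<cdot> (f \<boxplus> neg_arr C f)"
      by (rule comp_add(1)[symmetric]) (use assms in auto)
    then show "g \<cdot> f \<boxplus> g \<cdot> neg_arr C f = Zero C (Dom C (g \<cdot> f)) (Cod C (g \<cdot> f))" using assms by simp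
  qed (use assms in auto)
  show "neg_arr C g \<cdot> f = neg_arr C (g \<cdot> f)"
  proof (rule neg_unique[symmetric])
    have "g \<cdot> f \<boxplus> neg_arr C g \<cdot> f = (g \<boxplus> neg_arr C g) \<cdot> f"
      by (rule comp_add(2)[symmetric]) (use assms in auto)
    then show "g \<cdot> f \<boxplus> neg_arr C g \<cdot> f = Zero C (Dom C (g \<cdot> f)) (Cod C (g \<cdot> f))" using assms by simp
  qed (use assms in auto)
qed

lemma neg_zero [simp]: "\<lbrakk>X \<in> Obj C; Y \<in> Obj C\<rbrakk> \<Longrightarrow> neg_arr C (Zero C X Y) = Zero C X Y"
  by (rule neg_unique) auto

lemma neg_neg [simp]: "f \<in> Arr C \<Longrightarrow> neg_arr C (neg_arr C f) = f"
  by (rule neg_unique) auto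

lemma neg_eq_zero_iff:
  "\<lbrakk>f \<in> Arr C; Dom C f = X; Cod C f = Y\<rbrakk> \<Longrightarrow> neg_arr C f = Zero C X Y \<longleftrightarrow> f = Zero C X Y"
  by (metis neg_neg neg_zero dom_obj cod_obj)

lemma diff_eq_zero_iff:
  assumes "f \<in> Arr C" "g \<in> Arr C" "Dom C f = X" "Dom C g = X" "Cod C f = Y" "Cod C g = Y"
  shows "f \<boxplus> neg_arr C g = Zero C X Y \<longleftrightarrow> f = g"
  using add_right_cancel[of f "neg_arr C g" g] assms by auto

lemma diff_add_cancel:
  assumes "f \<in> Arr C" "g \<in> Arr C" "Dom C g = Dom C f" "Cod C g = Cod C f"
  shows "f \<boxplus> neg_arr C g \<boxplus> g = f" "g \<boxplus> (f \<boxplus> neg_arr C g) = f"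
proof -
  show 1: "f \<boxplus> neg_arr C g \<boxplus> g = f" using assms by (simp add: add_assoc)
  show "g \<boxplus> (f \<boxplus> neg_arr C g) = f" using 1 add_commute[of g "f \<boxplus> neg_arr C g"] assms by simp
qed

lemma zero_objectI:
  assumes "X \<in> Obj C" "Id C X = Zero C X X"
  shows "zero_object C X"
proof -
  have "f = Zero C X Y" if "f \<in> homset C X Y" for f Y
    using that comp_id_right[of f X] assms by auto
  moreover have "f = Zero C Y X" if "f \<in> homset C Y X" for f Y
    using that comp_id_left[of f X] assms by auto
  ultimately show ?thesis using assms unfolding zero_object_def by auto
qed

lemma zero_object_arr:
  assumes "zero_object C X" "f \<in> Arr C"
  shows "Dom C f = X \<Longrightarrow> f = Zero C X (Cod C f)" "Cod C f = X \<Longrightarrow> f = Zero C (Dom C f) X"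
  using assms unfolding zero_object_def
  by (metis cod_obj in_homset_iff singletonD, metis dom_obj in_homset_iff singletonD)

lemma zero_object_id: "zero_object C X \<Longrightarrow> Id C X = Zero C X X"
  using zero_object_arr(1)[of X "Id C X"] by (auto simp: zero_object_def)

lemma zero_object_obj: "zero_object C X \<Longrightarrow> X \<in> Obj C" by (simp add: zero_object_def)

lemma zero_object_retract:
  assumes "zero_object C X" "i \<in> homset C Y X" "r \<in> homset C X Y" "r \<cdot> i = Id C Y"
  shows "zero_object C Y"
proof (rule zero_objectI)
  show Y: "Y \<in> Obj C" using assms by auto
  have "Id C Y = r \<cdot> Zero C Y X" using assms zero_object_arr(2)[OF assms(1), of i] by auto
  then show "Id C Y = Zero C Y Y" using assms Y by auto
qed

lemma zero_object_iso:
  assumes "zero_object C X" "iso_arr C f"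
  shows "Dom C f = X \<Longrightarrow> zero_object C (Cod C f)" "Cod C f = X \<Longrightarrow> zero_object C (Dom C f)"
  using zero_object_retract[OF assms(1), of "inv_arr C f" "Cod C f" f]
    zero_object_retract[OF assms(1), of f "Dom C f" "inv_arr C f"] assms by auto

section \<open>Maps with finite support into a coproduct\<close>

lemma coproduct_projections:
  assumes co: "is_coproduct C I X P \<iota>"
  obtains \<pi> where "\<And>i. i \<in> I \<Longrightarrow> \<pi> i \<in> homset C P (X i)"
    "\<And>i j. \<lbrakk>i \<in> I; j \<in> I\<rbrakk> \<Longrightarrow> \<pi> i \<cdot> \<iota> j = (if i = j then Id C (X i) else Zero C (X j) (X i))"
proof -
  note c = coproduct_simps[OF co]
  have "\<exists>u. u \<in> homset C P (X i) \<and> (\<forall>j\<in>I. u \<cdot> \<iota> j = (if i = j then Id C (X i) else Zero C (X j) (X i)))"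
    if i: "i \<in> I" for i
  proof -
    have X: "X j \<in> Obj C" if "j \<in> I" for j by (rule c(5)[OF that])
    obtain u where "u \<in> homset C P (X i)"
      "\<And>j. j \<in> I \<Longrightarrow> u \<cdot> \<iota> j = (if i = j then Id C (X i) else Zero C (X j) (X i))"
      by (rule coproduct_map[OF co X[OF i], of "\<lambda>j. if i = j then Id C (X i) else Zero C (X j) (X i)"])
        (use X i in auto)
    then show ?thesis by blast
  qed
  then obtain \<pi> where "\<And>i. i \<in> I \<Longrightarrow> \<pi> i \<in> homset C P (X i) \<and>
      (\<forall>j\<in>I. \<pi> i \<cdot> \<iota> j = (if i = j then Id C (X i) else Zero C (X j) (X i)))" by metis
  then show thesis using that by blast
qed

end

text \<open>The maps from \<open>K\<close> that factor through a finite part of the coproduct.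
  Generating them from injections and sums avoids finite biproducts and choices of support, and
  turns uses of compactness into inductions.\<close>

inductive_set coprod_span for C :: "('o, 'm, 'z) additive_category_scheme" and I X P \<iota> K where
  zero: "Zero C K P \<in> coprod_span C I X P \<iota> K"
| inj: "i \<in> I \<Longrightarrow> x \<in> homset C K (X i) \<Longrightarrow> \<iota> i \<cdot>\<^bsub>C\<^esub> x \<in> coprod_span C I X P \<iota> K"
| add: "q \<in> coprod_span C I X P \<iota> K \<Longrightarrow> r \<in> coprod_span C I X P \<iota> K
    \<Longrightarrow> q \<boxplus>\<^bsub>C\<^esub> r \<in> coprod_span C I X P \<iota> K"

context additive_category
begin

lemma span_homset:
  assumes co: "is_coproduct C I X P \<iota>" and K: "K \<in> Obj C" and q: "q \<in> coprod_span C I X P \<iota> K"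
  shows "q \<in> homset C K P"
  using q
proof induction
  case (inj i x)
  then show ?case using coproduct_simps(2-5)[OF co, of i] coproduct_simps(1)[OF co] by auto
qed (use coproduct_simps[OF co] K in auto)

lemma span_comp:
  assumes co: "is_coproduct C I X P \<iota>" and x: "x \<in> homset C K' K" and q: "q \<in> coprod_span C I X P \<iota> K"
  shows "q \<cdot> x \<in> coprod_span C I X P \<iota> K'"
  using q
proof induction
  case zero
  then show ?case using x coproduct_simps[OF co] by (auto intro: coprod_span.zero)
next
  case (inj i y)
  have "(\<iota> i \<cdot> y) \<cdot> x = \<iota> i \<cdot> y \<cdot> x" using inj x coproduct_simps(2-5)[OF co, of i] coproduct_simps(1)[OF co] by auto
  moreover have "y \<cdot> x \<in> homset C K' (X i)" using inj x by auto
  ultimately show ?case using inj coprod_span.inj by metis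
next
  case (add q r)
  have K: "K \<in> Obj C" using x by auto
  have "q \<in> homset C K P" "r \<in> homset C K P" using span_homset[OF co K] add by blast+
  then have "(q \<boxplus> r) \<cdot> x = q \<cdot> x \<boxplus> r \<cdot> x" using x by auto
  then show ?case using add coprod_span.add by metis
qed

text \<open>The map \<open>e\<close> is the projection onto the summands in \<open>J\<close>.\<close>

lemma finite_projection:
  assumes co: "is_coproduct C I X P \<iota>" and J: "finite J" "J \<subseteq> I"
    and \<pi>: "\<And>i. i \<in> I \<Longrightarrow> \<pi> i \<in> homset C P (X i)"
    "\<And>i j. \<lbrakk>i \<in> I; j \<in> I\<rbrakk> \<Longrightarrow> \<pi> i \<cdot> \<iota> j = (if i = j then Id C (X i) else Zero C (X j) (X i))"
  shows "\<exists>e\<in>coprod_span C I X P \<iota> P.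
      (\<forall>i\<in>I. e \<cdot> \<iota> i = (if i \<in> J then \<iota> i else Zero C (X i) P)) \<and>
      (\<forall>K r. r \<in> homset C K P \<longrightarrow> (\<forall>i\<in>I. \<pi> i \<cdot> r = Zero C K (X i)) \<longrightarrow> e \<cdot> r = Zero C K P)"
  using J
proof (induction J)
  case empty
  note c = coproduct_simps[OF co]
  show ?case by (rule bexI[of _ "Zero C P P"]) (use c in \<open>auto intro: coprod_span.zero\<close>)
next
  case (insert j J)
  note c = coproduct_simps[OF co]
  obtain e where e: "e \<in> coprod_span C I X P \<iota> P"
    "\<forall>i\<in>I. e \<cdot> \<iota> i = (if i \<in> J then \<iota> i else Zero C (X i) P)"
    "\<forall>K r. r \<in> homset C K P \<longrightarrow> (\<forall>i\<in>I. \<pi> i \<cdot> r = Zero C K (X i)) \<longrightarrow> e \<cdot> r = Zero C K P"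
    using insert by blast
  have j: "j \<in> I" using insert by auto
  have eh: "e \<in> homset C P P" using span_homset[OF co _ e(1)] c by auto
  let ?e = "e \<boxplus> \<iota> j \<cdot> \<pi> j"
  note cj = c(2-4)[OF j] and pj = \<pi>(1)[OF j]
  show ?case
  proof (rule bexI[of _ ?e], intro conjI ballI allI impI)
    show "?e \<in> coprod_span C I X P \<iota> P" using e(1) j \<pi>(1) by (auto intro!: coprod_span.intros)
    fix i assume i: "i \<in> I"
    have X: "X i \<in> Obj C" by (rule c(5)[OF i])
    have "?e \<cdot> \<iota> i = e \<cdot> \<iota> i \<boxplus> \<iota> j \<cdot> \<pi> j \<cdot> \<iota> i" using eh cj c(2-4)[OF i] pj by simp
    also have "\<dots> = (if i \<in> insert j J then \<iota> i else Zero C (X i) P)"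
      using e(2) i j \<pi>(2)[OF j i] cj c(1) c(2-4)[OF i] X insert(2) by auto
    finally show "?e \<cdot> \<iota> i = (if i \<in> insert j J then \<iota> i else Zero C (X i) P)" .
  next
    fix K r assume r: "r \<in> homset C K P" "\<forall>i\<in>I. \<pi> i \<cdot> r = Zero C K (X i)"
    have K: "K \<in> Obj C" using r by auto
    have "?e \<cdot> r = e \<cdot> r \<boxplus> \<iota> j \<cdot> \<pi> j \<cdot> r" using eh cj pj r(1) by simp
    also have "\<dots> = Zero C K P" using e(3) r j cj c(1) K by simp
    finally show "?e \<cdot> r = Zero C K P" .
  qed
qed

text \<open>Finite support is expressed through endomorphisms of \<open>P\<close> rather than
  through a decomposition of \<open>q\<close>. In this form it passes to sums, by uniting the
  supports, without any bookkeeping of summands.\<close>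

lemma span_finite_support:
  assumes co: "is_coproduct C I X P \<iota>" and K: "K \<in> Obj C" and q: "q \<in> coprod_span C I X P \<iota> K"
  shows "\<exists>J. finite J \<and> J \<subseteq> I \<and> (\<forall>e\<in>homset C P P. (\<forall>i\<in>J. e \<cdot> \<iota> i = \<iota> i) \<longrightarrow> e \<cdot> q = q)"
  using q
proof induction
  case zero
  then show ?case using K coproduct_simps[OF co] by (intro exI[of _ "{}"]) auto
next
  case (inj i x)
  have "e \<cdot> \<iota> i \<cdot> x = \<iota> i \<cdot> x" if e: "e \<in> homset C P P" "e \<cdot> \<iota> i = \<iota> i" for e
    using comp_reassoc[OF e(2), of x] inj coproduct_simps(2-5)[OF co, of i] coproduct_simps(1)[OF co] e by auto
  then show ?case using inj by (intro exI[of _ "{i}"]) auto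
next
  case (add q r)
  then obtain J J' where J: "finite J" "J \<subseteq> I" "\<forall>e\<in>homset C P P. (\<forall>i\<in>J. e \<cdot> \<iota> i = \<iota> i) \<longrightarrow> e \<cdot> q = q"
    "finite J'" "J' \<subseteq> I" "\<forall>e\<in>homset C P P. (\<forall>i\<in>J'. e \<cdot> \<iota> i = \<iota> i) \<longrightarrow> e \<cdot> r = r" by blast
  have "q \<in> homset C K P" "r \<in> homset C K P" using span_homset[OF co K] add by auto
  then have "e \<cdot> (q \<boxplus> r) = q \<boxplus> r" if "e \<in> homset C P P" "\<forall>i\<in>J \<union> J'. e \<cdot> \<iota> i = \<iota> i" for e
    using that J by auto
  then show ?case using J by (intro exI[of _ "J \<union> J'"]) auto
qed

text \<open>Since \<open>e\<close> lies in the span itself, \<open>e \<cdot> x\<close> is in the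
  span for every \<open>x\<close>, even if only some composite of \<open>x\<close> was known to be.
  \<open>compact_cone\<close> rests on this.\<close>

lemma span_projection:
  assumes co: "is_coproduct C I X P \<iota>" and K: "K \<in> Obj C" and q: "q \<in> coprod_span C I X P \<iota> K"
  shows "\<exists>e\<in>coprod_span C I X P \<iota> P. e \<cdot> q = q"
proof -
  obtain \<pi> where \<pi>: "\<And>i. i \<in> I \<Longrightarrow> \<pi> i \<in> homset C P (X i)"
    "\<And>i j. \<lbrakk>i \<in> I; j \<in> I\<rbrakk> \<Longrightarrow> \<pi> i \<cdot> \<iota> j = (if i = j then Id C (X i) else Zero C (X j) (X i))"
    using coproduct_projections[OF co] by blast
  obtain J where J: "finite J" "J \<subseteq> I" "\<forall>e\<in>homset C P P. (\<forall>i\<in>J. e \<cdot> \<iota> i = \<iota> i) \<longrightarrow> e \<cdot> q = q"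
    using span_finite_support[OF co K q] by blast
  obtain e where "e \<in> coprod_span C I X P \<iota> P"
    "\<forall>i\<in>I. e \<cdot> \<iota> i = (if i \<in> J then \<iota> i else Zero C (X i) P)"
    using finite_projection[OF co J(1,2) \<pi>] by blast
  moreover then have "e \<in> homset C P P" using span_homset[OF co] coproduct_simps[OF co] by blast
  ultimately show ?thesis using J by (metis subsetD)
qed

text \<open>The projection onto a finite support fixes \<open>q\<close>, but it also kills whatever
  all the \<open>\<pi> i\<close> kill. In general the projections of an infinite coproduct need not
  be jointly monic; they become so on maps from compact objects.\<close>

lemma span_eq_zero:
  assumes co: "is_coproduct C I X P \<iota>" and K: "K \<in> Obj C" and q: "q \<in> coprod_span C I X P \<iota> K"
    and \<pi>: "\<And>i. i \<in> I \<Longrightarrow> \<pi> i \<in> homset C P (X i)"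
    "\<And>i j. \<lbrakk>i \<in> I; j \<in> I\<rbrakk> \<Longrightarrow> \<pi> i \<cdot> \<iota> j = (if i = j then Id C (X i) else Zero C (X j) (X i))"
    and 0: "\<And>i. i \<in> I \<Longrightarrow> \<pi> i \<cdot> q = Zero C K (X i)"
  shows "q = Zero C K P"
proof -
  obtain J where J: "finite J" "J \<subseteq> I" "\<forall>e\<in>homset C P P. (\<forall>i\<in>J. e \<cdot> \<iota> i = \<iota> i) \<longrightarrow> e \<cdot> q = q"
    using span_finite_support[OF co K q] by blast
  obtain e where e: "e \<in> coprod_span C I X P \<iota> P"
    "\<forall>i\<in>I. e \<cdot> \<iota> i = (if i \<in> J then \<iota> i else Zero C (X i) P)"
    "\<forall>K r. r \<in> homset C K P \<longrightarrow> (\<forall>i\<in>I. \<pi> i \<cdot> r = Zero C K (X i)) \<longrightarrow> e \<cdot> r = Zero C K P"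
    using finite_projection[OF co J(1,2) \<pi>] by blast
  have "e \<in> homset C P P" using span_homset[OF co] coproduct_simps[OF co] e by blast
  then have "e \<cdot> q = q" using J e(2) by (metis subsetD)
  moreover have "e \<cdot> q = Zero C K P" using e(3) span_homset[OF co K q] 0 by blast
  ultimately show ?thesis by simp
qed

lemma finprod_in_span:
  assumes co: "is_coproduct C I X P \<iota>" and K: "K \<in> Obj C" and A: "finite A" "A \<subseteq> I"
    and x: "\<And>i. i \<in> I \<Longrightarrow> x i \<in> homset C K (X i)"
  shows "finprod (hom_group C K P) (\<lambda>i. \<iota> i \<cdot> x i) A \<in> coprod_span C I X P \<iota> K"
proof -
  note c = coproduct_simps[OF co]
  interpret G: comm_group "hom_group C K P" by (rule hom_comm_group) (use K c in auto)
  show ?thesis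
    using A
  proof (induction A)
    case empty
    then show ?case by (simp add: coprod_span.zero)
  next
    case (insert i A)
    have "\<iota> j \<cdot> x j \<in> homset C K P" if "j \<in> I" for j using x[OF that] c(1) c(2-5)[OF that] by simp
    then have "(\<lambda>i. \<iota> i \<cdot> x i) \<in> insert i A \<rightarrow> carrier (hom_group C K P)"
      using insert by auto
    then have "finprod (hom_group C K P) (\<lambda>i. \<iota> i \<cdot> x i) (insert i A)
        = \<iota> i \<cdot> x i \<boxplus> finprod (hom_group C K P) (\<lambda>i. \<iota> i \<cdot> x i) A"
      using insert by (subst G.finprod_insert) (auto simp: Pi_iff)
    moreover have "\<iota> i \<cdot> x i \<in> coprod_span C I X P \<iota> K"
      using insert x by (intro coprod_span.inj) auto
    moreover have "finprod (hom_group C K P) (\<lambda>i. \<iota> i \<cdot> x i) A \<in> coprod_span C I X P \<iota> K"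
      by (rule insert.IH) (use insert.prems in auto)
    ultimately show ?case by (simp add: coprod_span.add)
  qed
qed

lemma finprod_projection:
  assumes co: "is_coproduct C I X P \<iota>" and K: "K \<in> Obj C" and A: "finite A" "A \<subseteq> I" "j \<in> I"
    and x: "\<And>i. i \<in> I \<Longrightarrow> x i \<in> homset C K (X i)"
    and \<pi>: "\<And>i. i \<in> I \<Longrightarrow> \<pi> i \<in> homset C P (X i)"
    "\<And>i j. \<lbrakk>i \<in> I; j \<in> I\<rbrakk> \<Longrightarrow> \<pi> i \<cdot> \<iota> j = (if i = j then Id C (X i) else Zero C (X j) (X i))"
  shows "\<pi> j \<cdot> finprod (hom_group C K P) (\<lambda>i. \<iota> i \<cdot> x i) A = (if j \<in> A then x j else Zero C K (X j))"
proof -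
  note c = coproduct_simps[OF co]
  interpret G: comm_group "hom_group C K P" by (rule hom_comm_group) (use K c in auto)
  have X: "X j \<in> Obj C" if "j \<in> I" for j by (rule c(5)[OF that])
  show ?thesis
    using A
  proof (induction A)
    case empty
    then show ?case using K c \<pi>(1)[of j] X by (auto)
  next
    case (insert i A)
    have i: "i \<in> I" and A: "A \<subseteq> I" using insert by auto
    have "\<iota> j \<cdot> x j \<in> homset C K P" if "j \<in> I" for j using x[OF that] c(1) c(2-5)[OF that] by simp
    then have "(\<lambda>i. \<iota> i \<cdot> x i) \<in> insert i A \<rightarrow> carrier (hom_group C K P)"
      using insert by auto
    then have "finprod (hom_group C K P) (\<lambda>i. \<iota> i \<cdot> x i) (insert i A)
        = \<iota> i \<cdot> x i \<boxplus> finprod (hom_group C K P) (\<lambda>i. \<iota> i \<cdot> x i) A" (is "_ = _ \<boxplus> ?r")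
      using insert by (subst G.finprod_insert) (auto simp: Pi_iff)
    moreover have r: "?r \<in> homset C K P"
      by (rule span_homset[OF co K finprod_in_span[OF co K insert(1) A]]) (use x in auto)
    moreover have "\<pi> j \<cdot> \<iota> i \<cdot> x i = (\<pi> j \<cdot> \<iota> i) \<cdot> x i"
      using c(2-4)[OF i] \<pi>(1)[OF \<open>j \<in> I\<close>] x[OF i] by simp
    moreover have "(\<pi> j \<cdot> \<iota> i) \<cdot> x i = (if i = j then x i else Zero C K (X j))"
      unfolding \<pi>(2)[OF \<open>j \<in> I\<close> i] using x[OF i] X[OF \<open>j \<in> I\<close>] by auto
    ultimately have "\<pi> j \<cdot> finprod (hom_group C K P) (\<lambda>i. \<iota> i \<cdot> x i) (insert i A) =
       (if i = j then x i else Zero C K (X j)) \<boxplus> \<pi> j \<cdot> ?r"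
      using c(2-4)[OF i] \<pi>(1)[OF \<open>j \<in> I\<close>] x[OF i] by auto
    then show ?case using insert.IH[OF A \<open>j \<in> I\<close>] insert(2) x[OF i] K X[OF \<open>j \<in> I\<close>] x[OF \<open>j \<in> I\<close>] by auto
  qed
qed

text \<open>The canonical map from the direct sum is always injective, because the projections
  recover the components of a family. Compactness is therefore a matter of surjectivity alone, and
  this says that all maps lie in the span. The direct sums of groups from the definition do not
  return after this point.\<close>

lemma compact_obj_iff_span:
  "compact_obj (U :: 'u itself) C K \<longleftrightarrow> K \<in> Obj C \<and> (\<forall>(I :: 'u set) Y P \<iota>. small U I \<and> is_coproduct C I Y P \<iota> \<longrightarrow>
      homset C K P \<subseteq> coprod_span C I Y P \<iota> K)"
proof -
  have *: "(\<lambda>x. gfinprod (hom_group C K P) (\<lambda>i. \<iota> i \<cdot> x i) I)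
          \<in> iso (sum_group I (\<lambda>i. hom_group C K (Y i))) (hom_group C K P) \<longleftrightarrow>
      homset C K P \<subseteq> coprod_span C I Y P \<iota> K" (is "?h \<in> iso ?S ?G \<longleftrightarrow> _")
    if co: "is_coproduct C I Y P \<iota>" and K: "K \<in> Obj C" for I :: "'u set" and Y P \<iota>
  proof -
    note c = coproduct_simps[OF co]
    interpret G: comm_group "hom_group C K P" by (rule hom_comm_group) (use K c in auto)
    have Y: "Y j \<in> Obj C" if "j \<in> I" for j by (rule c(5)[OF that])
    have grp: "comm_group (hom_group C K (Y i))" if "i \<in> I" for i
      using hom_comm_group[OF K Y[OF that]] .
    have grp': "group (hom_group C K (Y i))" if "i \<in> I" for i
      using grp[OF that] by (simp add: comm_group_def)
    note car = carrier_sum_group[OF grp']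
    have xc: "x i \<in> homset C K (Y i)" if "x \<in> carrier ?S" "i \<in> I" for x i
      using that by (auto simp: car  PiE_iff)
    obtain \<pi> where \<pi>: "\<And>i. i \<in> I \<Longrightarrow> \<pi> i \<in> homset C P (Y i)"
      "\<And>i j. \<lbrakk>i \<in> I; j \<in> I\<rbrakk> \<Longrightarrow> \<pi> i \<cdot> \<iota> j = (if i = j then Id C (Y i) else Zero C (Y j) (Y i))"
      using coproduct_projections[OF co] by blast
    have h: "?h \<in> hom ?S ?G"
    proof (rule G.hom_group_sum)
      fix i assume i: "i \<in> I"
      show "group (hom_group C K (Y i))" by (rule grp'[OF i])
      show "(\<lambda>x. \<iota> i \<cdot> x) \<in> hom (hom_group C K (Y i)) (hom_group C K P)"
        using c(2-4)[OF i] by (auto simp: hom_def )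
    qed
    have eq: "?h x = finprod ?G (\<lambda>i. \<iota> i \<cdot> x i) {i \<in> I. \<iota> i \<cdot> x i \<noteq> \<one>\<^bsub>?G\<^esub>}"
      and fin: "finite {i \<in> I. \<iota> i \<cdot> x i \<noteq> \<one>\<^bsub>?G\<^esub>}" if x: "x \<in> carrier ?S" for x
    proof -
      have "{i \<in> I. \<iota> i \<cdot> x i \<noteq> \<one>\<^bsub>?G\<^esub>} \<subseteq> {i \<in> I. x i \<noteq> \<one>\<^bsub>hom_group C K (Y i)\<^esub>}"
        using c K Y by auto
      moreover have "finite {i \<in> I. x i \<noteq> \<one>\<^bsub>hom_group C K (Y i)\<^esub>}" using x by (simp add: car)
      ultimately show fin: "finite {i \<in> I. \<iota> i \<cdot> x i \<noteq> \<one>\<^bsub>?G\<^esub>}" using finite_subset by blast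
      have "(\<lambda>i. \<iota> i \<cdot> x i) \<in> I \<rightarrow> carrier ?G" using xc[OF x] c by force
      then show "?h x = finprod ?G (\<lambda>i. \<iota> i \<cdot> x i) {i \<in> I. \<iota> i \<cdot> x i \<noteq> \<one>\<^bsub>?G\<^esub>}"
        using fin by (simp add: gfinprod_def)
    qed
    have span: "?h x \<in> coprod_span C I Y P \<iota> K" if x: "x \<in> carrier ?S" for x
      unfolding eq[OF x] by (rule finprod_in_span[OF co K fin[OF x]]) (use xc[OF x] in auto)
    have \<pi>h: "\<pi> j \<cdot> ?h x = x j" if x: "x \<in> carrier ?S" and j: "j \<in> I" for x j
    proof -
      \<comment> \<open>\<open>gfinprod\<close> collects the indices at which the term
        \<open>\<iota> j \<cdot> x j\<close> is non-zero, which could be fewer than those with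
        \<open>x j\<close> non-zero. Since \<open>\<iota> j\<close> is split by
        \<open>\<pi> j\<close>, the two supports agree.\<close>
      have "x j = Zero C K (Y j)" if "\<iota> j \<cdot> x j = Zero C K P"
      proof -
        have "x j = (\<pi> j \<cdot> \<iota> j) \<cdot> x j" using \<pi>(2)[OF j j] xc[OF x j] by auto
        also have "\<dots> = \<pi> j \<cdot> \<iota> j \<cdot> x j" using \<pi>(1)[OF j] xc[OF x j] c(2-4)[OF j] by simp
        also have "\<dots> = Zero C K (Y j)" using that \<pi>(1)[OF j] K c(1) by simp
        finally show ?thesis .
      qed
      then show ?thesis
        unfolding eq[OF x] using finprod_projection[OF co K fin[OF x] _ j, of x \<pi>] xc[OF x] \<pi> j
        by auto
    qed
    have "inj_on ?h (carrier ?S)"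
    proof (rule inj_onI)
      fix x y assume x: "x \<in> carrier ?S" and y: "y \<in> carrier ?S" and "?h x = ?h y"
      then have "x j = y j" if "j \<in> I" for j using \<pi>h[OF x that] \<pi>h[OF y that] by simp
      then show "x = y" using x y PiE_ext[of x I "\<lambda>i. carrier (hom_group C K (Y i))" y] by (auto simp: car)
    qed
    moreover have "?h ` carrier ?S = carrier ?G \<longleftrightarrow> homset C K P \<subseteq> coprod_span C I Y P \<iota> K"
    proof
      assume "?h ` carrier ?S = carrier ?G"
      then show "homset C K P \<subseteq> coprod_span C I Y P \<iota> K" using span by force
    next
      assume sub: "homset C K P \<subseteq> coprod_span C I Y P \<iota> K"
      interpret S: group ?S by (rule sum_group[OF grp'])
      interpret h: group_hom ?S ?G ?h by unfold_locales (rule h)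
      have "q \<in> ?h ` carrier ?S" if "q \<in> coprod_span C I Y P \<iota> K" for q
        using that
      proof induction
        case zero
        have "?h \<one>\<^bsub>?S\<^esub> = Zero C K P" using h.hom_one by (simp only: hom_group_simps)
        then show ?case using image_eqI[of "Zero C K P" ?h "\<one>\<^bsub>?S\<^esub>"] S.one_closed by (simp only: simp_thms)
      next
        case (inj i x)
        let ?x = "\<lambda>j\<in>I. if j = i then x else Zero C K (Y j)"
        have xS: "?x \<in> carrier ?S"
        proof -
          have "{j \<in> I. ?x j \<noteq> \<one>\<^bsub>hom_group C K (Y j)\<^esub>} \<subseteq> {i}" by (auto simp: split: if_splits)
          then have "finite {j \<in> I. ?x j \<noteq> \<one>\<^bsub>hom_group C K (Y j)\<^esub>}" using finite_subset by blast
          then show ?thesis using inj K Y by (auto simp: car  split: if_splits)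
        qed
        have "?h ?x = \<iota> i \<cdot> x"
        proof -
          have "gfinprod ?G (\<lambda>j. \<iota> j \<cdot> ?x j) I = gfinprod ?G (\<lambda>j. \<iota> j \<cdot> ?x j) {i}"
            by (rule G.gfinprod_mono_neutral_cong_right) (use inj K Y c in \<open>auto\<close>)
          also have "\<dots> = \<iota> i \<cdot> x"
            using inj c by (subst G.gfinprod_eq_finprod) auto
          finally show ?thesis by simp
        qed
        then show ?case by (intro image_eqI[OF _ xS]) (rule sym)
      next
        case (add q r)
        then obtain x y where "x \<in> carrier ?S" "y \<in> carrier ?S" "q = ?h x" "r = ?h y" by blast
        then have "q \<boxplus> r = ?h (x \<otimes>\<^bsub>?S\<^esub> y)" "x \<otimes>\<^bsub>?S\<^esub> y \<in> carrier ?S"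
          using h.hom_mult[of x y] S.m_closed by simp_all
        then show ?case by blast
      qed
      then show "?h ` carrier ?S = carrier ?G" using sub h.hom_closed by auto
    qed
    ultimately show ?thesis using h by (auto simp: iso_def bij_betw_def)
  qed
  show ?thesis
  proof (cases "K \<in> Obj C")
    case True
    have Y: "Y \<in> I \<rightarrow> Obj C" if "is_coproduct C I Y P \<iota>" for I :: "'u set" and Y P \<iota>
      using coproduct_simps[OF that] by (metis Pi_I dom_obj)
    show ?thesis
    proof
      assume K: "compact_obj U C K"
      show "K \<in> Obj C \<and> (\<forall>(I :: 'u set) Y P \<iota>. small U I \<and> is_coproduct C I Y P \<iota> \<longrightarrow>
          homset C K P \<subseteq> coprod_span C I Y P \<iota> K)"
      proof (intro conjI allI impI True)
        fix I :: "'u set" and Y P \<iota> assume co: "small U I \<and> is_coproduct C I Y P \<iota>"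
        then have "Y \<in> I \<rightarrow> Obj C" using Y by blast
        with co have "small U I \<and> Y \<in> I \<rightarrow> Obj C \<and> is_coproduct C I Y P \<iota>" by blast
        from K[unfolded compact_obj_def, THEN conjunct2, rule_format, OF this]
        show "homset C K P \<subseteq> coprod_span C I Y P \<iota> K" using * co True by blast
      qed
    next
      assume K: "K \<in> Obj C \<and> (\<forall>(I :: 'u set) Y P \<iota>. small U I \<and> is_coproduct C I Y P \<iota> \<longrightarrow>
          homset C K P \<subseteq> coprod_span C I Y P \<iota> K)"
      show "compact_obj U C K"
        unfolding compact_obj_def
      proof (intro conjI allI impI True)
        fix I :: "'u set" and Y P \<iota> assume co: "small U I \<and> Y \<in> I \<rightarrow> Obj C \<and> is_coproduct C I Y P \<iota>"
        then have "homset C K P \<subseteq> coprod_span C I Y P \<iota> K" using K by blast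
        then show "(\<lambda>x. gfinprod (hom_group C K P) (\<lambda>i. \<iota> i \<cdot> x i) I)
          \<in> iso (sum_group I (\<lambda>i. hom_group C K (Y i))) (hom_group C K P)" using * co True by blast
      qed
    qed
  qed (simp add: compact_obj_def)
qed

lemma compact_objD:
  "\<lbrakk>compact_obj U C K; small U I; is_coproduct C (I :: 'u set) Y P \<iota>; q \<in> homset C K P\<rbrakk>
    \<Longrightarrow> q \<in> coprod_span C I Y P \<iota> K" for U :: "'u itself"
  using compact_obj_iff_span[of U K] by blast

lemma compact_objI:
  assumes "K \<in> Obj C"
    "\<And>(I :: 'u set) Y P \<iota> q. \<lbrakk>small U I; is_coproduct C I Y P \<iota>; q \<in> homset C K P\<rbrakk>
      \<Longrightarrow> q \<in> coprod_span C I Y P \<iota> K"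
  shows "compact_obj (U :: 'u itself) C K"
  using compact_obj_iff_span[of U K] assms by blast

lemma compact_obj_obj: "compact_obj U C K \<Longrightarrow> K \<in> Obj C"
  by (simp add: compact_obj_def)

lemma compact_obj_iso:
  assumes K: "compact_obj U C K" and f: "f \<in> homset C K K'" "iso_arr C f"
  shows "compact_obj (U :: 'u itself) C K'"
proof (rule compact_objI)
  show "K' \<in> Obj C" using f by auto
  fix I :: "'u set" and Y P \<iota> q
  assume I: "small U I" and co: "is_coproduct C I Y P \<iota>" and q: "q \<in> homset C K' P"
  have "q \<cdot> f \<in> coprod_span C I Y P \<iota> K" using compact_objD[OF K I co] q f by simp
  then have "(q \<cdot> f) \<cdot> inv_arr C f \<in> coprod_span C I Y P \<iota> K'"
    using span_comp[OF co, of "inv_arr C f" K' K] f by auto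
  then show "q \<in> coprod_span C I Y P \<iota> K'" using q f by simp
qed

lemma small_reindex:
  assumes "small (U :: 'u itself) A"
  obtains J :: "'u set" and b where "bij_betw b J A" "small U J"
proof -
  have "|A| \<le>o |UNIV :: 'u set|" using assms ordLess_imp_ordLeq by (auto simp: small_def)
  then obtain g where g: "inj_on g A" "g ` A \<subseteq> (UNIV :: 'u set)" using card_of_ordLeq[of A "UNIV :: 'u set"] by auto
  have "bij_betw g A (g ` A)" using g by (simp add: inj_on_imp_bij_betw)
  then have b: "bij_betw (inv_into A g) (g ` A) A" by (rule bij_betw_inv_into)
  have "|g ` A| \<le>o |A|" by simp
  then have "small U (g ` A)" using assms ordLeq_ordLess_trans unfolding small_def by blast
  then show thesis using that b by blast
qed

lemma compact_span:
  assumes K: "compact_obj (U :: 'u itself) C K" and A: "small U A" and co: "is_coproduct C A Y P \<iota>"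
    and q: "q \<in> homset C K P"
  shows "q \<in> coprod_span C A Y P \<iota> K"
proof -
  obtain J :: "'u set" and b where b: "bij_betw b J A" "small U J" using small_reindex[OF A] by blast
  have "is_coproduct C J (Y \<circ> b) P (\<iota> \<circ> b)" using coproduct_reindex[OF b(1)] co by blast
  then have "q \<in> coprod_span C J (Y \<circ> b) P (\<iota> \<circ> b) K"
    using compact_objD[OF K b(2)] q by blast
  then show ?thesis
  proof induction
    case (inj i x)
    have "b i \<in> A" using inj b by (auto simp: bij_betw_def)
    then show ?case using inj coprod_span.inj[of "b i" A x C K Y \<iota> P] by auto
  qed (auto intro: coprod_span.intros)
qed

end

section \<open>Triangulated categories\<close>

context triangulated_category
begin

abbreviation S where "S \<equiv> fobj (Susp C)"
abbreviation Sa where "Sa \<equiv> farr (Susp C)"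

lemma susp_functor: "is_functor C C (Susp C)"
  using susp_additive by (simp add: additive_functor_def)

lemma susp_obj [simp]: "X \<in> Obj C \<Longrightarrow> S X \<in> Obj C"
  using susp_functor by (simp add: is_functor_def)

lemma susp_arr [simp]:
  assumes "f \<in> Arr C"
  shows "Sa f \<in> Arr C" "Dom C (Sa f) = S (Dom C f)" "Cod C (Sa f) = S (Cod C f)"
  using susp_functor assms by (auto simp: is_functor_def)

lemma susp_id [simp]: "X \<in> Obj C \<Longrightarrow> Sa (Id C X) = Id C (S X)"
  using susp_functor by (simp add: is_functor_def)

lemma susp_comp [simp]: "\<lbrakk>f \<in> Arr C; g \<in> Arr C; Dom C g = Cod C f\<rbrakk> \<Longrightarrow> Sa (g \<cdot> f) = Sa g \<cdot> Sa f"
  using susp_functor by (simp add: is_functor_def)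

lemma susp_add [simp]:
  assumes "f \<in> Arr C" "g \<in> Arr C" "Dom C g = Dom C f" "Cod C g = Cod C f"
  shows "Sa (f \<boxplus> g) = Sa f \<boxplus> Sa g"
proof -
  have "Sa \<in> hom (hom_group C (Dom C f) (Cod C f)) (hom_group C (S (Dom C f)) (S (Cod C f)))"
    using susp_additive assms by (simp add: additive_functor_def)
  from hom_mult[OF this, of f g] show ?thesis using assms by simp
qed

lemma susp_zero [simp]:
  assumes "X \<in> Obj C" "Y \<in> Obj C"
  shows "Sa (Zero C X Y) = Zero C (S X) (S Y)"
  using add_self_eq_zero[of "Sa (Zero C X Y)"] susp_add[of "Zero C X Y" "Zero C X Y"] assms
  by (simp del: susp_add)

lemma susp_inj:
  assumes "Sa f = Sa g" "f \<in> Arr C" "g \<in> Arr C" "Dom C g = Dom C f" "Cod C g = Cod C f"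
  shows "f = g"
proof -
  have "bij_betw Sa (homset C (Dom C f) (Cod C f)) (homset C (S (Dom C f)) (S (Cod C f)))"
    using susp_equivalence assms by (simp add: is_equivalence_def)
  then show ?thesis using assms unfolding bij_betw_def inj_on_def by simp
qed

lemma susp_full:
  assumes "g \<in> homset C (S X) (S Y)" "X \<in> Obj C" "Y \<in> Obj C"
  obtains f where "f \<in> homset C X Y" "Sa f = g"
proof -
  have "bij_betw Sa (homset C X Y) (homset C (S X) (S Y))"
    using susp_equivalence assms(2,3) by (simp add: is_equivalence_def)
  then have "g \<in> Sa ` homset C X Y" using assms(1) by (simp add: bij_betw_def)
  then show thesis using that by blast
qed

text \<open>The suspension is assumed to be an equivalence, not an automorphism, so there is no
  inverse functor to apply; each desuspension brings an isomorphism that has to be carried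
  along.\<close>

lemma desusp:
  assumes "X \<in> Obj C"
  obtains Y e where "Y \<in> Obj C" "e \<in> homset C (S Y) X" "iso_arr C e"
  using susp_equivalence assms unfolding is_equivalence_def by blast

lemma susp_iso [simp]: "iso_arr C f \<Longrightarrow> iso_arr C (Sa f)"
  using susp_comp[of f "inv_arr C f"] susp_comp[of "inv_arr C f" f]
  by (intro iso_arrI[of _ "Sa (inv_arr C f)"]) (simp_all del: susp_comp)

lemma susp_neg [simp]: "f \<in> Arr C \<Longrightarrow> Sa (neg_arr C f) = neg_arr C (Sa f)"
  using susp_add[of f "neg_arr C f"] by (intro neg_unique[symmetric]) (simp_all del: susp_add)

lemma susp_zero_object:
  assumes "X \<in> Obj C" shows "zero_object C (S X) \<longleftrightarrow> zero_object C X"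
proof
  assume "zero_object C X"
  then have "Sa (Id C X) = Sa (Zero C X X)" using zero_object_id by simp
  then show "zero_object C (S X)" using assms by (intro zero_objectI) auto
next
  assume z: "zero_object C (S X)"
  have "Sa (Id C X) = Sa (Zero C X X)" using zero_object_id[OF z] assms by simp
  then have "Id C X = Zero C X X" by (rule susp_inj) (use assms in auto)
  then show "zero_object C X" using assms by (intro zero_objectI)
qed

lemma tri_simps:
  assumes "(f, g, h) \<in> Tri C"
  shows "f \<in> Arr C" "g \<in> Arr C" "h \<in> Arr C" "Dom C g = Cod C f" "Dom C h = Cod C g"
    "Cod C h = S (Dom C f)"
  using tri_candidate[OF assms] unfolding candidate_triangle_def case_prod_conv homset_def mem_Collect_eq
  by blast+

section \<open>Exactness of Hom in both variables along a triangle\<close>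

lemma tri_rotateD:
  assumes "(f, g, h) \<in> Tri C"
  shows "(g, h, neg_arr C (Sa f)) \<in> Tri C"
  using tri_rotate[OF tri_candidate[OF assms]] assms by blast

text \<open>The identity and \<open>f\<close> begin a map from the trivial triangle on
  \<open>Dom C f\<close>, whose third object is zero. The third component of that map then forces
  the composite to vanish.\<close>

lemma tri_comp_zero:
  assumes t: "(f, g, h) \<in> Tri C"
  shows "g \<cdot> f = Zero C (Dom C f) (Cod C g)"
proof -
  note [simp] = tri_simps[OF t]
  obtain Z where Z: "zero_object C Z" using zero_object_exists by blast
  note [simp] = zero_object_obj[OF Z]
  let ?X = "Dom C f"
  have "(Id C ?X, Zero C ?X Z, Zero C Z (S ?X)) \<in> Tri C" by (rule tri_id) (use Z in auto)
  from tri_complete[OF this t, of "Id C ?X" f]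
  obtain c where "c \<in> homset C Z (Cod C g)" "c \<cdot> Zero C ?X Z = g \<cdot> f"
    by (auto simp: triangle_map_def)
  then show ?thesis by simp
qed

lemma tri_comp_zero2:
  assumes t: "(f, g, h) \<in> Tri C"
  shows "h \<cdot> g = Zero C (Cod C f) (S (Dom C f))"
  using tri_comp_zero[OF tri_rotateD[OF t]] tri_simps[OF t] by simp

lemma tri_comp_zero3:
  assumes t: "(f, g, h) \<in> Tri C"
  shows "Sa f \<cdot> h = Zero C (Cod C g) (S (Cod C f))"
proof -
  note [simp] = tri_simps[OF t]
  have "neg_arr C (Sa f \<cdot> h) = Zero C (Cod C g) (S (Cod C f))"
    using tri_comp_zero2[OF tri_rotateD[OF t]] by simp
  then show ?thesis by (subst (asm) neg_eq_zero_iff) auto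
qed

text \<open>The completion axiom produces third components only. The given triangle and the trivial
  one on \<open>K\<close> are both rotated once, so that the suspension of the wanted map becomes
  such a third component; full faithfulness of the suspension brings it back.\<close>

lemma tri_lift:
  assumes t: "(f, g, h) \<in> Tri C" and x: "x \<in> homset C K (Cod C f)"
    and 0: "g \<cdot> x = Zero C K (Cod C g)"
  obtains y where "y \<in> homset C K (Dom C f)" "x = f \<cdot> y"
proof -
  note [simp] = tri_simps[OF t]
  have K [simp]: "K \<in> Obj C" using x by auto
  obtain Z where Z: "zero_object C Z" using zero_object_exists by blast
  note [simp] = zero_object_obj[OF Z]
  have "(Id C K, Zero C K Z, Zero C Z (S K)) \<in> Tri C" by (rule tri_id) (use Z in auto)
  from tri_rotateD[OF this]
  have t1: "(Zero C K Z, Zero C Z (S K), neg_arr C (Id C (S K))) \<in> Tri C" by simp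
  from tri_complete[OF t1 tri_rotateD[OF t], of x "Zero C Z (Cod C g)"]
  obtain c where c: "c \<in> homset C (S K) (S (Dom C f))"
    "Sa x \<cdot> neg_arr C (Id C (S K)) = neg_arr C (Sa f) \<cdot> c"
    using x 0 by (auto simp: triangle_map_def)
  obtain y where y: "y \<in> homset C K (Dom C f)" "Sa y = c"
    using susp_full[OF c(1)] by auto
  have "neg_arr C (Sa x) = neg_arr C (Sa (f \<cdot> y))" using c x y by auto
  then have "neg_arr C (neg_arr C (Sa x)) = neg_arr C (neg_arr C (Sa (f \<cdot> y)))" by simp
  then have "Sa x = Sa (f \<cdot> y)" using x y by (simp del: susp_comp)
  then have "x = f \<cdot> y" by (rule susp_inj) (use x y in auto)
  then show thesis using that y by blast
qed

lemma tri_lift2: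
  assumes t: "(f, g, h) \<in> Tri C" and x: "x \<in> homset C K (Cod C g)"
    and 0: "h \<cdot> x = Zero C K (S (Dom C f))"
  obtains y where "y \<in> homset C K (Cod C f)" "x = g \<cdot> y"
  using tri_lift[OF tri_rotateD[OF t], of x K] x 0 tri_simps[OF t] by auto

lemma tri_lift3:
  assumes t: "(f, g, h) \<in> Tri C" and x: "x \<in> homset C K (S (Dom C f))"
    and 0: "Sa f \<cdot> x = Zero C K (S (Cod C f))"
  obtains y where "y \<in> homset C K (Cod C g)" "x = h \<cdot> y"
proof (rule tri_lift2[OF tri_rotateD[OF t], of x K])
  note [simp] = tri_simps[OF t]
  show "neg_arr C (Sa f) \<cdot> x = Zero C K (S (Dom C g))"
    using x 0 homset_obj(1)[OF x] by simp
qed (use x tri_simps[OF t] that in auto)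

lemma tri_extend:
  assumes t: "(f, g, h) \<in> Tri C" and x: "x \<in> homset C (Cod C f) Y"
    and 0: "x \<cdot> f = Zero C (Dom C f) Y"
  obtains y where "y \<in> homset C (Cod C g) Y" "x = y \<cdot> g"
proof -
  note [simp] = tri_simps[OF t]
  have Y [simp]: "Y \<in> Obj C" using x by auto
  obtain Z where Z: "zero_object C Z" using zero_object_exists by blast
  note [simp] = zero_object_obj[OF Z]
  \<comment> \<open>The zero object is taken in the form \<open>S Z\<close>, so that the triangle
    can be rotated backwards to one on \<open>Z\<close>, \<open>Y\<close>, \<open>Y\<close> with the
    identity in the middle.\<close>
  have "(Id C Y, Zero C Y (S Z), Zero C (S Z) (S Y)) \<in> Tri C"
    by (rule tri_id) (use Z susp_zero_object in auto)
  then have "(Zero C Z Y, Id C Y, Zero C Y (S Z)) \<in> Tri C"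
    by (subst tri_rotate) (auto simp: candidate_triangle_def)
  from tri_complete[OF t this, of "Zero C (Dom C f) Z" x]
  obtain c where "c \<in> homset C (Cod C g) Y" "c \<cdot> g = x"
    using x 0 by (auto simp: triangle_map_def)
  then show thesis using that by blast
qed

lemma tri_extend2:
  assumes t: "(f, g, h) \<in> Tri C" and x: "x \<in> homset C (Cod C g) Y"
    and 0: "x \<cdot> g = Zero C (Cod C f) Y"
  obtains y where "y \<in> homset C (S (Dom C f)) Y" "x = y \<cdot> h"
  using tri_extend[OF tri_rotateD[OF t], of x Y] x 0 tri_simps[OF t] by auto

text \<open>Rotation is an equivalence and can be read backwards once the third object is a
  suspension. The cone of \<open>p\<close> is only isomorphic to some \<open>S V\<close>, hence the
  replacement of the triangle; the sign of the first map cancels the one in the rotation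
  axiom.\<close>

lemma tri_fibre:
  assumes p: "p \<in> Arr C"
  obtains w h where "(w, p, h) \<in> Tri C"
proof -
  obtain s k where t: "(p, s, k) \<in> Tri C" using tri_exists p by blast
  note [simp] = tri_simps[OF t]
  obtain V e where V: "V \<in> Obj C" "e \<in> homset C (S V) (Cod C s)" "iso_arr C e"
    using desusp[of "Cod C s"] by auto
  have "k \<cdot> e \<in> homset C (S V) (S (Dom C p))" using V by simp
  then obtain w' where w': "w' \<in> homset C V (Dom C p)" "Sa w' = k \<cdot> e"
    using susp_full[of "k \<cdot> e" V "Dom C p"] V by auto
  have "(p, inv_arr C e \<cdot> s, k \<cdot> e) \<in> Tri C"
  proof (rule tri_iso_closed[OF t])
    show "candidate_triangle C (p, inv_arr C e \<cdot> s, k \<cdot> e)"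
      using V by (auto simp: candidate_triangle_def)
    show "triangle_map C (p, s, k) (p, inv_arr C e \<cdot> s, k \<cdot> e) (Id C (Dom C p)) (Id C (Cod C p)) (inv_arr C e)"
      using V by (auto simp: triangle_map_def)
  qed (use V in auto)
  then have "(neg_arr C w', p, inv_arr C e \<cdot> s) \<in> Tri C"
    using w' V by (subst tri_rotate) (auto simp: candidate_triangle_def)
  then show thesis using that by blast
qed

text \<open>If \<open>f\<close> is invertible, \<open>g\<close> and \<open>h\<close> vanish although
  the identity of the cone factors through \<open>h\<close>. If the cone is zero, lifting the
  identity gives a right inverse of \<open>f\<close>, and it remains to see that it is a left
  inverse too.\<close>

lemma tri_iso_iff_zero:
  assumes t: "(f, g, h) \<in> Tri C"
  shows "iso_arr C f \<longleftrightarrow> zero_object C (Cod C g)"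
proof
  note [simp] = tri_simps[OF t]
  assume iso: "iso_arr C f"
  have "g = Zero C (Cod C f) (Cod C g)"
    by (rule iso_right_cancel[OF iso]) (use tri_comp_zero[OF t] iso in auto)
  then obtain y where y: "y \<in> homset C (S (Dom C f)) (Cod C g)" "Id C (Cod C g) = y \<cdot> h"
    using tri_extend2[OF t, of "Id C (Cod C g)" "Cod C g"] by auto
  have "h = Zero C (Cod C g) (S (Dom C f))"
    by (rule iso_left_cancel[of "Sa f"]) (use tri_comp_zero3[OF t] iso in auto)
  then show "zero_object C (Cod C g)" using y by (intro zero_objectI) auto
next
  note [simp] = tri_simps[OF t]
  assume z: "zero_object C (Cod C g)"
  have g0: "g = Zero C (Cod C f) (Cod C g)" using zero_object_arr(2)[OF z, of g] by simp
  have "g \<cdot> Id C (Cod C f) = Zero C (Cod C f) (Cod C g)" using g0 by simp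
  then obtain y where y: "y \<in> homset C (Cod C f) (Dom C f)" "Id C (Cod C f) = f \<cdot> y"
    using tri_lift[OF t, of "Id C (Cod C f)" "Cod C f"] by auto
  have h0: "h = Zero C (Cod C g) (S (Dom C f))" using zero_object_arr(1)[OF z, of h] by simp
  \<comment> \<open>The defect of \<open>y\<close> as a left inverse. It is annihilated by
    \<open>f\<close>, so its suspension factors through \<open>h\<close>, which is zero.\<close>
  let ?d = "y \<cdot> f \<boxplus> neg_arr C (Id C (Dom C f))"
  have fy: "f \<cdot> y \<cdot> f = f" using comp_reassoc[OF y(2)[symmetric], of f] y(1) by simp
  have fd: "f \<cdot> ?d = Zero C (Dom C f) (Cod C f)" using fy y(1) by simp
  have "Sa f \<cdot> Sa ?d = Zero C (S (Dom C f)) (S (Cod C f))"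
    using arg_cong[OF fd, of Sa] y(1) by simp
  then obtain u where u: "u \<in> homset C (S (Dom C f)) (Cod C g)" "Sa ?d = h \<cdot> u"
    using tri_lift3[OF t, of "Sa ?d" "S (Dom C f)"] y(1) by auto
  have "Sa ?d = Sa (Zero C (Dom C f) (Dom C f))" using u h0 y(1) by auto
  then have "?d = Zero C (Dom C f) (Dom C f)" by (rule susp_inj) (use y(1) in auto)
  then have "y \<cdot> f = Id C (Dom C f)" using y(1) by (subst (asm) diff_eq_zero_iff) auto
  then show "iso_arr C f" using y by (intro iso_arrI[of f y]) auto
qed

text \<open>An equivalence preserves and reflects coproducts. Reflection serves to prove that
  suspensions of compact objects are compact; preservation serves for desuspensions and for the
  suspended towers below.\<close>

lemma susp_coproduct_iff:
  assumes \<iota>: "\<And>i. i \<in> I \<Longrightarrow> \<iota> i \<in> homset C (Y i) P" and P: "P \<in> Obj C"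
  shows "is_coproduct C I (S \<circ> Y) (S P) (Sa \<circ> \<iota>) \<longleftrightarrow> is_coproduct C I Y P \<iota>"
proof
  have Y: "Y i \<in> Obj C" if "i \<in> I" for i using homset_obj(1)[OF \<iota>[OF that]] .
  show "is_coproduct C I (S \<circ> Y) (S P) (Sa \<circ> \<iota>)" if co: "is_coproduct C I Y P \<iota>"
  proof (rule is_coproductI)
    show "S P \<in> Obj C" using P by simp
    show "(Sa \<circ> \<iota>) i \<in> homset C ((S \<circ> Y) i) (S P)" if "i \<in> I" for i using \<iota>[OF that] by auto
    show "\<exists>u\<in>homset C (S P) Z. \<forall>i\<in>I. u \<cdot> (Sa \<circ> \<iota>) i = f i"
      if Z: "Z \<in> Obj C" and f: "\<And>i. i \<in> I \<Longrightarrow> f i \<in> homset C ((S \<circ> Y) i) Z" for Z f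
    proof -
      obtain V e where V: "V \<in> Obj C" "e \<in> homset C (S V) Z" "iso_arr C e"
        using desusp[OF Z] by blast
      have "\<exists>g. g \<in> homset C (Y i) V \<and> Sa g = inv_arr C e \<cdot> f i" if "i \<in> I" for i
        using susp_full[of "inv_arr C e \<cdot> f i" "Y i" V] f[OF that] V Y[OF that] by auto
      then obtain g where g: "\<And>i. i \<in> I \<Longrightarrow> g i \<in> homset C (Y i) V \<and> Sa (g i) = inv_arr C e \<cdot> f i"
        by metis
      then obtain u where u: "u \<in> homset C P V" "\<And>i. i \<in> I \<Longrightarrow> u \<cdot> \<iota> i = g i"
        using coproduct_map[OF co V(1), of g] by blast
      have "(e \<cdot> Sa u) \<cdot> Sa (\<iota> i) = f i" if i: "i \<in> I" for i
      proof -
        have "Sa u \<cdot> Sa (\<iota> i) = inv_arr C e \<cdot> f i"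
          using susp_comp[of "\<iota> i" u] u(1) u(2)[OF i] g[OF i] \<iota>[OF i] by simp
        then show ?thesis using u(1) \<iota>[OF i] V f[OF i] by simp
      qed
      then show ?thesis using u V by (intro bexI[of _ "e \<cdot> Sa u"]) auto
    qed
    show "u = v" if u: "u \<in> homset C (S P) Z" and v: "v \<in> homset C (S P) Z"
      and uv: "\<And>i. i \<in> I \<Longrightarrow> u \<cdot> (Sa \<circ> \<iota>) i = v \<cdot> (Sa \<circ> \<iota>) i" for Z u v
    proof -
      have "Z \<in> Obj C" using u by auto
      then obtain V e where V: "V \<in> Obj C" "e \<in> homset C (S V) Z" "iso_arr C e"
        using desusp by blast
      obtain u' where u': "u' \<in> homset C P V" "Sa u' = inv_arr C e \<cdot> u"
        using susp_full[of "inv_arr C e \<cdot> u" P V] u V P by auto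
      obtain v' where v': "v' \<in> homset C P V" "Sa v' = inv_arr C e \<cdot> v"
        using susp_full[of "inv_arr C e \<cdot> v" P V] v V P by auto
      have "u' = v'"
      proof (rule coproduct_unique[OF co u'(1) v'(1)])
        fix i assume i: "i \<in> I"
        have "Sa u' \<cdot> Sa (\<iota> i) = Sa v' \<cdot> Sa (\<iota> i)"
          using uv[OF i] u v u'(2) v'(2) \<iota>[OF i] V by simp
        then have "Sa (u' \<cdot> \<iota> i) = Sa (v' \<cdot> \<iota> i)" using u'(1) v'(1) \<iota>[OF i] by simp
        then show "u' \<cdot> \<iota> i = v' \<cdot> \<iota> i" by (rule susp_inj) (use u'(1) v'(1) \<iota>[OF i] in auto)
      qed
      then have "inv_arr C e \<cdot> u = inv_arr C e \<cdot> v" using u' v' by simp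
      then show ?thesis by (rule iso_left_cancel[rotated -1]) (use V u v in auto)
    qed
  qed
  show "is_coproduct C I Y P \<iota>" if co: "is_coproduct C I (S \<circ> Y) (S P) (Sa \<circ> \<iota>)"
  proof (rule is_coproductI)
    show "\<exists>u\<in>homset C P Z. \<forall>i\<in>I. u \<cdot> \<iota> i = f i"
      if Z: "Z \<in> Obj C" and f: "\<And>i. i \<in> I \<Longrightarrow> f i \<in> homset C (Y i) Z" for Z f
    proof -
      have "(Sa \<circ> f) i \<in> homset C ((S \<circ> Y) i) (S Z)" if "i \<in> I" for i using f[OF that] by auto
      then obtain u where u: "u \<in> homset C (S P) (S Z)" "\<And>i. i \<in> I \<Longrightarrow> u \<cdot> Sa (\<iota> i) = Sa (f i)"
        using coproduct_map[OF co, of "S Z" "Sa \<circ> f"] Z by auto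
      obtain v where v: "v \<in> homset C P Z" "Sa v = u" using susp_full[OF u(1)] P Z by blast
      have "v \<cdot> \<iota> i = f i" if i: "i \<in> I" for i
        by (rule susp_inj) (use u(2)[OF i] v \<iota>[OF i] f[OF i] in auto)
      then show ?thesis using v by blast
    qed
    show "u = v" if u: "u \<in> homset C P Z" and v: "v \<in> homset C P Z"
      and uv: "\<And>i. i \<in> I \<Longrightarrow> u \<cdot> \<iota> i = v \<cdot> \<iota> i" for Z u v
    proof -
      have "Sa u = Sa v"
      proof (rule coproduct_unique[OF co, of _ "S Z"])
        fix i assume i: "i \<in> I"
        have "Sa (u \<cdot> \<iota> i) = Sa (v \<cdot> \<iota> i)" using uv[OF i] by simp
        then show "Sa u \<cdot> (Sa \<circ> \<iota>) i = Sa v \<cdot> (Sa \<circ> \<iota>) i" using u v \<iota>[OF i] by simp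
      qed (use u v in auto)
      then show ?thesis by (rule susp_inj) (use u v in auto)
    qed
  qed (use P \<iota> in auto)
qed

text \<open>The coproduct that receives a map from \<open>S K\<close> is first rewritten, up to
  isomorphism, as the suspension of a coproduct. The map then desuspends to one from
  \<open>K\<close>, and its finite support is suspended again.\<close>

lemma compact_susp:
  assumes K: "compact_obj (U :: 'u itself) C K"
  shows "compact_obj U C (S K)"
proof (rule compact_objI)
  have KO [simp]: "K \<in> Obj C" using compact_obj_obj[OF K] .
  then show "S K \<in> Obj C" by simp
  fix I :: "'u set" and Y P \<iota> q
  assume I: "small U I" and co: "is_coproduct C I Y P \<iota>" and q: "q \<in> homset C (S K) P"
  note c = coproduct_simps[OF co]
  \<comment> \<open>The object and the isomorphism onto \<open>Y i\<close> are chosen together as a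
    pair, so that one choice function serves for both.\<close>
  have "\<exists>r. fst r \<in> Obj C \<and> snd r \<in> homset C (S (fst r)) (Y i) \<and> iso_arr C (snd r)" if "i \<in> I" for i
    using desusp[OF c(5)[OF that]] by (metis fst_conv snd_conv)
  then obtain r where r: "\<And>i. i \<in> I \<Longrightarrow> fst (r i) \<in> Obj C \<and> snd (r i) \<in> homset C (S (fst (r i))) (Y i) \<and> iso_arr C (snd (r i))"
    by metis
  define Y' e where "Y' i = fst (r i)" and "e i = snd (r i)" for i
  have e: "Y' i \<in> Obj C" "e i \<in> homset C (S (Y' i)) (Y i)" "iso_arr C (e i)" if "i \<in> I" for i
    using r[OF that] by (auto simp: Y'_def e_def)
  obtain P' \<psi> where P': "P' \<in> Obj C" "\<psi> \<in> homset C (S P') P" "iso_arr C \<psi>" using desusp[OF c(1)] by blast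
  have "\<exists>j. j \<in> homset C (Y' i) P' \<and> Sa j = inv_arr C \<psi> \<cdot> \<iota> i \<cdot> e i" if i: "i \<in> I" for i
    using susp_full[of "inv_arr C \<psi> \<cdot> \<iota> i \<cdot> e i" "Y' i" P'] e[OF i] P' c(2-4)[OF i] by auto
  then obtain j where j: "\<And>i. i \<in> I \<Longrightarrow> j i \<in> homset C (Y' i) P' \<and> Sa (j i) = inv_arr C \<psi> \<cdot> \<iota> i \<cdot> e i"
    by metis
  have "is_coproduct C I (S \<circ> Y') (S P') (\<lambda>i. inv_arr C \<psi> \<cdot> \<iota> i \<cdot> e i)"
    by (rule coproduct_iso_transport[OF co]) (use e P' in auto)
  then have "is_coproduct C I (S \<circ> Y') (S P') (Sa \<circ> j)"
    by (rule coproduct_cong) (use j in auto)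
  then have co': "is_coproduct C I Y' P' j"
    by (subst (asm) susp_coproduct_iff) (use j P' in auto)
  obtain q' where q': "q' \<in> homset C K P'" "Sa q' = inv_arr C \<psi> \<cdot> q"
    using susp_full[of "inv_arr C \<psi> \<cdot> q" K P'] q P' by auto
  have "\<psi> \<cdot> Sa r \<in> coprod_span C I Y P \<iota> (S K)" if "r \<in> coprod_span C I Y' P' j K" for r
    using that
  proof induction
    case zero
    then show ?case using P' by (auto intro: coprod_span.zero)
  next
    case (inj i x)
    have ji: "j i \<in> homset C (Y' i) P'" using j[OF inj(1)] by blast
    have "Sa (j i \<cdot> x) = Sa (j i) \<cdot> Sa x" using inj ji by auto
    then have "\<psi> \<cdot> Sa (j i \<cdot> x) = \<psi> \<cdot> Sa (j i) \<cdot> Sa x" by simp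
    also have "\<dots> = (\<psi> \<cdot> Sa (j i)) \<cdot> Sa x"
      by (rule assoc[symmetric]) (use inj P' ji in auto)
    also have "\<psi> \<cdot> Sa (j i) = \<iota> i \<cdot> e i"
      using j[OF inj(1)] P' e[OF inj(1)] c(2-4)[OF inj(1)] by auto
    also have "(\<iota> i \<cdot> e i) \<cdot> Sa x = \<iota> i \<cdot> e i \<cdot> Sa x"
      using e[OF inj(1)] c(2-4)[OF inj(1)] inj by auto
    finally show ?case using e[OF inj(1)] inj coprod_span.inj[of i I "e i \<cdot> Sa x" C "S K" Y \<iota> P] by simp
  next
    case (add q r)
    have "q \<in> homset C K P'" "r \<in> homset C K P'" using add span_homset[OF co' KO] by blast+
    then have "\<psi> \<cdot> Sa (q \<boxplus> r) = \<psi> \<cdot> Sa q \<boxplus> \<psi> \<cdot> Sa r" using P' by auto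
    then show ?case using add coprod_span.add by metis
  qed
  from this[OF compact_objD[OF K I co' q'(1)]]
  show "q \<in> coprod_span C I Y P \<iota> (S K)" using q'(2) q P' by simp
qed

text \<open>Sets of generators are not assumed to be closed under desuspension, yet testing a cone
  against \<open>K\<close> leads to maps from a desuspension of \<open>K\<close>; see
  \<open>iso_if_compact_bijective\<close>.\<close>

lemma compact_desusp:
  assumes K: "compact_obj (U :: 'u itself) C (S K)" and KO: "K \<in> Obj C"
  shows "compact_obj U C K"
proof (rule compact_objI[OF KO])
  fix I :: "'u set" and Y P \<iota> q
  assume I: "small U I" and co: "is_coproduct C I Y P \<iota>" and q: "q \<in> homset C K P"
  note c = coproduct_simps[OF co]
  have co': "is_coproduct C I (S \<circ> Y) (S P) (Sa \<circ> \<iota>)"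
    by (subst susp_coproduct_iff) (use c co in auto)
  have "\<exists>q\<in>coprod_span C I Y P \<iota> K. r = Sa q" if "r \<in> coprod_span C I (S \<circ> Y) (S P) (Sa \<circ> \<iota>) (S K)" for r
    using that
  proof induction
    case zero
    then show ?case using c KO by (intro bexI[of _ "Zero C K P"]) (auto intro: coprod_span.zero)
  next
    case (inj i x)
    obtain y where y: "y \<in> homset C K (Y i)" "Sa y = x"
      using susp_full[of x K "Y i"] inj KO c(5)[OF inj(1)] by auto
    have "(Sa \<circ> \<iota>) i \<cdot> x = Sa (\<iota> i \<cdot> y)" using y c(2-4)[OF inj(1)] by auto
    moreover have "\<iota> i \<cdot> y \<in> coprod_span C I Y P \<iota> K" using inj(1) y(1) by (rule coprod_span.inj)
    ultimately show ?case by blast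
  next
    case (add q r)
    then obtain q' r' where q': "q' \<in> coprod_span C I Y P \<iota> K" "r' \<in> coprod_span C I Y P \<iota> K"
      "q = Sa q'" "r = Sa r'" by blast
    have "q' \<in> homset C K P" "r' \<in> homset C K P" using q' span_homset[OF co KO] by blast+
    then have "q \<boxplus> r = Sa (q' \<boxplus> r')" using q' by auto
    then show ?case by (rule bexI) (rule coprod_span.add[OF q'(1,2)])
  qed
  from this[OF compact_objD[OF K I co', of "Sa q"]]
  obtain q' where q': "q' \<in> coprod_span C I Y P \<iota> K" "Sa q = Sa q'" using q by auto
  then have "q' \<in> homset C K P" using span_homset[OF co KO] by blast
  then have "q = q'" using susp_inj[OF q'(2)] q by auto
  then show "q \<in> coprod_span C I Y P \<iota> K" using q' by simp
qed

text \<open>Finite support is reached in two corrections. The composite \<open>q \<cdot> g\<close>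
  has it, so subtracting \<open>e \<cdot> q\<close> for a suitable \<open>e\<close> in the span
  leaves a map that vanishes on \<open>g\<close>; this one factors through the compact object
  \<open>S (Dom C f)\<close>.\<close>

lemma compact_cone:
  assumes t: "(f, g, h) \<in> Tri C" and K: "compact_obj (U :: 'u itself) C (Dom C f)" "compact_obj U C (Cod C f)"
  shows "compact_obj U C (Cod C g)"
proof (rule compact_objI)
  note [simp] = tri_simps[OF t]
  show "Cod C g \<in> Obj C" by simp
  fix I :: "'u set" and Y P \<iota> q
  assume I: "small U I" and co: "is_coproduct C I Y P \<iota>" and q: "q \<in> homset C (Cod C g) P"
  note c = coproduct_simps[OF co]
  have "q \<cdot> g \<in> coprod_span C I Y P \<iota> (Cod C f)" using compact_objD[OF K(2) I co] q by simp
  from span_projection[OF co _ this]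
  obtain e where e: "e \<in> coprod_span C I Y P \<iota> P" "e \<cdot> q \<cdot> g = q \<cdot> g" by auto
  have eh: "e \<in> homset C P P" using span_homset[OF co c(1) e(1)] .
  let ?d = "q \<boxplus> neg_arr C (e \<cdot> q)"
  have "?d \<cdot> g = Zero C (Cod C f) P" using q eh e(2) by (simp add: diff_eq_zero_iff)
  then obtain k where k: "k \<in> homset C (S (Dom C f)) P" "?d = k \<cdot> h"
    using tri_extend2[OF t, of ?d P] q eh by auto
  have "k \<in> coprod_span C I Y P \<iota> (S (Dom C f))"
    using compact_objD[OF compact_susp[OF K(1)] I co k(1)] .
  then have "k \<cdot> h \<in> coprod_span C I Y P \<iota> (Cod C g)" by (rule span_comp[OF co, rotated]) simp
  moreover have "e \<cdot> q \<in> coprod_span C I Y P \<iota> (Cod C g)" using span_comp[OF co q e(1)] .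
  ultimately have "?d \<boxplus> e \<cdot> q \<in> coprod_span C I Y P \<iota> (Cod C g)" using k(2) coprod_span.add by metis
  moreover have "?d \<boxplus> e \<cdot> q = q" by (rule diff_add_cancel) (use q eh in auto)
  ultimately show "q \<in> coprod_span C I Y P \<iota> (Cod C g)" by simp
qed

end

section \<open>Killing maps from compact objects\<close>

text \<open>The universe hypothesis makes the natural numbers and unions of small families of hom
  sets small. The coproducts in the towers depend on both.\<close>

locale large_category = compactly_generated U C
  for U :: "'u itself" and C :: "('o, 'm, 'z) triangulated_category_scheme" (structure) +
  assumes univ: "universe U"

text \<open>The functors for which homotopy colimits are computed: the identity, tensoring with a
  fixed object, \<open>L\<close>, and composites of these. The third map of the image triangle is
  left open, so that no isomorphism with the suspension has to be followed; exactness of Hom at the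
  middle object is what gets extracted.\<close>

definition cocont_exact ::
  "'u itself \<Rightarrow> ('o, 'm, 'z) triangulated_category_scheme \<Rightarrow> ('o, 'm, 'o, 'm) cat_functor \<Rightarrow> bool" where
  "cocont_exact U C F \<longleftrightarrow> additive_functor C C F \<and>
     (\<forall>f g h. (f, g, h) \<in> Tri C \<longrightarrow> (\<exists>h'. (farr F f, farr F g, h') \<in> Tri C)) \<and>
     (\<forall>(I :: 'u set) Y P \<iota>. small U I \<and> is_coproduct C I Y P \<iota> \<longrightarrow>
        is_coproduct C I (fobj F \<circ> Y) (fobj F P) (farr F \<circ> \<iota>))"

text \<open>The set \<open>M\<close> indexes its own coproduct, with \<open>Dom C\<close> as the
  family of summands, so every map of \<open>M\<close> is a component of \<open>p\<close>. The
  triangle is part of the notion because maps killed by \<open>s\<close> have to be lifted along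
  \<open>p\<close>.\<close>

definition kills ::
  "('o, 'm, 'z) triangulated_category_scheme \<Rightarrow> 'm set \<Rightarrow> 'o \<Rightarrow> 'o \<Rightarrow> 'm \<Rightarrow> bool" where
  "kills C M X X' s \<longleftrightarrow> (\<exists>P p h \<iota>. (p, s, h) \<in> Tri C \<and> Dom C p = P \<and> Cod C p = X \<and> Cod C s = X' \<and>
     is_coproduct C M (Dom C) P \<iota> \<and> (\<forall>m\<in>M. p \<cdot>\<^bsub>C\<^esub> \<iota> m = m))"

primrec chain :: "('o, 'm, 'z) category_scheme \<Rightarrow> (nat \<Rightarrow> 'o) \<Rightarrow> (nat \<Rightarrow> 'm) \<Rightarrow> nat \<Rightarrow> nat \<Rightarrow> 'm" where
  "chain C X s n 0 = Id C (X n)"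
| "chain C X s n (Suc k) = s (n + k) \<cdot>\<^bsub>C\<^esub> chain C X s n k"

text \<open>Only what is needed of a homotopy colimit: for \<open>K\<close> compact, \<open>Hom(K, F -)\<close> takes it to the colimit of groups.\<close>

definition is_hocolim ::
  "'u itself \<Rightarrow> ('o, 'm, 'z) triangulated_category_scheme \<Rightarrow> (nat \<Rightarrow> 'o) \<Rightarrow> (nat \<Rightarrow> 'm) \<Rightarrow> 'o \<Rightarrow> (nat \<Rightarrow> 'm) \<Rightarrow> bool"
  where
  "is_hocolim U C X s Z j \<longleftrightarrow>
     Z \<in> Obj C \<and> (\<forall>n. j n \<in> homset C (X n) Z) \<and> (\<forall>n. j (Suc n) \<cdot>\<^bsub>C\<^esub> s n = j n) \<and>
     (\<forall>F K t. cocont_exact U C F \<and> compact_obj U C K \<and> t \<in> homset C K (fobj F Z) \<longrightarrow>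
        (\<exists>n. \<exists>t'\<in>homset C K (fobj F (X n)). t = farr F (j n) \<cdot>\<^bsub>C\<^esub> t')) \<and>
     (\<forall>F K t. cocont_exact U C F \<and> compact_obj U C K \<and> t \<in> homset C K (fobj F (X 0)) \<and>
        farr F (j 0) \<cdot>\<^bsub>C\<^esub> t = Zero C K (fobj F Z) \<longrightarrow>
        (\<exists>n. farr F (chain C X s 0 n) \<cdot>\<^bsub>C\<^esub> t = Zero C K (fobj F (X n))))"

lemma hocolim_injective:
  "\<lbrakk>is_hocolim U C X s Z j; cocont_exact U C F; compact_obj U C K; t \<in> homset C K (fobj F (X 0));
    farr F (j 0) \<cdot>\<^bsub>C\<^esub> t = Zero C K (fobj F Z)\<rbrakk>
    \<Longrightarrow> \<exists>n. farr F (chain C X s 0 n) \<cdot>\<^bsub>C\<^esub> t = Zero C K (fobj F (X n))"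
  unfolding is_hocolim_def by blast

section \<open>Additive functors, and functors that preserve coproducts and triangles\<close>

context additive_category
begin

lemma additive_functor_simps:
  assumes F: "additive_functor C C F"
  shows "X \<in> Obj C \<Longrightarrow> fobj F X \<in> Obj C"
    "f \<in> Arr C \<Longrightarrow> farr F f \<in> Arr C"
    "f \<in> Arr C \<Longrightarrow> Dom C (farr F f) = fobj F (Dom C f)"
    "f \<in> Arr C \<Longrightarrow> Cod C (farr F f) = fobj F (Cod C f)"
    "X \<in> Obj C \<Longrightarrow> farr F (Id C X) = Id C (fobj F X)"
    "\<lbrakk>f \<in> Arr C; g \<in> Arr C; Dom C g = Cod C f\<rbrakk> \<Longrightarrow> farr F (g \<cdot> f) = farr F g \<cdot> farr F f"
    "\<lbrakk>f \<in> Arr C; g \<in> Arr C; Dom C g = Dom C f; Cod C g = Cod C f\<rbrakk> \<Longrightarrow> farr F (f \<boxplus> g) = farr F f \<boxplus> farr F g"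
    "\<lbrakk>X \<in> Obj C; Y \<in> Obj C\<rbrakk> \<Longrightarrow> farr F (Zero C X Y) = Zero C (fobj F X) (fobj F Y)"
    "f \<in> Arr C \<Longrightarrow> farr F (neg_arr C f) = neg_arr C (farr F f)"
proof -
  have fnc: "is_functor C C F" using F by (simp add: additive_functor_def)
  show o: "X \<in> Obj C \<Longrightarrow> fobj F X \<in> Obj C" for X using fnc by (simp add: is_functor_def)
  show a: "f \<in> Arr C \<Longrightarrow> farr F f \<in> Arr C"
    "f \<in> Arr C \<Longrightarrow> Dom C (farr F f) = fobj F (Dom C f)"
    "f \<in> Arr C \<Longrightarrow> Cod C (farr F f) = fobj F (Cod C f)" for f
    using fnc by (auto simp: is_functor_def)
  show "X \<in> Obj C \<Longrightarrow> farr F (Id C X) = Id C (fobj F X)" using fnc by (simp add: is_functor_def)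
  show "\<lbrakk>f \<in> Arr C; g \<in> Arr C; Dom C g = Cod C f\<rbrakk> \<Longrightarrow> farr F (g \<cdot> f) = farr F g \<cdot> farr F f"
    using fnc by (simp add: is_functor_def)
  show add: "farr F (f \<boxplus> g) = farr F f \<boxplus> farr F g"
    if "f \<in> Arr C" "g \<in> Arr C" "Dom C g = Dom C f" "Cod C g = Cod C f" for f g
  proof -
    have "farr F \<in> hom (hom_group C (Dom C f) (Cod C f)) (hom_group C (fobj F (Dom C f)) (fobj F (Cod C f)))"
      using F that by (simp add: additive_functor_def)
    from hom_mult[OF this, of f g] show ?thesis using that by simp
  qed
  show zero: "farr F (Zero C X Y) = Zero C (fobj F X) (fobj F Y)" if "X \<in> Obj C" "Y \<in> Obj C" for X Y
    using add[of "Zero C X Y" "Zero C X Y"] that add_self_eq_zero[of "farr F (Zero C X Y)"] by (simp add: a)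
  show "farr F (neg_arr C f) = neg_arr C (farr F f)" if "f \<in> Arr C"
    using add[of f "neg_arr C f"] that zero[of "Dom C f" "Cod C f"]
    by (intro neg_unique[symmetric]) (simp_all add: a)
qed

end

context triangulated_category
begin

lemma cocont_exact_simps:
  assumes "cocont_exact U C F"
  shows "additive_functor C C F" "(f, g, h) \<in> Tri C \<Longrightarrow> \<exists>h'. (farr F f, farr F g, h') \<in> Tri C"
  using assms by (auto simp: cocont_exact_def)

lemma cocont_coproduct:
  assumes F: "cocont_exact (U :: 'u itself) C F" and A: "small U A" and co: "is_coproduct C A Y P \<iota>"
  shows "is_coproduct C A (fobj F \<circ> Y) (fobj F P) (farr F \<circ> \<iota>)"
proof -
  obtain J :: "'u set" and b where b: "bij_betw b J A" "small U J" using small_reindex[OF A] by blast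
  have "is_coproduct C J (Y \<circ> b) P (\<iota> \<circ> b)" using coproduct_reindex[OF b(1)] co by blast
  then have "is_coproduct C J (fobj F \<circ> (Y \<circ> b)) (fobj F P) (farr F \<circ> (\<iota> \<circ> b))"
    using F b(2) unfolding cocont_exact_def by blast
  then show ?thesis using coproduct_reindex[OF b(1), of "fobj F \<circ> Y" "fobj F P" "farr F \<circ> \<iota>"]
    by (simp add: comp_assoc[symmetric] o_assoc)
qed

text \<open>Compactness of \<open>K\<close> and preservation of the coproduct by \<open>F\<close> in
  one rule: a map from \<open>K\<close> into the image of a coproduct is a finite sum of maps
  through the images of the summands. The rule also records in the sum case that both terms are such
  maps.\<close>

lemma cocont_span_induct [consumes 5, case_names zero inj add]:
  assumes F: "cocont_exact (U :: 'u itself) C F" and A: "small U A" and co: "is_coproduct C A Y P \<iota>"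
    and K: "compact_obj U C K" and q: "q \<in> homset C K (fobj F P)"
    and Q: "Q (Zero C K (fobj F P))"
      "\<And>i x. i \<in> A \<Longrightarrow> x \<in> homset C K (fobj F (Y i)) \<Longrightarrow> Q (farr F (\<iota> i) \<cdot> x)"
      "\<And>q r. q \<in> homset C K (fobj F P) \<Longrightarrow> r \<in> homset C K (fobj F P) \<Longrightarrow> Q q \<Longrightarrow> Q r \<Longrightarrow> Q (q \<boxplus> r)"
  shows "Q q"
proof -
  note co' = cocont_coproduct[OF F A co]
  have "q \<in> coprod_span C A (fobj F \<circ> Y) (fobj F P) (farr F \<circ> \<iota>) K" by (rule compact_span[OF K A co' q])
  then have "q \<in> homset C K (fobj F P) \<and> Q q"
  proof induction
    case zero
    then show ?case using Q(1) coproduct_simps(1)[OF co'] compact_obj_obj[OF K] by simp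
  next
    case (inj i x)
    then show ?case using Q(2) coproduct_simps(2-5)[OF co' inj(1)] by simp
  next
    case (add q r)
    then show ?case using Q(3) by simp
  qed
  then show ?thesis by simp
qed

text \<open>The projections do not make \<open>fobj F P\<close> a product, but they detect zero on
  maps from a compact object, because such a map has finite support.\<close>

lemma cocont_joint_mono:
  assumes F: "cocont_exact (U :: 'u itself) C F" and A: "small U A" and co: "is_coproduct C A Y P \<iota>"
    and K: "compact_obj U C K" and q: "q \<in> homset C K (fobj F P)"
    and \<pi>: "\<And>i. i \<in> A \<Longrightarrow> \<pi> i \<in> homset C P (Y i)"
    "\<And>i j. \<lbrakk>i \<in> A; j \<in> A\<rbrakk> \<Longrightarrow> \<pi> i \<cdot> \<iota> j = (if i = j then Id C (Y i) else Zero C (Y j) (Y i))"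
    and 0: "\<And>i. i \<in> A \<Longrightarrow> farr F (\<pi> i) \<cdot> q = Zero C K (fobj F (Y i))"
  shows "q = Zero C K (fobj F P)"
proof -
  note co' = cocont_coproduct[OF F A co]
  note Fs = additive_functor_simps[OF cocont_exact_simps(1)[OF F]]
  note c = coproduct_simps[OF co]
  show ?thesis
  proof (rule span_eq_zero[OF co' compact_obj_obj[OF K] compact_span[OF K A co' q], of "farr F \<circ> \<pi>"])
    fix i assume i: "i \<in> A"
    show "(farr F \<circ> \<pi>) i \<in> homset C (fobj F P) ((fobj F \<circ> Y) i)" using \<pi>(1)[OF i] Fs by auto
    show "(farr F \<circ> \<pi>) i \<cdot> q = Zero C K ((fobj F \<circ> Y) i)" using 0[OF i] by simp
    fix j assume j: "j \<in> A"
    have "farr F (\<pi> i) \<cdot> farr F (\<iota> j) = farr F (\<pi> i \<cdot> \<iota> j)"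
      using Fs(6)[of "\<iota> j" "\<pi> i"] \<pi>(1)[OF i] c(2-4)[OF j] by simp
    then show "(farr F \<circ> \<pi>) i \<cdot> (farr F \<circ> \<iota>) j =
        (if i = j then Id C ((fobj F \<circ> Y) i) else Zero C ((fobj F \<circ> Y) j) ((fobj F \<circ> Y) i))"
      using \<pi>(2)[OF i j] Fs(5,8) c(5)[OF i] c(5)[OF j] by simp
  qed
qed

lemma kills_zero:
  assumes k: "kills C M X X' s" and m: "m \<in> M"
  shows "s \<cdot> m = Zero C (Dom C m) X'"
proof -
  obtain P p h \<iota> where t: "(p, s, h) \<in> Tri C" and co: "is_coproduct C M (Dom C) P \<iota>"
    and *: "Dom C p = P" "Cod C p = X" "Cod C s = X'" "\<forall>m\<in>M. p \<cdot> \<iota> m = m"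
    using k unfolding kills_def by blast
  note [simp] = tri_simps[OF t] and c = coproduct_simps(2-5)[OF co m]
  have X': "X' \<in> Obj C" using cod_obj[of s] * by simp
  have "s \<cdot> m = s \<cdot> p \<cdot> \<iota> m" using * m by simp
  also have "\<dots> = (s \<cdot> p) \<cdot> \<iota> m" by (rule assoc[symmetric]) (use * c in auto)
  also have "\<dots> = Zero C (Dom C m) X'" unfolding tri_comp_zero[OF t] using * c X' by simp
  finally show ?thesis .
qed

lemma kills_homset: "kills C M X X' s \<Longrightarrow> s \<in> homset C X X'"
  unfolding kills_def using tri_simps by auto

section \<open>Sequential homotopy colimits\<close>

lemma chain_homset:
  assumes "\<And>n. X n \<in> Obj C" "\<And>n. s n \<in> homset C (X n) (X (Suc n))"
  shows "chain C X s n k \<in> homset C (X n) (X (n + k))"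
proof (induction k)
  case (Suc k)
  then show ?case using assms(2)[of "n + k"] by auto
qed (use assms in auto)

lemma chain_cocone:
  assumes "\<And>n. X n \<in> Obj C" "\<And>n. s n \<in> homset C (X n) (X (Suc n))"
    "\<And>n. j n \<in> homset C (X n) Z" "\<And>n. j (Suc n) \<cdot> s n = j n"
  shows "j (n + k) \<cdot> chain C X s n k = j n"
proof (induction k)
  case (Suc k)
  note ch = chain_homset[of X s n k, OF assms(1,2)]
  have "j (n + Suc k) \<cdot> chain C X s n (Suc k) = (j (Suc (n + k)) \<cdot> s (n + k)) \<cdot> chain C X s n k"
    using assms(2)[of "n + k"] assms(3)[of "Suc (n + k)"] ch by simp
  then show ?case using Suc assms(4) by simp
qed (use assms(3)[of n] in auto)

text \<open>The map \<open>d\<close> is the identity minus the shift, whose cone is the telescope.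
  Seen through the projections it is a recursion: component \<open>Suc n\<close> of
  \<open>d \<cdot> u\<close> involves only components \<open>Suc n\<close> and \<open>n\<close> of
  \<open>u\<close>, so equations for \<open>d\<close> are solved one component at a time.\<close>

lemma shift_projections:
  assumes co: "is_coproduct C UNIV Z R \<iota>"
    and z: "\<And>n. z n \<in> homset C (Z n) (Z (Suc n))" and d: "d \<in> homset C R R"
    and d\<iota>: "\<And>n. d \<cdot> \<iota> n = \<iota> n \<boxplus> neg_arr C (\<iota> (Suc n) \<cdot> z n)"
  obtains \<pi> where "\<And>n. \<pi> n \<in> homset C R (Z n)"
    "\<And>m n. \<pi> m \<cdot> \<iota> n = (if m = n then Id C (Z m) else Zero C (Z n) (Z m))"
    "\<pi> 0 \<cdot> d = \<pi> 0" "\<And>n. \<pi> (Suc n) \<cdot> d = \<pi> (Suc n) \<boxplus> neg_arr C (z n \<cdot> \<pi> n)"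
proof -
  obtain \<pi> where \<pi>: "\<And>n. \<pi> n \<in> homset C R (Z n)"
    "\<And>m n. \<pi> m \<cdot> \<iota> n = (if m = n then Id C (Z m) else Zero C (Z n) (Z m))"
    using coproduct_projections[OF co] by (metis UNIV_I)
  have c: "R \<in> Obj C" "\<And>n. \<iota> n \<in> Arr C" "\<And>n. Dom C (\<iota> n) = Z n" "\<And>n. Cod C (\<iota> n) = R" "\<And>n. Z n \<in> Obj C"
    using coproduct_simps[OF co] by auto
  have \<pi>s: "\<And>n. \<pi> n \<in> Arr C" "\<And>n. Dom C (\<pi> n) = R" "\<And>n. Cod C (\<pi> n) = Z n"
    "\<And>n. z n \<in> Arr C" "\<And>n. Dom C (z n) = Z n" "\<And>n. Cod C (z n) = Z (Suc n)"
    "d \<in> Arr C" "Dom C d = R" "Cod C d = R"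
    using \<pi>(1) z d by auto
  have pz: "\<pi> m \<cdot> \<iota> (Suc n) \<cdot> z n = (if m = Suc n then z n else Zero C (Z n) (Z m))" for m n
    using comp_reassoc[OF \<pi>(2)[of m "Suc n"], of "z n"] c \<pi>s by simp
  have e: "(\<pi> m \<cdot> d) \<cdot> \<iota> n = \<pi> m \<cdot> \<iota> n \<boxplus> neg_arr C (if m = Suc n then z n else Zero C (Z n) (Z m))" for m n
  proof -
    have "(\<pi> m \<cdot> d) \<cdot> \<iota> n = \<pi> m \<cdot> d \<cdot> \<iota> n" by (rule assoc) (use c \<pi>s in auto)
    also have "\<dots> = \<pi> m \<cdot> \<iota> n \<boxplus> \<pi> m \<cdot> neg_arr C (\<iota> (Suc n) \<cdot> z n)"
      unfolding d\<iota> by (rule comp_add(1)) (use c \<pi>s in auto)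
    also have "\<pi> m \<cdot> neg_arr C (\<iota> (Suc n) \<cdot> z n) = neg_arr C (\<pi> m \<cdot> \<iota> (Suc n) \<cdot> z n)"
      by (rule comp_neg) (use c \<pi>s in auto)
    finally show ?thesis unfolding pz .
  qed
  have "\<pi> 0 \<cdot> d = \<pi> 0"
    by (rule coproduct_unique[OF co, of _ "Z 0"]) (use c \<pi>s in \<open>auto simp: e \<pi>(2) simp del: assoc\<close>)
  moreover have "\<pi> (Suc n) \<cdot> d = \<pi> (Suc n) \<boxplus> neg_arr C (z n \<cdot> \<pi> n)" for n
  proof (rule coproduct_unique[OF co, of _ "Z (Suc n)"])
    fix m
    have "(\<pi> (Suc n) \<boxplus> neg_arr C (z n \<cdot> \<pi> n)) \<cdot> \<iota> m = \<pi> (Suc n) \<cdot> \<iota> m \<boxplus> neg_arr C (z n \<cdot> \<pi> n \<cdot> \<iota> m)"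
      using c \<pi>s by simp
    also have "z n \<cdot> \<pi> n \<cdot> \<iota> m = (if Suc n = Suc m then z m else Zero C (Z m) (Z (Suc n)))"
      using c \<pi>s by (simp add: \<pi>(2))
    finally show "(\<pi> (Suc n) \<cdot> d) \<cdot> \<iota> m = (\<pi> (Suc n) \<boxplus> neg_arr C (z n \<cdot> \<pi> n)) \<cdot> \<iota> m"
      unfolding e by simp
  qed (use c \<pi>s in auto)
  ultimately show thesis using that \<pi> by blast
qed

text \<open>By the recursion component 0 of \<open>u\<close> vanishes, and every later component is
  the image of its predecessor. Compactness of \<open>K\<close> allows the conclusion from all
  components to \<open>u\<close>.\<close>

lemma shift_mono:
  assumes F: "cocont_exact (U :: 'u itself) C F" and K: "compact_obj U C K"
    and nat: "small U (UNIV :: nat set)" and co: "is_coproduct C UNIV Z R \<iota>"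
    and z: "\<And>n. z n \<in> homset C (Z n) (Z (Suc n))" and d: "d \<in> homset C R R"
    and d\<iota>: "\<And>n. d \<cdot> \<iota> n = \<iota> n \<boxplus> neg_arr C (\<iota> (Suc n) \<cdot> z n)"
    and u: "u \<in> homset C K (fobj F R)" and du: "farr F d \<cdot> u = Zero C K (fobj F R)"
  shows "u = Zero C K (fobj F R)"
proof -
  note Fs [simp] = additive_functor_simps[OF cocont_exact_simps(1)[OF F]]
  have KO [simp]: "K \<in> Obj C" using compact_obj_obj[OF K] .
  obtain \<pi> where \<pi>: "\<And>n. \<pi> n \<in> homset C R (Z n)"
    "\<And>m n. \<pi> m \<cdot> \<iota> n = (if m = n then Id C (Z m) else Zero C (Z n) (Z m))"
    "\<pi> 0 \<cdot> d = \<pi> 0" "\<And>n. \<pi> (Suc n) \<cdot> d = \<pi> (Suc n) \<boxplus> neg_arr C (z n \<cdot> \<pi> n)"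
    using shift_projections[OF co z d d\<iota>] by blast
  have ZO: "Z n \<in> Obj C" "R \<in> Obj C" for n using homset_obj[OF \<pi>(1)[of n]] by auto
  have \<pi>d: "farr F (\<pi> n \<cdot> d) \<cdot> u = Zero C K (fobj F (Z n))" for n
  proof -
    have "farr F (\<pi> n \<cdot> d) \<cdot> u = farr F (\<pi> n) \<cdot> farr F d \<cdot> u" using \<pi>(1)[of n] d u by auto
    then show ?thesis using du \<pi>(1)[of n] ZO by auto
  qed
  have "farr F (\<pi> n) \<cdot> u = Zero C K (fobj F (Z n))" for n
  proof (induction n)
    case 0
    then show ?case using \<pi>d[of 0] \<pi>(3) by simp
  next
    case (Suc n)
    have "Zero C K (fobj F (Z (Suc n))) = farr F (\<pi> (Suc n)) \<cdot> u \<boxplus> neg_arr C (farr F (z n) \<cdot> farr F (\<pi> n) \<cdot> u)"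
      using \<pi>d[of "Suc n"] \<pi>(4)[of n] \<pi>(1)[of n] \<pi>(1)[of "Suc n"] z[of n] u by auto
    then show ?case using Suc z[of n] \<pi>(1)[of "Suc n"] u ZO by auto
  qed
  then show ?thesis using cocont_joint_mono[OF F nat co K u \<pi>(1) \<pi>(2)] by simp
qed

lemma cocont_exact_id: "cocont_exact U C id_functor"
proof -
  have "additive_functor C C id_functor"
    by (auto simp: additive_functor_def is_functor_def id_functor_def hom_def)
  then show ?thesis by (auto simp: cocont_exact_def id_functor_def)
qed

end

context large_category
begin

lemma small_nat: "small U (UNIV :: nat set)"
  using univ card_of_nat ordIso_ordLess_trans unfolding small_def universe_def by blast

text \<open>Regularity of the universe enters here. It keeps the set of maps killed at one stage of
  a tower small.\<close>

lemma small_UNION: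
  assumes "small U A" "\<And>a. a \<in> A \<Longrightarrow> small U (B a)"
  shows "small U (\<Union>a\<in>A. B a)"
proof -
  have "cinfinite |UNIV :: 'u set|"
    using univ unfolding universe_def cinfinite_def
    by (metis Field_card_of card_of_nat infinite_iff_card_of_nat ordIso_ordLeq_trans ordLess_imp_ordLeq)
  then show ?thesis
    using assms univ regularCard_UNION_bound[of "|UNIV :: 'u set|" A B]
    unfolding small_def universe_def by auto
qed

lemma small_coproduct:
  assumes "small U A" "\<And>a. a \<in> A \<Longrightarrow> Y a \<in> Obj C"
  obtains P \<iota> where "is_coproduct C A Y P \<iota>"
proof -
  obtain J :: "'u set" and b where b: "bij_betw b J A" "small U J" using small_reindex[OF assms(1)] by blast
  have "Y \<circ> b \<in> J \<rightarrow> Obj C" using b assms by (auto simp: bij_betw_def)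
  then obtain P \<iota> where "is_coproduct C J (Y \<circ> b) P \<iota>" using coproducts b by blast
  \<comment> \<open>The injections are indexed by \<open>J\<close> but wanted on \<open>A\<close>.
    Pulled back along the inverse of \<open>b\<close> they agree with the old ones only on
    \<open>J\<close>, hence the comparison inside the definition.\<close>
  moreover have "is_coproduct C J (Y \<circ> b) P ((\<iota> \<circ> inv_into J b) \<circ> b) \<longleftrightarrow> is_coproduct C J (Y \<circ> b) P \<iota>"
    unfolding is_coproduct_def using b by (simp add: bij_betw_def cong: conj_cong)
  ultimately have "is_coproduct C A Y P (\<iota> \<circ> inv_into J b)"
    using coproduct_reindex[OF b(1)] by blast
  then show thesis using that by blast
qed

lemma kill_exists:
  assumes M: "small U M" "\<And>m. m \<in> M \<Longrightarrow> m \<in> Arr C \<and> Cod C m = X" and X: "X \<in> Obj C"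
  shows "\<exists>X' s. kills C M X X' s"
proof -
  obtain P \<iota> where co: "is_coproduct C M (Dom C) P \<iota>"
    by (rule small_coproduct[OF M(1), of "Dom C"]) (use M in auto)
  obtain p where p: "p \<in> homset C P X" "\<And>m. m \<in> M \<Longrightarrow> p \<cdot> \<iota> m = m"
    using coproduct_map[OF co X, of "\<lambda>m. m"] M by auto
  obtain s h where "(p, s, h) \<in> Tri C" using tri_exists[of p] p by auto
  then show ?thesis unfolding kills_def using co p by auto
qed

text \<open>The telescope, that is, the cone of the identity minus the shift. For a map
  \<open>t\<close> from a compact object into it, the composite with \<open>h\<close> vanishes since
  the suspended difference is injective on such maps; so \<open>t\<close> comes from the coproduct
  and, by finite support, from one stage. If a map at stage 0 dies in the cone, its image in the
  coproduct has the form \<open>d \<cdot> q\<close>, and the finite support of \<open>q\<close>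
  stops the recursion. Both arguments are carried out after applying \<open>F\<close>.\<close>

lemma hocolim_exists:
  assumes X: "\<And>n. X n \<in> Obj C" and s: "\<And>n. s n \<in> homset C (X n) (X (Suc n))"
  obtains Z j where "is_hocolim U C X s Z j"
proof -
  obtain Q \<iota> where co: "is_coproduct C UNIV X Q \<iota>"
    using small_coproduct[OF small_nat, of X] X by blast
  have c [simp]: "Q \<in> Obj C" "\<And>n. \<iota> n \<in> Arr C" "\<And>n. Dom C (\<iota> n) = X n" "\<And>n. Cod C (\<iota> n) = Q" "\<And>n. X n \<in> Obj C"
    using coproduct_simps[OF co] X by auto
  have ss [simp]: "\<And>n. s n \<in> Arr C" "\<And>n. Dom C (s n) = X n" "\<And>n. Cod C (s n) = X (Suc n)" using s by auto
  obtain d where d: "d \<in> homset C Q Q" "\<And>n. d \<cdot> \<iota> n = \<iota> n \<boxplus> neg_arr C (\<iota> (Suc n) \<cdot> s n)"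
    using coproduct_map[OF co c(1), of "\<lambda>n. \<iota> n \<boxplus> neg_arr C (\<iota> (Suc n) \<cdot> s n)"] by auto
  have ds [simp]: "d \<in> Arr C" "Dom C d = Q" "Cod C d = Q" using d(1) by auto
  obtain p h where t: "(d, p, h) \<in> Tri C" using tri_exists[of d] by auto
  note ts [simp] = tri_simps[OF t]
  define Z where "Z = Cod C p"
  define j where "j n = p \<cdot> \<iota> n" for n
  have ZO [simp]: "Z \<in> Obj C" by (simp add: Z_def)
  have js: "\<And>n. j n \<in> homset C (X n) Z" by (simp add: j_def Z_def)
  note js' [simp] = js[unfolded in_homset_iff, THEN conjunct1] js[unfolded in_homset_iff, THEN conjunct2, THEN conjunct1]
    js[unfolded in_homset_iff, THEN conjunct2, THEN conjunct2]
  have jsn: "j (Suc n) \<cdot> s n = j n" for n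
  proof -
    have "(p \<cdot> d) \<cdot> \<iota> n = Zero C (X n) Z" unfolding tri_comp_zero[OF t] by (simp add: Z_def)
    then have "p \<cdot> \<iota> n \<boxplus> neg_arr C (p \<cdot> \<iota> (Suc n) \<cdot> s n) = Zero C (X n) Z" by (simp add: d(2))
    then have "p \<cdot> \<iota> n = p \<cdot> \<iota> (Suc n) \<cdot> s n" by (subst (asm) diff_eq_zero_iff) (simp_all add: Z_def)
    then show ?thesis by (simp add: j_def)
  qed
  have surj: "\<exists>n. \<exists>t'\<in>homset C K (fobj F (X n)). t = farr F (j n) \<cdot> t'"
    if F: "cocont_exact U C F" and K: "compact_obj U C K" and tt: "t \<in> homset C K (fobj F Z)" for F K t
  proof -
    note Fs [simp] = additive_functor_simps[OF cocont_exact_simps(1)[OF F]]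
    have KO [simp]: "K \<in> Obj C" using compact_obj_obj[OF K] .
    \<comment> \<open>\<open>F\<close> is controlled on the first two maps of a triangle;
      \<open>h\<close> and \<open>Sa d\<close> are reached by rotating the triangle before
      \<open>F\<close> is applied.\<close>
    obtain h1 where t1: "(farr F p, farr F h, h1) \<in> Tri C"
      using cocont_exact_simps(2)[OF F tri_rotateD[OF t]] by blast
    obtain h2 where t2: "(farr F h, farr F (neg_arr C (Sa d)), h2) \<in> Tri C"
      using cocont_exact_simps(2)[OF F tri_rotateD[OF tri_rotateD[OF t]]] by blast
    let ?u = "farr F h \<cdot> t"
    have u: "?u \<in> homset C K (fobj F (S Q))" using tt by (simp add: Z_def)
    have "(farr F (neg_arr C (Sa d)) \<cdot> farr F h) \<cdot> t = Zero C K (fobj F (S Q))"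
      unfolding tri_comp_zero[OF t2] using tt by (simp add: Z_def)
    then have "neg_arr C (farr F (Sa d) \<cdot> ?u) = Zero C K (fobj F (S Q))"
      using tt by (simp add: Z_def)
    then have du: "farr F (Sa d) \<cdot> ?u = Zero C K (fobj F (S Q))"
      using u tt by (subst (asm) neg_eq_zero_iff) (simp_all add: Z_def)
    \<comment> \<open>\<open>F\<close> comes without an isomorphism to the suspension, so the
      suspended tower is treated as a tower in its own right.\<close>
    have coS: "is_coproduct C UNIV (S \<circ> X) (S Q) (Sa \<circ> \<iota>)"
      by (subst susp_coproduct_iff) (use co in auto)
    have "?u = Zero C K (fobj F (S Q))"
    proof (rule shift_mono[OF F K small_nat coS _ _ _ u du, of "Sa \<circ> s"])
      fix n
      have "Sa d \<cdot> Sa (\<iota> n) = Sa (d \<cdot> \<iota> n)" by simp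
      also have "\<dots> = Sa (\<iota> n) \<boxplus> neg_arr C (Sa (\<iota> (Suc n)) \<cdot> Sa (s n))" by (simp add: d(2))
      finally show "Sa d \<cdot> (Sa \<circ> \<iota>) n = (Sa \<circ> \<iota>) n \<boxplus> neg_arr C ((Sa \<circ> \<iota>) (Suc n) \<cdot> (Sa \<circ> s) n)" by simp
    qed auto
    then obtain q where q: "q \<in> homset C K (fobj F Q)" "t = farr F p \<cdot> q"
      using tri_lift[OF t1, of t K] tt by (auto simp: Z_def)
    have "\<exists>n. \<exists>t'\<in>homset C K (fobj F (X n)). farr F p \<cdot> q = farr F (j n) \<cdot> t'"
      using F small_nat co K q(1)
    proof (induction rule: cocont_span_induct)
      case zero
      show ?case by (intro exI[of _ 0] bexI[of _ "Zero C K (fobj F (X 0))"]) (simp_all add: Z_def[symmetric])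
    next
      case (inj i x)
      have "farr F p \<cdot> farr F (\<iota> i) \<cdot> x = (farr F p \<cdot> farr F (\<iota> i)) \<cdot> x"
        by (rule assoc[symmetric]) (use inj in auto)
      also have "\<dots> = farr F (j i) \<cdot> x" unfolding j_def by simp
      finally show ?case using inj(2) by blast
    next
      \<comment> \<open>The two representatives live at different stages \<open>n\<close> and
        \<open>m\<close>; both are pushed to stage \<open>n + m\<close> before they are
        added.\<close>
      case (add q r)
      then obtain n t' m r' where
        t': "t' \<in> homset C K (fobj F (X n))" "farr F p \<cdot> q = farr F (j n) \<cdot> t'"
        and r': "r' \<in> homset C K (fobj F (X m))" "farr F p \<cdot> r = farr F (j m) \<cdot> r'" by blast
      note c1 = chain_homset[of X s n m, OF X s] and c2 = chain_homset[of X s m n, OF X s]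
      have E: "farr F (j a) \<cdot> v = farr F (j (a + b)) \<cdot> farr F (chain C X s a b) \<cdot> v"
        if "v \<in> homset C K (fobj F (X a))" for a b v
      proof -
        note ch = chain_homset[of X s a b, OF X s]
        have "farr F (j (a + b)) \<cdot> farr F (chain C X s a b) = farr F (j a)"
          using arg_cong[OF chain_cocone[of X s j Z a b, OF X s js jsn], of "farr F"] ch by simp
        from comp_reassoc[OF this, of v] show ?thesis using that ch by simp
      qed
      have e1: "farr F (j n) \<cdot> t' = farr F (j (n + m)) \<cdot> farr F (chain C X s n m) \<cdot> t'"
        by (rule E[OF t'(1)])
      have e2: "farr F (j m) \<cdot> r' = farr F (j (n + m)) \<cdot> farr F (chain C X s m n) \<cdot> r'"
        using E[OF r'(1), of n] by (simp add: add.commute)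
      have "farr F p \<cdot> (q \<boxplus> r) = farr F (j n) \<cdot> t' \<boxplus> farr F (j m) \<cdot> r'" using add t' r' by simp
      also have "\<dots> = farr F (j (n + m)) \<cdot> (farr F (chain C X s n m) \<cdot> t' \<boxplus> farr F (chain C X s m n) \<cdot> r')"
        unfolding e1 e2 using c1 c2 t'(1) r'(1) by (auto simp: add.commute)
      finally show ?case using c1 c2 t'(1) r'(1)
        by (intro exI[of _ "n + m"] bexI[of _ "farr F (chain C X s n m) \<cdot> t' \<boxplus> farr F (chain C X s m n) \<cdot> r'"])
          (auto simp: add.commute)
    qed
    then show ?thesis using q(2) by simp
  qed
  have inj: "\<exists>n. farr F (chain C X s 0 n) \<cdot> t = Zero C K (fobj F (X n))"
    if F: "cocont_exact U C F" and K: "compact_obj U C K" and tt: "t \<in> homset C K (fobj F (X 0))"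
      and t0: "farr F (j 0) \<cdot> t = Zero C K (fobj F Z)" for F K t
  proof -
    note Fs [simp] = additive_functor_simps[OF cocont_exact_simps(1)[OF F]]
    have KO [simp]: "K \<in> Obj C" using compact_obj_obj[OF K] .
    have [simp]: "t \<in> Arr C" "Dom C t = K" "Cod C t = fobj F (X 0)" using tt by auto
    obtain h1 where t1: "(farr F d, farr F p, h1) \<in> Tri C"
      using cocont_exact_simps(2)[OF F t] by blast
    have "farr F p \<cdot> farr F (\<iota> 0) \<cdot> t = Zero C K (fobj F Z)"
      using t0 by (simp add: j_def)
    then obtain q where q: "q \<in> homset C K (fobj F Q)" "farr F (\<iota> 0) \<cdot> t = farr F d \<cdot> q"
      using tri_lift[OF t1, of "farr F (\<iota> 0) \<cdot> t" K] by (auto simp: Z_def)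
    have qs [simp]: "q \<in> Arr C" "Dom C q = K" "Cod C q = fobj F Q" using q(1) by auto
    obtain \<pi> where \<pi>: "\<And>n. \<pi> n \<in> homset C Q (X n)"
      "\<And>m n. \<pi> m \<cdot> \<iota> n = (if m = n then Id C (X m) else Zero C (X n) (X m))"
      "\<pi> 0 \<cdot> d = \<pi> 0" "\<And>n. \<pi> (Suc n) \<cdot> d = \<pi> (Suc n) \<boxplus> neg_arr C (s n \<cdot> \<pi> n)"
      using shift_projections[OF co s d] by blast
    have \<pi>s [simp]: "\<And>n. \<pi> n \<in> Arr C" "\<And>n. Dom C (\<pi> n) = Q" "\<And>n. Cod C (\<pi> n) = X n" using \<pi>(1) by auto
    have \<pi>\<iota>: "farr F (\<pi> n) \<cdot> farr F (\<iota> i) = (if n = i then Id C (fobj F (X n)) else Zero C (fobj F (X i)) (fobj F (X n)))" for n i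
      using arg_cong[OF \<pi>(2)[of n i], of "farr F"] by simp
    have fin: "\<exists>N. \<forall>n\<ge>N. farr F (\<pi> n) \<cdot> q = Zero C K (fobj F (X n))"
      using F small_nat co K q(1)
    proof (induction rule: cocont_span_induct)
      case (inj i x)
      have "farr F (\<pi> n) \<cdot> farr F (\<iota> i) \<cdot> x = Zero C K (fobj F (X n))" if "n \<ge> Suc i" for n
        using comp_reassoc[OF \<pi>\<iota>[of n i], of x] inj that by auto
      then show ?case by blast
    next
      case (add q r)
      then obtain N N' where "\<forall>n\<ge>N. farr F (\<pi> n) \<cdot> q = Zero C K (fobj F (X n))"
        "\<forall>n\<ge>N'. farr F (\<pi> n) \<cdot> r = Zero C K (fobj F (X n))" by blast
      then show ?case using add by (intro exI[of _ "max N N'"]) auto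
    qed auto
    have rel: "farr F (\<pi> n \<cdot> d) \<cdot> q = (if n = 0 then t else Zero C K (fobj F (X n)))" for n
    proof -
      have "farr F (\<pi> n \<cdot> d) \<cdot> q = farr F (\<pi> n) \<cdot> farr F (\<iota> 0) \<cdot> t" by (simp add: q(2))
      then show ?thesis using comp_reassoc[OF \<pi>\<iota>[of n 0], of t] by auto
    qed
    \<comment> \<open>Component \<open>n\<close> of \<open>q\<close> is the image of
      \<open>t\<close> at stage \<open>n\<close>. As the components vanish from some index on, so do
      these images.\<close>
    have "farr F (\<pi> n) \<cdot> q = farr F (chain C X s 0 n) \<cdot> t" for n
    proof (induction n)
      case 0
      then show ?case using rel[of 0] \<pi>(3) by simp
    next
      case (Suc n)
      have "farr F (\<pi> (Suc n)) \<cdot> q \<boxplus> neg_arr C (farr F (s n) \<cdot> farr F (\<pi> n) \<cdot> q) = Zero C K (fobj F (X (Suc n)))"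
        using rel[of "Suc n"] \<pi>(4)[of n] by simp
      then have "farr F (\<pi> (Suc n)) \<cdot> q = farr F (s n) \<cdot> farr F (\<pi> n) \<cdot> q"
        by (subst (asm) diff_eq_zero_iff) auto
      then show ?case using Suc chain_homset[of X s 0 n, OF X s] by simp
    qed
    then show ?thesis using fin by (metis order_refl)
  qed
  have "is_hocolim U C X s Z j"
    unfolding is_hocolim_def using js jsn surj inj ZO by blast
  then show thesis using that by blast
qed

lemma tower_exists:
  assumes X0: "X0 \<in> Obj C" and M: "\<And>X. X \<in> Obj C \<Longrightarrow> small U (M X)"
    "\<And>X m. X \<in> Obj C \<Longrightarrow> m \<in> M X \<Longrightarrow> m \<in> Arr C \<and> Cod C m = X"
  obtains X s Z j where "X 0 = X0" "\<And>n. X n \<in> Obj C" "\<And>n. kills C (M (X n)) (X n) (X (Suc n)) (s n)"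
    "is_hocolim U C X s Z j"
proof -
  have "\<exists>r. kills C (M X) X (fst r) (snd r)" if "X \<in> Obj C" for X
    using kill_exists[OF M(1)[OF that] M(2)[OF that] that] by (metis fst_conv snd_conv)
  \<comment> \<open>With a killing map chosen for every object at once, the tower is the iteration
    of one function, although the set killed at a stage depends on the object reached.\<close>
  then obtain r where r: "\<And>X. X \<in> Obj C \<Longrightarrow> kills C (M X) X (fst (r X)) (snd (r X))" by metis
  define X where "X n = ((fst \<circ> r) ^^ n) X0" for n
  have XO: "X n \<in> Obj C" for n
  proof (induction n)
    case (Suc n)
    then show ?case using homset_obj(2)[OF kills_homset[OF r]] by (simp add: X_def)
  qed (simp add: X_def X0)
  have k: "kills C (M (X n)) (X n) (X (Suc n)) (snd (r (X n)))" for n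
    using r[OF XO[of n]] by (simp add: X_def)
  obtain Z j where "is_hocolim U C X (\<lambda>n. snd (r (X n))) Z j"
    using hocolim_exists[of X "\<lambda>n. snd (r (X n))", OF XO kills_homset[OF k]] by blast
  with that[of X "\<lambda>n. snd (r (X n))" Z j] show thesis using XO k by (simp add: X_def)
qed

end

context large_category
begin

section \<open>Transformations of finitary homological functors that are bijective on
  generators\<close>

context
  fixes F1 F2 :: "('o, 'm, 'o, 'm) cat_functor" and K1 K2 :: 'o and \<phi> :: "'o \<Rightarrow> 'm \<Rightarrow> 'm" and G :: "'o set"
  assumes F1: "cocont_exact U C F1" and F2: "cocont_exact U C F2"
    and K1: "compact_obj U C K1" and K2: "compact_obj U C K2"
    and G: "small U G" "\<And>A. A \<in> G \<Longrightarrow> compact_obj U C A"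
      "\<And>X. X \<in> Obj C \<Longrightarrow> (\<And>A. A \<in> G \<Longrightarrow> homset C A X = {Zero C A X}) \<Longrightarrow> zero_object C X"
    and \<phi>: "\<And>Y t. Y \<in> Obj C \<Longrightarrow> t \<in> homset C K1 (fobj F1 Y) \<Longrightarrow> \<phi> Y t \<in> homset C K2 (fobj F2 Y)"
    and \<phi>_add: "\<And>Y t u. \<lbrakk>Y \<in> Obj C; t \<in> homset C K1 (fobj F1 Y); u \<in> homset C K1 (fobj F1 Y)\<rbrakk>
      \<Longrightarrow> \<phi> Y (t \<boxplus> u) = \<phi> Y t \<boxplus> \<phi> Y u"
    and \<phi>_nat: "\<And>Y Y' f t. \<lbrakk>f \<in> homset C Y Y'; t \<in> homset C K1 (fobj F1 Y)\<rbrakk>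
      \<Longrightarrow> \<phi> Y' (farr F1 f \<cdot> t) = farr F2 f \<cdot> \<phi> Y t"
    and surjG: "\<And>A s. A \<in> G \<Longrightarrow> s \<in> homset C K2 (fobj F2 A) \<Longrightarrow> \<exists>t\<in>homset C K1 (fobj F1 A). \<phi> A t = s"
    and injG: "\<And>A t. A \<in> G \<Longrightarrow> t \<in> homset C K1 (fobj F1 A) \<Longrightarrow> \<phi> A t = Zero C K2 (fobj F2 A)
      \<Longrightarrow> t = Zero C K1 (fobj F1 A)"
    and injSG: "\<And>A t. A \<in> G \<Longrightarrow> t \<in> homset C K1 (fobj F1 (S A)) \<Longrightarrow> \<phi> (S A) t = Zero C K2 (fobj F2 (S A))
      \<Longrightarrow> t = Zero C K1 (fobj F1 (S A))"
begin

private lemmas Fs [simp] = additive_functor_simps[OF cocont_exact_simps(1)[OF F1]]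
  additive_functor_simps[OF cocont_exact_simps(1)[OF F2]]
private lemmas KO [simp] = compact_obj_obj[OF K1] compact_obj_obj[OF K2]

private abbreviation M where "M X \<equiv> \<Union>A\<in>G. homset C A X"

private lemma \<phi>_simps [simp]:
  assumes "Y \<in> Obj C" "t \<in> Arr C" "Dom C t = K1" "Cod C t = fobj F1 Y"
  shows "\<phi> Y t \<in> Arr C" "Dom C (\<phi> Y t) = K2" "Cod C (\<phi> Y t) = fobj F2 Y"
  using \<phi>[of Y t] assms by auto

private lemma \<phi>_zero [simp]:
  assumes "Y \<in> Obj C" shows "\<phi> Y (Zero C K1 (fobj F1 Y)) = Zero C K2 (fobj F2 Y)"
  using add_self_eq_zero[of "\<phi> Y (Zero C K1 (fobj F1 Y))"] \<phi>_add[of Y "Zero C K1 (fobj F1 Y)" "Zero C K1 (fobj F1 Y)"] assms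
  by simp

private lemma \<phi>_diff:
  assumes "Y \<in> Obj C" "t \<in> homset C K1 (fobj F1 Y)" "u \<in> homset C K1 (fobj F1 Y)"
  shows "\<phi> Y (t \<boxplus> neg_arr C u) = \<phi> Y t \<boxplus> neg_arr C (\<phi> Y u)"
proof -
  have "\<phi> Y u \<boxplus> \<phi> Y (neg_arr C u) = Zero C K2 (fobj F2 Y)"
    using \<phi>_add[of Y u "neg_arr C u"] assms by simp
  then have "neg_arr C (\<phi> Y u) = \<phi> Y (neg_arr C u)" by (intro neg_unique) (use assms in auto)
  then show ?thesis using \<phi>_add[of Y t "neg_arr C u"] assms by simp
qed

private lemma small_M: "X \<in> Obj C \<Longrightarrow> small U (M X)"
  by (rule small_UNION[OF G(1)]) (rule locally_small[OF compact_obj_obj[OF G(2)]])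

text \<open>A map from \<open>K2\<close> into the image of the coproduct is a finite sum through
  generators. Each term has a preimage, and naturality along the injections carries it to
  \<open>P\<close>.\<close>

private lemma surj_coproduct:
  assumes A: "small U A" and co: "is_coproduct C A Y P \<iota>" and Y: "\<And>i. i \<in> A \<Longrightarrow> Y i \<in> G"
    and s: "s \<in> homset C K2 (fobj F2 P)"
  shows "\<exists>t\<in>homset C K1 (fobj F1 P). \<phi> P t = s"
  using F2 A co K2 s
proof (induction rule: cocont_span_induct)
  case zero
  show ?case using coproduct_simps(1)[OF co] by (intro bexI[of _ "Zero C K1 (fobj F1 P)"]) auto
next
  case (inj i x)
  note c = coproduct_simps(2-5)[OF co inj(1)]
  obtain t where t: "t \<in> homset C K1 (fobj F1 (Y i))" "\<phi> (Y i) t = x" using surjG[OF Y[OF inj(1)] inj(2)] by blast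
  have "\<phi> P (farr F1 (\<iota> i) \<cdot> t) = farr F2 (\<iota> i) \<cdot> x" using \<phi>_nat[of "\<iota> i" "Y i" P t] c t by simp
  then show ?case using c t by (intro bexI[of _ "farr F1 (\<iota> i) \<cdot> t"]) auto
next
  case (add q r)
  then obtain t u where "t \<in> homset C K1 (fobj F1 P)" "\<phi> P t = q" "u \<in> homset C K1 (fobj F1 P)" "\<phi> P u = r" by blast
  then show ?case using \<phi>_add[of P t u] coproduct_simps(1)[OF co] by (intro bexI[of _ "t \<boxplus> u"]) auto
qed

text \<open>Naturality along the projections moves the question to the summands, and the projections
  are jointly monic on maps from \<open>K1\<close>.\<close>

private lemma inj_coproduct:
  assumes A: "small U A" and co: "is_coproduct C A Y P \<iota>"
    and Y: "\<And>i t. i \<in> A \<Longrightarrow> t \<in> homset C K1 (fobj F1 (Y i)) \<Longrightarrow> \<phi> (Y i) t = Zero C K2 (fobj F2 (Y i))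
      \<Longrightarrow> t = Zero C K1 (fobj F1 (Y i))"
    and t: "t \<in> homset C K1 (fobj F1 P)" "\<phi> P t = Zero C K2 (fobj F2 P)"
  shows "t = Zero C K1 (fobj F1 P)"
proof -
  obtain \<pi> where \<pi>: "\<And>i. i \<in> A \<Longrightarrow> \<pi> i \<in> homset C P (Y i)"
    "\<And>i j. \<lbrakk>i \<in> A; j \<in> A\<rbrakk> \<Longrightarrow> \<pi> i \<cdot> \<iota> j = (if i = j then Id C (Y i) else Zero C (Y j) (Y i))"
    using coproduct_projections[OF co] by blast
  have 0: "farr F1 (\<pi> i) \<cdot> t = Zero C K1 (fobj F1 (Y i))" if i: "i \<in> A" for i
  proof (rule Y[OF i])
    show "farr F1 (\<pi> i) \<cdot> t \<in> homset C K1 (fobj F1 (Y i))" using \<pi>(1)[OF i] t by auto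
    show "\<phi> (Y i) (farr F1 (\<pi> i) \<cdot> t) = Zero C K2 (fobj F2 (Y i))"
      using \<phi>_nat[OF \<pi>(1)[OF i] t(1)] t(2) \<pi>(1)[OF i] homset_obj[OF \<pi>(1)[OF i]] by simp
  qed
  show ?thesis by (rule cocont_joint_mono[OF F1 A co K1 t(1) \<pi> 0])
qed

private lemma inj_P:
  assumes X: "X \<in> Obj C" and co: "is_coproduct C (M X) (Dom C) P \<iota>"
    and t: "t \<in> homset C K1 (fobj F1 P)" "\<phi> P t = Zero C K2 (fobj F2 P)"
  shows "t = Zero C K1 (fobj F1 P)"
  by (rule inj_coproduct[OF small_M[OF X] co _ t]) (use injG in auto)

private lemma inj_SP:
  assumes X: "X \<in> Obj C" and co: "is_coproduct C (M X) (Dom C) P \<iota>"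
    and t: "t \<in> homset C K1 (fobj F1 (S P))" "\<phi> (S P) t = Zero C K2 (fobj F2 (S P))"
  shows "t = Zero C K1 (fobj F1 (S P))"
proof (rule inj_coproduct[OF small_M[OF X] _ _ t])
  show "is_coproduct C (M X) (S \<circ> Dom C) (S P) (Sa \<circ> \<iota>)"
    by (subst susp_coproduct_iff) (use co coproduct_simps[OF co] in auto)
qed (use injSG in auto)

text \<open>The four lemma along the triangle of \<open>p\<close>, \<open>s\<close> and
  \<open>h\<close>. Injectivity at the suspended coproduct makes \<open>t'\<close> come from
  \<open>X\<close>; the remaining defect comes from the coproduct itself, where
  \<open>\<phi>\<close> is onto. The hypothesis on suspended generators exists for this
  step.\<close>

private lemma surj_step:
  assumes k: "kills C (M X) X X' s" and X: "X \<in> Obj C" and y: "y \<in> homset C K2 (fobj F2 X)"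
    and t': "t' \<in> homset C K1 (fobj F1 X')" "\<phi> X' t' = farr F2 s \<cdot> y"
  shows "\<exists>t\<in>homset C K1 (fobj F1 X). \<phi> X t = y"
proof -
  obtain p h \<iota> where t: "(p, s, h) \<in> Tri C" and co: "is_coproduct C (M X) (Dom C) (Dom C p) \<iota>"
    and cd: "Cod C p = X" "Cod C s = X'" using k unfolding kills_def by blast
  note [simp] = tri_simps[OF t] cd X
  have X' [simp]: "X' \<in> Obj C" using cod_obj[of s] by simp
  have [simp]: "y \<in> Arr C" "Dom C y = K2" "Cod C y = fobj F2 X" "t' \<in> Arr C" "Dom C t' = K1" "Cod C t' = fobj F1 X'"
    using y t' by auto
  obtain h1 where t1: "(farr F1 s, farr F1 h, h1) \<in> Tri C"
    using cocont_exact_simps(2)[OF F1 tri_rotateD[OF t]] by blast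
  obtain h2 where t2: "(farr F2 p, farr F2 s, h2) \<in> Tri C" using cocont_exact_simps(2)[OF F2 t] by blast
  have "(farr F2 h \<cdot> farr F2 s) \<cdot> y = farr F2 (h \<cdot> s) \<cdot> y" by simp
  also have "\<dots> = Zero C K2 (fobj F2 (S (Dom C p)))" unfolding tri_comp_zero2[OF t] by simp
  finally have "\<phi> (S (Dom C p)) (farr F1 h \<cdot> t') = Zero C K2 (fobj F2 (S (Dom C p)))"
    using \<phi>_nat[of h X' "S (Dom C p)" t'] t'(2) by simp
  then have "farr F1 h \<cdot> t' = Zero C K1 (fobj F1 (S (Dom C p)))" by (intro inj_SP[OF X co]) auto
  then obtain t0 where t0: "t0 \<in> homset C K1 (fobj F1 X)" "t' = farr F1 s \<cdot> t0"
    using tri_lift[OF t1, of t' K1] by auto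
  have [simp]: "t0 \<in> Arr C" "Dom C t0 = K1" "Cod C t0 = fobj F1 X" using t0 by auto
  let ?d = "\<phi> X t0 \<boxplus> neg_arr C y"
  have "farr F2 s \<cdot> ?d = \<phi> X' t' \<boxplus> neg_arr C (farr F2 s \<cdot> y)" using \<phi>_nat[of s X X' t0] t0(2) by simp
  also have "\<dots> = Zero C K2 (fobj F2 X')" by (simp add: t'(2))
  finally obtain z where z: "z \<in> homset C K2 (fobj F2 (Dom C p))" "?d = farr F2 p \<cdot> z"
    using tri_lift[OF t2, of ?d K2] by auto
  obtain z' where z': "z' \<in> homset C K1 (fobj F1 (Dom C p))" "\<phi> (Dom C p) z' = z"
    using surj_coproduct[OF small_M[OF X] co _ z(1)] by auto
  have "\<phi> X (farr F1 p \<cdot> z') = farr F2 p \<cdot> z" using \<phi>_nat[of p "Dom C p" X z'] z' by simp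
  then have "\<phi> X (t0 \<boxplus> neg_arr C (farr F1 p \<cdot> z')) = \<phi> X t0 \<boxplus> neg_arr C ?d"
    using \<phi>_diff[of X t0 "farr F1 p \<cdot> z'"] z' z(2) by simp
  also have "\<dots> = y"
  proof -
    have "?d \<boxplus> y = \<phi> X t0" by (rule diff_add_cancel) auto
    then have "y \<boxplus> ?d \<boxplus> neg_arr C ?d = \<phi> X t0 \<boxplus> neg_arr C ?d" using add_commute[of y ?d] by simp
    moreover have "y \<boxplus> ?d \<boxplus> neg_arr C ?d = y \<boxplus> (?d \<boxplus> neg_arr C ?d)" by (rule add_assoc) auto
    moreover have "?d \<boxplus> neg_arr C ?d = Zero C K2 (fobj F2 X)" using add_neg(1)[of ?d] by simp
    ultimately show ?thesis by simp
  qed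
  finally show ?thesis using z' by (intro bexI[of _ "t0 \<boxplus> neg_arr C (farr F1 p \<cdot> z')"]) auto
qed

text \<open>The four lemma once more, with the fibre \<open>w\<close> of \<open>p\<close> put in
  front of the triangle. Surjectivity is needed at the domain of \<open>w\<close>, an arbitrary
  object, which is why it is established everywhere before injectivity is considered.\<close>

private lemma inj_step:
  assumes k: "kills C (M X) X X' s" and X: "X \<in> Obj C" and y: "y \<in> homset C K1 (fobj F1 X)"
    and y0: "\<phi> X y = Zero C K2 (fobj F2 X)" "farr F1 s \<cdot> y = Zero C K1 (fobj F1 X')"
    and surj: "\<And>V r. V \<in> Obj C \<Longrightarrow> r \<in> homset C K2 (fobj F2 V) \<Longrightarrow> \<exists>t\<in>homset C K1 (fobj F1 V). \<phi> V t = r"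
  shows "y = Zero C K1 (fobj F1 X)"
proof -
  obtain p h \<iota> where t: "(p, s, h) \<in> Tri C" and co: "is_coproduct C (M X) (Dom C) (Dom C p) \<iota>"
    and cd: "Cod C p = X" "Cod C s = X'" using k unfolding kills_def by blast
  note [simp] = tri_simps[OF t] cd X
  have X' [simp]: "X' \<in> Obj C" using cod_obj[of s] by simp
  have [simp]: "y \<in> Arr C" "Dom C y = K1" "Cod C y = fobj F1 X" using y by auto
  obtain w k2 where tw: "(w, p, k2) \<in> Tri C" using tri_fibre[of p] by auto
  note [simp] = tri_simps(1)[OF tw] tri_simps(4)[OF tw, symmetric]
  obtain h1 where t1: "(farr F1 p, farr F1 s, h1) \<in> Tri C" using cocont_exact_simps(2)[OF F1 t] by blast
  obtain h2 where t2: "(farr F2 w, farr F2 p, h2) \<in> Tri C" using cocont_exact_simps(2)[OF F2 tw] by blast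
  obtain e where e: "e \<in> homset C K1 (fobj F1 (Dom C p))" "y = farr F1 p \<cdot> e"
    using tri_lift[OF t1, of y K1] y0 by auto
  have [simp]: "e \<in> Arr C" "Dom C e = K1" "Cod C e = fobj F1 (Dom C p)" using e by auto
  have "farr F2 p \<cdot> \<phi> (Dom C p) e = Zero C K2 (fobj F2 X)"
    using \<phi>_nat[of p "Dom C p" X e] y0 e(2) by simp
  then obtain r where r: "r \<in> homset C K2 (fobj F2 (Dom C w))" "\<phi> (Dom C p) e = farr F2 w \<cdot> r"
    using tri_lift[OF t2, of "\<phi> (Dom C p) e" K2] by auto
  obtain r' where r': "r' \<in> homset C K1 (fobj F1 (Dom C w))" "\<phi> (Dom C w) r' = r" using surj[OF _ r(1)] by auto
  have [simp]: "r' \<in> Arr C" "Dom C r' = K1" "Cod C r' = fobj F1 (Dom C w)" using r' by auto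
  have "\<phi> (Dom C p) (e \<boxplus> neg_arr C (farr F1 w \<cdot> r')) = Zero C K2 (fobj F2 (Dom C p))"
    using \<phi>_diff[of "Dom C p" e "farr F1 w \<cdot> r'"] \<phi>_nat[of w "Dom C w" "Dom C p" r'] r(2) r'(2) r(1) by simp
  then have "e \<boxplus> neg_arr C (farr F1 w \<cdot> r') = Zero C K1 (fobj F1 (Dom C p))" by (intro inj_P[OF X co]) auto
  then have "e = farr F1 w \<cdot> r'" by (subst (asm) diff_eq_zero_iff) auto
  then have "y = farr F1 (p \<cdot> w) \<cdot> r'" using e(2) by simp
  then show ?thesis unfolding tri_comp_zero[OF tw] by simp
qed

text \<open>The homotopy colimit of the tower vanishes, since it receives no non-zero map from a generator.\<close>

private lemma tower:
  assumes X0: "X0 \<in> Obj C"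
  obtains X s where "X 0 = X0" "\<And>n. X n \<in> Obj C" "\<And>n. kills C (M (X n)) (X n) (X (Suc n)) (s n)"
    "\<And>F K t. \<lbrakk>cocont_exact U C F; compact_obj U C K; t \<in> homset C K (fobj F X0)\<rbrakk>
      \<Longrightarrow> \<exists>n. farr F (chain C X s 0 n) \<cdot> t = Zero C K (fobj F (X n))"
proof -
  obtain X s Z j where X: "X 0 = X0" "\<And>n. X n \<in> Obj C" "\<And>n. kills C (M (X n)) (X n) (X (Suc n)) (s n)"
    and hc: "is_hocolim U C X s Z j"
    by (rule tower_exists[OF X0, of M]) (use small_M in auto)
  have Z: "Z \<in> Obj C" and j: "\<And>n. j n \<in> homset C (X n) Z" "\<And>n. j (Suc n) \<cdot> s n = j n"
    using hc by (auto simp: is_hocolim_def)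
  have s: "\<And>n. s n \<in> homset C (X n) (X (Suc n))" using kills_homset[OF X(3)] .
  have zero: "zero_object C Z"
  proof (rule G(3)[OF Z])
    fix A assume A: "A \<in> G"
    have AO: "A \<in> Obj C" using compact_obj_obj[OF G(2)[OF A]] .
    have "x = Zero C A Z" if x: "x \<in> homset C A Z" for x
    proof -
      \<comment> \<open>\<open>A\<close> is compact, so \<open>x\<close> comes from a finite stage,
        and there it is one of the maps killed by the next transition.\<close>
      obtain n x' where x': "x' \<in> homset C A (X n)" "x = j n \<cdot> x'"
        using hc cocont_exact_id[of U] G(2)[OF A] x unfolding is_hocolim_def
        by (metis (no_types, lifting) cat_functor.select_convs id_apply id_functor_def)
      have "x' \<in> M (X n)" using x' A by blast
      then have "s n \<cdot> x' = Zero C A (X (Suc n))" using kills_zero[OF X(3)] x' by auto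
      then have "j (Suc n) \<cdot> s n \<cdot> x' = Zero C A Z" using j(1)[of "Suc n"] AO by auto
      then show ?thesis using comp_reassoc[OF j(2)[of n], of x'] x' s[of n] j(1)[of "Suc n"] by auto
    qed
    then show "homset C A Z = {Zero C A Z}" using AO Z by auto
  qed
  show thesis
  proof (rule that[OF X])
    fix F K t assume F: "cocont_exact U C F" and K: "compact_obj U C K" and t: "t \<in> homset C K (fobj F X0)"
    note FF = additive_functor_simps[OF cocont_exact_simps(1)[OF F]]
    have "zero_object C (fobj F Z)"
      using zero_object_id[OF zero] FF(5,8)[of Z] FF(8)[of Z Z] Z FF(1) by (intro zero_objectI) auto
    then have "farr F (j 0) \<cdot> t = Zero C K (fobj F Z)"
      using zero_object_arr(2)[of "fobj F Z" "farr F (j 0) \<cdot> t"] j(1)[of 0] X(1) t FF by auto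
    then show "\<exists>n. farr F (chain C X s 0 n) \<cdot> t = Zero C K (fobj F (X n))"
      using hc F K t X(1) unfolding is_hocolim_def by blast
  qed
qed

text \<open>At some stage of the tower the image of \<open>y\<close> is zero and so has a preimage,
  namely zero. Each use of \<open>surj_step\<close> descends by one stage until \<open>X0\<close> is
  reached.\<close>

lemma natural_surjective:
  assumes X0: "X0 \<in> Obj C" and y: "y \<in> homset C K2 (fobj F2 X0)"
  shows "\<exists>t\<in>homset C K1 (fobj F1 X0). \<phi> X0 t = y"
proof -
  obtain X s where X: "X 0 = X0" "\<And>n. X n \<in> Obj C" "\<And>n. kills C (M (X n)) (X n) (X (Suc n)) (s n)"
    and tw: "\<And>F K t. \<lbrakk>cocont_exact U C F; compact_obj U C K; t \<in> homset C K (fobj F X0)\<rbrakk>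
      \<Longrightarrow> \<exists>n. farr F (chain C X s 0 n) \<cdot> t = Zero C K (fobj F (X n))"
    using tower[OF X0] by blast
  have s: "\<And>n. s n \<in> homset C (X n) (X (Suc n))" using kills_homset[OF X(3)] .
  have ch: "chain C X s 0 n \<in> homset C X0 (X n)" for n
    using chain_homset[of X s 0 n, OF X(2) s] X(1) by simp
  obtain n where n: "farr F2 (chain C X s 0 n) \<cdot> y = Zero C K2 (fobj F2 (X n))" using tw[OF F2 K2 y] by blast
  \<comment> \<open>The induction counts the distance \<open>k\<close> below stage \<open>n\<close>;
    the bound \<open>k \<le> n\<close> keeps the truncated subtraction honest.\<close>
  have "k \<le> n \<Longrightarrow> \<exists>t\<in>homset C K1 (fobj F1 (X (n - k))). \<phi> (X (n - k)) t = farr F2 (chain C X s 0 (n - k)) \<cdot> y" for k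
  proof (induction k)
    case 0
    then show ?case using n X(2)[of n] by (intro bexI[of _ "Zero C K1 (fobj F1 (X n))"]) auto
  next
    case (Suc k)
    define i where "i = n - Suc k"
    have i: "n - k = Suc i" using Suc.prems by (simp add: i_def)
    obtain t' where "t' \<in> homset C K1 (fobj F1 (X (Suc i)))" "\<phi> (X (Suc i)) t' = farr F2 (chain C X s 0 (Suc i)) \<cdot> y"
      using Suc i by auto
    moreover have "farr F2 (chain C X s 0 (Suc i)) \<cdot> y = farr F2 (s i) \<cdot> farr F2 (chain C X s 0 i) \<cdot> y"
      using ch[of i] s[of i] y by simp
    moreover have "farr F2 (chain C X s 0 i) \<cdot> y \<in> homset C K2 (fobj F2 (X i))" using ch[of i] y by simp
    ultimately show ?case using surj_step[OF X(3)[of i] X(2)[of i]] by (simp add: i_def[symmetric])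
  qed
  from this[of n] show ?thesis using X(1) X0 y by simp
qed

text \<open>The same descent, from a stage at which \<open>y\<close> has died. The surjectivity
  demanded by \<open>inj_step\<close> is available at all objects from
  \<open>natural_surjective\<close>.\<close>

lemma natural_injective:
  assumes X0: "X0 \<in> Obj C" and y: "y \<in> homset C K1 (fobj F1 X0)" and y0: "\<phi> X0 y = Zero C K2 (fobj F2 X0)"
  shows "y = Zero C K1 (fobj F1 X0)"
proof -
  obtain X s where X: "X 0 = X0" "\<And>n. X n \<in> Obj C" "\<And>n. kills C (M (X n)) (X n) (X (Suc n)) (s n)"
    and tw: "\<And>F K t. \<lbrakk>cocont_exact U C F; compact_obj U C K; t \<in> homset C K (fobj F X0)\<rbrakk>
      \<Longrightarrow> \<exists>n. farr F (chain C X s 0 n) \<cdot> t = Zero C K (fobj F (X n))"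
    using tower[OF X0] by blast
  have s: "\<And>n. s n \<in> homset C (X n) (X (Suc n))" using kills_homset[OF X(3)] .
  have ch: "chain C X s 0 n \<in> homset C X0 (X n)" for n
    using chain_homset[of X s 0 n, OF X(2) s] X(1) by simp
  obtain n where n: "farr F1 (chain C X s 0 n) \<cdot> y = Zero C K1 (fobj F1 (X n))" using tw[OF F1 K1 y] by blast
  have "k \<le> n \<Longrightarrow> farr F1 (chain C X s 0 (n - k)) \<cdot> y = Zero C K1 (fobj F1 (X (n - k)))" for k
  proof (induction k)
    case (Suc k)
    define i where "i = n - Suc k"
    have i: "n - k = Suc i" using Suc.prems by (simp add: i_def)
    let ?y = "farr F1 (chain C X s 0 i) \<cdot> y"
    have "farr F1 (s i) \<cdot> ?y = farr F1 (chain C X s 0 (Suc i)) \<cdot> y" using ch[of i] s[of i] y by simp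
    then have 1: "farr F1 (s i) \<cdot> ?y = Zero C K1 (fobj F1 (X (Suc i)))" using Suc i by simp
    have "\<phi> (X i) ?y = farr F2 (chain C X s 0 i) \<cdot> \<phi> X0 y" by (rule \<phi>_nat[OF ch y])
    then have 2: "\<phi> (X i) ?y = Zero C K2 (fobj F2 (X i))" using y0 ch[of i] X0 by simp
    have "?y = Zero C K1 (fobj F1 (X i))"
      by (rule inj_step[OF X(3)[of i] X(2)[of i] _ 2 1]) (use ch[of i] y natural_surjective in auto)
    then show ?case by (simp add: i_def[symmetric])
  qed (use n in simp)
  from this[of n] show ?thesis using X(1) X0 y by simp
qed

declare Fs [simp del] KO [simp del] \<phi>_simps [simp del] \<phi>_zero [simp del]

end

end

section \<open>Coherence and duality\<close>

context closed_symmetric_monoidal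
begin

abbreviation a where "a X Y Z \<equiv> Assoc C X Y Z"
abbreviation a' where "a' X Y Z \<equiv> inv_arr C (Assoc C X Y Z)"
abbreviation l where "l X \<equiv> LUnit C X"
abbreviation r where "r X \<equiv> RUnit C X"
abbreviation b where "b X Y \<equiv> Braid C X Y"
abbreviation i where "i X \<equiv> Id C X"
abbreviation e1 where "e1 \<equiv> Unit C"

lemma tensor_simps [simp]:
  "\<lbrakk>X \<in> Obj C; Y \<in> Obj C\<rbrakk> \<Longrightarrow> X \<boxtimes> Y \<in> Obj C"
  "\<lbrakk>f \<in> Arr C; g \<in> Arr C\<rbrakk> \<Longrightarrow> f \<diamondop> g \<in> Arr C"
  "\<lbrakk>f \<in> Arr C; g \<in> Arr C\<rbrakk> \<Longrightarrow> Dom C (f \<diamondop> g) = Dom C f \<boxtimes> Dom C g"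
  "\<lbrakk>f \<in> Arr C; g \<in> Arr C\<rbrakk> \<Longrightarrow> Cod C (f \<diamondop> g) = Cod C f \<boxtimes> Cod C g"
  "\<lbrakk>X \<in> Obj C; Y \<in> Obj C\<rbrakk> \<Longrightarrow> i X \<diamondop> i Y = i (X \<boxtimes> Y)"
  "e1 \<in> Obj C"
  using tensor_obj tensor_arr[of f "Dom C f" "Cod C f" g "Dom C g" "Cod C g"] tensor_id unit_obj by auto

lemma struct_simps [simp]:
  "\<lbrakk>X \<in> Obj C; Y \<in> Obj C; Z \<in> Obj C\<rbrakk> \<Longrightarrow> a X Y Z \<in> Arr C"
  "\<lbrakk>X \<in> Obj C; Y \<in> Obj C; Z \<in> Obj C\<rbrakk> \<Longrightarrow> Dom C (a X Y Z) = X \<boxtimes> Y \<boxtimes> Z"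
  "\<lbrakk>X \<in> Obj C; Y \<in> Obj C; Z \<in> Obj C\<rbrakk> \<Longrightarrow> Cod C (a X Y Z) = X \<boxtimes> (Y \<boxtimes> Z)"
  "\<lbrakk>X \<in> Obj C; Y \<in> Obj C; Z \<in> Obj C\<rbrakk> \<Longrightarrow> iso_arr C (a X Y Z)"
  "X \<in> Obj C \<Longrightarrow> l X \<in> Arr C" "X \<in> Obj C \<Longrightarrow> Dom C (l X) = e1 \<boxtimes> X"
  "X \<in> Obj C \<Longrightarrow> Cod C (l X) = X" "X \<in> Obj C \<Longrightarrow> iso_arr C (l X)"
  "X \<in> Obj C \<Longrightarrow> r X \<in> Arr C" "X \<in> Obj C \<Longrightarrow> Dom C (r X) = X \<boxtimes> e1"
  "X \<in> Obj C \<Longrightarrow> Cod C (r X) = X" "X \<in> Obj C \<Longrightarrow> iso_arr C (r X)"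
  "\<lbrakk>X \<in> Obj C; Y \<in> Obj C\<rbrakk> \<Longrightarrow> b X Y \<in> Arr C"
  "\<lbrakk>X \<in> Obj C; Y \<in> Obj C\<rbrakk> \<Longrightarrow> Dom C (b X Y) = X \<boxtimes> Y"
  "\<lbrakk>X \<in> Obj C; Y \<in> Obj C\<rbrakk> \<Longrightarrow> Cod C (b X Y) = Y \<boxtimes> X"
  "\<lbrakk>X \<in> Obj C; Y \<in> Obj C\<rbrakk> \<Longrightarrow> IHom C X Y \<in> Obj C"
  "\<lbrakk>X \<in> Obj C; Y \<in> Obj C\<rbrakk> \<Longrightarrow> Ev C X Y \<in> Arr C"
  "\<lbrakk>X \<in> Obj C; Y \<in> Obj C\<rbrakk> \<Longrightarrow> Dom C (Ev C X Y) = IHom C X Y \<boxtimes> X"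
  "\<lbrakk>X \<in> Obj C; Y \<in> Obj C\<rbrakk> \<Longrightarrow> Cod C (Ev C X Y) = Y"
  using assoc_iso[of X Y Z] lunit_iso[of X] runit_iso[of X] braid_arr[of X Y] ev_arr[of X Y] by auto

lemma braid_iso [simp]: "\<lbrakk>X \<in> Obj C; Y \<in> Obj C\<rbrakk> \<Longrightarrow> iso_arr C (b X Y)"
  using braid_symmetric[of X Y] braid_symmetric[of Y X] by (intro iso_arrI[of _ "b Y X"]) auto

lemma interchange:
  "\<lbrakk>f \<in> Arr C; f' \<in> Arr C; g \<in> Arr C; g' \<in> Arr C; Dom C f' = Cod C f; Dom C g' = Cod C g\<rbrakk>
    \<Longrightarrow> (f' \<diamondop> g') \<cdot> (f \<diamondop> g) = (f' \<cdot> f) \<diamondop> (g' \<cdot> g)"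
  using tensor_comp[of f "Dom C f" "Cod C f" f' "Cod C f'" g "Dom C g" "Cod C g" g' "Cod C g'"] by simp

lemma iso_tensor [simp]:
  assumes "iso_arr C f" "iso_arr C g" shows "iso_arr C (f \<diamondop> g)"
  by (rule iso_arrI[of _ "inv_arr C f \<diamondop> inv_arr C g"]) (use assms in \<open>auto simp: interchange\<close>)

lemma assoc_nat:
  "\<lbrakk>f \<in> Arr C; g \<in> Arr C; h \<in> Arr C; Cod C f = X; Cod C g = Y; Cod C h = Z\<rbrakk>
    \<Longrightarrow> a X Y Z \<cdot> ((f \<diamondop> g) \<diamondop> h) = (f \<diamondop> (g \<diamondop> h)) \<cdot> a (Dom C f) (Dom C g) (Dom C h)"
  using assoc_natural[of f "Dom C f" X g "Dom C g" Y h "Dom C h" Z] by simp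

lemma assoc_nat_inv:
  assumes "f \<in> Arr C" "g \<in> Arr C" "h \<in> Arr C" "Cod C f = X" "Cod C g = Y" "Cod C h = Z"
  shows "a' X Y Z \<cdot> (f \<diamondop> (g \<diamondop> h)) = ((f \<diamondop> g) \<diamondop> h) \<cdot> a' (Dom C f) (Dom C g) (Dom C h)"
proof -
  have o: "X \<in> Obj C" "Y \<in> Obj C" "Z \<in> Obj C" using assms by auto
  show ?thesis
  proof (rule iso_left_cancel[of "a X Y Z"])
    have "a X Y Z \<cdot> ((f \<diamondop> g) \<diamondop> h) \<cdot> a' (Dom C f) (Dom C g) (Dom C h) =
        ((f \<diamondop> (g \<diamondop> h)) \<cdot> a (Dom C f) (Dom C g) (Dom C h)) \<cdot> a' (Dom C f) (Dom C g) (Dom C h)"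
      by (rule comp_reassoc[OF assoc_nat]) (use assms o in auto)
    then show "a X Y Z \<cdot> a' X Y Z \<cdot> (f \<diamondop> (g \<diamondop> h)) =
        a X Y Z \<cdot> ((f \<diamondop> g) \<diamondop> h) \<cdot> a' (Dom C f) (Dom C g) (Dom C h)"
      using assms o by simp
  qed (use assms o in auto)
qed

section \<open>Coherence of unitors and braiding\<close>

lemma lunit_nat: "f \<in> Arr C \<Longrightarrow> Cod C f = Y \<Longrightarrow> l Y \<cdot> (i e1 \<diamondop> f) = f \<cdot> l (Dom C f)"
  using lunit_natural[of f "Dom C f" Y] by simp

lemma runit_nat: "f \<in> Arr C \<Longrightarrow> Cod C f = Y \<Longrightarrow> r Y \<cdot> (f \<diamondop> i e1) = f \<cdot> r (Dom C f)"
  using runit_natural[of f "Dom C f" Y] by simp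

lemma braid_nat:
  "\<lbrakk>f \<in> Arr C; g \<in> Arr C; Cod C f = X; Cod C g = Y\<rbrakk> \<Longrightarrow> b X Y \<cdot> (f \<diamondop> g) = (g \<diamondop> f) \<cdot> b (Dom C f) (Dom C g)"
  using braid_natural[of f "Dom C f" X g "Dom C g" Y] by simp

text \<open>Tensoring with the unit is conjugate to the identity functor and hence faithful. The
  unit coherences below follow from pentagon, triangle and hexagon once an extra unit factor has
  been added.\<close>

lemma lunit_cancel:
  assumes "i e1 \<diamondop> f = i e1 \<diamondop> g" "f \<in> Arr C" "g \<in> Arr C" "Dom C g = Dom C f" "Cod C g = Cod C f"
  shows "f = g"
proof (rule iso_right_cancel[of "l (Dom C f)"])
  show "f \<cdot> l (Dom C f) = g \<cdot> l (Dom C f)"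
    using lunit_nat[of f "Cod C f"] lunit_nat[of g "Cod C g"] assms by simp
qed (use assms in auto)

lemma runit_cancel:
  assumes "f \<diamondop> i e1 = g \<diamondop> i e1" "f \<in> Arr C" "g \<in> Arr C" "Dom C g = Dom C f" "Cod C g = Cod C f"
  shows "f = g"
proof (rule iso_right_cancel[of "r (Dom C f)"])
  show "f \<cdot> r (Dom C f) = g \<cdot> r (Dom C f)"
    using runit_nat[of f "Cod C f"] runit_nat[of g "Cod C g"] assms by simp
qed (use assms in auto)

lemma whisker_left:
  "\<lbrakk>f \<in> Arr C; g \<in> Arr C; Dom C g = Cod C f; X \<in> Obj C\<rbrakk> \<Longrightarrow> (i X \<diamondop> (g \<cdot> f)) = (i X \<diamondop> g) \<cdot> (i X \<diamondop> f)"
  by (simp add: interchange)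

lemma whisker_right:
  "\<lbrakk>f \<in> Arr C; g \<in> Arr C; Dom C g = Cod C f; X \<in> Obj C\<rbrakk> \<Longrightarrow> ((g \<cdot> f) \<diamondop> i X) = (g \<diamondop> i X) \<cdot> (f \<diamondop> i X)"
  by (simp add: interchange)

text \<open>Kelly's argument: with a unit added on the left, the pentagon for 1, 1,
  \<open>X\<close>, \<open>Y\<close> and two instances of the triangle identity give the claim up to
  the invertible factor \<open>?k\<close>.\<close>

lemma lunit_tensor:
  assumes [simp]: "X \<in> Obj C" "Y \<in> Obj C"
  shows "l (X \<boxtimes> Y) \<cdot> a e1 X Y = l X \<diamondop> i Y"
proof (rule lunit_cancel)
  let ?k = "a e1 (e1 \<boxtimes> X) Y \<cdot> (a e1 e1 X \<diamondop> i Y)"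
  show "i e1 \<diamondop> (l (X \<boxtimes> Y) \<cdot> a e1 X Y) = i e1 \<diamondop> (l X \<diamondop> i Y)"
  proof (rule iso_right_cancel[of ?k])
    have "(i e1 \<diamondop> (l (X \<boxtimes> Y) \<cdot> a e1 X Y)) \<cdot> ?k = (i e1 \<diamondop> l (X \<boxtimes> Y)) \<cdot> (i e1 \<diamondop> a e1 X Y) \<cdot> ?k"
      by (simp add: whisker_left)
    also have "\<dots> = (i e1 \<diamondop> l (X \<boxtimes> Y)) \<cdot> a e1 e1 (X \<boxtimes> Y) \<cdot> a (e1 \<boxtimes> e1) X Y"
      by (simp add: pentagon)
    also have "\<dots> = ((i e1 \<diamondop> l (X \<boxtimes> Y)) \<cdot> a e1 e1 (X \<boxtimes> Y)) \<cdot> a (e1 \<boxtimes> e1) X Y" by simp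
    also have "\<dots> = (r e1 \<diamondop> i (X \<boxtimes> Y)) \<cdot> a (e1 \<boxtimes> e1) X Y" by (simp add: triangle del: assoc)
    also have "\<dots> = (r e1 \<diamondop> (i X \<diamondop> i Y)) \<cdot> a (e1 \<boxtimes> e1) X Y" by simp
    also have "\<dots> = a e1 X Y \<cdot> ((r e1 \<diamondop> i X) \<diamondop> i Y)" by (subst assoc_nat) auto
    also have "r e1 \<diamondop> i X = (i e1 \<diamondop> l X) \<cdot> a e1 e1 X" by (simp add: triangle)
    also have "((i e1 \<diamondop> l X) \<cdot> a e1 e1 X) \<diamondop> i Y = ((i e1 \<diamondop> l X) \<diamondop> i Y) \<cdot> (a e1 e1 X \<diamondop> i Y)"
      by (simp add: whisker_right)
    also have "a e1 X Y \<cdot> \<dots> = (a e1 X Y \<cdot> ((i e1 \<diamondop> l X) \<diamondop> i Y)) \<cdot> (a e1 e1 X \<diamondop> i Y)" by simp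
    also have "\<dots> = ((i e1 \<diamondop> (l X \<diamondop> i Y)) \<cdot> a e1 (e1 \<boxtimes> X) Y) \<cdot> (a e1 e1 X \<diamondop> i Y)" by (subst assoc_nat) auto
    also have "\<dots> = (i e1 \<diamondop> (l X \<diamondop> i Y)) \<cdot> ?k" by simp
    finally show "(i e1 \<diamondop> (l (X \<boxtimes> Y) \<cdot> a e1 X Y)) \<cdot> ?k = (i e1 \<diamondop> (l X \<diamondop> i Y)) \<cdot> ?k" .
  qed auto
qed auto

text \<open>The mirror image of Kelly's argument: the unit is added on the right and the pentagon is
  taken for \<open>X\<close>, \<open>Y\<close>, 1, 1.\<close>

lemma runit_tensor:
  assumes [simp]: "X \<in> Obj C" "Y \<in> Obj C"
  shows "(i X \<diamondop> r Y) \<cdot> a X Y e1 = r (X \<boxtimes> Y)"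
proof (rule runit_cancel)
  show "((i X \<diamondop> r Y) \<cdot> a X Y e1) \<diamondop> i e1 = r (X \<boxtimes> Y) \<diamondop> i e1"
  proof (rule iso_left_cancel[of "a X Y e1"])
    have "a X Y e1 \<cdot> (((i X \<diamondop> r Y) \<cdot> a X Y e1) \<diamondop> i e1) =
        (a X Y e1 \<cdot> ((i X \<diamondop> r Y) \<diamondop> i e1)) \<cdot> (a X Y e1 \<diamondop> i e1)" by (simp add: whisker_right)
    also have "\<dots> = ((i X \<diamondop> (r Y \<diamondop> i e1)) \<cdot> a X (Y \<boxtimes> e1) e1) \<cdot> (a X Y e1 \<diamondop> i e1)" by (subst assoc_nat) auto
    also have "r Y \<diamondop> i e1 = (i Y \<diamondop> l e1) \<cdot> a Y e1 e1" by (simp add: triangle)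
    also have "((i X \<diamondop> ((i Y \<diamondop> l e1) \<cdot> a Y e1 e1)) \<cdot> a X (Y \<boxtimes> e1) e1) \<cdot> (a X Y e1 \<diamondop> i e1) =
        (i X \<diamondop> (i Y \<diamondop> l e1)) \<cdot> (i X \<diamondop> a Y e1 e1) \<cdot> a X (Y \<boxtimes> e1) e1 \<cdot> (a X Y e1 \<diamondop> i e1)"
      by (simp add: whisker_left)
    also have "\<dots> = (i X \<diamondop> (i Y \<diamondop> l e1)) \<cdot> a X Y (e1 \<boxtimes> e1) \<cdot> a (X \<boxtimes> Y) e1 e1" by (simp add: pentagon)
    also have "\<dots> = ((i X \<diamondop> (i Y \<diamondop> l e1)) \<cdot> a X Y (e1 \<boxtimes> e1)) \<cdot> a (X \<boxtimes> Y) e1 e1" by simp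
    also have "(i X \<diamondop> (i Y \<diamondop> l e1)) \<cdot> a X Y (e1 \<boxtimes> e1) = a X Y e1 \<cdot> ((i X \<diamondop> i Y) \<diamondop> l e1)"
      by (subst assoc_nat) auto
    also have "(a X Y e1 \<cdot> ((i X \<diamondop> i Y) \<diamondop> l e1)) \<cdot> a (X \<boxtimes> Y) e1 e1 =
        a X Y e1 \<cdot> (i (X \<boxtimes> Y) \<diamondop> l e1) \<cdot> a (X \<boxtimes> Y) e1 e1" by simp
    also have "(i (X \<boxtimes> Y) \<diamondop> l e1) \<cdot> a (X \<boxtimes> Y) e1 e1 = r (X \<boxtimes> Y) \<diamondop> i e1" by (simp add: triangle)
    finally show "a X Y e1 \<cdot> (((i X \<diamondop> r Y) \<cdot> a X Y e1) \<diamondop> i e1) = a X Y e1 \<cdot> (r (X \<boxtimes> Y) \<diamondop> i e1)" .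
  qed auto
qed auto

text \<open>By naturality, \<open>l (e1 \<boxtimes> e1)\<close> equals
  \<open>i e1 \<diamondop> l e1\<close>. With this, \<open>lunit_tensor\<close> and the triangle
  identity describe the same map, and the unit factor on the right cancels.\<close>

lemma lunit_eq_runit: "l e1 = r e1"
proof (rule runit_cancel)
  have "l (e1 \<boxtimes> e1) = i e1 \<diamondop> l e1"
    by (rule iso_left_cancel[of "l e1"]) (use lunit_nat[of "l e1" e1] in auto)
  then show "l e1 \<diamondop> i e1 = r e1 \<diamondop> i e1" using lunit_tensor[of e1 e1] triangle[of e1 e1] by simp
qed auto

text \<open>The hexagon for \<open>X\<close>, 1, 1. The braiding \<open>b X e1\<close> comes out as
  a left factor on both sides and is cancelled.\<close>

lemma lunit_braid:
  assumes [simp]: "X \<in> Obj C"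
  shows "l X \<cdot> b X e1 = r X"
proof (rule runit_cancel)
  show "(l X \<cdot> b X e1) \<diamondop> i e1 = r X \<diamondop> i e1"
  proof (rule iso_left_cancel[of "b X e1"])
    have "b X e1 \<cdot> (r X \<diamondop> i e1) = (b X e1 \<cdot> (i X \<diamondop> l e1)) \<cdot> a X e1 e1" by (simp add: triangle)
    also have "b X e1 \<cdot> (i X \<diamondop> l e1) = (l e1 \<diamondop> i X) \<cdot> b X (e1 \<boxtimes> e1)" by (subst braid_nat) auto
    also have "l e1 \<diamondop> i X = l (e1 \<boxtimes> X) \<cdot> a e1 e1 X" by (simp add: lunit_tensor)
    also have "((l (e1 \<boxtimes> X) \<cdot> a e1 e1 X) \<cdot> b X (e1 \<boxtimes> e1)) \<cdot> a X e1 e1 =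
        l (e1 \<boxtimes> X) \<cdot> a e1 e1 X \<cdot> b X (e1 \<boxtimes> e1) \<cdot> a X e1 e1" by simp
    also have "\<dots> = l (e1 \<boxtimes> X) \<cdot> (i e1 \<diamondop> b X e1) \<cdot> a e1 X e1 \<cdot> (b X e1 \<diamondop> i e1)" by (simp add: hexagon)
    also have "\<dots> = (l (e1 \<boxtimes> X) \<cdot> (i e1 \<diamondop> b X e1)) \<cdot> a e1 X e1 \<cdot> (b X e1 \<diamondop> i e1)" by simp
    also have "l (e1 \<boxtimes> X) \<cdot> (i e1 \<diamondop> b X e1) = b X e1 \<cdot> l (X \<boxtimes> e1)" by (subst lunit_nat) auto
    also have "(b X e1 \<cdot> l (X \<boxtimes> e1)) \<cdot> a e1 X e1 \<cdot> (b X e1 \<diamondop> i e1) =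
        b X e1 \<cdot> (l (X \<boxtimes> e1) \<cdot> a e1 X e1) \<cdot> (b X e1 \<diamondop> i e1)" by simp
    also have "\<dots> = b X e1 \<cdot> ((l X \<cdot> b X e1) \<diamondop> i e1)" by (simp add: lunit_tensor whisker_right del: assoc)
    finally show "b X e1 \<cdot> ((l X \<cdot> b X e1) \<diamondop> i e1) = b X e1 \<cdot> (r X \<diamondop> i e1)" by simp
  qed auto
qed auto

text \<open>The pentagon with some associators inverted, in the three shapes in which the duality
  calculations meet it.\<close>

lemma pentagon_inv:
  assumes [simp]: "W \<in> Obj C" "X \<in> Obj C" "Y \<in> Obj C" "Z \<in> Obj C"
  shows "a (W \<boxtimes> X) Y Z \<cdot> (a' W X Y \<diamondop> i Z) = a' W X (Y \<boxtimes> Z) \<cdot> (i W \<diamondop> a X Y Z) \<cdot> a W (X \<boxtimes> Y) Z"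
    and "a' W X (Y \<boxtimes> Z) \<cdot> (i W \<diamondop> a X Y Z) = a (W \<boxtimes> X) Y Z \<cdot> (a' W X Y \<diamondop> i Z) \<cdot> a' W (X \<boxtimes> Y) Z"
    and "(i W \<diamondop> a' X Y Z) \<cdot> a W X (Y \<boxtimes> Z) = a W (X \<boxtimes> Y) Z \<cdot> (a W X Y \<diamondop> i Z) \<cdot> a' (W \<boxtimes> X) Y Z"
proof -
  have inv: "(a W X Y \<diamondop> i Z) \<cdot> (a' W X Y \<diamondop> i Z) = i (W \<boxtimes> (X \<boxtimes> Y) \<boxtimes> Z)"
    "(i W \<diamondop> a' X Y Z) \<cdot> (i W \<diamondop> a X Y Z) = i (W \<boxtimes> (X \<boxtimes> Y \<boxtimes> Z))"
    by (simp_all add: interchange)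
  note p = pentagon[OF assms]
  have "a' W X (Y \<boxtimes> Z) \<cdot> ((i W \<diamondop> a X Y Z) \<cdot> a W (X \<boxtimes> Y) Z \<cdot> (a W X Y \<diamondop> i Z)) = a (W \<boxtimes> X) Y Z"
    by (subst p[symmetric]) simp
  then have q: "(a' W X (Y \<boxtimes> Z) \<cdot> (i W \<diamondop> a X Y Z) \<cdot> a W (X \<boxtimes> Y) Z) \<cdot> (a W X Y \<diamondop> i Z) = a (W \<boxtimes> X) Y Z"
    by simp
  show 1: "a (W \<boxtimes> X) Y Z \<cdot> (a' W X Y \<diamondop> i Z) = a' W X (Y \<boxtimes> Z) \<cdot> (i W \<diamondop> a X Y Z) \<cdot> a W (X \<boxtimes> Y) Z"
    by (subst q[symmetric]) (simp add: inv)
  show "a' W X (Y \<boxtimes> Z) \<cdot> (i W \<diamondop> a X Y Z) = a (W \<boxtimes> X) Y Z \<cdot> (a' W X Y \<diamondop> i Z) \<cdot> a' W (X \<boxtimes> Y) Z"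
    by (subst comp_reassoc[OF 1]) simp_all
  have "(i W \<diamondop> a' X Y Z) \<cdot> a W X (Y \<boxtimes> Z) \<cdot> a (W \<boxtimes> X) Y Z = a W (X \<boxtimes> Y) Z \<cdot> (a W X Y \<diamondop> i Z)"
    unfolding p by (subst comp_reassoc[OF inv(2)]) simp_all
  then have "((i W \<diamondop> a' X Y Z) \<cdot> a W X (Y \<boxtimes> Z) \<cdot> a (W \<boxtimes> X) Y Z) \<cdot> a' (W \<boxtimes> X) Y Z =
      (a W (X \<boxtimes> Y) Z \<cdot> (a W X Y \<diamondop> i Z)) \<cdot> a' (W \<boxtimes> X) Y Z" by simp
  then show "(i W \<diamondop> a' X Y Z) \<cdot> a W X (Y \<boxtimes> Z) = a W (X \<boxtimes> Y) Z \<cdot> (a W X Y \<diamondop> i Z) \<cdot> a' (W \<boxtimes> X) Y Z" by simp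
qed

section \<open>Transposition along the internal hom\<close>

lemma transpose_unique:
  assumes "Ev C X Y \<cdot> (g \<diamondop> i X) = Ev C X Y \<cdot> (g' \<diamondop> i X)" "g \<in> homset C Z (IHom C X Y)"
    "g' \<in> homset C Z (IHom C X Y)" "X \<in> Obj C" "Y \<in> Obj C"
  shows "g = g'"
  using ev_universal[of X Y Z "Ev C X Y \<cdot> (g \<diamondop> i X)"] assms homset_obj(1)[OF assms(2)] by auto

lemma transpose:
  assumes "f \<in> homset C (Z \<boxtimes> X) Y" "X \<in> Obj C" "Z \<in> Obj C"
  shows "hom_transpose C Z X Y f \<in> homset C Z (IHom C X Y)"
    "Ev C X Y \<cdot> (hom_transpose C Z X Y f \<diamondop> i X) = f"
  using theI'[OF ev_universal[of X Y Z f]] assms homset_obj(2)[OF assms(1)]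
  unfolding hom_transpose_def by auto

text \<open>Tensoring with \<open>Y\<close> is a left adjoint: families of maps out of the
  \<open>X j \<boxtimes> Y\<close> are transposed to maps into an internal hom, assembled there, and
  transposed back.\<close>

lemma tensor_coproduct:
  assumes co: "is_coproduct C I X P \<iota>" and Y [simp]: "Y \<in> Obj C"
  shows "is_coproduct C I (\<lambda>j. X j \<boxtimes> Y) (P \<boxtimes> Y) (\<lambda>j. \<iota> j \<diamondop> i Y)"
proof (rule is_coproductI)
  note c = coproduct_simps[OF co]
  show "P \<boxtimes> Y \<in> Obj C" using c by simp
  show "\<iota> j \<diamondop> i Y \<in> homset C (X j \<boxtimes> Y) (P \<boxtimes> Y)" if "j \<in> I" for j using c(2-4)[OF that] by simp
  show "\<exists>u\<in>homset C (P \<boxtimes> Y) Z. \<forall>j\<in>I. u \<cdot> (\<iota> j \<diamondop> i Y) = f j"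
    if Z: "Z \<in> Obj C" and f: "\<And>j. j \<in> I \<Longrightarrow> f j \<in> homset C (X j \<boxtimes> Y) Z" for Z f
  proof -
    let ?t = "\<lambda>j. hom_transpose C (X j) Y Z (f j)"
    have t: "?t j \<in> homset C (X j) (IHom C Y Z)" "Ev C Y Z \<cdot> (?t j \<diamondop> i Y) = f j" if "j \<in> I" for j
      using transpose[OF f[OF that] Y c(5)[OF that]] by auto
    obtain u where u: "u \<in> homset C P (IHom C Y Z)" "\<And>j. j \<in> I \<Longrightarrow> u \<cdot> \<iota> j = ?t j"
      using coproduct_map[OF co, of "IHom C Y Z" ?t] t(1) Z by auto
    have "(Ev C Y Z \<cdot> (u \<diamondop> i Y)) \<cdot> (\<iota> j \<diamondop> i Y) = f j" if j: "j \<in> I" for j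
      using t(2)[OF j] u(1) u(2)[OF j] c(2-4)[OF j] Z by (simp add: interchange)
    moreover have "Ev C Y Z \<cdot> (u \<diamondop> i Y) \<in> homset C (P \<boxtimes> Y) Z" using u Z by simp
    ultimately show ?thesis by blast
  qed
  show "u = v" if u: "u \<in> homset C (P \<boxtimes> Y) Z" and v: "v \<in> homset C (P \<boxtimes> Y) Z"
    and uv: "\<And>j. j \<in> I \<Longrightarrow> u \<cdot> (\<iota> j \<diamondop> i Y) = v \<cdot> (\<iota> j \<diamondop> i Y)" for Z u v
  proof -
    have Z: "Z \<in> Obj C" using homset_obj(2)[OF u] .
    let ?u = "hom_transpose C P Y Z u" and ?v = "hom_transpose C P Y Z v"
    have tu: "?u \<in> homset C P (IHom C Y Z)" "Ev C Y Z \<cdot> (?u \<diamondop> i Y) = u"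
      using transpose[OF u Y c(1)] by auto
    have tv: "?v \<in> homset C P (IHom C Y Z)" "Ev C Y Z \<cdot> (?v \<diamondop> i Y) = v"
      using transpose[OF v Y c(1)] by auto
    have "?u = ?v"
    proof (rule coproduct_unique[OF co tu(1) tv(1)])
      fix j assume j: "j \<in> I"
      show "?u \<cdot> \<iota> j = ?v \<cdot> \<iota> j"
      proof (rule transpose_unique[of Y Z _ _ "X j"])
        have "(Ev C Y Z \<cdot> (?u \<diamondop> i Y)) \<cdot> (\<iota> j \<diamondop> i Y) = (Ev C Y Z \<cdot> (?v \<diamondop> i Y)) \<cdot> (\<iota> j \<diamondop> i Y)"
          unfolding tu(2) tv(2) by (rule uv[OF j])
        then show "Ev C Y Z \<cdot> ((?u \<cdot> \<iota> j) \<diamondop> i Y) = Ev C Y Z \<cdot> ((?v \<cdot> \<iota> j) \<diamondop> i Y)"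
          using tu(1) tv(1) c(2-4)[OF j] Z by (simp add: interchange)
      qed (use tu(1) tv(1) c(2-4)[OF j] Z in auto)
    qed
    then show ?thesis using tu(2) tv(2) by metis
  qed
qed

text \<open>Duality data with one of the two triangle identities. For the internal dual with its
  evaluation the other one follows from the universal property of evaluation
  (\<open>dual_pair_zigzag\<close>), and any pair can be exchanged for one of that kind
  (\<open>dual_pair_dual\<close>).\<close>

definition dual_pair where
  "dual_pair V W e c \<longleftrightarrow> V \<in> Obj C \<and> W \<in> Obj C \<and> e \<in> homset C (V \<boxtimes> W) e1 \<and> c \<in> homset C e1 (W \<boxtimes> V) \<and>
     r W \<cdot> (i W \<diamondop> e) \<cdot> a W V W \<cdot> (c \<diamondop> i W) = l W"

abbreviation dual where "dual X \<equiv> IHom C X (Unit C)"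
abbreviation ev where "ev X \<equiv> Ev C X (Unit C)"

declare dual_obj_def [simp]

lemma dual_arr:
  assumes [simp]: "f \<in> Arr C"
  shows "dual_arr C f \<in> Arr C" "Dom C (dual_arr C f) = dual (Cod C f)" "Cod C (dual_arr C f) = dual (Dom C f)"
    "ev (Dom C f) \<cdot> (dual_arr C f \<diamondop> i (Dom C f)) = ev (Cod C f) \<cdot> (i (dual (Cod C f)) \<diamondop> f)"
  using transpose[of "ev (Cod C f) \<cdot> (i (dual (Cod C f)) \<diamondop> f)" "dual (Cod C f)" "Dom C f" e1]
  by (auto simp: dual_arr_def dual_obj_def)

text \<open>Comparing \<open>e\<close> with the evaluation gives a map from \<open>V\<close> to the
  internal dual, and the coevaluation is pushed along it.\<close>

lemma dual_pair_dual:
  assumes dp: "dual_pair V W e c"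
  shows "\<exists>c. dual_pair (dual W) W (ev W) c"
proof -
  have [simp]: "V \<in> Obj C" "W \<in> Obj C" "e \<in> Arr C" "Dom C e = V \<boxtimes> W" "Cod C e = e1"
    "c \<in> Arr C" "Dom C c = e1" "Cod C c = W \<boxtimes> V"
    and z: "r W \<cdot> (i W \<diamondop> e) \<cdot> a W V W \<cdot> (c \<diamondop> i W) = l W" using dp by (auto simp: dual_pair_def)
  let ?t = "hom_transpose C V W e1 e"
  have t: "?t \<in> homset C V (dual W)" "ev W \<cdot> (?t \<diamondop> i W) = e"
    using transpose[of e V W e1] by (auto simp: dual_obj_def)
  have [simp]: "?t \<in> Arr C" "Dom C ?t = V" "Cod C ?t = dual W" using t(1) by auto
  have "a W (dual W) W \<cdot> (((i W \<diamondop> ?t) \<cdot> c) \<diamondop> i W) = (a W (dual W) W \<cdot> ((i W \<diamondop> ?t) \<diamondop> i W)) \<cdot> (c \<diamondop> i W)"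
    by (simp add: whisker_right)
  also have "\<dots> = ((i W \<diamondop> (?t \<diamondop> i W)) \<cdot> a W V W) \<cdot> (c \<diamondop> i W)" by (subst assoc_nat) auto
  finally have "r W \<cdot> (i W \<diamondop> ev W) \<cdot> a W (dual W) W \<cdot> (((i W \<diamondop> ?t) \<cdot> c) \<diamondop> i W) =
      r W \<cdot> ((i W \<diamondop> ev W) \<cdot> (i W \<diamondop> (?t \<diamondop> i W))) \<cdot> a W V W \<cdot> (c \<diamondop> i W)" by simp
  also have "(i W \<diamondop> ev W) \<cdot> (i W \<diamondop> (?t \<diamondop> i W)) = i W \<diamondop> e" by (simp add: interchange t(2))
  finally have "dual_pair (dual W) W (ev W) ((i W \<diamondop> ?t) \<cdot> c)" using z by (simp add: dual_pair_def)
  then show ?thesis by blast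
qed


text \<open>Together with \<open>unmate\<close>: the two directions of the adjunction between
  \<open>V \<boxtimes> -\<close> and \<open>W \<boxtimes> -\<close> that a duality provides, with
  \<open>c\<close> the coevaluation and \<open>e\<close> the evaluation.\<close>

definition mate where "mate c V W Z m = (i W \<diamondop> m) \<cdot> a W V Z \<cdot> (c \<diamondop> i Z) \<cdot> inv_arr C (l Z)"
definition unmate where "unmate e V W Y n = l Y \<cdot> (e \<diamondop> i Y) \<cdot> a' V W Y \<cdot> (i V \<diamondop> n)"

text \<open>Maps into an internal dual are compared after evaluation, so evaluations of unmates have
  to be computed. The two pairings act on different tensor factors, hence the contraction with
  \<open>e\<close> may be carried out first.\<close>

lemma ev_unmate:
  assumes d: "d \<in> homset C (V \<boxtimes> A) e1" and t: "t \<in> homset C Z (A \<boxtimes> B)" and e: "e \<in> homset C (B \<boxtimes> W) e1"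
    and [simp]: "V \<in> Obj C" "A \<in> Obj C" "B \<in> Obj C" "W \<in> Obj C"
  shows "e \<cdot> (unmate d V A B t \<diamondop> i W) = unmate d V A e1 ((i A \<diamondop> e) \<cdot> a A B W \<cdot> (t \<diamondop> i W)) \<cdot> a V Z W"
proof -
  have [simp]: "d \<in> Arr C" "Dom C d = V \<boxtimes> A" "Cod C d = e1" "t \<in> Arr C" "Dom C t = Z" "Cod C t = A \<boxtimes> B"
    "e \<in> Arr C" "Dom C e = B \<boxtimes> W" "Cod C e = e1" "Z \<in> Obj C" using d t e homset_obj[OF t] by auto
  have 1: "e \<cdot> (l B \<diamondop> i W) = l e1 \<cdot> (i e1 \<diamondop> e) \<cdot> a e1 B W"
    using comp_reassoc[OF lunit_nat[of e e1], of "a e1 B W"] lunit_tensor[of B W] by simp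
  have 2: "a e1 B W \<cdot> ((d \<diamondop> i B) \<diamondop> i W) = (d \<diamondop> i (B \<boxtimes> W)) \<cdot> a (V \<boxtimes> A) B W" by (subst assoc_nat) auto
  have 3: "(i e1 \<diamondop> e) \<cdot> (d \<diamondop> i (B \<boxtimes> W)) = (d \<diamondop> i e1) \<cdot> (i (V \<boxtimes> A) \<diamondop> e)" by (simp add: interchange)
  have 4: "(i (V \<boxtimes> A) \<diamondop> e) \<cdot> a' V A (B \<boxtimes> W) = a' V A e1 \<cdot> (i V \<diamondop> (i A \<diamondop> e))" by (subst assoc_nat_inv) auto
  have 5: "a V (A \<boxtimes> B) W \<cdot> ((i V \<diamondop> t) \<diamondop> i W) = (i V \<diamondop> (t \<diamondop> i W)) \<cdot> a V Z W" by (subst assoc_nat) auto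
  have "e \<cdot> (unmate d V A B t \<diamondop> i W) = (e \<cdot> (l B \<diamondop> i W)) \<cdot> ((d \<diamondop> i B) \<diamondop> i W) \<cdot> (a' V A B \<diamondop> i W) \<cdot> ((i V \<diamondop> t) \<diamondop> i W)"
    unfolding unmate_def by (simp add: whisker_right)
  also have "\<dots> = l e1 \<cdot> (i e1 \<diamondop> e) \<cdot> (a e1 B W \<cdot> ((d \<diamondop> i B) \<diamondop> i W)) \<cdot> (a' V A B \<diamondop> i W) \<cdot> ((i V \<diamondop> t) \<diamondop> i W)"
    unfolding 1 by simp
  also have "\<dots> = l e1 \<cdot> ((i e1 \<diamondop> e) \<cdot> (d \<diamondop> i (B \<boxtimes> W))) \<cdot> (a (V \<boxtimes> A) B W \<cdot> (a' V A B \<diamondop> i W)) \<cdot> ((i V \<diamondop> t) \<diamondop> i W)"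
    unfolding 2 by simp
  also have "\<dots> = l e1 \<cdot> (d \<diamondop> i e1) \<cdot> ((i (V \<boxtimes> A) \<diamondop> e) \<cdot> a' V A (B \<boxtimes> W)) \<cdot> (i V \<diamondop> a A B W) \<cdot> (a V (A \<boxtimes> B) W \<cdot> ((i V \<diamondop> t) \<diamondop> i W))"
    unfolding 3 by (simp add: pentagon_inv(1))
  also have "\<dots> = (l e1 \<cdot> (d \<diamondop> i e1) \<cdot> a' V A e1 \<cdot> (i V \<diamondop> ((i A \<diamondop> e) \<cdot> a A B W \<cdot> (t \<diamondop> i W)))) \<cdot> a V Z W"
    unfolding 4 5 by (simp add: whisker_left)
  finally show ?thesis unfolding unmate_def .
qed

text \<open>Both sides map into an internal dual and may be compared after evaluation. There
  \<open>ev_unmate\<close> brings in the known triangle identity, and only unit constraints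
  remain.\<close>

lemma dual_pair_zigzag:
  assumes dp: "dual_pair (dual W) W (ev W) c"
  shows "l (dual W) \<cdot> (ev W \<diamondop> i (dual W)) \<cdot> a' (dual W) W (dual W) \<cdot> (i (dual W) \<diamondop> c) = r (dual W)"
    (is "?L = _")
proof -
  let ?V = "dual W" and ?e = "ev W"
  have [simp]: "W \<in> Obj C" "c \<in> Arr C" "Dom C c = e1" "Cod C c = W \<boxtimes> ?V"
    and z: "r W \<cdot> (i W \<diamondop> ?e) \<cdot> a W ?V W \<cdot> (c \<diamondop> i W) = l W" using dp by (auto simp: dual_pair_def)
  have 1: "(i W \<diamondop> ?e) \<cdot> a W ?V W \<cdot> (c \<diamondop> i W) = inv_arr C (r W) \<cdot> l W" unfolding z[symmetric] by simp
  have 2: "(r (?V \<boxtimes> W) \<cdot> a' ?V W e1) = i ?V \<diamondop> r W" by (subst runit_tensor[symmetric]) auto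
  have "?e \<cdot> (?L \<diamondop> i W) = unmate ?e ?V W e1 (inv_arr C (r W) \<cdot> l W) \<cdot> a ?V e1 W"
    using ev_unmate[of ?e ?V W c e1 ?V ?e W] unfolding 1 unmate_def by simp
  also have "\<dots> = (r e1 \<cdot> (?e \<diamondop> i e1)) \<cdot> a' ?V W e1 \<cdot> (i ?V \<diamondop> (inv_arr C (r W) \<cdot> l W)) \<cdot> a ?V e1 W"
    unfolding unmate_def lunit_eq_runit by simp
  also have "r e1 \<cdot> (?e \<diamondop> i e1) = ?e \<cdot> r (?V \<boxtimes> W)" by (subst runit_nat) auto
  also have "(?e \<cdot> r (?V \<boxtimes> W)) \<cdot> a' ?V W e1 \<cdot> (i ?V \<diamondop> (inv_arr C (r W) \<cdot> l W)) \<cdot> a ?V e1 W =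
      ?e \<cdot> (r (?V \<boxtimes> W) \<cdot> a' ?V W e1) \<cdot> (i ?V \<diamondop> (inv_arr C (r W) \<cdot> l W)) \<cdot> a ?V e1 W" by simp
  also have "\<dots> = ?e \<cdot> ((i ?V \<diamondop> r W) \<cdot> (i ?V \<diamondop> (inv_arr C (r W) \<cdot> l W))) \<cdot> a ?V e1 W" unfolding 2 by simp
  also have "(i ?V \<diamondop> r W) \<cdot> (i ?V \<diamondop> (inv_arr C (r W) \<cdot> l W)) = i ?V \<diamondop> l W" by (simp add: interchange)
  also have "?e \<cdot> (i ?V \<diamondop> l W) \<cdot> a ?V e1 W = ?e \<cdot> (r ?V \<diamondop> i W)" by (simp add: triangle)
  finally show ?thesis
    by (rule transpose_unique[of W e1 _ _ "?V \<boxtimes> e1"]) auto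
qed

text \<open>This composite meets the second triangle identity, \<open>dual_pair_zigzag\<close>, and
  is therefore stated for the internal dual.\<close>

lemma unmate_mate:
  assumes dp: "dual_pair (dual W) W (ev W) c" and m: "m \<in> homset C (dual W \<boxtimes> Z) Y" and Z [simp]: "Z \<in> Obj C"
  shows "unmate (ev W) (dual W) W Y (mate c (dual W) W Z m) = m"
proof -
  let ?V = "dual W" and ?e = "ev W"
  have [simp]: "W \<in> Obj C" "c \<in> Arr C" "Dom C c = e1" "Cod C c = W \<boxtimes> ?V" using dp by (auto simp: dual_pair_def)
  have [simp]: "m \<in> Arr C" "Dom C m = ?V \<boxtimes> Z" "Cod C m = Y" "Y \<in> Obj C" using m homset_obj(2)[OF m] by auto
  have 1: "a' ?V W Y \<cdot> (i ?V \<diamondop> (i W \<diamondop> m)) = (i (?V \<boxtimes> W) \<diamondop> m) \<cdot> a' ?V W (?V \<boxtimes> Z)" by (subst assoc_nat_inv) auto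
  have 2: "(?e \<diamondop> i Y) \<cdot> (i (?V \<boxtimes> W) \<diamondop> m) = (i e1 \<diamondop> m) \<cdot> (?e \<diamondop> i (?V \<boxtimes> Z))" by (simp add: interchange)
  have 3: "l Y \<cdot> (i e1 \<diamondop> m) = m \<cdot> l (?V \<boxtimes> Z)" by (subst lunit_nat) auto
  have 5: "a' ?V (W \<boxtimes> ?V) Z \<cdot> (i ?V \<diamondop> (c \<diamondop> i Z)) = ((i ?V \<diamondop> c) \<diamondop> i Z) \<cdot> a' ?V e1 Z" by (subst assoc_nat_inv) auto
  have 6: "(?e \<diamondop> i (?V \<boxtimes> Z)) \<cdot> a (?V \<boxtimes> W) ?V Z = a e1 ?V Z \<cdot> ((?e \<diamondop> i ?V) \<diamondop> i Z)" by (subst assoc_nat) auto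
  have 7: "(r ?V \<diamondop> i Z) \<cdot> a' ?V e1 Z = i ?V \<diamondop> l Z" by (subst triangle[symmetric]) auto
  have "l Y \<cdot> (?e \<diamondop> i Y) \<cdot> a' ?V W Y \<cdot> (i ?V \<diamondop> ((i W \<diamondop> m) \<cdot> a W ?V Z \<cdot> (c \<diamondop> i Z))) =
      l Y \<cdot> (?e \<diamondop> i Y) \<cdot> (a' ?V W Y \<cdot> (i ?V \<diamondop> (i W \<diamondop> m))) \<cdot> (i ?V \<diamondop> a W ?V Z) \<cdot> (i ?V \<diamondop> (c \<diamondop> i Z))"
    by (simp add: whisker_left)
  also have "\<dots> = l Y \<cdot> ((?e \<diamondop> i Y) \<cdot> (i (?V \<boxtimes> W) \<diamondop> m)) \<cdot> (a' ?V W (?V \<boxtimes> Z) \<cdot> (i ?V \<diamondop> a W ?V Z)) \<cdot> (i ?V \<diamondop> (c \<diamondop> i Z))"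
    unfolding 1 by simp
  also have "\<dots> = (l Y \<cdot> (i e1 \<diamondop> m)) \<cdot> ((?e \<diamondop> i (?V \<boxtimes> Z)) \<cdot> a (?V \<boxtimes> W) ?V Z) \<cdot> (a' ?V W ?V \<diamondop> i Z) \<cdot>
      (a' ?V (W \<boxtimes> ?V) Z \<cdot> (i ?V \<diamondop> (c \<diamondop> i Z)))"
    unfolding 2 by (simp add: pentagon_inv(2))
  also have "\<dots> = m \<cdot> (l (?V \<boxtimes> Z) \<cdot> a e1 ?V Z) \<cdot> ((?e \<diamondop> i ?V) \<diamondop> i Z) \<cdot> (a' ?V W ?V \<diamondop> i Z) \<cdot> ((i ?V \<diamondop> c) \<diamondop> i Z) \<cdot> a' ?V e1 Z"
    unfolding 3 5 6 by simp
  also have "\<dots> = m \<cdot> ((l ?V \<cdot> (?e \<diamondop> i ?V) \<cdot> a' ?V W ?V \<cdot> (i ?V \<diamondop> c)) \<diamondop> i Z) \<cdot> a' ?V e1 Z"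
    by (simp add: lunit_tensor whisker_right)
  also have "\<dots> = m \<cdot> (i ?V \<diamondop> l Z)" unfolding dual_pair_zigzag[OF dp] 7 ..
  finally have "(l Y \<cdot> (?e \<diamondop> i Y) \<cdot> a' ?V W Y \<cdot> (i ?V \<diamondop> ((i W \<diamondop> m) \<cdot> a W ?V Z \<cdot> (c \<diamondop> i Z)))) \<cdot> (i ?V \<diamondop> inv_arr C (l Z)) =
     (m \<cdot> (i ?V \<diamondop> l Z)) \<cdot> (i ?V \<diamondop> inv_arr C (l Z))" by simp
  moreover have "(i ?V \<diamondop> l Z) \<cdot> (i ?V \<diamondop> inv_arr C (l Z)) = i (?V \<boxtimes> Z)" by (simp add: interchange)
  ultimately show ?thesis unfolding mate_def unmate_def by (simp add: whisker_left)
qed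

text \<open>In this order the triangle identity contained in \<open>dual_pair\<close> appears
  directly, so the statement covers arbitrary duality data.\<close>

lemma mate_unmate:
  assumes dp: "dual_pair V W e c" and n: "n \<in> homset C Z (W \<boxtimes> Y)" and Y [simp]: "Y \<in> Obj C"
  shows "mate c V W Z (unmate e V W Y n) = n"
proof -
  have [simp]: "V \<in> Obj C" "W \<in> Obj C" "e \<in> Arr C" "Dom C e = V \<boxtimes> W" "Cod C e = e1"
    "c \<in> Arr C" "Dom C c = e1" "Cod C c = W \<boxtimes> V"
    and z: "r W \<cdot> (i W \<diamondop> e) \<cdot> a W V W \<cdot> (c \<diamondop> i W) = l W" using dp by (auto simp: dual_pair_def)
  have [simp]: "n \<in> Arr C" "Dom C n = Z" "Cod C n = W \<boxtimes> Y" "Z \<in> Obj C" using n homset_obj(1)[OF n] by auto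
  have 1: "(i W \<diamondop> (i V \<diamondop> n)) \<cdot> a W V Z = a W V (W \<boxtimes> Y) \<cdot> (i (W \<boxtimes> V) \<diamondop> n)"
    using assoc_nat[of "i W" "i V" n W V "W \<boxtimes> Y"] by simp
  have 2: "(i (W \<boxtimes> V) \<diamondop> n) \<cdot> (c \<diamondop> i Z) = (c \<diamondop> i (W \<boxtimes> Y)) \<cdot> (i e1 \<diamondop> n)" by (simp add: interchange)
  have 4: "a' (W \<boxtimes> V) W Y \<cdot> (c \<diamondop> i (W \<boxtimes> Y)) = ((c \<diamondop> i W) \<diamondop> i Y) \<cdot> a' e1 W Y"
    using assoc_nat_inv[of c "i W" "i Y" "W \<boxtimes> V" W Y] by simp
  have 5: "(i W \<diamondop> (e \<diamondop> i Y)) \<cdot> a W (V \<boxtimes> W) Y = a W e1 Y \<cdot> ((i W \<diamondop> e) \<diamondop> i Y)" by (subst assoc_nat) auto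
  have 6: "l W \<diamondop> i Y = l (W \<boxtimes> Y) \<cdot> a e1 W Y" by (simp add: lunit_tensor)
  have "(i W \<diamondop> unmate e V W Y n) \<cdot> a W V Z \<cdot> (c \<diamondop> i Z) =
     (i W \<diamondop> l Y) \<cdot> (i W \<diamondop> (e \<diamondop> i Y)) \<cdot> (i W \<diamondop> a' V W Y) \<cdot> ((i W \<diamondop> (i V \<diamondop> n)) \<cdot> a W V Z) \<cdot> (c \<diamondop> i Z)"
    unfolding unmate_def by (simp add: whisker_left)
  also have "\<dots> = (i W \<diamondop> l Y) \<cdot> (i W \<diamondop> (e \<diamondop> i Y)) \<cdot> ((i W \<diamondop> a' V W Y) \<cdot> a W V (W \<boxtimes> Y)) \<cdot> ((i (W \<boxtimes> V) \<diamondop> n) \<cdot> (c \<diamondop> i Z))"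
    unfolding 1 by simp
  also have "\<dots> = (i W \<diamondop> l Y) \<cdot> ((i W \<diamondop> (e \<diamondop> i Y)) \<cdot> a W (V \<boxtimes> W) Y) \<cdot> (a W V W \<diamondop> i Y) \<cdot> (a' (W \<boxtimes> V) W Y \<cdot> (c \<diamondop> i (W \<boxtimes> Y))) \<cdot> (i e1 \<diamondop> n)"
    unfolding 2 by (simp add: pentagon_inv(3))
  also have "\<dots> = ((i W \<diamondop> l Y) \<cdot> a W e1 Y) \<cdot> ((i W \<diamondop> e) \<diamondop> i Y) \<cdot> (a W V W \<diamondop> i Y) \<cdot> ((c \<diamondop> i W) \<diamondop> i Y) \<cdot> a' e1 W Y \<cdot> (i e1 \<diamondop> n)"
    unfolding 4 5 by simp
  also have "\<dots> = ((r W \<cdot> (i W \<diamondop> e) \<cdot> a W V W \<cdot> (c \<diamondop> i W)) \<diamondop> i Y) \<cdot> a' e1 W Y \<cdot> (i e1 \<diamondop> n)"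
    by (simp add: triangle whisker_right del: assoc) (simp add: triangle whisker_right)
  also have "\<dots> = l (W \<boxtimes> Y) \<cdot> (i e1 \<diamondop> n)" unfolding z 6 by simp
  also have "\<dots> = n \<cdot> l Z" by (subst lunit_nat) auto
  finally have "((i W \<diamondop> unmate e V W Y n) \<cdot> a W V Z \<cdot> (c \<diamondop> i Z)) \<cdot> inv_arr C (l Z) = (n \<cdot> l Z) \<cdot> inv_arr C (l Z)"
    by simp
  moreover have "unmate e V W Y n \<in> homset C (V \<boxtimes> Z) Y" unfolding unmate_def by simp
  ultimately show ?thesis unfolding mate_def by simp
qed

lemma mate_homset:
  assumes "dual_pair V W e c" "m \<in> homset C (V \<boxtimes> Z) Y" "Z \<in> Obj C"
  shows "mate c V W Z m \<in> homset C Z (W \<boxtimes> Y)"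
  using assms unfolding mate_def dual_pair_def by simp

lemma unmate_homset:
  assumes "dual_pair V W e c" "n \<in> homset C Z (W \<boxtimes> Y)" "Y \<in> Obj C"
  shows "unmate e V W Y n \<in> homset C (V \<boxtimes> Z) Y"
  using assms unfolding unmate_def dual_pair_def by simp

text \<open>Naturality in the dualized variable: the defining property of \<open>dual_arr\<close>
  exchanges \<open>w\<close> on one side of the evaluation for its dual on the other.\<close>

lemma unmate_dual:
  assumes w: "w \<in> homset C W W'" and n: "n \<in> homset C Z (W \<boxtimes> Y)" and Y [simp]: "Y \<in> Obj C"
  shows "unmate (ev W') (dual W') W' Y ((w \<diamondop> i Y) \<cdot> n) = unmate (ev W) (dual W) W Y n \<cdot> (dual_arr C w \<diamondop> i Z)"
proof -
  have [simp]: "W \<in> Obj C" "W' \<in> Obj C" "w \<in> Arr C" "Dom C w = W" "Cod C w = W'" "n \<in> Arr C" "Dom C n = Z"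
    "Cod C n = W \<boxtimes> Y" "Z \<in> Obj C" using w n homset_obj[OF w] homset_obj[OF n] by auto
  note d = dual_arr[of w, simplified]
  note [simp] = d(1-3)
  have 1: "a' (dual W') W' Y \<cdot> (i (dual W') \<diamondop> (w \<diamondop> i Y)) = ((i (dual W') \<diamondop> w) \<diamondop> i Y) \<cdot> a' (dual W') W Y"
    by (subst assoc_nat_inv) auto
  have 2: "((dual_arr C w \<diamondop> i W) \<diamondop> i Y) \<cdot> a' (dual W') W Y = a' (dual W) W Y \<cdot> (dual_arr C w \<diamondop> i (W \<boxtimes> Y))"
    using assoc_nat_inv[of "dual_arr C w" "i W" "i Y" "dual W" W Y] by simp
  have "unmate (ev W') (dual W') W' Y ((w \<diamondop> i Y) \<cdot> n) =
     l Y \<cdot> (ev W' \<diamondop> i Y) \<cdot> (a' (dual W') W' Y \<cdot> (i (dual W') \<diamondop> (w \<diamondop> i Y))) \<cdot> (i (dual W') \<diamondop> n)"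
    unfolding unmate_def by (simp add: whisker_left)
  also have "\<dots> = l Y \<cdot> ((ev W' \<diamondop> i Y) \<cdot> ((i (dual W') \<diamondop> w) \<diamondop> i Y)) \<cdot> a' (dual W') W Y \<cdot> (i (dual W') \<diamondop> n)"
    unfolding 1 by simp
  also have "(ev W' \<diamondop> i Y) \<cdot> ((i (dual W') \<diamondop> w) \<diamondop> i Y) = (ev W \<diamondop> i Y) \<cdot> ((dual_arr C w \<diamondop> i W) \<diamondop> i Y)"
    using d(4) by (simp add: interchange)
  also have "l Y \<cdot> ((ev W \<diamondop> i Y) \<cdot> ((dual_arr C w \<diamondop> i W) \<diamondop> i Y)) \<cdot> a' (dual W') W Y \<cdot> (i (dual W') \<diamondop> n) =
     l Y \<cdot> (ev W \<diamondop> i Y) \<cdot> (((dual_arr C w \<diamondop> i W) \<diamondop> i Y) \<cdot> a' (dual W') W Y) \<cdot> (i (dual W') \<diamondop> n)" by simp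
  also have "\<dots> = l Y \<cdot> (ev W \<diamondop> i Y) \<cdot> a' (dual W) W Y \<cdot> ((dual_arr C w \<diamondop> i (W \<boxtimes> Y)) \<cdot> (i (dual W') \<diamondop> n))"
    unfolding 2 by simp
  also have "(dual_arr C w \<diamondop> i (W \<boxtimes> Y)) \<cdot> (i (dual W') \<diamondop> n) = (i (dual W) \<diamondop> n) \<cdot> (dual_arr C w \<diamondop> i Z)"
    by (simp add: interchange)
  finally show ?thesis unfolding unmate_def by simp
qed

lemma unmate_comp:
  assumes "dual_pair V W e c" "n \<in> homset C Z (W \<boxtimes> Y)" "y \<in> homset C Y Y'"
  shows "unmate e V W Y' ((i W \<diamondop> y) \<cdot> n) = y \<cdot> unmate e V W Y n"
proof -
  have [simp]: "V \<in> Obj C" "W \<in> Obj C" "e \<in> Arr C" "Dom C e = V \<boxtimes> W" "Cod C e = e1" "Y \<in> Obj C" "Y' \<in> Obj C"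
    "n \<in> Arr C" "Cod C n = W \<boxtimes> Y" "y \<in> Arr C" "Dom C y = Y" "Cod C y = Y'"
    using assms homset_obj[OF assms(3)] by (auto simp: dual_pair_def)
  have 1: "a' V W Y' \<cdot> (i V \<diamondop> (i W \<diamondop> y)) = (i (V \<boxtimes> W) \<diamondop> y) \<cdot> a' V W Y" by (subst assoc_nat_inv) auto
  have 2: "(e \<diamondop> i Y') \<cdot> (i (V \<boxtimes> W) \<diamondop> y) = (i e1 \<diamondop> y) \<cdot> (e \<diamondop> i Y)" by (simp add: interchange)
  have 3: "l Y' \<cdot> (i e1 \<diamondop> y) = y \<cdot> l Y" by (subst lunit_nat) auto
  have "unmate e V W Y' ((i W \<diamondop> y) \<cdot> n) = l Y' \<cdot> (e \<diamondop> i Y') \<cdot> (a' V W Y' \<cdot> (i V \<diamondop> (i W \<diamondop> y))) \<cdot> (i V \<diamondop> n)"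
    unfolding unmate_def by (simp add: whisker_left)
  also have "\<dots> = l Y' \<cdot> ((e \<diamondop> i Y') \<cdot> (i (V \<boxtimes> W) \<diamondop> y)) \<cdot> a' V W Y \<cdot> (i V \<diamondop> n)" unfolding 1 by simp
  also have "\<dots> = (l Y' \<cdot> (i e1 \<diamondop> y)) \<cdot> (e \<diamondop> i Y) \<cdot> a' V W Y \<cdot> (i V \<diamondop> n)" unfolding 2 by simp
  also have "\<dots> = y \<cdot> unmate e V W Y n" unfolding 3 unmate_def by simp
  finally show ?thesis .
qed

text \<open>At \<open>Y = W\<close> the rigidity map is an isomorphism onto the internal
  endomorphisms of \<open>W\<close>, where the identity of \<open>W\<close> has a name
  \<open>?u\<close>. Its preimage \<open>c0\<close>, with the factors exchanged by the braiding, is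
  the coevaluation.\<close>

lemma rigid_dual_pair:
  assumes "rigid C W"
  shows "\<exists>c. dual_pair (dual W) W (ev W) c"
proof -
  have W [simp]: "W \<in> Obj C" and iso: "iso_arr C (rigid_map C W W)" using assms by (auto simp: rigid_def)
  let ?V = "dual W" and ?e = "ev W"
  define k where "k = l W \<cdot> (?e \<diamondop> i W) \<cdot> a' ?V W W \<cdot> (i ?V \<diamondop> b W W) \<cdot> a ?V W W"
  have k: "k \<in> homset C (?V \<boxtimes> W \<boxtimes> W) W" unfolding k_def by simp
  have rm: "rigid_map C W W = hom_transpose C (?V \<boxtimes> W) W W k" unfolding rigid_map_def k_def by (simp add: Let_def)
  have t: "rigid_map C W W \<in> homset C (?V \<boxtimes> W) (IHom C W W)" "Ev C W W \<cdot> (rigid_map C W W \<diamondop> i W) = k"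
    unfolding rm using transpose[OF k] by auto
  let ?u = "hom_transpose C e1 W W (l W)"
  have u: "?u \<in> homset C e1 (IHom C W W)" "Ev C W W \<cdot> (?u \<diamondop> i W) = l W"
    using transpose[of "l W" e1 W W] by auto
  define c0 where "c0 = inv_arr C (rigid_map C W W) \<cdot> ?u"
  have c0 [simp]: "c0 \<in> Arr C" "Dom C c0 = e1" "Cod C c0 = ?V \<boxtimes> W" and rc: "rigid_map C W W \<cdot> c0 = ?u"
    unfolding c0_def using t(1) u(1) iso by auto
  have "k \<cdot> (c0 \<diamondop> i W) = Ev C W W \<cdot> ((rigid_map C W W \<cdot> c0) \<diamondop> i W)"
    unfolding t(2)[symmetric] using t(1) by (simp add: whisker_right)
  then have kc: "k \<cdot> (c0 \<diamondop> i W) = l W" unfolding rc u(2) .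
  \<comment> \<open>The rigidity map is built with a braiding of \<open>W\<close> past
    \<open>W\<close>. The hexagon trades it for a braiding past the whole of
    \<open>?V \<boxtimes> W\<close>, which evaluation turns into the one with the unit, absorbed by
    \<open>lunit_braid\<close>.\<close>
  have kb: "k \<cdot> (b W ?V \<diamondop> i W) = r W \<cdot> (i W \<diamondop> ?e) \<cdot> a W ?V W"
  proof -
    have "k \<cdot> (b W ?V \<diamondop> i W) = l W \<cdot> (?e \<diamondop> i W) \<cdot> a' ?V W W \<cdot> ((i ?V \<diamondop> b W W) \<cdot> a ?V W W \<cdot> (b W ?V \<diamondop> i W))"
      unfolding k_def by simp
    also have "\<dots> = l W \<cdot> (?e \<diamondop> i W) \<cdot> a' ?V W W \<cdot> (a ?V W W \<cdot> b W (?V \<boxtimes> W) \<cdot> a W ?V W)"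
      by (simp add: hexagon)
    also have "\<dots> = l W \<cdot> ((?e \<diamondop> i W) \<cdot> b W (?V \<boxtimes> W)) \<cdot> a W ?V W" by simp
    also have "(?e \<diamondop> i W) \<cdot> b W (?V \<boxtimes> W) = b W e1 \<cdot> (i W \<diamondop> ?e)" by (subst braid_nat) auto
    also have "l W \<cdot> (b W e1 \<cdot> (i W \<diamondop> ?e)) \<cdot> a W ?V W = (l W \<cdot> b W e1) \<cdot> (i W \<diamondop> ?e) \<cdot> a W ?V W" by simp
    finally show ?thesis unfolding lunit_braid[OF W] .
  qed
  have "r W \<cdot> (i W \<diamondop> ?e) \<cdot> a W ?V W \<cdot> ((b ?V W \<cdot> c0) \<diamondop> i W) = (r W \<cdot> (i W \<diamondop> ?e) \<cdot> a W ?V W) \<cdot> (b ?V W \<diamondop> i W) \<cdot> (c0 \<diamondop> i W)"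
    by (simp add: whisker_right)
  also have "\<dots> = k \<cdot> ((b W ?V \<diamondop> i W) \<cdot> (b ?V W \<diamondop> i W)) \<cdot> (c0 \<diamondop> i W)" unfolding kb[symmetric] using k by simp
  also have "(b W ?V \<diamondop> i W) \<cdot> (b ?V W \<diamondop> i W) = i (?V \<boxtimes> W \<boxtimes> W)" by (simp add: interchange braid_symmetric)
  finally have "r W \<cdot> (i W \<diamondop> ?e) \<cdot> a W ?V W \<cdot> ((b ?V W \<cdot> c0) \<diamondop> i W) = l W" using kc by simp
  then have "dual_pair ?V W ?e (b ?V W \<cdot> c0)" by (simp add: dual_pair_def)
  then show ?thesis by blast
qed

lemma ihom_unit:
  assumes Y [simp]: "Y \<in> Obj C"
  shows "iso_arr C (Ev C e1 Y \<cdot> inv_arr C (r (IHom C e1 Y)))" (is "iso_arr C ?\<epsilon>")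
proof -
  let ?u = "hom_transpose C Y e1 Y (r Y)"
  have u: "?u \<in> homset C Y (IHom C e1 Y)" "Ev C e1 Y \<cdot> (?u \<diamondop> i e1) = r Y"
    using transpose[of "r Y" Y e1 Y] by auto
  then have [simp]: "?u \<in> Arr C" "Dom C ?u = Y" "Cod C ?u = IHom C e1 Y" by auto
  have eu: "?\<epsilon> \<cdot> ?u = i Y"
  proof -
    have "r (IHom C e1 Y) \<cdot> (?u \<diamondop> i e1) = ?u \<cdot> r Y" by (subst runit_nat) auto
    then have "?\<epsilon> \<cdot> ?u \<cdot> r Y = Ev C e1 Y \<cdot> inv_arr C (r (IHom C e1 Y)) \<cdot> r (IHom C e1 Y) \<cdot> (?u \<diamondop> i e1)" by simp
    also have "\<dots> = Ev C e1 Y \<cdot> (?u \<diamondop> i e1)" by simp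
    finally have "(?\<epsilon> \<cdot> ?u) \<cdot> r Y = i Y \<cdot> r Y" unfolding u(2) by simp
    then show ?thesis by (rule iso_right_cancel[of "r Y", rotated -1]) simp_all
  qed
  have "?u \<cdot> ?\<epsilon> = i (IHom C e1 Y)"
  proof (rule transpose_unique[of e1 Y])
    have "Ev C e1 Y \<cdot> ((?u \<cdot> ?\<epsilon>) \<diamondop> i e1) = (Ev C e1 Y \<cdot> (?u \<diamondop> i e1)) \<cdot> (?\<epsilon> \<diamondop> i e1)"
      using whisker_right[of ?\<epsilon> ?u e1] by simp
    also have "\<dots> = r Y \<cdot> (?\<epsilon> \<diamondop> i e1)" unfolding u(2) ..
    also have "\<dots> = ?\<epsilon> \<cdot> r (IHom C e1 Y)" by (subst runit_nat) auto
    finally show "Ev C e1 Y \<cdot> ((?u \<cdot> ?\<epsilon>) \<diamondop> i e1) = Ev C e1 Y \<cdot> (i (IHom C e1 Y) \<diamondop> i e1)" by simp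
  qed simp_all
  then show ?thesis by (intro iso_arrI[of _ ?u]) (use eu in simp_all)
qed

text \<open>Where compact and rigid objects coincide, this yields compactness of the unit. The proof
  cancels the isomorphism from \<open>ihom_unit\<close> and the right unitor, after which the
  rigidity map becomes a composite of isomorphisms.\<close>

lemma rigid_unit: "rigid C e1"
  unfolding rigid_def
proof (intro conjI ballI)
  show "e1 \<in> Obj C" by simp
  fix Y assume Y [simp]: "Y \<in> Obj C"
  let ?V = "dual e1" and ?R = "rigid_map C e1 Y"
  define k where "k = l Y \<cdot> (ev e1 \<diamondop> i Y) \<cdot> a' ?V e1 Y \<cdot> (i ?V \<diamondop> b Y e1) \<cdot> a ?V Y e1"
  have k: "k \<in> homset C (?V \<boxtimes> Y \<boxtimes> e1) Y" unfolding k_def by simp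
  have rm: "?R = hom_transpose C (?V \<boxtimes> Y) e1 Y k" unfolding rigid_map_def k_def by (simp add: Let_def)
  have t: "?R \<in> homset C (?V \<boxtimes> Y) (IHom C e1 Y)" "Ev C e1 Y \<cdot> (?R \<diamondop> i e1) = k"
    unfolding rm using transpose[OF k] by auto
  then have [simp]: "?R \<in> Arr C" "Dom C ?R = ?V \<boxtimes> Y" "Cod C ?R = IHom C e1 Y" by auto
  let ?\<epsilon> = "Ev C e1 Y \<cdot> inv_arr C (r (IHom C e1 Y))"
  have iso: "iso_arr C ?\<epsilon>" by (rule ihom_unit) simp
  have "iso_arr C (ev e1)"
    using iso_comp[of "r ?V" "Ev C e1 e1 \<cdot> inv_arr C (r ?V)"] ihom_unit[of e1] by simp
  then have isok: "iso_arr C k" unfolding k_def by simp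
  have "r (IHom C e1 Y) \<cdot> (?R \<diamondop> i e1) = ?R \<cdot> r (?V \<boxtimes> Y)" by (subst runit_nat) auto
  then have "?\<epsilon> \<cdot> ?R \<cdot> r (?V \<boxtimes> Y) = Ev C e1 Y \<cdot> inv_arr C (r (IHom C e1 Y)) \<cdot> r (IHom C e1 Y) \<cdot> (?R \<diamondop> i e1)" by simp
  also have "\<dots> = k" using t(2) by simp
  finally have e: "?\<epsilon> \<cdot> ?R \<cdot> r (?V \<boxtimes> Y) = k" .
  have "?R \<cdot> r (?V \<boxtimes> Y) = inv_arr C ?\<epsilon> \<cdot> ?\<epsilon> \<cdot> ?R \<cdot> r (?V \<boxtimes> Y)"
    by (rule inv_cancel(1)[OF iso, symmetric]) simp_all
  then have "iso_arr C (?R \<cdot> r (?V \<boxtimes> Y))" unfolding e using iso isok k by simp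
  then have "iso_arr C ((?R \<cdot> r (?V \<boxtimes> Y)) \<cdot> inv_arr C (r (?V \<boxtimes> Y)))" by (rule iso_comp[rotated]) simp_all
  then show "iso_arr C ?R" by simp
qed

text \<open>Serves for the suspended generators of the local category: duals are known for the
  objects \<open>Lo (S A)\<close>, whereas those of \<open>S (Lo A)\<close> are wanted.\<close>

lemma dual_pair_iso:
  assumes dp: "dual_pair V W e c" and f: "f \<in> homset C W W'" "iso_arr C f"
  shows "dual_pair V W' (e \<cdot> (i V \<diamondop> inv_arr C f)) ((f \<diamondop> i V) \<cdot> c)"
proof -
  have [simp]: "V \<in> Obj C" "W \<in> Obj C" "e \<in> Arr C" "Dom C e = V \<boxtimes> W" "Cod C e = e1"
    "c \<in> Arr C" "Dom C c = e1" "Cod C c = W \<boxtimes> V"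
    and z: "r W \<cdot> (i W \<diamondop> e) \<cdot> a W V W \<cdot> (c \<diamondop> i W) = l W" using dp by (auto simp: dual_pair_def)
  let ?g = "inv_arr C f"
  have [simp]: "f \<in> Arr C" "Dom C f = W" "Cod C f = W'" "W' \<in> Obj C" "?g \<in> Arr C" "Dom C ?g = W'" "Cod C ?g = W"
    using f homset_obj[OF f(1)] by auto
  have 1: "a W' V W' \<cdot> ((f \<diamondop> i V) \<diamondop> i W') = (f \<diamondop> i (V \<boxtimes> W')) \<cdot> a W V W'" by (subst assoc_nat) auto
  have 2: "(i W \<diamondop> (i V \<diamondop> ?g)) \<cdot> a W V W' = a W V W \<cdot> (i (W \<boxtimes> V) \<diamondop> ?g)"
    using assoc_nat[of "i W" "i V" ?g W V W] by simp
  have 3: "(i W' \<diamondop> (e \<cdot> (i V \<diamondop> ?g))) \<cdot> (f \<diamondop> i (V \<boxtimes> W')) = (f \<diamondop> i e1) \<cdot> (i W \<diamondop> e) \<cdot> (i W \<diamondop> (i V \<diamondop> ?g))"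
    by (simp add: interchange)
  have "r W' \<cdot> (i W' \<diamondop> (e \<cdot> (i V \<diamondop> ?g))) \<cdot> a W' V W' \<cdot> (((f \<diamondop> i V) \<cdot> c) \<diamondop> i W') =
     r W' \<cdot> (i W' \<diamondop> (e \<cdot> (i V \<diamondop> ?g))) \<cdot> (a W' V W' \<cdot> ((f \<diamondop> i V) \<diamondop> i W')) \<cdot> (c \<diamondop> i W')"
    by (simp add: whisker_right)
  also have "\<dots> = r W' \<cdot> ((i W' \<diamondop> (e \<cdot> (i V \<diamondop> ?g))) \<cdot> (f \<diamondop> i (V \<boxtimes> W'))) \<cdot> a W V W' \<cdot> (c \<diamondop> i W')"
    unfolding 1 by simp
  also have "\<dots> = (r W' \<cdot> (f \<diamondop> i e1)) \<cdot> (i W \<diamondop> e) \<cdot> ((i W \<diamondop> (i V \<diamondop> ?g)) \<cdot> a W V W') \<cdot> (c \<diamondop> i W')"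
    unfolding 3 by simp
  also have "r W' \<cdot> (f \<diamondop> i e1) = f \<cdot> r W" by (subst runit_nat) auto
  also have "(f \<cdot> r W) \<cdot> (i W \<diamondop> e) \<cdot> ((i W \<diamondop> (i V \<diamondop> ?g)) \<cdot> a W V W') \<cdot> (c \<diamondop> i W') =
     f \<cdot> r W \<cdot> (i W \<diamondop> e) \<cdot> a W V W \<cdot> ((i (W \<boxtimes> V) \<diamondop> ?g) \<cdot> (c \<diamondop> i W'))" unfolding 2 by simp
  also have "(i (W \<boxtimes> V) \<diamondop> ?g) \<cdot> (c \<diamondop> i W') = (c \<diamondop> i W) \<cdot> (i e1 \<diamondop> ?g)" by (simp add: interchange)
  also have "f \<cdot> r W \<cdot> (i W \<diamondop> e) \<cdot> a W V W \<cdot> (c \<diamondop> i W) \<cdot> (i e1 \<diamondop> ?g) =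
     f \<cdot> (r W \<cdot> (i W \<diamondop> e) \<cdot> a W V W \<cdot> (c \<diamondop> i W)) \<cdot> (i e1 \<diamondop> ?g)" by simp
  also have "\<dots> = f \<cdot> ?g \<cdot> l W'" unfolding z by (subst lunit_nat) auto
  finally show ?thesis using f by (simp add: dual_pair_def)
qed

end

section \<open>Finitely presented functors\<close>

definition cls :: "('o, 'm, 'z) additive_category_scheme \<Rightarrow> 'm \<Rightarrow> 'o \<Rightarrow> 'm \<Rightarrow> 'm set" where
  "cls C f X t = (\<lambda>u. u \<cdot>\<^bsub>C\<^esub> f \<boxplus>\<^bsub>C\<^esub> t) ` homset C (Cod C f) X"

text \<open>The choice of the representative \<open>t\<close> is immaterial only if \<open>f \<cdot> z = 0\<close>.\<close>

definition yon ::
  "'u itself \<Rightarrow> ('o, 'm, 'z) additive_category_scheme \<Rightarrow> 'm \<Rightarrow> 'm \<Rightarrow> 'o \<Rightarrow> 'm set \<Rightarrow> 'm" where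
  "yon U C f z = (\<lambda>X\<in>{X. compact_obj U C X}. \<lambda>c\<in>carrier (val (coker_functor C f) X). (SOME t. t \<in> c) \<cdot>\<^bsub>C\<^esub> z)"

context additive_category
begin

section \<open>Elements of a cokernel functor as explicit cosets\<close>

lemma hom_image_subgroup:
  assumes [simp]: "f \<in> Arr C" "X \<in> Obj C"
  shows "subgroup (hom_image C f X) (hom_group C (Dom C f) X)"
proof -
  interpret G: comm_group "hom_group C (Dom C f) X" by (rule hom_comm_group) auto
  show ?thesis
  proof (rule G.subgroupI)
    show "hom_image C f X \<subseteq> carrier (hom_group C (Dom C f) X)" by (auto simp: hom_image_def)
    have "Zero C (Cod C f) X \<cdot> f \<in> hom_image C f X" unfolding hom_image_def by (rule imageI) simp
    then show "hom_image C f X \<noteq> {}" by blast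
  next
    fix x assume "x \<in> hom_image C f X"
    then obtain u where u: "u \<in> homset C (Cod C f) X" "x = u \<cdot> f" by (auto simp: hom_image_def)
    then have "neg_arr C x = neg_arr C u \<cdot> f" by auto
    moreover have "inv\<^bsub>hom_group C (Dom C f) X\<^esub> x = neg_arr C x" using u by (auto simp: neg_arr_def)
    ultimately show "inv\<^bsub>hom_group C (Dom C f) X\<^esub> x \<in> hom_image C f X"
      using u(1) unfolding hom_image_def by (intro image_eqI[of _ _ "neg_arr C u"]) auto
  next
    fix x y assume "x \<in> hom_image C f X" "y \<in> hom_image C f X"
    then obtain u v where u: "u \<in> homset C (Cod C f) X" "x = u \<cdot> f" "v \<in> homset C (Cod C f) X" "y = v \<cdot> f"
      by (auto simp: hom_image_def)
    then have "x \<boxplus> y = (u \<boxplus> v) \<cdot> f" by auto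
    then show "x \<otimes>\<^bsub>hom_group C (Dom C f) X\<^esub> y \<in> hom_image C f X"
      using u unfolding hom_image_def by (intro image_eqI[of _ _ "u \<boxplus> v"]) auto
  qed
qed

lemma coset_eq_cls: "hom_image C f X #>\<^bsub>hom_group C A X\<^esub> t = cls C f X t"
  by (auto simp: r_coset_def cls_def hom_image_def)

lemma coker_carrier: "carrier (val (coker_functor C f) X) = cls C f X ` homset C (Dom C f) X"
  by (auto simp: coker_functor_def FactGroup_def RCOSETS_def coset_eq_cls simp del: in_homset_iff)

lemma cls_in_carrier: "t \<in> homset C (Dom C f) X \<Longrightarrow> cls C f X t \<in> carrier (val (coker_functor C f) X)"
  unfolding coker_carrier by blast

lemma coker_carrierE:
  assumes "c \<in> carrier (val (coker_functor C f) X)"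
  obtains t where "t \<in> homset C (Dom C f) X" "c = cls C f X t"
  using assms unfolding coker_carrier by blast

lemma coker_mult:
  assumes "f \<in> Arr C" "X \<in> Obj C" "t \<in> homset C (Dom C f) X" "s \<in> homset C (Dom C f) X"
  shows "cls C f X t \<otimes>\<^bsub>val (coker_functor C f) X\<^esub> cls C f X s = cls C f X (t \<boxplus> s)"
proof -
  interpret G: comm_group "hom_group C (Dom C f) X" by (rule hom_comm_group) (use assms in auto)
  interpret N: normal "hom_image C f X" "hom_group C (Dom C f) X"
    by (rule G.subgroup_imp_normal) (rule hom_image_subgroup[OF assms(1,2)])
  show ?thesis using N.rcos_sum[of t s] assms by (simp add: coset_eq_cls coker_functor_def FactGroup_def)
qed

lemma cls_eq_iff:
  assumes [simp]: "f \<in> Arr C" and t: "t \<in> homset C (Dom C f) X" and s: "s \<in> homset C (Dom C f) X"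
  shows "cls C f X t = cls C f X s \<longleftrightarrow> (\<exists>u\<in>homset C (Cod C f) X. t = u \<cdot> f \<boxplus> s)"
proof
  have X [simp]: "X \<in> Obj C" using homset_obj(2)[OF t] .
  assume "cls C f X t = cls C f X s"
  moreover have "t \<in> cls C f X t"
    unfolding cls_def using t by (intro image_eqI[of _ _ "Zero C (Cod C f) X"]) auto
  ultimately have "t \<in> cls C f X s" by simp
  then show "\<exists>u\<in>homset C (Cod C f) X. t = u \<cdot> f \<boxplus> s" unfolding cls_def by blast
next
  have X [simp]: "X \<in> Obj C" using homset_obj(2)[OF t] .
  interpret G: comm_group "hom_group C (Dom C f) X" by (rule hom_comm_group) auto
  assume "\<exists>u\<in>homset C (Cod C f) X. t = u \<cdot> f \<boxplus> s"
  then have "t \<in> hom_image C f X #>\<^bsub>hom_group C (Dom C f) X\<^esub> s"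
    unfolding coset_eq_cls cls_def by blast
  from G.repr_independence[OF this _ hom_image_subgroup] show "cls C f X t = cls C f X s"
    using s unfolding coset_eq_cls by simp
qed

lemma coker_one:
  assumes "f \<in> Arr C" "X \<in> Obj C"
  shows "\<one>\<^bsub>val (coker_functor C f) X\<^esub> = cls C f X (Zero C (Dom C f) X)"
proof -
  have "(u \<cdot> f \<boxplus> Zero C (Dom C f) X) = u \<cdot> f" if "u \<in> homset C (Cod C f) X" for u
    using that assms by simp
  then show ?thesis by (simp add: coker_functor_def FactGroup_def cls_def hom_image_def cong: image_cong_simp)
qed

lemma coker_group:
  assumes "f \<in> Arr C" "X \<in> Obj C"
  shows "group (val (coker_functor C f) X)"
proof -
  interpret G: comm_group "hom_group C (Dom C f) X" by (rule hom_comm_group) (use assms in auto)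
  interpret N: normal "hom_image C f X" "hom_group C (Dom C f) X"
    by (rule G.subgroup_imp_normal) (rule hom_image_subgroup[OF assms])
  show ?thesis using N.factorgroup_is_group by (simp add: coker_functor_def)
qed

lemma cls_zero_iff:
  assumes f: "f \<in> Arr C" and t: "t \<in> homset C (Dom C f) X"
  shows "cls C f X t = cls C f X (Zero C (Dom C f) X) \<longleftrightarrow> t \<in> hom_image C f X"
proof -
  have X: "X \<in> Obj C" using homset_obj(2)[OF t] .
  have "u \<cdot> f \<boxplus> Zero C (Dom C f) X = u \<cdot> f" if "u \<in> homset C (Cod C f) X" for u
    using that f X by simp
  then show ?thesis
    unfolding cls_eq_iff[OF f t zero_simps(1)[THEN in_homset_iff[THEN iffD2, OF conjI, OF _ conjI]], OF dom_obj[OF f] X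
      zero_simps(2)[OF dom_obj[OF f] X] zero_simps(3)[OF dom_obj[OF f] X]]
    unfolding hom_image_def by (simp add: image_iff del: in_homset_iff cong: bex_cong)
qed

text \<open>All representatives of a coset have the same image coset, so the union over
  representatives in \<open>act\<close> collapses to a single coset.\<close>

lemma coker_act:
  assumes f: "f \<in> Arr C" and k: "k \<in> Arr C" and t: "t \<in> homset C (Dom C f) (Dom C k)"
  shows "act (coker_functor C f) k (cls C f (Dom C k) t) = cls C f (Cod C k) (k \<cdot> t)"
proof -
  have "cls C f (Cod C k) (k \<cdot> x) = cls C f (Cod C k) (k \<cdot> t)" if x: "x \<in> cls C f (Dom C k) t" for x
  proof -
    obtain u where u: "u \<in> homset C (Cod C f) (Dom C k)" "x = u \<cdot> f \<boxplus> t" using x by (auto simp: cls_def)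
    have "k \<cdot> x = (k \<cdot> u) \<cdot> f \<boxplus> k \<cdot> t" using u f k t by simp
    moreover have "k \<cdot> u \<in> homset C (Cod C f) (Cod C k)" using u k by simp
    ultimately have "\<exists>u\<in>homset C (Cod C f) (Cod C k). k \<cdot> x = u \<cdot> f \<boxplus> k \<cdot> t" by blast
    then show ?thesis by (subst cls_eq_iff) (use u f k t in auto)
  qed
  moreover have "t \<in> cls C f (Dom C k) t"
    unfolding cls_def using t f k by (intro image_eqI[of _ _ "Zero C (Cod C f) (Dom C k)"]) auto
  ultimately have "(\<Union>x\<in>cls C f (Dom C k) t. cls C f (Cod C k) (k \<cdot> x)) = cls C f (Cod C k) (k \<cdot> t)" by blast
  then show ?thesis by (simp add: coker_functor_def coset_eq_cls del: in_homset_iff)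
qed

lemma trivial_coker_iff:
  assumes f: "f \<in> Arr C" and X: "X \<in> Obj C"
  shows "trivial_group (val (coker_functor C f) X) \<longleftrightarrow> homset C (Dom C f) X \<subseteq> hom_image C f X"
proof -
  have "trivial_group (val (coker_functor C f) X) \<longleftrightarrow>
      (\<forall>t\<in>homset C (Dom C f) X. cls C f X t = cls C f X (Zero C (Dom C f) X))"
  proof -
    have "Zero C (Dom C f) X \<in> homset C (Dom C f) X" using f X by simp
    then have "cls C f X ` homset C (Dom C f) X = {cls C f X (Zero C (Dom C f) X)} \<longleftrightarrow>
        (\<forall>t\<in>homset C (Dom C f) X. cls C f X t = cls C f X (Zero C (Dom C f) X))" by blast
    then show ?thesis
      unfolding trivial_group_def coker_one[OF f X] coker_carrier using coker_group[OF f X] by blast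
  qed
  then show ?thesis using cls_zero_iff[OF f] by blast
qed

lemma hom_image_homset: "f \<in> Arr C \<Longrightarrow> hom_image C f X \<subseteq> homset C (Dom C f) X"
  by (auto simp: hom_image_def)

section \<open>The Yoneda lemma for cokernels of representable functors\<close>

context
  fixes U :: "'u itself" and f :: 'm
  assumes f: "f \<in> compact_arrs U C"
begin

private lemma fA [simp]: "f \<in> Arr C" and fc: "compact_obj U C (Dom C f)" "compact_obj U C (Cod C f)"
  using f by (auto simp: compact_arrs_def)

lemma yon_apply:
  assumes "compact_obj U C X" "z \<in> homset C E (Dom C f)" "f \<cdot> z = Zero C E (Cod C f)" "t \<in> homset C (Dom C f) X"
  shows "yon U C f z X (cls C f X t) = t \<cdot> z"
proof -
  have [simp]: "E \<in> Obj C" "X \<in> Obj C" using assms homset_obj compact_obj_obj by blast+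
  have "t \<in> cls C f X t"
    unfolding cls_def using assms by (intro image_eqI[of _ _ "Zero C (Cod C f) X"]) auto
  then have "(SOME y. y \<in> cls C f X t) \<in> cls C f X t" by (rule someI)
  then obtain u where u: "u \<in> homset C (Cod C f) X" "(SOME y. y \<in> cls C f X t) = u \<cdot> f \<boxplus> t"
    by (auto simp: cls_def)
  have "(u \<cdot> f \<boxplus> t) \<cdot> z = u \<cdot> f \<cdot> z \<boxplus> t \<cdot> z" using u(1) assms by simp
  also have "\<dots> = t \<cdot> z" using u(1) assms by simp
  finally show ?thesis using cls_in_carrier[OF assms(4)] assms(1) u(2) by (simp add: yon_def)
qed

lemma yon_in_ab_nat:
  assumes z: "z \<in> homset C E (Dom C f)" "f \<cdot> z = Zero C E (Cod C f)"
  shows "yon U C f z \<in> ab_nat U C (coker_functor C f) (hom_functor C E)"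
  unfolding ab_nat_def
proof (intro CollectI conjI PiE_I ballI IntI)
  fix X assume "X \<in> {X. compact_obj U C X}"
  then have X: "compact_obj U C X" by simp
  have XO: "X \<in> Obj C" using compact_obj_obj[OF X] .
  show "yon U C f z X \<in> hom (val (coker_functor C f) X) (val (hom_functor C E) X)"
  proof (rule homI)
    fix c assume "c \<in> carrier (val (coker_functor C f) X)"
    then obtain t where t: "t \<in> homset C (Dom C f) X" "c = cls C f X t" by (rule coker_carrierE)
    then show "yon U C f z X c \<in> carrier (val (hom_functor C E) X)"
      using yon_apply[OF X z t(1)] z by (simp add: hom_functor_def)
    fix d assume "d \<in> carrier (val (coker_functor C f) X)"
    then obtain s where s: "s \<in> homset C (Dom C f) X" "d = cls C f X s" by (rule coker_carrierE)
    have ts: "t \<boxplus> s \<in> homset C (Dom C f) X" using t(1) s(1) by simp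
    show "yon U C f z X (c \<otimes>\<^bsub>val (coker_functor C f) X\<^esub> d) =
        yon U C f z X c \<otimes>\<^bsub>val (hom_functor C E) X\<^esub> yon U C f z X d"
      unfolding t(2) s(2) coker_mult[OF fA XO t(1) s(1)] yon_apply[OF X z t(1)] yon_apply[OF X z s(1)]
        yon_apply[OF X z ts] using t(1) s(1) z by (simp add: hom_functor_def)
  qed
  show "yon U C f z X \<in> extensional (carrier (val (coker_functor C f) X))" using X by (simp add: yon_def)
next
  fix X assume "X \<notin> {X. compact_obj U C X}"
  then show "yon U C f z X = undefined" by (simp add: yon_def)
next
  fix k c assume k: "k \<in> compact_arrs U C" and c: "c \<in> carrier (val (coker_functor C f) (Dom C k))"
  obtain t where t: "t \<in> homset C (Dom C f) (Dom C k)" "c = cls C f (Dom C k) t" using c by (rule coker_carrierE)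
  have kA: "k \<in> Arr C" "compact_obj U C (Dom C k)" "compact_obj U C (Cod C k)" using k by (auto simp: compact_arrs_def)
  have kt: "k \<cdot> t \<in> homset C (Dom C f) (Cod C k)" using kA t by simp
  show "yon U C f z (Cod C k) (act (coker_functor C f) k c) = act (hom_functor C E) k (yon U C f z (Dom C k) c)"
    unfolding t(2) coker_act[OF fA kA(1) t(1)] yon_apply[OF kA(3) z kt] yon_apply[OF kA(2) z t(1)]
    using kA t z by (simp add: hom_functor_def)
qed

text \<open>The transformation is determined by its value on the class of the identity, and
  \<open>f\<close> annihilates this value because the class of \<open>f\<close> itself is zero.
  Compactness of the domain and codomain of \<open>f\<close> puts both among the objects at which
  the transformation is defined.\<close>

lemma ab_nat_yon:
  assumes \<phi>: "\<phi> \<in> ab_nat U C (coker_functor C f) (hom_functor C E)" and E [simp]: "E \<in> Obj C"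
  defines "z \<equiv> \<phi> (Dom C f) (cls C f (Dom C f) (Id C (Dom C f)))"
  shows "z \<in> homset C E (Dom C f)" "f \<cdot> z = Zero C E (Cod C f)" "\<phi> = yon U C f z"
proof -
  let ?A = "Dom C f" and ?B = "Cod C f"
  let ?id = "cls C f ?A (Id C ?A)"
  have idh: "Id C ?A \<in> homset C ?A ?A" by simp
  have hom: "\<phi> X \<in> hom (val (coker_functor C f) X) (hom_group C E X)" and
    ext: "\<phi> X \<in> extensional (carrier (val (coker_functor C f) X))" if "compact_obj U C X" for X
    using \<phi> that unfolding ab_nat_def by (auto simp: hom_functor_def)
  have nat: "\<phi> (Cod C k) (act (coker_functor C f) k x) = k \<cdot> \<phi> (Dom C k) x"
    if "k \<in> compact_arrs U C" "x \<in> carrier (val (coker_functor C f) (Dom C k))" for k x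
    using \<phi> that unfolding ab_nat_def by (auto simp: hom_functor_def)
  show z: "z \<in> homset C E ?A"
    using hom_in_carrier[OF hom[OF fc(1)] cls_in_carrier[OF idh]] by (simp add: z_def)
  have \<phi>t: "\<phi> X (cls C f X t) = t \<cdot> z" if X: "compact_obj U C X" and t: "t \<in> homset C ?A X" for X t
  proof -
    have tc: "t \<in> compact_arrs U C" using t X fc by (auto simp: compact_arrs_def)
    have tA: "t \<in> Arr C" "Dom C t = ?A" "Cod C t = X" using t by auto
    have "act (coker_functor C f) t ?id = cls C f X t"
      using coker_act[OF fA tA(1), of "Id C ?A"] tA by simp
    then show ?thesis using nat[OF tc, of ?id] cls_in_carrier[OF idh] tA by (simp add: z_def)
  qed
  have fh: "f \<in> homset C ?A ?B" and zh: "Zero C ?A ?B \<in> homset C ?A ?B" by simp_all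
  have "cls C f ?B f = cls C f ?B (Zero C ?A ?B)"
    unfolding cls_zero_iff[OF fA fh] hom_image_def by (intro image_eqI[of _ _ "Id C ?B"]) auto
  then have "f \<cdot> z = Zero C ?A ?B \<cdot> z" using \<phi>t[OF fc(2) fh] \<phi>t[OF fc(2) zh] by simp
  then show fz: "f \<cdot> z = Zero C E ?B" using z by simp
  show "\<phi> = yon U C f z"
  proof
    fix X
    show "\<phi> X = yon U C f z X"
    proof (cases "compact_obj U C X")
      case True
      show ?thesis
      proof
        fix c
        show "\<phi> X c = yon U C f z X c"
        proof (cases "c \<in> carrier (val (coker_functor C f) X)")
          case c: True
          obtain t where t: "t \<in> homset C ?A X" "c = cls C f X t" using c by (rule coker_carrierE)
          show ?thesis unfolding t(2) \<phi>t[OF True t(1)] yon_apply[OF True z fz t(1)] ..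
        next
          case False
          then show ?thesis using ext[OF True] True by (simp add: yon_def extensional_def)
        qed
      qed
    next
      case False
      then show ?thesis using \<phi> by (auto simp: yon_def ab_nat_def PiE_def extensional_def)
    qed
  qed
qed

text \<open>Makes \<open>z\<close> recoverable from its transformation. Identities between
  transformations are turned into identities between maps by evaluating here.\<close>

lemma yon_eval:
  assumes "z \<in> homset C E (Dom C f)" "f \<cdot> z = Zero C E (Cod C f)"
  shows "yon U C f z (Dom C f) (cls C f (Dom C f) (Id C (Dom C f))) = z"
  using yon_apply[OF fc(1) assms, of "Id C (Dom C f)"] assms by simp

lemma yon_add:
  assumes z: "z \<in> homset C E (Dom C f)" "f \<cdot> z = Zero C E (Cod C f)"
    and z': "z' \<in> homset C E (Dom C f)" "f \<cdot> z' = Zero C E (Cod C f)"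
  shows "yon U C f z \<otimes>\<^bsub>ab_nat_group U C (coker_functor C f) (hom_functor C E)\<^esub> yon U C f z' = yon U C f (z \<boxplus> z')"
proof -
  have zz: "z \<boxplus> z' \<in> homset C E (Dom C f)" "f \<cdot> (z \<boxplus> z') = Zero C E (Cod C f)"
    using z z' homset_obj(1)[OF z(1)] by auto
  have "yon U C f z X c \<boxplus> yon U C f z' X c = yon U C f (z \<boxplus> z') X c"
    if X: "compact_obj U C X" and c: "c \<in> carrier (val (coker_functor C f) X)" for X c
  proof -
    obtain t where t: "t \<in> homset C (Dom C f) X" "c = cls C f X t" using c by (rule coker_carrierE)
    show ?thesis unfolding t(2) yon_apply[OF X z t(1)] yon_apply[OF X z' t(1)] yon_apply[OF X zz t(1)]
      using t z z' by simp
  qed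
  then show ?thesis
    unfolding ab_nat_group_def
    by (auto simp: hom_functor_def fun_eq_iff restrict_def) (auto simp: yon_def)
qed

declare fA [simp del]

end

end

section \<open>The dual definable category\<close>

definition right_tensor :: "('o, 'm, 'z) tt_category_scheme \<Rightarrow> 'o \<Rightarrow> ('o, 'm, 'o, 'm) cat_functor" where
  "right_tensor C Y = \<lparr>fobj = (\<lambda>X. X \<boxtimes>\<^bsub>C\<^esub> Y), farr = (\<lambda>f. f \<diamondop>\<^bsub>C\<^esub> Id C Y)\<rparr>"

lemma right_tensor_simps [simp]:
  "fobj (right_tensor C Y) X = X \<boxtimes>\<^bsub>C\<^esub> Y" "farr (right_tensor C Y) f = f \<diamondop>\<^bsub>C\<^esub> Id C Y"
  by (simp_all add: right_tensor_def)

text \<open>The axioms that can be verified for the local category before its compact objects are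
  known to have duals. They are strong enough to prove, in \<open>compact_dualizable_if\<close>,
  that they do.\<close>

locale tensor_tt = large_category U C + closed_symmetric_monoidal C
  for U :: "'u itself" and C :: "('o, 'm, 'z) tt_category_scheme" (structure) +
  assumes tensor_add_left: "\<lbrakk>f \<in> homset C X X'; g \<in> homset C X X'; Y \<in> Obj C\<rbrakk>
      \<Longrightarrow> (f \<boxplus> g) \<diamondop> Id C Y = f \<diamondop> Id C Y \<boxplus> g \<diamondop> Id C Y"
    and tensor_add_right: "\<lbrakk>f \<in> homset C X X'; g \<in> homset C X X'; Y \<in> Obj C\<rbrakk>
      \<Longrightarrow> Id C Y \<diamondop> (f \<boxplus> g) = Id C Y \<diamondop> f \<boxplus> Id C Y \<diamondop> g"
    and tensor_tri: "\<lbrakk>(f, g, h) \<in> Tri C; Y \<in> Obj C\<rbrakk> \<Longrightarrow> \<exists>h'. (f \<diamondop> Id C Y, g \<diamondop> Id C Y, h') \<in> Tri C"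
    and unit_compact: "compact_obj U C (Unit C)"
begin

lemma tensor_add [simp]:
  "\<lbrakk>f \<in> Arr C; g \<in> Arr C; Dom C g = Dom C f; Cod C g = Cod C f; Y \<in> Obj C\<rbrakk>
    \<Longrightarrow> (f \<boxplus> g) \<diamondop> i Y = f \<diamondop> i Y \<boxplus> g \<diamondop> i Y"
  "\<lbrakk>f \<in> Arr C; g \<in> Arr C; Dom C g = Dom C f; Cod C g = Cod C f; Y \<in> Obj C\<rbrakk>
    \<Longrightarrow> i Y \<diamondop> (f \<boxplus> g) = i Y \<diamondop> f \<boxplus> i Y \<diamondop> g"
  using tensor_add_left[of f "Dom C f" "Cod C f" g Y] tensor_add_right[of f "Dom C f" "Cod C f" g Y] by auto

lemma tensor_zero [simp]:
  "\<lbrakk>X \<in> Obj C; X' \<in> Obj C; Y \<in> Obj C\<rbrakk> \<Longrightarrow> Zero C X X' \<diamondop> i Y = Zero C (X \<boxtimes> Y) (X' \<boxtimes> Y)"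
  "\<lbrakk>X \<in> Obj C; X' \<in> Obj C; Y \<in> Obj C\<rbrakk> \<Longrightarrow> i Y \<diamondop> Zero C X X' = Zero C (Y \<boxtimes> X) (Y \<boxtimes> X')"
proof -
  assume [simp]: "X \<in> Obj C" "X' \<in> Obj C" "Y \<in> Obj C"
  show "Zero C X X' \<diamondop> i Y = Zero C (X \<boxtimes> Y) (X' \<boxtimes> Y)"
    using add_self_eq_zero[of "Zero C X X' \<diamondop> i Y"] tensor_add(1)[of "Zero C X X'" "Zero C X X'" Y]
    by (simp del: tensor_add)
  show "i Y \<diamondop> Zero C X X' = Zero C (Y \<boxtimes> X) (Y \<boxtimes> X')"
    using add_self_eq_zero[of "i Y \<diamondop> Zero C X X'"] tensor_add(2)[of "Zero C X X'" "Zero C X X'" Y]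
    by (simp del: tensor_add)
qed

lemma tensor_cocont:
  assumes Y [simp]: "Y \<in> Obj C"
  shows "cocont_exact U C (right_tensor C Y)"
  unfolding cocont_exact_def
proof (intro conjI allI impI)
  show "additive_functor C C (right_tensor C Y)"
    by (auto simp: additive_functor_def is_functor_def hom_def interchange)
  show "\<exists>h'. (farr (right_tensor C Y) f, farr (right_tensor C Y) g, h') \<in> Tri C" if "(f, g, h) \<in> Tri C" for f g h
    using tensor_tri[OF that Y] by simp
  fix I :: "'u set" and X P \<iota> assume "small U I \<and> is_coproduct C I X P \<iota>"
  then have co: "is_coproduct C I X P \<iota>" by simp
  have "is_coproduct C I (\<lambda>j. X j \<boxtimes> Y) (P \<boxtimes> Y) (\<lambda>j. \<iota> j \<diamondop> i Y)" by (rule tensor_coproduct[OF co Y])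
  then show "is_coproduct C I (fobj (right_tensor C Y) \<circ> X) (fobj (right_tensor C Y) P) (farr (right_tensor C Y) \<circ> \<iota>)"
    unfolding right_tensor_simps by (rule coproduct_cong) auto
qed

lemma tensor_coproduct_right:
  assumes co: "is_coproduct C I X P \<iota>" and Y [simp]: "Y \<in> Obj C"
  shows "is_coproduct C I (\<lambda>j. Y \<boxtimes> X j) (Y \<boxtimes> P) (\<lambda>j. i Y \<diamondop> \<iota> j)"
proof -
  note c = coproduct_simps[OF co]
  have "is_coproduct C I (\<lambda>j. Y \<boxtimes> X j) (Y \<boxtimes> P) (\<lambda>j. b P Y \<cdot> (\<iota> j \<diamondop> i Y) \<cdot> b Y (X j))"
    by (rule coproduct_iso_transport[OF tensor_coproduct[OF co Y]]) (use c in auto)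
  then show ?thesis
  proof (rule coproduct_cong)
    fix j assume j: "j \<in> I"
    have "b P Y \<cdot> (\<iota> j \<diamondop> i Y) \<cdot> b Y (X j) = (b P Y \<cdot> (\<iota> j \<diamondop> i Y)) \<cdot> b Y (X j)"
      by (rule assoc[symmetric]) (use c(1) c(2-5)[OF j] in auto)
    also have "b P Y \<cdot> (\<iota> j \<diamondop> i Y) = (i Y \<diamondop> \<iota> j) \<cdot> b (X j) Y"
      using c(1) c(2-5)[OF j] by (subst braid_nat) auto
    also have "((i Y \<diamondop> \<iota> j) \<cdot> b (X j) Y) \<cdot> b Y (X j) = i Y \<diamondop> \<iota> j"
      using c(1) c(2-5)[OF j] by (simp add: braid_symmetric)
    finally show "b P Y \<cdot> (\<iota> j \<diamondop> i Y) \<cdot> b Y (X j) = i Y \<diamondop> \<iota> j" .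
  qed auto
qed

lemma mate_zero:
  assumes "dual_pair V W e c" "Y \<in> Obj C" "Z \<in> Obj C"
  shows "mate c V W Z (Zero C (V \<boxtimes> Z) Y) = Zero C Z (W \<boxtimes> Y)"
  using assms unfolding mate_def dual_pair_def by simp

lemma unmate_zero:
  assumes "dual_pair V W e c" "Y \<in> Obj C" "Z \<in> Obj C"
  shows "unmate e V W Y (Zero C Z (W \<boxtimes> Y)) = Zero C (V \<boxtimes> Z) Y"
  using assms unfolding unmate_def dual_pair_def by simp

text \<open>For \<open>W\<close> compact, the maps \<open>Hom(1, Y \<otimes> D W) \<rightarrow> Hom(W, Y)\<close> are bijective as soon as they are so for \<open>Y\<close>
  in a set of generators; a coevaluation of \<open>W\<close> is a preimage of the identity of \<open>W\<close>.\<close>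

lemma compact_dualizable_if:
  assumes G: "small U G" "\<And>A. A \<in> G \<Longrightarrow> compact_obj U C A"
    "\<And>X. X \<in> Obj C \<Longrightarrow> (\<And>A. A \<in> G \<Longrightarrow> homset C A X = {Zero C A X}) \<Longrightarrow> zero_object C X"
    and dual: "\<And>A. A \<in> G \<Longrightarrow> \<exists>V e c. dual_pair V A e c" "\<And>A. A \<in> G \<Longrightarrow> \<exists>V e c. dual_pair V (S A) e c"
    and W: "compact_obj U C W"
  shows "\<exists>c. dual_pair (dual W) W (ev W) c"
proof -
  have WO [simp]: "W \<in> Obj C" using compact_obj_obj[OF W] .
  let ?B = "dual W" and ?e = "ev W"
  define \<phi> where "\<phi> Y t = r Y \<cdot> (i Y \<diamondop> ?e) \<cdot> a Y ?B W \<cdot> (t \<diamondop> i W) \<cdot> inv_arr C (l W)" for Y t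
  have \<phi>: "\<phi> Y t \<in> homset C W Y" if "t \<in> homset C e1 (Y \<boxtimes> ?B)" "Y \<in> Obj C" for Y t
    using that unfolding \<phi>_def by simp
  have surj: "\<exists>t\<in>homset C e1 (A \<boxtimes> ?B). \<phi> A t = s"
    if A: "\<exists>V e c. dual_pair V A e c" and s: "s \<in> homset C W A" for A s
  proof -
    obtain c where dp: "dual_pair (dual A) A (ev A) c" using A dual_pair_dual by blast
    have [simp]: "A \<in> Obj C" "c \<in> Arr C" "Dom C c = e1" "Cod C c = A \<boxtimes> dual A"
      and z: "r A \<cdot> (i A \<diamondop> ev A) \<cdot> a A (dual A) A \<cdot> (c \<diamondop> i A) = l A" using dp by (auto simp: dual_pair_def)
    have [simp]: "s \<in> Arr C" "Dom C s = W" "Cod C s = A" using s by auto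
    note ds = dual_arr[of s, simplified]
    note [simp] = ds(1-3)
    \<comment> \<open>The element corresponding to \<open>s\<close> under the duality of
      \<open>A\<close>: the coevaluation of \<open>A\<close>, followed by the dual of
      \<open>s\<close> on the second factor.\<close>
    let ?t = "(i A \<diamondop> dual_arr C s) \<cdot> c"
    have 1: "a A ?B W \<cdot> ((i A \<diamondop> dual_arr C s) \<diamondop> i W) = (i A \<diamondop> (dual_arr C s \<diamondop> i W)) \<cdot> a A (dual A) W"
      by (subst assoc_nat) auto
    have 2: "(i A \<diamondop> (i (dual A) \<diamondop> s)) \<cdot> a A (dual A) W = a A (dual A) A \<cdot> (i (A \<boxtimes> dual A) \<diamondop> s)"
      using assoc_nat[of "i A" "i (dual A)" s A "dual A" A] by simp
    have "\<phi> A ?t = r A \<cdot> (i A \<diamondop> ?e) \<cdot> (a A ?B W \<cdot> ((i A \<diamondop> dual_arr C s) \<diamondop> i W)) \<cdot> (c \<diamondop> i W) \<cdot> inv_arr C (l W)"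
      unfolding \<phi>_def by (simp add: whisker_right)
    also have "\<dots> = r A \<cdot> ((i A \<diamondop> ?e) \<cdot> (i A \<diamondop> (dual_arr C s \<diamondop> i W))) \<cdot> a A (dual A) W \<cdot> (c \<diamondop> i W) \<cdot> inv_arr C (l W)"
      unfolding 1 by simp
    also have "(i A \<diamondop> ?e) \<cdot> (i A \<diamondop> (dual_arr C s \<diamondop> i W)) = (i A \<diamondop> ev A) \<cdot> (i A \<diamondop> (i (dual A) \<diamondop> s))"
      using ds(4) by (simp add: interchange)
    also have "r A \<cdot> ((i A \<diamondop> ev A) \<cdot> (i A \<diamondop> (i (dual A) \<diamondop> s))) \<cdot> a A (dual A) W \<cdot> (c \<diamondop> i W) \<cdot> inv_arr C (l W) =
       r A \<cdot> (i A \<diamondop> ev A) \<cdot> ((i A \<diamondop> (i (dual A) \<diamondop> s)) \<cdot> a A (dual A) W) \<cdot> (c \<diamondop> i W) \<cdot> inv_arr C (l W)" by simp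
    also have "\<dots> = r A \<cdot> (i A \<diamondop> ev A) \<cdot> a A (dual A) A \<cdot> ((i (A \<boxtimes> dual A) \<diamondop> s) \<cdot> (c \<diamondop> i W)) \<cdot> inv_arr C (l W)"
      unfolding 2 by simp
    also have "(i (A \<boxtimes> dual A) \<diamondop> s) \<cdot> (c \<diamondop> i W) = (c \<diamondop> i A) \<cdot> (i e1 \<diamondop> s)" by (simp add: interchange)
    also have "r A \<cdot> (i A \<diamondop> ev A) \<cdot> a A (dual A) A \<cdot> ((c \<diamondop> i A) \<cdot> (i e1 \<diamondop> s)) \<cdot> inv_arr C (l W) =
      (r A \<cdot> (i A \<diamondop> ev A) \<cdot> a A (dual A) A \<cdot> (c \<diamondop> i A)) \<cdot> (i e1 \<diamondop> s) \<cdot> inv_arr C (l W)" by simp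
    also have "\<dots> = (l A \<cdot> (i e1 \<diamondop> s)) \<cdot> inv_arr C (l W)" unfolding z by simp
    also have "l A \<cdot> (i e1 \<diamondop> s) = s \<cdot> l W" by (subst lunit_nat) auto
    also have "(s \<cdot> l W) \<cdot> inv_arr C (l W) = s" by simp
    finally show ?thesis by (intro bexI[of _ ?t]) simp_all
  qed
  have inj: "t = Zero C e1 (A \<boxtimes> ?B)"
    if A: "\<exists>V e c. dual_pair V A e c" and t: "t \<in> homset C e1 (A \<boxtimes> ?B)" and 0: "\<phi> A t = Zero C W A" for A t
  proof -
    obtain c where dp: "dual_pair (dual A) A (ev A) c" using A dual_pair_dual by blast
    have [simp]: "A \<in> Obj C" using dp by (auto simp: dual_pair_def)
    have [simp]: "t \<in> Arr C" "Dom C t = e1" "Cod C t = A \<boxtimes> ?B" using t by auto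
    let ?n = "(i A \<diamondop> ?e) \<cdot> a A ?B W \<cdot> (t \<diamondop> i W)"
    have nh: "?n \<in> homset C (e1 \<boxtimes> W) (A \<boxtimes> e1)" by simp
    have "?n = Zero C (e1 \<boxtimes> W) (A \<boxtimes> e1)"
    proof (rule iso_left_cancel[of "r A"])
      show "r A \<cdot> ?n = r A \<cdot> Zero C (e1 \<boxtimes> W) (A \<boxtimes> e1)"
      proof (rule iso_right_cancel[of "inv_arr C (l W)"])
        show "(r A \<cdot> ?n) \<cdot> inv_arr C (l W) = (r A \<cdot> Zero C (e1 \<boxtimes> W) (A \<boxtimes> e1)) \<cdot> inv_arr C (l W)"
          using 0 unfolding \<phi>_def by simp
      qed simp_all
    qed simp_all
    \<comment> \<open>Vanishing of \<open>\<phi> A t\<close> is vanishing after contraction with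
      \<open>W\<close>. Through \<open>ev_unmate\<close> it reaches the evaluation of the unmate,
      and the universal property of \<open>ev W\<close> then makes the unmate zero.\<close>
    then have "?e \<cdot> (unmate (ev A) (dual A) A ?B t \<diamondop> i W) = unmate (ev A) (dual A) A e1 (Zero C (e1 \<boxtimes> W) (A \<boxtimes> e1)) \<cdot> a (dual A) e1 W"
      using ev_unmate[of "ev A" "dual A" A t e1 ?B ?e W] by simp
    also have "\<dots> = ?e \<cdot> (Zero C (dual A \<boxtimes> e1) ?B \<diamondop> i W)"
      using unmate_zero[OF dp, of e1 "e1 \<boxtimes> W"] by simp
    finally have u0: "unmate (ev A) (dual A) A ?B t = Zero C (dual A \<boxtimes> e1) ?B"
      by (rule transpose_unique[of W e1 _ _ "dual A \<boxtimes> e1"]) (use unmate_homset[OF dp t] in auto)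
    show ?thesis using mate_unmate[OF dp t] mate_zero[OF dp, of ?B e1] unfolding u0 by simp
  qed
  have "\<exists>t\<in>homset C e1 (fobj (right_tensor C ?B) W). \<phi> W t = i W"
  proof (rule natural_surjective[OF tensor_cocont[of ?B] cocont_exact_id[of U] unit_compact W G, of \<phi>])
    show "\<phi> Y t \<in> homset C W (fobj id_functor Y)" if "Y \<in> Obj C" "t \<in> homset C e1 (fobj (right_tensor C ?B) Y)" for Y t
      using \<phi>[of t Y] that by (simp add: id_functor_def)
    show "\<phi> Y (t \<boxplus> u) = \<phi> Y t \<boxplus> \<phi> Y u"
      if "Y \<in> Obj C" "t \<in> homset C e1 (fobj (right_tensor C ?B) Y)" "u \<in> homset C e1 (fobj (right_tensor C ?B) Y)" for Y t u
      using that unfolding \<phi>_def by simp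
    show "\<phi> Y' (farr (right_tensor C ?B) f \<cdot> t) = farr id_functor f \<cdot> \<phi> Y t"
      if f: "f \<in> homset C Y Y'" and t: "t \<in> homset C e1 (fobj (right_tensor C ?B) Y)" for Y Y' f t
    proof -
      have [simp]: "f \<in> Arr C" "Dom C f = Y" "Cod C f = Y'" "Y \<in> Obj C" "Y' \<in> Obj C" "t \<in> Arr C" "Dom C t = e1" "Cod C t = Y \<boxtimes> ?B"
        using f t homset_obj[OF f] by auto
      have 1: "a Y' ?B W \<cdot> ((f \<diamondop> i ?B) \<diamondop> i W) = (f \<diamondop> i (?B \<boxtimes> W)) \<cdot> a Y ?B W" by (subst assoc_nat) auto
      have 2: "(i Y' \<diamondop> ?e) \<cdot> (f \<diamondop> i (?B \<boxtimes> W)) = (f \<diamondop> i e1) \<cdot> (i Y \<diamondop> ?e)" by (simp add: interchange)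
      have 3: "r Y' \<cdot> (f \<diamondop> i e1) = f \<cdot> r Y" by (subst runit_nat) auto
      have "\<phi> Y' ((f \<diamondop> i ?B) \<cdot> t) = r Y' \<cdot> (i Y' \<diamondop> ?e) \<cdot> (a Y' ?B W \<cdot> ((f \<diamondop> i ?B) \<diamondop> i W)) \<cdot> (t \<diamondop> i W) \<cdot> inv_arr C (l W)"
        unfolding \<phi>_def by (simp add: whisker_right)
      also have "\<dots> = r Y' \<cdot> ((i Y' \<diamondop> ?e) \<cdot> (f \<diamondop> i (?B \<boxtimes> W))) \<cdot> a Y ?B W \<cdot> (t \<diamondop> i W) \<cdot> inv_arr C (l W)" unfolding 1 by simp
      also have "\<dots> = (r Y' \<cdot> (f \<diamondop> i e1)) \<cdot> (i Y \<diamondop> ?e) \<cdot> a Y ?B W \<cdot> (t \<diamondop> i W) \<cdot> inv_arr C (l W)" unfolding 2 by simp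
      also have "\<dots> = f \<cdot> \<phi> Y t" unfolding 3 \<phi>_def by simp
      finally show ?thesis by (simp add: id_functor_def)
    qed
  next
    fix A assume A: "A \<in> G"
    show "\<exists>t\<in>homset C e1 (fobj (right_tensor C ?B) A). \<phi> A t = s" if "s \<in> homset C W (fobj id_functor A)" for s
      using surj[OF dual(1)[OF A], of s] that by (simp add: id_functor_def)
    show "t = Zero C e1 (fobj (right_tensor C ?B) A)"
      if "t \<in> homset C e1 (fobj (right_tensor C ?B) A)" "\<phi> A t = Zero C W (fobj id_functor A)" for t
      using inj[OF dual(1)[OF A], of t] that by (simp add: id_functor_def)
    show "t = Zero C e1 (fobj (right_tensor C ?B) (S A))"
      if "t \<in> homset C e1 (fobj (right_tensor C ?B) (S A))" "\<phi> (S A) t = Zero C W (fobj id_functor (S A))" for t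
      using inj[OF dual(2)[OF A], of t] that by (simp add: id_functor_def)
  qed (simp_all add: id_functor_def)
  then obtain t where t: "t \<in> homset C e1 (W \<boxtimes> ?B)" "\<phi> W t = i W" by auto
  have "r W \<cdot> (i W \<diamondop> ?e) \<cdot> a W ?B W \<cdot> (t \<diamondop> i W) = l W"
  proof (rule iso_right_cancel[of "inv_arr C (l W)"])
    show "(r W \<cdot> (i W \<diamondop> ?e) \<cdot> a W ?B W \<cdot> (t \<diamondop> i W)) \<cdot> inv_arr C (l W) = l W \<cdot> inv_arr C (l W)"
      using t unfolding \<phi>_def by simp
  qed (use t(1) in simp_all)
  then have "dual_pair ?B W ?e t" using t(1) by (simp add: dual_pair_def)
  then show ?thesis by blast
qed

end

locale dualizable_tt = tensor_tt U C
  for U :: "'u itself" and C :: "('o, 'm, 'z) tt_category_scheme" (structure) +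
  assumes compact_dualizable: "compact_obj U C W \<Longrightarrow> \<exists>c. dual_pair (IHom C W (Unit C)) W (Ev C W (Unit C)) c"
begin

text \<open>\<open>unmate\<close> for \<open>Z = e1\<close> with the right unitor removed: maps from
  the unit to \<open>A \<boxtimes> Y\<close> become maps from the dual of \<open>A\<close> to
  \<open>Y\<close>.\<close>

definition flat where "flat A Y t = unmate (ev A) (dual A) A Y t \<cdot> inv_arr C (r (dual A))"

lemma flat_dual:
  assumes f: "f \<in> homset C A B" and t: "t \<in> homset C e1 (A \<boxtimes> Y)" and Y [simp]: "Y \<in> Obj C"
  shows "flat B Y ((f \<diamondop> i Y) \<cdot> t) = flat A Y t \<cdot> dual_arr C f"
proof -
  have [simp]: "f \<in> Arr C" "Dom C f = A" "Cod C f = B" "A \<in> Obj C" "B \<in> Obj C" "t \<in> Arr C" "Dom C t = e1" "Cod C t = A \<boxtimes> Y"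
    using f t homset_obj[OF f] by auto
  note d = dual_arr[of f, simplified]
  note [simp] = d(1-3)
  have "r (dual A) \<cdot> (dual_arr C f \<diamondop> i e1) = dual_arr C f \<cdot> r (dual B)" by (subst runit_nat) auto
  then have "inv_arr C (r (dual A)) \<cdot> (r (dual A) \<cdot> (dual_arr C f \<diamondop> i e1)) \<cdot> inv_arr C (r (dual B))
     = inv_arr C (r (dual A)) \<cdot> (dual_arr C f \<cdot> r (dual B)) \<cdot> inv_arr C (r (dual B))" by simp
  then have e: "(dual_arr C f \<diamondop> i e1) \<cdot> inv_arr C (r (dual B)) = inv_arr C (r (dual A)) \<cdot> dual_arr C f" by simp
  have [simp]: "unmate (ev A) (dual A) A Y t \<in> Arr C" "Dom C (unmate (ev A) (dual A) A Y t) = dual A \<boxtimes> e1"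
    unfolding unmate_def by simp_all
  show ?thesis unfolding flat_def unmate_dual[OF f t Y] using e by simp
qed

lemma flat_homset:
  assumes "A \<in> Obj C" "t \<in> homset C e1 (A \<boxtimes> Y)" "Y \<in> Obj C"
  shows "flat A Y t \<in> homset C (dual A) Y"
  using assms unfolding flat_def unmate_def by simp

context
  fixes A assumes A: "compact_obj U C A"
begin

private lemma AO [simp]: "A \<in> Obj C" using compact_obj_obj[OF A] .

lemma flat_add:
  assumes "t \<in> homset C e1 (A \<boxtimes> Y)" "t' \<in> homset C e1 (A \<boxtimes> Y)" "Y \<in> Obj C"
  shows "flat A Y (t \<boxplus> t') = flat A Y t \<boxplus> flat A Y t'"
  using assms unfolding flat_def unmate_def by simp

lemma flat_comp:
  assumes t: "t \<in> homset C e1 (A \<boxtimes> Y)" and y: "y \<in> homset C Y Y'"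
  shows "flat A Y' ((i A \<diamondop> y) \<cdot> t) = y \<cdot> flat A Y t"
proof -
  obtain c where dp: "dual_pair (dual A) A (ev A) c" using compact_dualizable[OF A] by blast
  have "Y \<in> Obj C" using homset_obj(1)[OF y] .
  then have "unmate (ev A) (dual A) A Y t \<in> homset C (dual A \<boxtimes> e1) Y" using unmate_homset[OF dp t] by simp
  then show ?thesis unfolding flat_def unmate_comp[OF dp t y] using y by simp
qed

lemma flat_surj:
  assumes v: "v \<in> homset C (dual A) Y"
  shows "\<exists>t\<in>homset C e1 (A \<boxtimes> Y). flat A Y t = v"
proof -
  obtain c where dp: "dual_pair (dual A) A (ev A) c" using compact_dualizable[OF A] by blast
  have vr: "v \<cdot> r (dual A) \<in> homset C (dual A \<boxtimes> e1) Y" using v by simp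
  have "flat A Y (mate c (dual A) A e1 (v \<cdot> r (dual A))) = (v \<cdot> r (dual A)) \<cdot> inv_arr C (r (dual A))"
    unfolding flat_def unmate_mate[OF dp vr tensor_simps(6)] ..
  then show ?thesis using mate_homset[OF dp vr] v by (intro bexI[of _ "mate c (dual A) A e1 (v \<cdot> r (dual A))"]) simp_all
qed

lemma flat_inj:
  assumes t: "t \<in> homset C e1 (A \<boxtimes> Y)" "t' \<in> homset C e1 (A \<boxtimes> Y)" "flat A Y t = flat A Y t'" and Y: "Y \<in> Obj C"
  shows "t = t'"
proof -
  obtain c where dp: "dual_pair (dual A) A (ev A) c" using compact_dualizable[OF A] by blast
  have iso: "iso_arr C (inv_arr C (r (dual A)))" by simp
  have eq: "unmate (ev A) (dual A) A Y t \<cdot> inv_arr C (r (dual A)) = unmate (ev A) (dual A) A Y t' \<cdot> inv_arr C (r (dual A))"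
    using t(3) by (simp only: flat_def)
  note u = unmate_homset[OF dp t(1) Y] unmate_homset[OF dp t(2) Y]
  have "unmate (ev A) (dual A) A Y t = unmate (ev A) (dual A) A Y t'"
    by (rule iso_right_cancel[OF iso _ _ _ _ eq]) (use u in simp_all)
  then show ?thesis using mate_unmate[OF dp t(1) Y] mate_unmate[OF dp t(2) Y] by metis
qed

lemma flat_zero:
  assumes [simp]: "Y \<in> Obj C" shows "flat A Y (Zero C e1 (A \<boxtimes> Y)) = Zero C (dual A) Y"
  unfolding flat_def unmate_def by simp

text \<open>Maps from the dual of \<open>A\<close> to \<open>P\<close> are maps from the unit to
  \<open>A \<boxtimes> P\<close>. Tensoring with \<open>A\<close> preserves coproducts and the unit
  is compact, so finite support is transported along \<open>flat\<close>.\<close>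

lemma compact_dual: "compact_obj U C (dual A)"
proof (rule compact_objI)
  show "dual A \<in> Obj C" by simp
  fix I :: "'u set" and Y P \<iota> q
  assume I: "small U I" and co: "is_coproduct C I Y P \<iota>" and q: "q \<in> homset C (dual A) P"
  have P [simp]: "P \<in> Obj C" using coproduct_simps(1)[OF co] .
  obtain t where t: "t \<in> homset C e1 (A \<boxtimes> P)" "flat A P t = q" using flat_surj[OF q] by blast
  note co' = tensor_coproduct_right[OF co AO]
  have "t \<in> coprod_span C I (\<lambda>j. A \<boxtimes> Y j) (A \<boxtimes> P) (\<lambda>j. i A \<diamondop> \<iota> j) e1"
    using compact_objD[OF unit_compact I co' t(1)] .
  then have "flat A P t \<in> coprod_span C I Y P \<iota> (dual A)"
  proof induction
    case zero
    then show ?case unfolding flat_zero[OF P] by (rule coprod_span.zero)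
  next
    case (inj j x)
    note c = coproduct_simps(2-5)[OF co inj(1)]
    have \<iota>: "\<iota> j \<in> homset C (Y j) P" using c by simp
    show ?case unfolding flat_comp[OF inj(2) \<iota>]
      by (rule coprod_span.inj[OF inj(1)]) (rule flat_homset[OF AO inj(2) c(4)])
  next
    case (add q r)
    have "q \<in> homset C e1 (A \<boxtimes> P)" "r \<in> homset C e1 (A \<boxtimes> P)" using add span_homset[OF co' tensor_simps(6)] by blast+
    then show ?case using add coprod_span.add by (simp only: flat_add P)
  qed
  then show "q \<in> coprod_span C I Y P \<iota> (dual A)" using t(2) by simp
qed

declare AO [simp del]

end

text \<open>The composite of \<open>flat\<close> for \<open>A\<close>, inverted, the braiding, and
  \<open>flat\<close> for \<open>W\<close>. It reconciles two descriptions: elements of the dual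
  functor at \<open>W\<close> are maps from the dual of \<open>W\<close> to \<open>A\<close>,
  whereas a presentation speaks of maps from the dual of \<open>A\<close> to
  \<open>W\<close>.\<close>

definition tau where
  "tau A W x = flat W A (b A W \<cdot> (THE t. t \<in> homset C e1 (A \<boxtimes> W) \<and> flat A W t = x))"

lemma tau_flat:
  assumes A: "compact_obj U C A" and W: "W \<in> Obj C" and t: "t \<in> homset C e1 (A \<boxtimes> W)"
  shows "tau A W (flat A W t) = flat W A (b A W \<cdot> t)"
proof -
  have "(THE t'. t' \<in> homset C e1 (A \<boxtimes> W) \<and> flat A W t' = flat A W t) = t"
    using t flat_inj[OF A _ t _ W] by (intro the_equality) blast+
  then show ?thesis by (simp add: tau_def)
qed

section \<open>Additivity, bijectivity and naturality of \<open>tau\<close>\<close>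

context
  fixes A W assumes A: "compact_obj U C A" and W: "compact_obj U C W"
begin

private lemma AO2 [simp]: "A \<in> Obj C" and WO [simp]: "W \<in> Obj C" using compact_obj_obj A W by auto

lemma tau_homset:
  assumes "x \<in> homset C (dual A) W" shows "tau A W x \<in> homset C (dual W) A"
proof -
  obtain t where t: "t \<in> homset C e1 (A \<boxtimes> W)" "x = flat A W t" using flat_surj[OF A assms] by blast
  show ?thesis unfolding t(2) tau_flat[OF A WO t(1)] by (rule flat_homset) (use t(1) in auto)
qed

lemma tau_add:
  assumes "x \<in> homset C (dual A) W" "y \<in> homset C (dual A) W"
  shows "tau A W (x \<boxplus> y) = tau A W x \<boxplus> tau A W y"
proof -
  obtain t where t: "t \<in> homset C e1 (A \<boxtimes> W)" "x = flat A W t" using flat_surj[OF A assms(1)] by blast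
  obtain s where s: "s \<in> homset C e1 (A \<boxtimes> W)" "y = flat A W s" using flat_surj[OF A assms(2)] by blast
  have ts: "t \<boxplus> s \<in> homset C e1 (A \<boxtimes> W)" using t(1) s(1) by simp
  have "b A W \<cdot> (t \<boxplus> s) = b A W \<cdot> t \<boxplus> b A W \<cdot> s" using t(1) s(1) by simp
  moreover have "flat W A (b A W \<cdot> t \<boxplus> b A W \<cdot> s) = flat W A (b A W \<cdot> t) \<boxplus> flat W A (b A W \<cdot> s)"
    by (rule flat_add[OF W]) (use t(1) s(1) in auto)
  ultimately show ?thesis
    unfolding t(2) s(2) flat_add[OF A t(1) s(1) WO, symmetric] tau_flat[OF A WO t(1)] tau_flat[OF A WO s(1)] tau_flat[OF A WO ts]
    by simp
qed

lemma tau_surj: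
  assumes "z \<in> homset C (dual W) A"
  shows "\<exists>x\<in>homset C (dual A) W. tau A W x = z"
proof -
  obtain s where s: "s \<in> homset C e1 (W \<boxtimes> A)" "flat W A s = z" using flat_surj[OF W assms] by blast
  have bs: "b W A \<cdot> s \<in> homset C e1 (A \<boxtimes> W)" using s(1) by simp
  have "b A W \<cdot> b W A \<cdot> s = s" using comp_reassoc[OF braid_symmetric[of W A], of s] s(1) by simp
  then have "tau A W (flat A W (b W A \<cdot> s)) = z" unfolding tau_flat[OF A WO bs] using s(2) by simp
  then show ?thesis using flat_homset[OF AO2 bs WO] by blast
qed

lemma tau_inj:
  assumes "x \<in> homset C (dual A) W" "y \<in> homset C (dual A) W" "tau A W x = tau A W y"
  shows "x = y"
proof -
  obtain t where t: "t \<in> homset C e1 (A \<boxtimes> W)" "x = flat A W t" using flat_surj[OF A assms(1)] by blast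
  obtain s where s: "s \<in> homset C e1 (A \<boxtimes> W)" "y = flat A W s" using flat_surj[OF A assms(2)] by blast
  have e: "flat W A (b A W \<cdot> t) = flat W A (b A W \<cdot> s)"
    using assms(3) unfolding t(2) s(2) tau_flat[OF A WO t(1)] tau_flat[OF A WO s(1)] .
  have "b A W \<cdot> t = b A W \<cdot> s" by (rule flat_inj[OF W _ _ e]) (use t(1) s(1) in auto)
  then have "t = s" by (rule iso_left_cancel[rotated -1]) (use t(1) s(1) in auto)
  then show ?thesis using t(2) s(2) by simp
qed

lemma tau_zero: "tau A W (Zero C (dual A) W) = Zero C (dual W) A"
proof -
  have z: "Zero C (dual A) W \<in> homset C (dual A) W" by simp
  show ?thesis using tau_add[OF z z] tau_homset[OF z] add_self_eq_zero[of "tau A W (Zero C (dual A) W)"] by simp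
qed

lemma tau_comp:
  assumes x: "x \<in> homset C (dual A) W" and w: "w \<in> homset C W W'"
  shows "tau A W' (w \<cdot> x) = tau A W x \<cdot> dual_arr C w"
proof -
  have W': "W' \<in> Obj C" using homset_obj(2)[OF w] .
  obtain t where t: "t \<in> homset C e1 (A \<boxtimes> W)" "x = flat A W t" using flat_surj[OF A x] by blast
  have wt: "(i A \<diamondop> w) \<cdot> t \<in> homset C e1 (A \<boxtimes> W')" and bt: "b A W \<cdot> t \<in> homset C e1 (W \<boxtimes> A)"
    using t(1) w W' by auto
  have "b A W' \<cdot> (i A \<diamondop> w) = (w \<diamondop> i A) \<cdot> b A W" using w W' by (subst braid_nat) auto
  from comp_reassoc[OF this, of t] have "b A W' \<cdot> (i A \<diamondop> w) \<cdot> t = (w \<diamondop> i A) \<cdot> b A W \<cdot> t"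
    using t(1) w W' by auto
  then show ?thesis
    unfolding t(2) flat_comp[OF A t(1) w, symmetric] tau_flat[OF A W' wt] tau_flat[OF A WO t(1)]
    using flat_dual[OF w bt AO2] by simp
qed

text \<open>Under \<open>tau\<close>, being killed by precomposition with the dual of
  \<open>f\<close> becomes being killed by \<open>f\<close>. This matches the exactness clauses of a
  presentation with the elements of the dual functor.\<close>

lemma tau_dual:
  assumes x: "x \<in> homset C (dual A) W" and f: "f \<in> homset C A B" and B: "compact_obj U C B"
  shows "tau B W (x \<cdot> dual_arr C f) = f \<cdot> tau A W x"
proof -
  have BO [simp]: "B \<in> Obj C" using compact_obj_obj[OF B] .
  obtain t where t: "t \<in> homset C e1 (A \<boxtimes> W)" "x = flat A W t" using flat_surj[OF A x] by blast
  have ft: "(f \<diamondop> i W) \<cdot> t \<in> homset C e1 (B \<boxtimes> W)" and bt: "b A W \<cdot> t \<in> homset C e1 (W \<boxtimes> A)"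
    using t(1) f by auto
  have "b B W \<cdot> (f \<diamondop> i W) = (i W \<diamondop> f) \<cdot> b A W" using f by (subst braid_nat) auto
  from comp_reassoc[OF this, of t] have "b B W \<cdot> (f \<diamondop> i W) \<cdot> t = (i W \<diamondop> f) \<cdot> b A W \<cdot> t"
    using t(1) f by auto
  then show ?thesis
    unfolding t(2) flat_dual[OF f t(1) WO, symmetric] tau_flat[OF B WO ft] tau_flat[OF A WO t(1)]
    using flat_comp[OF W bt f] by simp
qed

declare AO2 [simp del] WO [simp del]

end

text \<open>\<open>presents f h m\<close> says that \<open>D B \<rightarrow> D A \<rightarrow> P \<rightarrow> Q\<close>, for \<open>f : A \<rightarrow> B\<close>, \<open>h : P \<rightarrow> Q\<close>, becomes exact
  under \<open>Hom(-,W)\<close> for all compact \<open>W\<close>; equivalently \<open>h\<close> presents the functor \<open>\<delta> G\<close>, where \<open>f\<close> presents \<open>G\<close>.\<close>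

definition presents where
  "presents f h m \<longleftrightarrow> m \<in> homset C (dual (Dom C f)) (Dom C h) \<and>
     m \<cdot> dual_arr C f = Zero C (dual (Cod C f)) (Dom C h) \<and>
     (\<forall>W. compact_obj U C W \<longrightarrow>
       (\<forall>x\<in>homset C (Dom C h) W. x \<cdot> m = Zero C (dual (Dom C f)) W \<longleftrightarrow> x \<in> hom_image C h W) \<and>
       (\<forall>v\<in>homset C (dual (Dom C f)) W. v \<cdot> dual_arr C f = Zero C (dual (Cod C f)) W \<longrightarrow>
          (\<exists>x\<in>homset C (Dom C h) W. v = x \<cdot> m)))"

section \<open>Presentations of dual functors and their vanishing\<close>

context
  fixes f h assumes f: "f \<in> compact_arrs U C" and h: "h \<in> compact_arrs U C"
begin

private lemma fh [simp]: "f \<in> Arr C" "h \<in> Arr C" "Dom C f \<in> Obj C" "Cod C f \<in> Obj C" "Dom C h \<in> Obj C" "Cod C h \<in> Obj C"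
  and fc: "compact_obj U C (Dom C f)" "compact_obj U C (Cod C f)"
  and hc: "compact_obj U C (Dom C h)" "compact_obj U C (Cod C h)"
  using f h by (auto simp: compact_arrs_def)

private abbreviation (input) A where "A \<equiv> Dom C f"
private abbreviation (input) B where "B \<equiv> Cod C f"
private abbreviation (input) P where "P \<equiv> Dom C h"
private abbreviation (input) Q where "Q \<equiv> Cod C h"

private lemmas df [simp] = dual_arr(1-3)[of f, OF fh(1)]

private lemma delta_val: "val (delta U C (coker_functor C f)) W = ab_nat_group U C (coker_functor C f) (hom_functor C (dual W))"
  by (simp add: delta_def)

private lemma delta_car: "carrier (val (delta U C (coker_functor C f)) W) = ab_nat U C (coker_functor C f) (hom_functor C (dual W))"
  by (simp add: delta_val ab_nat_group_def)

private lemma delta_act_yon: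
  assumes z: "z \<in> homset C (dual (Dom C k)) A" "f \<cdot> z = Zero C (dual (Dom C k)) B" and k: "k \<in> Arr C"
  shows "act (delta U C (coker_functor C f)) k (yon U C f z) = yon U C f (z \<cdot> dual_arr C k)"
proof -
  note dk = dual_arr(1-3)[OF k]
  have z': "z \<cdot> dual_arr C k \<in> homset C (dual (Cod C k)) A" "f \<cdot> z \<cdot> dual_arr C k = Zero C (dual (Cod C k)) B"
    using z dk comp_reassoc[OF z(2), of "dual_arr C k"] k by auto
  have "yon U C f z X c \<cdot> dual_arr C k = yon U C f (z \<cdot> dual_arr C k) X c"
    if X: "compact_obj U C X" and c: "c \<in> carrier (val (coker_functor C f) X)" for X c
  proof -
    obtain t where t: "t \<in> homset C A X" "c = cls C f X t" using c by (rule coker_carrierE)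
    show ?thesis unfolding t(2) yon_apply[OF f X z t(1)] yon_apply[OF f X z' t(1)] using t z dk k by simp
  qed
  then show ?thesis
    unfolding delta_def by (auto simp: fun_eq_iff restrict_def) (auto simp: yon_def)
qed

text \<open>The Yoneda lemma is applied twice. For fixed \<open>W\<close>, the transformation
  attached to the class of \<open>x\<close> is a single map \<open>\<kappa> W x\<close>; and
  \<open>\<kappa>\<close> is natural in \<open>W\<close>, so it is determined by its value at the
  identity of the domain of \<open>h\<close>.\<close>

lemma presents_if_isomorphic:
  assumes iso: "ab_isomorphic U C (coker_functor C h) (delta U C (coker_functor C f))"
  shows "\<exists>m. presents f h m"
proof -
  obtain \<theta> where \<theta>: "\<theta> \<in> ab_nat U C (coker_functor C h) (delta U C (coker_functor C f))"
    and \<theta>i: "\<And>X. compact_obj U C X \<Longrightarrow> \<theta> X \<in> iso (val (coker_functor C h) X) (val (delta U C (coker_functor C f)) X)"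
    using iso unfolding ab_isomorphic_def by blast
  define \<kappa> where "\<kappa> W x = \<theta> W (cls C h W x) A (cls C f A (i A))" for W x
  have in_nat: "\<theta> W (cls C h W x) \<in> ab_nat U C (coker_functor C f) (hom_functor C (dual W))"
    if W: "compact_obj U C W" and x: "x \<in> homset C P W" for W x
    using \<theta>i[OF W] cls_in_carrier[OF x] unfolding iso_def delta_car[symmetric] by (auto dest: hom_in_carrier)
  have k: "\<kappa> W x \<in> homset C (dual W) A" "f \<cdot> \<kappa> W x = Zero C (dual W) B" "\<theta> W (cls C h W x) = yon U C f (\<kappa> W x)"
    if W: "compact_obj U C W" and x: "x \<in> homset C P W" for W x
    using ab_nat_yon[OF f in_nat[OF W x]] compact_obj_obj[OF W] unfolding \<kappa>_def by auto
  have k_add: "\<kappa> W (x \<boxplus> y) = \<kappa> W x \<boxplus> \<kappa> W y"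
    if W: "compact_obj U C W" and x: "x \<in> homset C P W" and y: "y \<in> homset C P W" for W x y
  proof -
    have xy: "x \<boxplus> y \<in> homset C P W" using x y by simp
    have "\<theta> W \<in> hom (val (coker_functor C h) W) (val (delta U C (coker_functor C f)) W)" using \<theta>i[OF W] by (simp add: iso_def)
    from hom_mult[OF this cls_in_carrier[OF x] cls_in_carrier[OF y]]
    have "yon U C f (\<kappa> W (x \<boxplus> y)) = yon U C f (\<kappa> W x \<boxplus> \<kappa> W y)"
      unfolding coker_mult[OF fh(2) compact_obj_obj[OF W] x y] k(3)[OF W x] k(3)[OF W y] k(3)[OF W xy] delta_val
        yon_add[OF f k(1,2)[OF W x] k(1,2)[OF W y]] .
    then have "yon U C f (\<kappa> W (x \<boxplus> y)) A (cls C f A (i A)) = yon U C f (\<kappa> W x \<boxplus> \<kappa> W y) A (cls C f A (i A))" by simp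
    moreover have "\<kappa> W x \<boxplus> \<kappa> W y \<in> homset C (dual W) A" "f \<cdot> (\<kappa> W x \<boxplus> \<kappa> W y) = Zero C (dual W) B"
      using k(1,2)[OF W x] k(1,2)[OF W y] compact_obj_obj[OF W] by auto
    ultimately show ?thesis using yon_eval[OF f] k(1,2)[OF W xy] by metis
  qed
  have k_nat: "\<kappa> W' (w \<cdot> x) = \<kappa> W x \<cdot> dual_arr C w"
    if W: "compact_obj U C W" "compact_obj U C W'" and x: "x \<in> homset C P W" and w: "w \<in> homset C W W'" for W W' x w
  proof -
    have ws: "w \<in> Arr C" "Dom C w = W" "Cod C w = W'" using w by auto
    have wc: "w \<in> compact_arrs U C" using w W by (auto simp: compact_arrs_def)
    have wx: "w \<cdot> x \<in> homset C P W'" using w x by simp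
    have "cls C h W x \<in> carrier (val (coker_functor C h) (Dom C w))" using cls_in_carrier[OF x] ws by simp
    then have "\<theta> (Cod C w) (act (coker_functor C h) w (cls C h W x)) =
        act (delta U C (coker_functor C f)) w (\<theta> (Dom C w) (cls C h W x))"
      using \<theta> wc unfolding ab_nat_def by blast
    moreover have "act (coker_functor C h) w (cls C h W x) = cls C h W' (w \<cdot> x)"
      using coker_act[OF fh(2) ws(1), of x] x ws by simp
    ultimately have "yon U C f (\<kappa> W' (w \<cdot> x)) = yon U C f (\<kappa> W x \<cdot> dual_arr C w)"
      using delta_act_yon[of "\<kappa> W x" w] k[OF W(1) x] k(3)[OF W(2) wx] ws by simp
    then have "yon U C f (\<kappa> W' (w \<cdot> x)) A (cls C f A (i A)) = yon U C f (\<kappa> W x \<cdot> dual_arr C w) A (cls C f A (i A))" by simp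
    moreover have "\<kappa> W x \<cdot> dual_arr C w \<in> homset C (dual W') A" "f \<cdot> \<kappa> W x \<cdot> dual_arr C w = Zero C (dual W') B"
      using k(1)[OF W(1) x] comp_reassoc[OF k(2)[OF W(1) x], of "dual_arr C w"] dual_arr(1-3)[OF ws(1)] ws
        compact_obj_obj[OF W(2)] by auto
    ultimately show ?thesis using yon_eval[OF f] k(1,2)[OF W(2) wx] by metis
  qed
  have k_zero: "\<kappa> W (Zero C P W) = Zero C (dual W) A" if W: "compact_obj U C W" for W
  proof -
    have z: "Zero C P W \<in> homset C P W" using compact_obj_obj[OF W] by simp
    show ?thesis using k_add[OF W z z] k(1)[OF W z] add_self_eq_zero[of "\<kappa> W (Zero C P W)"] compact_obj_obj[OF W] by simp
  qed
  have k_ker: "\<kappa> W x = Zero C (dual W) A \<longleftrightarrow> x \<in> hom_image C h W"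
    if W: "compact_obj U C W" and x: "x \<in> homset C P W" for W x
  proof -
    have z: "Zero C P W \<in> homset C P W" using compact_obj_obj[OF W] by simp
    have "\<kappa> W x = \<kappa> W (Zero C P W) \<longleftrightarrow> cls C h W x = cls C h W (Zero C P W)"
    proof
      assume "\<kappa> W x = \<kappa> W (Zero C P W)"
      then have "\<theta> W (cls C h W x) = \<theta> W (cls C h W (Zero C P W))" unfolding k(3)[OF W x] k(3)[OF W z] by simp
      moreover have "inj_on (\<theta> W) (carrier (val (coker_functor C h) W))" using \<theta>i[OF W] by (simp add: iso_def bij_betw_def)
      ultimately show "cls C h W x = cls C h W (Zero C P W)"
        using cls_in_carrier[OF x] cls_in_carrier[OF z] by (meson inj_onD)
    qed (simp add: \<kappa>_def)
    then show ?thesis unfolding k_zero[OF W] cls_zero_iff[OF fh(2) x] .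
  qed
  have k_surj: "\<exists>x\<in>homset C P W. \<kappa> W x = z"
    if W: "compact_obj U C W" and z: "z \<in> homset C (dual W) A" "f \<cdot> z = Zero C (dual W) B" for W z
  proof -
    have "yon U C f z \<in> \<theta> W ` carrier (val (coker_functor C h) W)"
      using \<theta>i[OF W] yon_in_ab_nat[OF f z] unfolding iso_def bij_betw_def delta_car[symmetric] by auto
    then obtain x where x: "x \<in> homset C P W" "yon U C f z = \<theta> W (cls C h W x)" by (auto simp: coker_carrier simp del: in_homset_iff)
    then have "\<kappa> W x = z" unfolding \<kappa>_def x(2)[symmetric] by (rule_tac yon_eval[OF f z])
    then show ?thesis using x(1) by blast
  qed
  have iP: "i P \<in> homset C P P" by simp
  \<comment> \<open>\<open>\<kappa>\<close> at the identity of \<open>P\<close> goes from the dual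
    of \<open>P\<close> to \<open>A\<close>. Its preimage under \<open>tau\<close> goes from the
    dual of \<open>A\<close> to \<open>P\<close>, and then \<open>\<kappa> W x\<close> corresponds
    to \<open>x \<cdot> m\<close>.\<close>
  obtain m where m: "m \<in> homset C (dual A) P" "tau A P m = \<kappa> P (i P)"
    using tau_surj[OF fc(1) hc(1) k(1)[OF hc(1) iP]] by blast
  have tm: "tau A W (x \<cdot> m) = \<kappa> W x" if W: "compact_obj U C W" and x: "x \<in> homset C P W" for W x
    using tau_comp[OF fc(1) hc(1) m(1) x] k_nat[OF hc(1) W iP x] m(2) x by simp
  have "presents f h m"
    unfolding presents_def
  proof (intro conjI allI impI ballI)
    show "m \<in> homset C (dual A) P" by (rule m(1))
    have "tau B P (m \<cdot> dual_arr C f) = tau B P (Zero C (dual B) P)"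
      using tau_dual[OF fc(1) hc(1) m(1) _ fc(2), of f] k(2)[OF hc(1) iP] m(2) tau_zero[OF fc(2) hc(1)] by simp
    then show "m \<cdot> dual_arr C f = Zero C (dual B) P"
      by (rule tau_inj[OF fc(2) hc(1), rotated -1]) (use m(1) in auto)
  next
    fix W x assume W: "compact_obj U C W" and x: "x \<in> homset C P W"
    have WO: "W \<in> Obj C" using compact_obj_obj[OF W] .
    have "x \<cdot> m = Zero C (dual A) W \<longleftrightarrow> tau A W (x \<cdot> m) = Zero C (dual W) A"
      unfolding tau_zero[OF fc(1) W, symmetric] using tau_inj[OF fc(1) W, of "x \<cdot> m" "Zero C (dual A) W"] x m(1) WO by auto
    then show "x \<cdot> m = Zero C (dual A) W \<longleftrightarrow> x \<in> hom_image C h W"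
      unfolding tm[OF W x] k_ker[OF W x] .
  next
    fix W v assume W: "compact_obj U C W" and v: "v \<in> homset C (dual A) W" "v \<cdot> dual_arr C f = Zero C (dual B) W"
    have "f \<cdot> tau A W v = Zero C (dual W) B"
      using tau_dual[OF fc(1) W v(1) _ fc(2), of f] v(2) tau_zero[OF fc(2) W] by simp
    then obtain x where x: "x \<in> homset C P W" "\<kappa> W x = tau A W v"
      using k_surj[OF W tau_homset[OF fc(1) W v(1)]] by blast
    have "v = x \<cdot> m"
      by (rule tau_inj[OF fc(1) W v(1)]) (use tm[OF W x(1)] x m(1) in auto)
    then show "\<exists>x\<in>homset C P W. v = x \<cdot> m" using x(1) by blast
  qed
  then show ?thesis by blast
qed

text \<open>The preceding construction run backwards: composing with \<open>m\<close> and applying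
  \<open>tau\<close> gives the transformation. The two exactness clauses of \<open>presents\<close>
  make it injective and surjective.\<close>

lemma isomorphic_if_presents:
  assumes m: "presents f h m"
  shows "ab_isomorphic U C (coker_functor C h) (delta U C (coker_functor C f))"
proof -
  have mh: "m \<in> homset C (dual A) P" "m \<cdot> dual_arr C f = Zero C (dual B) P"
    and m1: "\<And>W x. \<lbrakk>compact_obj U C W; x \<in> homset C P W\<rbrakk> \<Longrightarrow> x \<cdot> m = Zero C (dual A) W \<longleftrightarrow> x \<in> hom_image C h W"
    and m2: "\<And>W v. \<lbrakk>compact_obj U C W; v \<in> homset C (dual A) W; v \<cdot> dual_arr C f = Zero C (dual B) W\<rbrakk>
      \<Longrightarrow> \<exists>x\<in>homset C P W. v = x \<cdot> m"
    using m unfolding presents_def by blast+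
  define \<kappa> where "\<kappa> W x = tau A W (x \<cdot> m)" for W x
  define \<theta> where "\<theta> = (\<lambda>W\<in>{W. compact_obj U C W}. \<lambda>c\<in>carrier (val (coker_functor C h) W). yon U C f (\<kappa> W (SOME x. x \<in> c)))"
  have xm: "x \<cdot> m \<in> homset C (dual A) W" if "x \<in> homset C P W" for W x using that mh(1) by simp
  have k: "\<kappa> W x \<in> homset C (dual W) A" "f \<cdot> \<kappa> W x = Zero C (dual W) B"
    if W: "compact_obj U C W" and x: "x \<in> homset C P W" for W x
  proof -
    show "\<kappa> W x \<in> homset C (dual W) A" unfolding \<kappa>_def by (rule tau_homset[OF fc(1) W xm[OF x]])
    have "(x \<cdot> m) \<cdot> dual_arr C f = Zero C (dual B) W" using x mh compact_obj_obj[OF W] by auto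
    then show "f \<cdot> \<kappa> W x = Zero C (dual W) B"
      using tau_dual[OF fc(1) W xm[OF x] _ fc(2), of f] tau_zero[OF fc(2) W] by (simp add: \<kappa>_def)
  qed
  have k_add: "\<kappa> W (x \<boxplus> y) = \<kappa> W x \<boxplus> \<kappa> W y"
    if W: "compact_obj U C W" and x: "x \<in> homset C P W" and y: "y \<in> homset C P W" for W x y
  proof -
    have "(x \<boxplus> y) \<cdot> m = x \<cdot> m \<boxplus> y \<cdot> m" using x y mh(1) by simp
    then show ?thesis unfolding \<kappa>_def using tau_add[OF fc(1) W xm[OF x] xm[OF y]] by simp
  qed
  have k_image: "\<kappa> W x = Zero C (dual W) A" if W: "compact_obj U C W" and x: "x \<in> hom_image C h W" for W x
  proof -
    have "x \<in> homset C P W" using hom_image_homset[OF fh(2)] x by blast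
    from m1[OF W this] show ?thesis unfolding \<kappa>_def using x tau_zero[OF fc(1) W] by simp
  qed
  have th: "\<theta> W (cls C h W x) = yon U C f (\<kappa> W x)" if W: "compact_obj U C W" and x: "x \<in> homset C P W" for W x
  proof -
    have [simp]: "W \<in> Obj C" using compact_obj_obj[OF W] .
    have "x \<in> cls C h W x"
      unfolding cls_def using x by (intro image_eqI[of _ _ "Zero C Q W"]) auto
    then have "(SOME y. y \<in> cls C h W x) \<in> cls C h W x" by (rule someI)
    then obtain u where u: "u \<in> homset C Q W" "(SOME y. y \<in> cls C h W x) = u \<cdot> h \<boxplus> x" by (auto simp: cls_def)
    have uh: "u \<cdot> h \<in> homset C P W" "u \<cdot> h \<in> hom_image C h W" using u(1) by (auto simp: hom_image_def)
    \<comment> \<open>Independence of the chosen representative: two of them differ by a multiple of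
      \<open>h\<close>, and \<open>\<kappa>\<close> vanishes on these.\<close>
    have "\<kappa> W (u \<cdot> h \<boxplus> x) = \<kappa> W x"
      unfolding k_add[OF W uh(1) x] k_image[OF W uh(2)] using k(1)[OF W x] by simp
    then show ?thesis using W cls_in_carrier[OF x] u(2) by (simp add: \<theta>_def)
  qed
  have hom: "\<theta> W \<in> hom (val (coker_functor C h) W) (val (delta U C (coker_functor C f)) W)" if W: "compact_obj U C W" for W
  proof (rule homI)
    fix c assume "c \<in> carrier (val (coker_functor C h) W)"
    then obtain x where x: "x \<in> homset C P W" "c = cls C h W x" by (rule coker_carrierE)
    show "\<theta> W c \<in> carrier (val (delta U C (coker_functor C f)) W)"
      unfolding x(2) th[OF W x(1)] delta_car by (rule yon_in_ab_nat[OF f k[OF W x(1)]])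
    fix d assume "d \<in> carrier (val (coker_functor C h) W)"
    then obtain y where y: "y \<in> homset C P W" "d = cls C h W y" by (rule coker_carrierE)
    have xy: "x \<boxplus> y \<in> homset C P W" using x y by simp
    show "\<theta> W (c \<otimes>\<^bsub>val (coker_functor C h) W\<^esub> d) = \<theta> W c \<otimes>\<^bsub>val (delta U C (coker_functor C f)) W\<^esub> \<theta> W d"
      unfolding x(2) y(2) coker_mult[OF fh(2) compact_obj_obj[OF W] x(1) y(1)] th[OF W x(1)] th[OF W y(1)] th[OF W xy]
        delta_val yon_add[OF f k[OF W x(1)] k[OF W y(1)]] k_add[OF W x(1) y(1)] ..
  qed
  have "\<theta> \<in> ab_nat U C (coker_functor C h) (delta U C (coker_functor C f))"
    unfolding ab_nat_def
  proof (intro CollectI conjI PiE_I ballI IntI)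
    fix W assume "W \<in> {W. compact_obj U C W}"
    then show "\<theta> W \<in> hom (val (coker_functor C h) W) (val (delta U C (coker_functor C f)) W)"
      "\<theta> W \<in> extensional (carrier (val (coker_functor C h) W))" using hom by (auto simp: \<theta>_def)
  next
    fix W assume "W \<notin> {W. compact_obj U C W}" then show "\<theta> W = undefined" by (simp add: \<theta>_def)
  next
    fix w c assume w: "w \<in> compact_arrs U C" and c: "c \<in> carrier (val (coker_functor C h) (Dom C w))"
    obtain x where x: "x \<in> homset C P (Dom C w)" "c = cls C h (Dom C w) x" using c by (rule coker_carrierE)
    have W: "w \<in> Arr C" "compact_obj U C (Dom C w)" "compact_obj U C (Cod C w)" using w by (auto simp: compact_arrs_def)
    have wh: "w \<in> homset C (Dom C w) (Cod C w)" using W by simp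
    have wx: "w \<cdot> x \<in> homset C P (Cod C w)" using W x by simp
    have "\<kappa> (Cod C w) (w \<cdot> x) = \<kappa> (Dom C w) x \<cdot> dual_arr C w"
      using tau_comp[OF fc(1) W(2) xm[OF x(1)] wh] x(1) mh(1) W(1) by (simp add: \<kappa>_def)
    then show "\<theta> (Cod C w) (act (coker_functor C h) w c) = act (delta U C (coker_functor C f)) w (\<theta> (Dom C w) c)"
      unfolding x(2) coker_act[OF fh(2) W(1) x(1)] th[OF W(2) x(1)] th[OF W(3) wx] delta_act_yon[OF k[OF W(2) x(1)] W(1)]
      by simp
  qed
  moreover have "\<theta> W \<in> iso (val (coker_functor C h) W) (val (delta U C (coker_functor C f)) W)" if W: "compact_obj U C W" for W
  proof -
    have "inj_on (\<theta> W) (carrier (val (coker_functor C h) W))"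
    proof (rule inj_onI)
      fix c d assume "c \<in> carrier (val (coker_functor C h) W)" "d \<in> carrier (val (coker_functor C h) W)" and e: "\<theta> W c = \<theta> W d"
      then obtain x y where x: "x \<in> homset C P W" "c = cls C h W x" and y: "y \<in> homset C P W" "d = cls C h W y"
        by (metis coker_carrierE)
      have "yon U C f (\<kappa> W x) A (cls C f A (i A)) = yon U C f (\<kappa> W y) A (cls C f A (i A))"
        using e unfolding x(2) y(2) th[OF W x(1)] th[OF W y(1)] by simp
      then have "\<kappa> W x = \<kappa> W y" unfolding yon_eval[OF f k[OF W x(1)]] yon_eval[OF f k[OF W y(1)]] .
      then have eq: "x \<cdot> m = y \<cdot> m" unfolding \<kappa>_def by (rule tau_inj[OF fc(1) W xm[OF x(1)] xm[OF y(1)]])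
      have d: "x \<boxplus> neg_arr C y \<in> homset C P W" using x y by simp
      have "(x \<boxplus> neg_arr C y) \<cdot> m = Zero C (dual A) W" using x y mh(1) eq by simp
      then have "x \<boxplus> neg_arr C y \<in> hom_image C h W" using m1[OF W d] by simp
      then obtain u where u: "u \<in> homset C Q W" "x \<boxplus> neg_arr C y = u \<cdot> h" by (auto simp: hom_image_def)
      have "x = x \<boxplus> neg_arr C y \<boxplus> y" by (rule diff_add_cancel(1)[symmetric]) (use x y in auto)
      then have "x = u \<cdot> h \<boxplus> y" using u(2) by simp
      then show "c = d" unfolding x(2) y(2) cls_eq_iff[OF fh(2) x(1) y(1)] using u(1) by blast
    qed
    moreover have "\<theta> W ` carrier (val (coker_functor C h) W) = carrier (val (delta U C (coker_functor C f)) W)"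
    proof
      show "\<theta> W ` carrier (val (coker_functor C h) W) \<subseteq> carrier (val (delta U C (coker_functor C f)) W)"
        using hom[OF W] by (auto dest: hom_in_carrier)
      show "carrier (val (delta U C (coker_functor C f)) W) \<subseteq> \<theta> W ` carrier (val (coker_functor C h) W)"
      proof
        fix \<phi> assume "\<phi> \<in> carrier (val (delta U C (coker_functor C f)) W)"
        then have "\<phi> \<in> ab_nat U C (coker_functor C f) (hom_functor C (dual W))" unfolding delta_car .
        from ab_nat_yon[OF f this] obtain z where z: "z \<in> homset C (dual W) A" "f \<cdot> z = Zero C (dual W) B" "\<phi> = yon U C f z"
          using compact_obj_obj[OF W] by auto
        obtain v where v: "v \<in> homset C (dual A) W" "tau A W v = z" using tau_surj[OF fc(1) W z(1)] by blast
        have "tau B W (v \<cdot> dual_arr C f) = tau B W (Zero C (dual B) W)"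
          using tau_dual[OF fc(1) W v(1) _ fc(2), of f] v(2) z(2) tau_zero[OF fc(2) W] by simp
        then have "v \<cdot> dual_arr C f = Zero C (dual B) W"
          by (rule tau_inj[OF fc(2) W, rotated -1]) (use v(1) compact_obj_obj[OF W] in auto)
        from m2[OF W v(1) this] obtain x where x: "x \<in> homset C P W" "v = x \<cdot> m" by blast
        have "\<phi> = \<theta> W (cls C h W x)" unfolding th[OF W x(1)] z(3) \<kappa>_def x(2)[symmetric] v(2) ..
        then show "\<phi> \<in> \<theta> W ` carrier (val (coker_functor C h) W)" using cls_in_carrier[OF x(1)] by blast
      qed
    qed
    ultimately show ?thesis using hom[OF W] by (simp add: iso_def bij_betw_def)
  qed
  ultimately show ?thesis unfolding ab_isomorphic_def by blast
qed

text \<open>The clauses of \<open>presents\<close> concern compact objects, while \<open>Y\<close>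
  is arbitrary. The way out is the cone \<open>?M\<close> of the dual of \<open>f\<close>, which is
  compact: \<open>m\<close> and the cone map \<open>g\<close> factor through each other up to maps
  through \<open>h\<close>, and these factorisations can then be composed with maps into any
  \<open>Y\<close>.\<close>

lemma presents_vanishing:
  assumes m: "presents f h m" and Y [simp]: "Y \<in> Obj C"
  shows "homset C P Y \<subseteq> hom_image C h Y \<longleftrightarrow>
    (\<forall>v\<in>homset C (dual A) Y. v \<cdot> dual_arr C f = Zero C (dual B) Y \<longrightarrow> v = Zero C (dual A) Y)"
proof -
  have mh: "m \<in> homset C (dual A) P" "m \<cdot> dual_arr C f = Zero C (dual B) P"
    and m1: "\<And>W x. \<lbrakk>compact_obj U C W; x \<in> homset C P W\<rbrakk> \<Longrightarrow> x \<cdot> m = Zero C (dual A) W \<longleftrightarrow> x \<in> hom_image C h W"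
    and m2: "\<And>W v. \<lbrakk>compact_obj U C W; v \<in> homset C (dual A) W; v \<cdot> dual_arr C f = Zero C (dual B) W\<rbrakk>
      \<Longrightarrow> \<exists>x\<in>homset C P W. v = x \<cdot> m"
    using m unfolding presents_def by blast+
  obtain g k where t: "(dual_arr C f, g, k) \<in> Tri C" using tri_exists[of "dual_arr C f"] by auto
  note ts = tri_simps[OF t]
  let ?M = "Cod C g"
  have M: "compact_obj U C ?M" using compact_cone[OF t] compact_dual[OF fc(1)] compact_dual[OF fc(2)] by simp
  have SB: "compact_obj U C (S (dual B))" using compact_susp[OF compact_dual[OF fc(2)]] .
  have [simp]: "m \<in> Arr C" "Dom C m = dual A" "Cod C m = P" "g \<in> Arr C" "k \<in> Arr C" "Dom C g = dual A" "Dom C k = ?M"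
    "Cod C k = S (dual B)" using mh(1) ts by auto
  have "g \<cdot> dual_arr C f = Zero C (dual B) ?M" using tri_comp_zero[OF t] by simp
  \<comment> \<open>Compactness of \<open>?M\<close> is used here; the factorisation of
    \<open>m\<close> through \<open>g\<close> in the other direction comes from the
    triangle.\<close>
  from m2[OF M _ this] obtain x where x: "x \<in> homset C P ?M" "g = x \<cdot> m" by auto
  obtain n where n: "n \<in> homset C ?M P" "m = n \<cdot> g" using tri_extend[OF t, of m P] mh by auto
  have xn [simp]: "x \<in> Arr C" "Dom C x = P" "Cod C x = ?M" "n \<in> Arr C" "Dom C n = ?M" "Cod C n = P" using x(1) n(1) by auto
  \<comment> \<open>\<open>n\<close> and \<open>x\<close> need not be mutually inverse, but the
    defect vanishes on \<open>m\<close> and therefore factors through \<open>h\<close>.\<close>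
  have "(i P \<boxplus> neg_arr C (n \<cdot> x)) \<cdot> m = m \<boxplus> neg_arr C (n \<cdot> x \<cdot> m)" by simp
  also have "\<dots> = Zero C (dual A) P" using x(2) n(2) by simp
  finally have "i P \<boxplus> neg_arr C (n \<cdot> x) \<in> hom_image C h P" using m1[OF hc(1), of "i P \<boxplus> neg_arr C (n \<cdot> x)"] by simp
  then obtain c where c: "c \<in> homset C Q P" "i P \<boxplus> neg_arr C (n \<cdot> x) = c \<cdot> h" by (auto simp: hom_image_def)
  have [simp]: "c \<in> Arr C" "Dom C c = Q" "Cod C c = P" using c(1) by auto
  have "(k \<cdot> x) \<cdot> m = k \<cdot> g" unfolding x(2) by (rule assoc) simp_all
  also have "\<dots> = Zero C (dual A) (S (dual B))" using tri_comp_zero2[OF t] by simp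
  finally have "k \<cdot> x \<in> hom_image C h (S (dual B))" using m1[OF SB, of "k \<cdot> x"] by simp
  then obtain e where e: "e \<in> homset C Q (S (dual B))" "k \<cdot> x = e \<cdot> h" by (auto simp: hom_image_def)
  have [simp]: "e \<in> Arr C" "Dom C e = Q" "Cod C e = S (dual B)" using e(1) by auto
  show ?thesis
  proof
    assume sub: "homset C P Y \<subseteq> hom_image C h Y"
    show "\<forall>v\<in>homset C (dual A) Y. v \<cdot> dual_arr C f = Zero C (dual B) Y \<longrightarrow> v = Zero C (dual A) Y"
    proof (intro ballI impI)
      fix v assume v: "v \<in> homset C (dual A) Y" "v \<cdot> dual_arr C f = Zero C (dual B) Y"
      obtain v' where v': "v' \<in> homset C ?M Y" "v = v' \<cdot> g" using tri_extend[OF t, of v Y] v by auto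
      have "v' \<cdot> x \<in> hom_image C h Y" using sub v'(1) by auto
      then obtain u where u: "u \<in> homset C Q Y" "v' \<cdot> x = u \<cdot> h" by (auto simp: hom_image_def)
      have "h \<in> hom_image C h Q" unfolding hom_image_def by (intro image_eqI[of _ _ "i Q"]) auto
      then have hm: "h \<cdot> m = Zero C (dual A) Q" using m1[OF hc(2), of h] by simp
      have "v = v' \<cdot> x \<cdot> m" using v'(2) unfolding x(2) .
      also have "\<dots> = (v' \<cdot> x) \<cdot> m" by (rule assoc[symmetric]) (use v'(1) in simp_all)
      also have "\<dots> = u \<cdot> h \<cdot> m" unfolding u(2) using u(1) by simp
      also have "\<dots> = Zero C (dual A) Y" unfolding hm using u(1) by simp
      finally show "v = Zero C (dual A) Y" .
    qed
  next
    assume inj: "\<forall>v\<in>homset C (dual A) Y. v \<cdot> dual_arr C f = Zero C (dual B) Y \<longrightarrow> v = Zero C (dual A) Y"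
    show "homset C P Y \<subseteq> hom_image C h Y"
    proof
      fix y assume y: "y \<in> homset C P Y"
      have [simp]: "y \<in> Arr C" "Dom C y = P" "Cod C y = Y" using y by auto
      have "(y \<cdot> m) \<cdot> dual_arr C f = Zero C (dual B) Y" using mh(2) by simp
      then have ym: "y \<cdot> m = Zero C (dual A) Y" using inj by auto
      then have "(y \<cdot> n) \<cdot> g = Zero C (dual A) Y" using n(2) by simp
      then obtain w where w: "w \<in> homset C (S (dual B)) Y" "y \<cdot> n = w \<cdot> k" using tri_extend2[OF t, of "y \<cdot> n" Y] by auto
      have [simp]: "w \<in> Arr C" "Dom C w = S (dual B)" "Cod C w = Y" using w by auto
      have "i P = c \<cdot> h \<boxplus> n \<cdot> x" using diff_add_cancel(1)[of "i P" "n \<cdot> x"] c(2) by simp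
      then have "y = y \<cdot> (c \<cdot> h \<boxplus> n \<cdot> x)" using comp_id_right[of y P] by simp
      also have "\<dots> = (y \<cdot> c) \<cdot> h \<boxplus> (y \<cdot> n) \<cdot> x" by simp
      also have "(y \<cdot> n) \<cdot> x = w \<cdot> e \<cdot> h" unfolding w(2) using e(2) by simp
      also have "(y \<cdot> c) \<cdot> h \<boxplus> w \<cdot> e \<cdot> h = (y \<cdot> c \<boxplus> w \<cdot> e) \<cdot> h" by simp
      finally show "y \<in> hom_image C h Y" unfolding hom_image_def by (intro image_eqI[of _ _ "y \<cdot> c \<boxplus> w \<cdot> e"]) auto
    qed
  qed
qed

declare fh [simp del] df [simp del]

end

text \<open>Maps out of the triangle on the dual of \<open>f\<close> form exact sequences, so its
  third map presents the dual functor. It runs between compact objects because duals, cones and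
  suspensions of compact objects are compact.\<close>

lemma presentation_exists:
  assumes f: "f \<in> compact_arrs U C"
  shows "\<exists>h\<in>compact_arrs U C. \<exists>m. presents f h m"
proof -
  have fA [simp]: "f \<in> Arr C" and fc: "compact_obj U C (Dom C f)" "compact_obj U C (Cod C f)"
    using f by (auto simp: compact_arrs_def)
  note [simp] = dual_arr(1-3)[OF fA]
  obtain g k where t: "(dual_arr C f, g, k) \<in> Tri C" using tri_exists[of "dual_arr C f"] by auto
  note [simp] = tri_simps[OF t]
  have "k \<in> compact_arrs U C"
    using compact_cone[OF t] compact_dual[OF fc(1)] compact_dual[OF fc(2)] compact_susp[OF compact_dual[OF fc(2)]]
    by (simp add: compact_arrs_def)
  moreover have "presents f k g"
    unfolding presents_def
  proof (intro conjI allI impI ballI)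
    show "g \<in> homset C (dual (Dom C f)) (Dom C k)" by simp
    show "g \<cdot> dual_arr C f = Zero C (dual (Cod C f)) (Dom C k)" using tri_comp_zero[OF t] by simp
    fix W x assume W: "compact_obj U C W" and x: "x \<in> homset C (Dom C k) W"
    show "x \<cdot> g = Zero C (dual (Dom C f)) W \<longleftrightarrow> x \<in> hom_image C k W"
    proof
      assume "x \<cdot> g = Zero C (dual (Dom C f)) W"
      then obtain y where "y \<in> homset C (S (dual (Cod C f))) W" "x = y \<cdot> k"
        using tri_extend2[OF t, of x W] x by auto
      then show "x \<in> hom_image C k W" by (auto simp: hom_image_def)
    next
      assume "x \<in> hom_image C k W"
      then obtain y where y: "y \<in> homset C (S (dual (Cod C f))) W" "x = y \<cdot> k" by (auto simp: hom_image_def)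
      then have "x \<cdot> g = y \<cdot> k \<cdot> g" by simp
      then show "x \<cdot> g = Zero C (dual (Dom C f)) W" using tri_comp_zero2[OF t] y(1) by simp
    qed
  next
    fix W v assume "compact_obj U C W" and v: "v \<in> homset C (dual (Dom C f)) W"
      and 0: "v \<cdot> dual_arr C f = Zero C (dual (Cod C f)) W"
    have "v \<in> homset C (Cod C (dual_arr C f)) W" "v \<cdot> dual_arr C f = Zero C (Dom C (dual_arr C f)) W"
      using v 0 by simp_all
    from tri_extend[OF t this] obtain x where "x \<in> homset C (Cod C g) W" "v = x \<cdot> g" by blast
    then show "\<exists>x\<in>homset C (Dom C k) W. v = x \<cdot> g" by auto
  qed
  ultimately show ?thesis by blast
qed

lemma dual_injective_iff:
  assumes f: "f \<in> compact_arrs U C" and Y [simp]: "Y \<in> Obj C"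
  shows "(\<forall>v\<in>homset C (dual (Dom C f)) Y. v \<cdot> dual_arr C f = Zero C (dual (Cod C f)) Y \<longrightarrow> v = Zero C (dual (Dom C f)) Y)
    \<longleftrightarrow> (\<forall>t\<in>homset C e1 (Dom C f \<boxtimes> Y). (f \<diamondop> i Y) \<cdot> t = Zero C e1 (Cod C f \<boxtimes> Y) \<longrightarrow> t = Zero C e1 (Dom C f \<boxtimes> Y))"
proof -
  let ?A = "Dom C f" and ?B = "Cod C f"
  have fA [simp]: "f \<in> Arr C" and fc: "compact_obj U C ?A" "compact_obj U C ?B"
    using f by (auto simp: compact_arrs_def)
  have fh: "f \<in> homset C ?A ?B" by simp
  have 1: "flat ?A Y t \<cdot> dual_arr C f = Zero C (dual ?B) Y \<longleftrightarrow> (f \<diamondop> i Y) \<cdot> t = Zero C e1 (?B \<boxtimes> Y)"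
    if t: "t \<in> homset C e1 (?A \<boxtimes> Y)" for t
  proof -
    have "flat ?B Y ((f \<diamondop> i Y) \<cdot> t) = flat ?B Y (Zero C e1 (?B \<boxtimes> Y)) \<longleftrightarrow> (f \<diamondop> i Y) \<cdot> t = Zero C e1 (?B \<boxtimes> Y)"
      using flat_inj[OF fc(2), of "(f \<diamondop> i Y) \<cdot> t" Y "Zero C e1 (?B \<boxtimes> Y)"] t by auto
    then show ?thesis unfolding flat_dual[OF fh t Y] flat_zero[OF fc(2) Y] .
  qed
  have 2: "flat ?A Y t = Zero C (dual ?A) Y \<longleftrightarrow> t = Zero C e1 (?A \<boxtimes> Y)" if t: "t \<in> homset C e1 (?A \<boxtimes> Y)" for t
    using flat_inj[OF fc(1), of t Y "Zero C e1 (?A \<boxtimes> Y)"] t flat_zero[OF fc(1) Y] by auto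
  have 3: "(\<forall>v\<in>homset C (dual ?A) Y. R v) \<longleftrightarrow> (\<forall>t\<in>homset C e1 (?A \<boxtimes> Y). R (flat ?A Y t))" for R
    using flat_surj[OF fc(1), of _ Y] flat_homset[of ?A _ Y] dom_obj[OF fA] Y by metis
  show ?thesis unfolding 3 using 1 2 by (simp del: in_homset_iff)
qed

section \<open>The dual definable category described by injectivity\<close>

definition tensor_injective where
  "tensor_injective f Y \<longleftrightarrow>
     (\<forall>t\<in>homset C e1 (Dom C f \<boxtimes> Y). (f \<diamondop> i Y) \<cdot> t = Zero C e1 (Cod C f \<boxtimes> Y) \<longrightarrow> t = Zero C e1 (Dom C f \<boxtimes> Y))"

lemma annihilator_iff:
  assumes "D \<subseteq> Obj C"
  shows "f \<in> annihilator U C D \<longleftrightarrow> f \<in> compact_arrs U C \<and> (\<forall>X\<in>D. homset C (Dom C f) X \<subseteq> hom_image C f X)"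
  using trivial_coker_iff[of f] assms by (auto simp: annihilator_def compact_arrs_def simp del: in_homset_iff)

text \<open>The two families of tests match: every annihilating \<open>f\<close> has some
  \<open>h\<close> presenting its dual functor, and every \<open>h\<close> in
  \<open>delta_annihilator\<close> satisfies \<open>presents\<close> for some annihilating
  \<open>f\<close>. Isomorphisms of functors need not be considered after this.\<close>

lemma dual_definable_iff:
  shows "Y \<in> dual_definable U C D \<longleftrightarrow> Y \<in> Obj C \<and> (\<forall>f\<in>annihilator U C D. tensor_injective f Y)"
proof (cases "Y \<in> Obj C")
  case Y: True
  have *: "trivial_group (val (coker_functor C h) Y) \<longleftrightarrow> tensor_injective f Y"
    if f: "f \<in> compact_arrs U C" and h: "h \<in> compact_arrs U C" and m: "presents f h m" for f h m
  proof -
    have hA: "h \<in> Arr C" using h by (simp add: compact_arrs_def)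
    show ?thesis
      unfolding trivial_coker_iff[OF hA Y] presents_vanishing[OF f h m Y] dual_injective_iff[OF f Y]
        tensor_injective_def ..
  qed
  have ann: "f \<in> compact_arrs U C" if "f \<in> annihilator U C D" for f using that by (simp add: annihilator_def)
  show ?thesis
  proof
    assume Yd: "Y \<in> dual_definable U C D"
    have "tensor_injective f Y" if f: "f \<in> annihilator U C D" for f
    proof -
      obtain h m where h: "h \<in> compact_arrs U C" "presents f h m" using presentation_exists[OF ann[OF f]] by blast
      have "h \<in> delta_annihilator U C D"
        using h f isomorphic_if_presents[OF ann[OF f] h] by (auto simp: delta_annihilator_def)
      then have "trivial_group (val (coker_functor C h) Y)" using Yd by (simp add: dual_definable_def)
      then show ?thesis using *[OF ann[OF f] h] by simp
    qed
    then show "Y \<in> Obj C \<and> (\<forall>f\<in>annihilator U C D. tensor_injective f Y)" using Y by blast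
  next
    assume inj: "Y \<in> Obj C \<and> (\<forall>f\<in>annihilator U C D. tensor_injective f Y)"
    have "trivial_group (val (coker_functor C h) Y)" if h: "h \<in> delta_annihilator U C D" for h
    proof -
      obtain f where f: "h \<in> compact_arrs U C" "f \<in> annihilator U C D"
        "ab_isomorphic U C (coker_functor C h) (delta U C (coker_functor C f))"
        using h by (auto simp: delta_annihilator_def)
      obtain m where "presents f h m" using presents_if_isomorphic[OF ann[OF f(2)] f(1,3)] by blast
      from *[OF ann[OF f(2)] f(1) this] show ?thesis using inj f(2) by blast
    qed
    then show "Y \<in> dual_definable U C D" using Y by (simp add: dual_definable_def)
  qed
qed (simp add: dual_definable_def)

text \<open>A map killed by \<open>s \<diamondop> i Y\<close> lifts along
  \<open>p \<diamondop> i Y\<close>. As the unit is compact, the lift is a finite sum of maps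
  through single members of \<open>M\<close>, and each of these contributes zero.\<close>

lemma kills_tensor_mono:
  assumes k: "kills C M X X' s" and Y [simp]: "Y \<in> Obj C" and M: "small U M"
    and 0: "\<And>m x. m \<in> M \<Longrightarrow> x \<in> homset C e1 (Dom C m \<boxtimes> Y) \<Longrightarrow> (m \<diamondop> i Y) \<cdot> x = Zero C e1 (X \<boxtimes> Y)"
    and t: "t \<in> homset C e1 (X \<boxtimes> Y)" and st: "(s \<diamondop> i Y) \<cdot> t = Zero C e1 (X' \<boxtimes> Y)"
  shows "t = Zero C e1 (X \<boxtimes> Y)"
proof -
  obtain p h \<iota> where tr: "(p, s, h) \<in> Tri C" and co: "is_coproduct C M (Dom C) (Dom C p) \<iota>"
    and cd: "Cod C p = X" "Cod C s = X'" and p\<iota>: "\<And>m. m \<in> M \<Longrightarrow> p \<cdot> \<iota> m = m" using k unfolding kills_def by blast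
  note [simp] = tri_simps[OF tr] cd
  have [simp]: "X \<in> Obj C" using cod_obj[of p] by simp
  obtain h' where tr': "(p \<diamondop> i Y, s \<diamondop> i Y, h') \<in> Tri C" using tensor_tri[OF tr Y] by blast
  obtain u where u: "u \<in> homset C e1 (Dom C p \<boxtimes> Y)" "t = (p \<diamondop> i Y) \<cdot> u"
    using tri_lift[OF tr', of t e1] t st by auto
  have "u \<in> homset C e1 (fobj (right_tensor C Y) (Dom C p))" using u(1) by simp
  with tensor_cocont[OF Y] M co unit_compact have "(p \<diamondop> i Y) \<cdot> u = Zero C e1 (X \<boxtimes> Y)"
  proof (induction rule: cocont_span_induct)
    case (inj m x)
    note c = coproduct_simps(2-5)[OF co inj(1)]
    have x: "x \<in> homset C e1 (Dom C m \<boxtimes> Y)" using inj(2) by simp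
    have "(p \<diamondop> i Y) \<cdot> (\<iota> m \<diamondop> i Y) \<cdot> x = ((p \<cdot> \<iota> m) \<diamondop> i Y) \<cdot> x"
      using comp_reassoc[OF whisker_right[symmetric], of "\<iota> m" p Y x] c x by simp
    then show ?case using p\<iota>[OF inj(1)] 0[OF inj(1) x] by simp
  qed auto
  then show ?thesis using u(2) by simp
qed

theorem dual_definable_eq:
  assumes \<Phi>: "small U \<Phi>" "\<Phi> \<subseteq> compact_arrs U C"
    and D: "D = {X \<in> Obj C. \<forall>f\<in>\<Phi>. hom_image C f X = homset C (Dom C f) X}"
  shows "dual_definable U C D = {Y \<in> Obj C. \<forall>f\<in>\<Phi>. tensor_injective f Y}"
proof (intro equalityI subsetI)
  have DO: "D \<subseteq> Obj C" using D by blast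
  fix Y assume "Y \<in> dual_definable U C D"
  moreover have "f \<in> annihilator U C D" if f: "f \<in> \<Phi>" for f
  proof -
    have "hom_image C f X = homset C (Dom C f) X" if "X \<in> D" for X using that f unfolding D by blast
    then show ?thesis unfolding annihilator_iff[OF DO] using f \<Phi>(2) by blast
  qed
  ultimately show "Y \<in> {Y \<in> Obj C. \<forall>f\<in>\<Phi>. tensor_injective f Y}" unfolding dual_definable_iff by blast
next
  have DO: "D \<subseteq> Obj C" using D by blast
  fix Y assume "Y \<in> {Y \<in> Obj C. \<forall>f\<in>\<Phi>. tensor_injective f Y}"
  then have Y [simp]: "Y \<in> Obj C" and inj: "\<And>f. f \<in> \<Phi> \<Longrightarrow> tensor_injective f Y" by auto
  have \<Phi>A: "f \<in> Arr C" "compact_obj U C (Dom C f)" if "f \<in> \<Phi>" for f using \<Phi>(2) that by (auto simp: compact_arrs_def)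
  have "\<exists>w. \<exists>k. (w, f, k) \<in> Tri C" if "f \<in> \<Phi>" for f using tri_fibre[OF \<Phi>A(1)[OF that]] by metis
  then obtain w where w: "\<And>f. f \<in> \<Phi> \<Longrightarrow> \<exists>k. (w f, f, k) \<in> Tri C" by metis
  have ws: "w f \<in> Arr C" "Cod C (w f) = Dom C f" if "f \<in> \<Phi>" for f using w[OF that] tri_simps by metis+
  \<comment> \<open>A map from \<open>Dom C f\<close> factors through \<open>f\<close> exactly when
    it vanishes on the fibre \<open>w f\<close>. Thus \<open>M X\<close> consists of the
    obstructions to such factorisations for all maps into \<open>X\<close>.\<close>
  define M where "M X = (\<Union>f\<in>\<Phi>. (\<lambda>x. x \<cdot> w f) ` homset C (Dom C f) X)" for X
  have ME: "\<exists>f\<in>\<Phi>. \<exists>x\<in>homset C (Dom C f) X. m = x \<cdot> w f" if "m \<in> M X" for m X using that unfolding M_def by blast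
  have smallM: "small U (M X)" if X: "X \<in> Obj C" for X
    unfolding M_def
  proof (rule small_UNION[OF \<Phi>(1)])
    fix f assume f: "f \<in> \<Phi>"
    have "small U (homset C (Dom C f) X)" using locally_small \<Phi>A(1)[OF f] X by simp
    then show "small U ((\<lambda>x. x \<cdot> w f) ` homset C (Dom C f) X)"
      unfolding small_def using card_of_image ordLeq_ordLess_trans by blast
  qed
  have "tensor_injective g Y" if g: "g \<in> annihilator U C D" for g
    unfolding tensor_injective_def
  proof (intro ballI impI)
    fix t assume t: "t \<in> homset C e1 (Dom C g \<boxtimes> Y)" and gt: "(g \<diamondop> i Y) \<cdot> t = Zero C e1 (Cod C g \<boxtimes> Y)"
    have gA: "g \<in> Arr C" using g by (simp add: annihilator_def compact_arrs_def)
    obtain X s Z j where X: "X 0 = Dom C g" "\<And>n. X n \<in> Obj C" "\<And>n. kills C (M (X n)) (X n) (X (Suc n)) (s n)"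
      and hc: "is_hocolim U C X s Z j"
    proof (rule tower_exists[of "Dom C g" M])
      show "m \<in> Arr C \<and> Cod C m = X" if "X \<in> Obj C" "m \<in> M X" for X m using ME[OF that(2)] ws by auto
    qed (use gA smallM in auto)
    have Z: "Z \<in> Obj C" and j: "\<And>n. j n \<in> homset C (X n) Z" "\<And>n. j (Suc n) \<cdot> s n = j n"
      using hc by (auto simp: is_hocolim_def)
    have s: "\<And>n. s n \<in> homset C (X n) (X (Suc n))" using kills_homset[OF X(3)] .
    \<comment> \<open>A map into the colimit comes from a stage \<open>n\<close>. At the next stage
      its obstruction has been killed, and the factorisation through \<open>f\<close> obtained there
      is carried on to \<open>Z\<close>.\<close>
    have "homset C (Dom C f) Z \<subseteq> hom_image C f Z" if f: "f \<in> \<Phi>" for f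
    proof
      fix x assume x: "x \<in> homset C (Dom C f) Z"
      obtain n x' where x': "x' \<in> homset C (Dom C f) (X n)" "x = j n \<cdot> x'"
        using hc cocont_exact_id[of U] \<Phi>A(2)[OF f] x unfolding is_hocolim_def
        by (metis (no_types, lifting) cat_functor.select_convs id_apply id_functor_def)
      have "x' \<cdot> w f \<in> M (X n)" unfolding M_def using x' f by blast
      from kills_zero[OF X(3) this]
      have "(s n \<cdot> x') \<cdot> w f = Zero C (Dom C (w f)) (X (Suc n))" using s[of n] x'(1) ws[OF f] by auto
      moreover obtain k where t: "(w f, f, k) \<in> Tri C" using w[OF f] by blast
      ultimately obtain y where y: "y \<in> homset C (Cod C f) (X (Suc n))" "s n \<cdot> x' = y \<cdot> f"
        using tri_extend[OF t, of "s n \<cdot> x'" "X (Suc n)"] s[of n] x'(1) ws[OF f] by auto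
      have "x = (j (Suc n) \<cdot> s n) \<cdot> x'" using x'(2) j(2) by simp
      also have "\<dots> = j (Suc n) \<cdot> s n \<cdot> x'" by (rule assoc) (use j(1)[of "Suc n"] s[of n] x'(1) in auto)
      also have "\<dots> = (j (Suc n) \<cdot> y) \<cdot> f" unfolding y(2) using j(1)[of "Suc n"] y(1) \<Phi>A(1)[OF f] by simp
      finally show "x \<in> hom_image C f Z"
        unfolding hom_image_def using j(1)[of "Suc n"] y(1) by (intro image_eqI[of _ _ "j (Suc n) \<cdot> y"]) auto
    qed
    then have "Z \<in> D" unfolding D using Z hom_image_homset \<Phi>A(1) by blast
    then have "homset C (Dom C g) Z \<subseteq> hom_image C g Z" using g unfolding annihilator_iff[OF DO] by blast
    then have "j 0 \<in> hom_image C g Z" using j(1)[of 0] X(1) by auto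
    then obtain q where q: "q \<in> homset C (Cod C g) Z" "j 0 = q \<cdot> g" by (auto simp: hom_image_def)
    have "(j 0 \<diamondop> i Y) \<cdot> t = (q \<diamondop> i Y) \<cdot> (g \<diamondop> i Y) \<cdot> t" unfolding q(2) using q(1) gA t by (simp add: whisker_right)
    also have "\<dots> = Zero C e1 (Z \<boxtimes> Y)" unfolding gt using q(1) gA by simp
    finally have "\<exists>n. farr (right_tensor C Y) (chain C X s 0 n) \<cdot> t = Zero C e1 (fobj (right_tensor C Y) (X n))"
      using t X(1) by (intro hocolim_injective[OF hc tensor_cocont[OF Y] unit_compact]) simp_all
    then obtain n where n: "(chain C X s 0 n \<diamondop> i Y) \<cdot> t = Zero C e1 (X n \<boxtimes> Y)" by auto
    have ch: "chain C X s 0 n \<in> homset C (Dom C g) (X n)" for n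
      using chain_homset[of X s 0 n, OF X(2) s] X(1) by simp
    \<comment> \<open>\<open>f \<cdot> w f\<close> is zero and \<open>f\<close> tensored with
      \<open>Y\<close> is injective on maps from the unit, so \<open>w f\<close> tensored with
      \<open>Y\<close> annihilates all such maps.\<close>
    have kill: "(m \<diamondop> i Y) \<cdot> x = Zero C e1 (X n \<boxtimes> Y)" if m: "m \<in> M (X n)" and x: "x \<in> homset C e1 (Dom C m \<boxtimes> Y)" for n m x
    proof -
      obtain f y where f: "f \<in> \<Phi>" and y: "y \<in> homset C (Dom C f) (X n)" "m = y \<cdot> w f" using ME[OF m] by blast
      obtain k where t: "(w f, f, k) \<in> Tri C" using w[OF f] by blast
      note fs = ws[OF f] \<Phi>A(1)[OF f]
      have x': "x \<in> homset C e1 (Dom C (w f) \<boxtimes> Y)" using x y fs by simp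
      have "(f \<diamondop> i Y) \<cdot> (w f \<diamondop> i Y) \<cdot> x = ((f \<cdot> w f) \<diamondop> i Y) \<cdot> x"
        using x' fs by (simp add: whisker_right)
      then have "(f \<diamondop> i Y) \<cdot> (w f \<diamondop> i Y) \<cdot> x = Zero C e1 (Cod C f \<boxtimes> Y)"
        unfolding tri_comp_zero[OF t] using x' fs by simp
      then have "(w f \<diamondop> i Y) \<cdot> x = Zero C e1 (Dom C f \<boxtimes> Y)"
        using inj[OF f] x' fs unfolding tensor_injective_def by simp
      then show ?thesis using y x' fs X(2)[of n] by (simp add: whisker_right)
    qed
    \<comment> \<open>Each transition is injective on maps from the unit after tensoring with
      \<open>Y\<close>, so vanishing at stage \<open>n\<close> is pulled back to stage 0.\<close>
    have "(chain C X s 0 n \<diamondop> i Y) \<cdot> t = Zero C e1 (X n \<boxtimes> Y) \<Longrightarrow> t = Zero C e1 (Dom C g \<boxtimes> Y)" for n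
    proof (induction n)
      case 0
      then show ?case using X(1) t gA by simp
    next
      case (Suc n)
      have 1: "(s n \<diamondop> i Y) \<cdot> (chain C X s 0 n \<diamondop> i Y) \<cdot> t = Zero C e1 (X (Suc n) \<boxtimes> Y)"
        using Suc.prems s[of n] ch[of n] t by (simp add: whisker_right)
      have "(chain C X s 0 n \<diamondop> i Y) \<cdot> t = Zero C e1 (X n \<boxtimes> Y)"
        by (rule kills_tensor_mono[OF X(3) Y smallM[OF X(2)] kill _ 1]) (use ch[of n] t in auto)
      then show ?case by (rule Suc.IH)
    qed
    then show "t = Zero C e1 (Dom C g \<boxtimes> Y)" using n by blast
  qed
  then show "Y \<in> dual_definable U C D" unfolding dual_definable_iff using Y by blast
qed

end

section \<open>Smashing localisations\<close>

context large_category
begin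

text \<open>No generator maps non-trivially to the cone: injectivity lets a map into the cone come
  from the codomain of \<open>f\<close>, surjectivity lifts it further to the domain, and two
  consecutive maps of a triangle compose to zero.\<close>

lemma iso_if_compact_bijective:
  assumes f [simp]: "f \<in> Arr C"
    and surj: "\<And>K z. compact_obj U C K \<Longrightarrow> z \<in> homset C K (Cod C f) \<Longrightarrow> \<exists>z'\<in>homset C K (Dom C f). z = f \<cdot> z'"
    and inj: "\<And>K y. compact_obj U C K \<Longrightarrow> y \<in> homset C K (Dom C f) \<Longrightarrow> f \<cdot> y = Zero C K (Cod C f)
      \<Longrightarrow> y = Zero C K (Dom C f)"
  shows "iso_arr C f"
proof -
  obtain g h where t: "(f, g, h) \<in> Tri C" using tri_exists[OF f] by blast
  note [simp] = tri_simps[OF t]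
  obtain G where "small U G" and G: "\<And>A. A \<in> G \<Longrightarrow> compact_obj U C A"
    "\<And>X. X \<in> Obj C \<Longrightarrow> (\<And>A. A \<in> G \<Longrightarrow> homset C A X = {Zero C A X}) \<Longrightarrow> zero_object C X"
    using generators by blast
  have "zero_object C (Cod C g)"
  proof (rule G(2))
    fix K assume "K \<in> G"
    then have K: "compact_obj U C K" by (rule G(1))
    have KO [simp]: "K \<in> Obj C" using compact_obj_obj[OF K] .
    have "x = Zero C K (Cod C g)" if x: "x \<in> homset C K (Cod C g)" for x
    proof -
      have [simp]: "x \<in> Arr C" "Dom C x = K" "Cod C x = Cod C g" using x by auto
      \<comment> \<open>\<open>h \<cdot> x\<close> lands in the suspension of
        \<open>Dom C f\<close>, while injectivity is given for maps into \<open>Dom C f\<close>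
        itself; the source is desuspended accordingly.\<close>
      obtain K' k where k: "K' \<in> Obj C" "k \<in> homset C (S K') K" "iso_arr C k" using desusp[OF KO] by blast
      have K': "compact_obj U C K'"
        by (rule compact_desusp[OF compact_obj_iso[OF K, of "inv_arr C k"]]) (use k in auto)
      have [simp]: "k \<in> Arr C" "Dom C k = S K'" "Cod C k = K" using k by auto
      obtain y where y: "y \<in> homset C K' (Dom C f)" "Sa y = h \<cdot> x \<cdot> k"
        using susp_full[of "h \<cdot> x \<cdot> k" K' "Dom C f"] k(1) by auto
      have "(Sa f \<cdot> h) \<cdot> x \<cdot> k = Zero C (S K') (S (Cod C f))" unfolding tri_comp_zero3[OF t] using k(1) by simp
      then have "Sa (f \<cdot> y) = Sa (Zero C K' (Cod C f))" using y k(1) by simp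
      then have "f \<cdot> y = Zero C K' (Cod C f)" by (rule susp_inj) (use y k(1) in auto)
      then have "y = Zero C K' (Dom C f)" by (rule inj[OF K' y(1)])
      then have "(h \<cdot> x) \<cdot> k = Zero C K (S (Dom C f)) \<cdot> k" using y(2) k(1) by simp
      then have "h \<cdot> x = Zero C K (S (Dom C f))" by (rule iso_right_cancel[OF k(3), rotated -1]) simp_all
      then obtain z where z: "z \<in> homset C K (Cod C f)" "x = g \<cdot> z" using tri_lift2[OF t x] by auto
      obtain z' where z': "z' \<in> homset C K (Dom C f)" "z = f \<cdot> z'" using surj[OF K z(1)] by blast
      have "x = (g \<cdot> f) \<cdot> z'" using z(2) z'(1) unfolding z'(2) by simp
      then show ?thesis unfolding tri_comp_zero[OF t] using z'(1) by simp
    qed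
    then show "homset C K (Cod C g) = {Zero C K (Cod C g)}" by auto
  qed simp
  then show ?thesis using tri_iso_iff_zero[OF t] by simp
qed

end

locale smashing_tt = dualizable_tt U C + smashing_localisation U C L \<eta>
  for U :: "'u itself" and C :: "('o, 'm) tt_category" (structure) and L :: "('o, 'm, 'o, 'm) cat_functor" and \<eta> :: "'o \<Rightarrow> 'm"
begin

abbreviation Lo where "Lo \<equiv> fobj L"
abbreviation La where "La \<equiv> farr L"
abbreviation local where "local X \<equiv> is_local C \<eta> X"

lemma L_additive: "additive_functor C C L"
  using exact by (simp add: exact_functor_def)

lemmas L_simps [simp] = additive_functor_simps[OF L_additive]

lemma \<eta>_simps [simp]:
  assumes "X \<in> Obj C"
  shows "\<eta> X \<in> Arr C" "Dom C (\<eta> X) = X" "Cod C (\<eta> X) = Lo X"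
  using eta_natural assms by (auto simp: nat_trans_def id_functor_def)

lemma \<eta>_nat: "f \<in> Arr C \<Longrightarrow> La f \<cdot> \<eta> (Dom C f) = \<eta> (Cod C f) \<cdot> f"
  using eta_natural by (simp add: nat_trans_def id_functor_def)

lemma L_tri: "(f, g, h) \<in> Tri C \<Longrightarrow> \<exists>h'. (La f, La g, h') \<in> Tri C"
  using exact unfolding exact_functor_def by blast

lemma L_cocont: "cocont_exact U C L"
proof -
  have "is_coproduct C I (Lo \<circ> Y) (Lo P) (La \<circ> \<iota>)"
    if "small U (I :: 'u set)" "is_coproduct C I Y P \<iota>" for I Y P \<iota>
    using preserves_coproducts[OF that(1) _ that(2)] coproduct_simps(5)[OF that(2)] by (simp add: Pi_iff)
  then show ?thesis using L_additive L_tri by (simp add: cocont_exact_def)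
qed

lemma L_iso [simp]: "iso_arr C f \<Longrightarrow> iso_arr C (La f)"
  using L_simps(6)[of f "inv_arr C f"] L_simps(6)[of "inv_arr C f" f]
  by (intro iso_arrI[of _ "La (inv_arr C f)"]) (simp_all del: L_simps(6))

lemma L_susp:
  assumes "X \<in> Obj C"
  obtains k where "k \<in> homset C (Lo (S X)) (S (Lo X))" "iso_arr C k"
proof -
  obtain k where "nat_iso C C (comp_functor L (Susp C)) (comp_functor (Susp C) L) k"
    using exact unfolding exact_functor_def by blast
  then have "k X \<in> homset C (Lo (S X)) (S (Lo X))" "iso_arr C (k X)"
    using assms by (auto simp: nat_iso_def nat_trans_def comp_functor_def)
  then show thesis using that by blast
qed

section \<open>Local and acyclic objects\<close>

lemma localI: "X \<in> Obj C \<Longrightarrow> iso_arr C (\<eta> X) \<Longrightarrow> local X"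
  by (simp add: is_local_def)

lemma local_obj [simp]: "local X \<Longrightarrow> X \<in> Obj C" and local_iso_eta [simp]: "local X \<Longrightarrow> iso_arr C (\<eta> X)"
  by (auto simp: is_local_def)

lemma local_L [simp]: "X \<in> Obj C \<Longrightarrow> local (Lo X)"
  using L_eta_iso[of X] L_eta[of X] by (intro localI) simp_all

lemma local_ext:
  assumes f: "f \<in> homset C X Y" and Y: "local Y"
  shows "\<exists>g\<in>homset C (Lo X) Y. g \<cdot> \<eta> X = f"
proof -
  have [simp]: "f \<in> Arr C" "Dom C f = X" "Cod C f = Y" "X \<in> Obj C" using f by auto
  have "(inv_arr C (\<eta> Y) \<cdot> La f) \<cdot> \<eta> X = inv_arr C (\<eta> Y) \<cdot> La f \<cdot> \<eta> (Dom C f)" using Y by simp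
  also have "\<dots> = f" unfolding \<eta>_nat[of f, OF \<open>f \<in> Arr C\<close>] using Y by simp
  finally show ?thesis using Y by (intro bexI[of _ "inv_arr C (\<eta> Y) \<cdot> La f"]) simp_all
qed

text \<open>Naturality together with \<open>L_eta\<close> gives
  \<open>\<eta> Y \<cdot> h = La (h \<cdot> \<eta> X)\<close>, and \<open>\<eta> Y\<close> is
  invertible, so \<open>h\<close> is determined by its restriction along
  \<open>\<eta> X\<close>.\<close>

lemma local_ext_unique:
  assumes g: "g \<in> homset C (Lo X) Y" "g' \<in> homset C (Lo X) Y" and Y: "local Y" and X [simp]: "X \<in> Obj C"
    and eq: "g \<cdot> \<eta> X = g' \<cdot> \<eta> X"
  shows "g = g'"
proof -
  have *: "\<eta> Y \<cdot> h = La (h \<cdot> \<eta> X)" if h: "h \<in> homset C (Lo X) Y" for h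
    using \<eta>_nat[of h] h L_eta[OF X] by auto
  have "\<eta> Y \<cdot> g = \<eta> Y \<cdot> g'" unfolding *[OF g(1)] *[OF g(2)] eq ..
  then show ?thesis by (rule iso_left_cancel[rotated -1]) (use g Y in auto)
qed

abbreviation acyclic where "acyclic N \<equiv> zero_object C (Lo N)"

lemma acyclic_hom:
  assumes N: "acyclic N" "N \<in> Obj C" and Y: "local Y" and f: "f \<in> homset C N Y"
  shows "f = Zero C N Y"
proof -
  obtain g where g: "g \<in> homset C (Lo N) Y" "g \<cdot> \<eta> N = f" using local_ext[OF f Y] by blast
  have "g = Zero C (Lo N) Y" using zero_object_arr(1)[OF N(1), of g] g(1) by auto
  then show ?thesis using g(2) N(2) Y by auto
qed

lemma acyclic_susp: "X \<in> Obj C \<Longrightarrow> acyclic (S X) \<longleftrightarrow> acyclic X"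
proof -
  assume X: "X \<in> Obj C"
  obtain k where "k \<in> homset C (Lo (S X)) (S (Lo X))" "iso_arr C k" using L_susp[OF X] by blast
  then have "acyclic (S X) \<longleftrightarrow> zero_object C (S (Lo X))"
    using zero_object_iso[of "Lo (S X)" k] zero_object_iso[of "S (Lo X)" k] by auto
  then show ?thesis using susp_zero_object[of "Lo X"] X by simp
qed

lemma acyclic_iso:
  assumes "acyclic N" "f \<in> homset C N N'" "iso_arr C f" shows "acyclic N'"
  using zero_object_iso(1)[OF assms(1) L_iso[OF assms(3)]] assms(2) by auto

text \<open>\<open>L\<close> inverts \<open>\<eta> X\<close>, so the image under \<open>L\<close> of
  the triangle on \<open>\<eta> X\<close> has a vanishing cone, which is the suspension of
  \<open>Lo (Dom C w)\<close>.\<close>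

lemma acyclic_fibre:
  assumes X [simp]: "X \<in> Obj C"
  obtains w h where "(w, \<eta> X, h) \<in> Tri C" "acyclic (Dom C w)"
proof -
  obtain w h where t: "(w, \<eta> X, h) \<in> Tri C" using tri_fibre[of "\<eta> X"] by auto
  note ts = tri_simps[OF t]
  obtain h' where t': "(La w, La (\<eta> X), h') \<in> Tri C" using L_tri[OF t] by blast
  have "zero_object C (Cod C h')" using tri_iso_iff_zero[OF tri_rotateD[OF t']] L_eta_iso[OF X] by simp
  then have "zero_object C (S (Lo (Dom C w)))" using tri_simps[OF t'] ts by simp
  then show thesis using that[OF t] susp_zero_object[of "Lo (Dom C w)"] ts by simp
qed

text \<open>The fibre of \<open>\<eta> X\<close> is acyclic, so its map to \<open>X\<close> vanishes
  and the identity of \<open>X\<close> factors through \<open>\<eta> X\<close>. Uniqueness of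
  extensions turns this retraction into an inverse. Most closure properties below are derived
  through orthogonality.\<close>

lemma local_if_orthogonal:
  assumes X [simp]: "X \<in> Obj C"
    and orth: "\<And>N f. acyclic N \<Longrightarrow> N \<in> Obj C \<Longrightarrow> f \<in> homset C N X \<Longrightarrow> f = Zero C N X"
  shows "local X"
proof -
  obtain w h where t: "(w, \<eta> X, h) \<in> Tri C" "acyclic (Dom C w)" using acyclic_fibre[OF X] by blast
  note ts = tri_simps[OF t(1)]
  have w: "w \<in> homset C (Dom C w) X" using ts by simp
  then have "w = Zero C (Dom C w) X" using orth[OF t(2) _ w] by simp
  then have "i X \<cdot> w = Zero C (Dom C w) X" using w by simp
  then obtain q where q: "q \<in> homset C (Lo X) X" "i X = q \<cdot> \<eta> X" using tri_extend[OF t(1), of "i X" X] w by auto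
  have "\<eta> X \<cdot> q = i (Lo X)"
  proof (rule local_ext_unique[of _ X "Lo X"])
    have "(\<eta> X \<cdot> q) \<cdot> \<eta> X = \<eta> X \<cdot> q \<cdot> \<eta> X" using q(1) by simp
    also have "\<dots> = \<eta> X" unfolding q(2)[symmetric] by simp
    finally show "(\<eta> X \<cdot> q) \<cdot> \<eta> X = i (Lo X) \<cdot> \<eta> X" by simp
  qed (use q(1) in auto)
  then have "iso_arr C (\<eta> X)" using q by (intro iso_arrI[of _ q]) auto
  then show ?thesis by (intro localI) simp_all
qed

lemma local_iso:
  assumes X: "local X" and f: "f \<in> homset C X Y" "iso_arr C f"
  shows "local Y"
proof (rule local_if_orthogonal)
  show "Y \<in> Obj C" using f by auto
  fix N g assume N: "acyclic N" "N \<in> Obj C" and g: "g \<in> homset C N Y"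
  have "inv_arr C f \<cdot> g = Zero C N X" using acyclic_hom[OF N X, of "inv_arr C f \<cdot> g"] f g by auto
  then have "f \<cdot> inv_arr C f \<cdot> g = f \<cdot> Zero C N X" by simp
  then show "g = Zero C N Y" using f g N by auto
qed

lemma local_susp_iff:
  assumes X [simp]: "X \<in> Obj C"
  shows "local (S X) \<longleftrightarrow> local X"
proof
  assume SX: "local (S X)"
  show "local X"
  proof (rule local_if_orthogonal[OF X])
    fix N f assume N: "acyclic N" "N \<in> Obj C" and f: "f \<in> homset C N X"
    have "acyclic (S N)" using acyclic_susp N by simp
    then have "Sa f = Zero C (S N) (S X)" using acyclic_hom[OF _ _ SX, of "S N" "Sa f"] N f by auto
    then have "Sa f = Sa (Zero C N X)" using N by simp
    then show "f = Zero C N X" by (rule susp_inj) (use f N in auto)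
  qed
next
  assume LX: "local X"
  show "local (S X)"
  proof (rule local_if_orthogonal)
    fix N f assume N: "acyclic N" "N \<in> Obj C" and f: "f \<in> homset C N (S X)"
    obtain N' k where k: "N' \<in> Obj C" "k \<in> homset C (S N') N" "iso_arr C k" using desusp[OF N(2)] by blast
    have "acyclic (S N')" using acyclic_iso[OF N(1), of "inv_arr C k"] k by auto
    then have N': "acyclic N'" using acyclic_susp k by simp
    obtain g where g: "g \<in> homset C N' X" "Sa g = f \<cdot> k" using susp_full[of "f \<cdot> k" N' X] f k by auto
    have "g = Zero C N' X" by (rule acyclic_hom[OF N' k(1) LX g(1)])
    then have "f \<cdot> k = Zero C N (S X) \<cdot> k" using g(2) k N by auto
    then show "f = Zero C N (S X)" by (rule iso_right_cancel[OF k(3), rotated -1]) (use f k N in auto)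
  qed simp
qed

lemma local_cone:
  assumes t: "(f, g, h) \<in> Tri C" and X: "local (Dom C f)" "local (Cod C f)"
  shows "local (Cod C g)"
proof (rule local_if_orthogonal)
  note [simp] = tri_simps[OF t]
  show "Cod C g \<in> Obj C" by simp
  fix N x assume N: "acyclic N" "N \<in> Obj C" and x: "x \<in> homset C N (Cod C g)"
  have SX: "local (S (Dom C f))" using X(1) by (simp add: local_susp_iff)
  have "h \<cdot> x = Zero C N (S (Dom C f))" by (rule acyclic_hom[OF N SX]) (use x in auto)
  then obtain y where y: "y \<in> homset C N (Cod C f)" "x = g \<cdot> y" using tri_lift2[OF t x] by auto
  then show "x = Zero C N (Cod C g)" using acyclic_hom[OF N X(2) y(1)] N by simp
qed

text \<open>As \<open>L\<close> preserves the coproduct, the inverses of the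
  \<open>\<eta> (Y j)\<close> assemble to a map from \<open>Lo P\<close> to \<open>P\<close>. It is
  a retraction of \<open>\<eta> P\<close>, and uniqueness of extensions makes it an inverse.\<close>

lemma local_coproduct:
  assumes I: "small U I" and co: "is_coproduct C I Y P \<iota>" and Y: "\<And>j. j \<in> I \<Longrightarrow> local (Y j)"
  shows "local P"
proof -
  note c = coproduct_simps[OF co]
  have coL: "is_coproduct C I (Lo \<circ> Y) (Lo P) (La \<circ> \<iota>)" by (rule cocont_coproduct[OF L_cocont I co])
  have h: "\<iota> j \<cdot> inv_arr C (\<eta> (Y j)) \<in> homset C ((Lo \<circ> Y) j) P" if "j \<in> I" for j
    using c(1) c(2-5)[OF that] Y[OF that] by simp
  obtain q where q: "q \<in> homset C (Lo P) P" "\<And>j. j \<in> I \<Longrightarrow> q \<cdot> (La \<circ> \<iota>) j = \<iota> j \<cdot> inv_arr C (\<eta> (Y j))"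
    using coproduct_map[OF coL c(1) h] by blast
  have q\<eta>: "q \<cdot> \<eta> P = i P"
  proof (rule coproduct_unique[OF co, of _ P])
    fix j assume j: "j \<in> I"
    note cj = c(2-5)[OF j]
    have "(q \<cdot> \<eta> P) \<cdot> \<iota> j = q \<cdot> \<eta> (Cod C (\<iota> j)) \<cdot> \<iota> j" using q(1) cj c(1) by simp
    also have "\<dots> = (q \<cdot> La (\<iota> j)) \<cdot> \<eta> (Y j)" unfolding \<eta>_nat[OF cj(1), symmetric] using q(1) cj by simp
    also have "\<dots> = \<iota> j" using q(2)[OF j] cj Y[OF j] by simp
    finally show "(q \<cdot> \<eta> P) \<cdot> \<iota> j = i P \<cdot> \<iota> j" using cj by simp
  qed (use q c in auto)
  have "\<eta> P \<cdot> q = i (Lo P)"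
  proof (rule local_ext_unique[of _ P "Lo P"])
    have "(\<eta> P \<cdot> q) \<cdot> \<eta> P = \<eta> P \<cdot> q \<cdot> \<eta> P" using q(1) c(1) by simp
    then show "(\<eta> P \<cdot> q) \<cdot> \<eta> P = i (Lo P) \<cdot> \<eta> P" unfolding q\<eta> using c(1) by simp
  qed (use q(1) c(1) in auto)
  then have "iso_arr C (\<eta> P)" using q(1) q\<eta> c(1) by (intro iso_arrI[of _ q]) auto
  then show ?thesis using c(1) by (intro localI)
qed

lemma local_zero: "zero_object C Z \<Longrightarrow> local Z"
  by (rule local_if_orthogonal) (use zero_object_obj zero_object_arr(2) in auto)

lemma acyclic_tensor:
  assumes "acyclic N" "N \<in> Obj C" "Y \<in> Obj C"
  shows "acyclic (N \<boxtimes> Y)" "acyclic (Y \<boxtimes> N)"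
proof -
  show 1: "acyclic (N \<boxtimes> Y)" using kernel_ideal[OF assms(2,1,3)] .
  show "acyclic (Y \<boxtimes> N)" by (rule acyclic_iso[OF 1, of "b N Y"]) (use assms in auto)
qed

text \<open>Duality moves \<open>A\<close> to the other side: maps from \<open>N\<close> to
  \<open>A \<boxtimes> Y\<close> are maps from \<open>dual A \<boxtimes> N\<close> to
  \<open>Y\<close>, and the acyclic objects form an ideal.\<close>

lemma local_compact_tensor:
  assumes A: "compact_obj U C A" and Y: "local Y"
  shows "local (A \<boxtimes> Y)"
proof (rule local_if_orthogonal)
  have AO [simp]: "A \<in> Obj C" using compact_obj_obj[OF A] .
  show "A \<boxtimes> Y \<in> Obj C" using Y by simp
  obtain c where dp: "dual_pair (dual A) A (ev A) c" using compact_dualizable[OF A] by blast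
  fix N f assume N: "acyclic N" "N \<in> Obj C" and f: "f \<in> homset C N (A \<boxtimes> Y)"
  have "unmate (ev A) (dual A) A Y f = Zero C (dual A \<boxtimes> N) Y"
    by (rule acyclic_hom[OF _ _ Y unmate_homset[OF dp f]]) (use acyclic_tensor(2)[OF N] N Y in auto)
  then show "f = Zero C N (A \<boxtimes> Y)"
    using mate_unmate[OF dp f] mate_zero[OF dp, of Y N] N Y by simp
qed

text \<open>Here the localisation has to be smashing: for fixed \<open>Y\<close>, the transformation \<open>Hom(K, A \<otimes> Y) \<rightarrow> Hom(K, L (A \<otimes> Y))\<close>
  is one between finitary functors of \<open>A\<close>, and it is bijective for \<open>A\<close> compact.\<close>

lemma local_tensor:
  assumes X [simp]: "X \<in> Obj C" and Y: "local Y"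
  shows "local (X \<boxtimes> Y)"
proof -
  have YO [simp]: "Y \<in> Obj C" using Y by simp
  obtain G where G: "small U G" "\<And>A. A \<in> G \<Longrightarrow> compact_obj U C A"
    "\<And>X. X \<in> Obj C \<Longrightarrow> (\<And>A. A \<in> G \<Longrightarrow> homset C A X = {Zero C A X}) \<Longrightarrow> zero_object C X"
    using generators by blast
  let ?F = "right_tensor C Y" and ?F' = "comp_functor L (right_tensor C Y)"
  define \<phi> where "\<phi> A t = \<eta> (A \<boxtimes> Y) \<cdot> t" for A t
  have F: "cocont_exact U C ?F" by (rule tensor_cocont[OF YO])
  have F': "cocont_exact U C ?F'"
    unfolding cocont_exact_def
  proof (intro conjI allI impI)
    note Fs = additive_functor_simps[OF cocont_exact_simps(1)[OF F], simplified]
    show "additive_functor C C ?F'"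
      by (auto simp: additive_functor_def is_functor_def hom_def comp_functor_def interchange) (simp add: whisker_right)
    show "\<exists>h'. (farr ?F' f, farr ?F' g, h') \<in> Tri C" if "(f, g, h) \<in> Tri C" for f g h
      using tensor_tri[OF that YO] L_tri by (fastforce simp: comp_functor_def)
    fix I :: "'u set" and W P \<iota> assume co: "small U I \<and> is_coproduct C I W P \<iota>"
    then have "is_coproduct C I (fobj ?F \<circ> W) (fobj ?F P) (farr ?F \<circ> \<iota>)" using cocont_coproduct[OF F] by blast
    then have "is_coproduct C I (Lo \<circ> (fobj ?F \<circ> W)) (Lo (fobj ?F P)) (La \<circ> (farr ?F \<circ> \<iota>))"
      using cocont_coproduct[OF L_cocont] co by blast
    then show "is_coproduct C I (fobj ?F' \<circ> W) (fobj ?F' P) (farr ?F' \<circ> \<iota>)"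
      by (simp add: comp_functor_def o_assoc)
  qed
  \<comment> \<open>For a generator \<open>A\<close>, the first half gives bijectivity at
    \<open>A\<close> and the second the injectivity at \<open>S A\<close> that the comparison of
    functors requires.\<close>
  have loc: "local (A \<boxtimes> Y)" "local (S A \<boxtimes> Y)" if A: "A \<in> G" for A
    using local_compact_tensor[OF G(2)[OF A] Y] local_compact_tensor[OF compact_susp[OF G(2)[OF A]] Y] by auto
  have 1: "\<phi> A t \<in> homset C K (fobj ?F' A)"
    if "A \<in> Obj C" "t \<in> homset C K (fobj ?F A)" for A t K
    using that by (simp add: \<phi>_def comp_functor_def)
  have 2: "\<phi> A (t \<boxplus> u) = \<phi> A t \<boxplus> \<phi> A u"
    if "A \<in> Obj C" "t \<in> homset C K (fobj ?F A)" "u \<in> homset C K (fobj ?F A)" for A t u K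
    using that by (simp add: \<phi>_def)
  have 3: "\<phi> A' (farr ?F f \<cdot> t) = farr ?F' f \<cdot> \<phi> A t"
    if f: "f \<in> homset C A A'" and t: "t \<in> homset C K (fobj ?F A)" for A A' f t K
  proof -
    have [simp]: "f \<in> Arr C" "Dom C f = A" "Cod C f = A'" "t \<in> Arr C" "Dom C t = K" "Cod C t = A \<boxtimes> Y"
      "A \<in> Obj C" "A' \<in> Obj C" using f t homset_obj[OF f] by auto
    have "La (f \<diamondop> i Y) \<cdot> \<eta> (A \<boxtimes> Y) = \<eta> (A' \<boxtimes> Y) \<cdot> (f \<diamondop> i Y)" using \<eta>_nat[of "f \<diamondop> i Y"] by simp
    from comp_reassoc[OF this, of t] show ?thesis by (simp add: \<phi>_def comp_functor_def)
  qed
  have 4: "\<exists>t\<in>homset C K (fobj ?F A). \<phi> A t = s" if A: "A \<in> G" and s: "s \<in> homset C K (fobj ?F' A)" for A s K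
  proof -
    have [simp]: "A \<in> Obj C" using compact_obj_obj[OF G(2)[OF A]] .
    show ?thesis using s loc(1)[OF A]
      by (intro bexI[of _ "inv_arr C (\<eta> (A \<boxtimes> Y)) \<cdot> s"]) (simp_all add: \<phi>_def comp_functor_def)
  qed
  have 5: "t = Zero C K (fobj ?F A)"
    if A: "local (A \<boxtimes> Y)" "A \<in> Obj C" and t: "t \<in> homset C K (fobj ?F A)" "\<phi> A t = Zero C K (fobj ?F' A)" for A t K
  proof -
    have K: "K \<in> Obj C" using homset_obj(1)[OF t(1)] .
    show ?thesis
      by (rule iso_left_cancel[of "\<eta> (A \<boxtimes> Y)"]) (use t A K in \<open>auto simp: \<phi>_def comp_functor_def\<close>)
  qed
  have GO: "A \<in> Obj C" "S A \<in> Obj C" if "A \<in> G" for A using compact_obj_obj[OF G(2)[OF that]] by auto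
  have "iso_arr C (\<eta> (X \<boxtimes> Y))"
  proof (rule iso_if_compact_bijective)
    fix K assume K: "compact_obj U C K"
    show "\<exists>z'\<in>homset C K (Dom C (\<eta> (X \<boxtimes> Y))). z = \<eta> (X \<boxtimes> Y) \<cdot> z'" if "z \<in> homset C K (Cod C (\<eta> (X \<boxtimes> Y)))" for z
    proof -
      have "\<exists>t\<in>homset C K (fobj ?F X). \<phi> X t = z"
        by (rule natural_surjective[OF F F' K K G 1 2 3 4 5[OF loc(1) GO(1)] 5[OF loc(2) GO(2)]])
          (use that in \<open>simp_all add: comp_functor_def\<close>)
      then show ?thesis by (auto simp: \<phi>_def)
    qed
    show "y = Zero C K (Dom C (\<eta> (X \<boxtimes> Y)))"
      if "y \<in> homset C K (Dom C (\<eta> (X \<boxtimes> Y)))" "\<eta> (X \<boxtimes> Y) \<cdot> y = Zero C K (Cod C (\<eta> (X \<boxtimes> Y)))" for y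
    proof -
      have "y = Zero C K (fobj ?F X)"
        by (rule natural_injective[OF F F' K K G 1 2 3 4 5[OF loc(1) GO(1)] 5[OF loc(2) GO(2)]])
          (use that in \<open>simp_all add: comp_functor_def \<phi>_def\<close>)
      then show ?thesis by simp
    qed
  qed simp
  then show ?thesis by (intro localI) simp_all
qed

text \<open>The fibre of \<open>\<eta> X\<close>, tensored with \<open>Y\<close>, is acyclic since
  the kernel of \<open>L\<close> is an ideal, and local since \<open>Y\<close> is. An object that is
  both is zero.\<close>

lemma eta_tensor_iso:
  assumes X [simp]: "X \<in> Obj C" and Y: "local Y"
  shows "iso_arr C (\<eta> X \<diamondop> i Y)" "iso_arr C (i Y \<diamondop> \<eta> X)"
proof -
  have YO [simp]: "Y \<in> Obj C" using Y by simp
  obtain w h where t: "(w, \<eta> X, h) \<in> Tri C" "acyclic (Dom C w)" using acyclic_fibre[OF X] by blast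
  have [simp]: "w \<in> Arr C" "Cod C w = X" using tri_simps[OF t(1)] by simp_all
  obtain h' where t': "(w \<diamondop> i Y, \<eta> X \<diamondop> i Y, h') \<in> Tri C" using tensor_tri[OF t(1) YO] by blast
  let ?N = "Dom C w \<boxtimes> Y"
  have "i ?N = Zero C ?N ?N"
    by (rule acyclic_hom[OF acyclic_tensor(1)[OF t(2)] _ local_tensor[OF _ Y]]) auto
  then have "zero_object C (S ?N)" by (subst susp_zero_object) (auto intro: zero_objectI)
  then show 1: "iso_arr C (\<eta> X \<diamondop> i Y)" using tri_iso_iff_zero[OF tri_rotateD[OF t']] tri_simps[OF t'] by simp
  have "b (Lo X) Y \<cdot> (\<eta> X \<diamondop> i Y) = (i Y \<diamondop> \<eta> X) \<cdot> b X Y" by (subst braid_nat) auto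
  then have "(b (Lo X) Y \<cdot> (\<eta> X \<diamondop> i Y)) \<cdot> inv_arr C (b X Y) = ((i Y \<diamondop> \<eta> X) \<cdot> b X Y) \<cdot> inv_arr C (b X Y)" by simp
  then have "(b (Lo X) Y \<cdot> (\<eta> X \<diamondop> i Y)) \<cdot> inv_arr C (b X Y) = i Y \<diamondop> \<eta> X" by simp
  moreover have "iso_arr C ((b (Lo X) Y \<cdot> (\<eta> X \<diamondop> i Y)) \<cdot> inv_arr C (b X Y))"
    by (intro iso_comp) (use 1 in simp_all)
  ultimately show "iso_arr C (i Y \<diamondop> \<eta> X)" by simp
qed

text \<open>A map from an acyclic \<open>N\<close> to the internal hom transposes to one from
  \<open>N \<boxtimes> X\<close>, which is acyclic, to the local object \<open>Y\<close>.\<close>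

lemma local_ihom:
  assumes X [simp]: "X \<in> Obj C" and Y: "local Y"
  shows "local (IHom C X Y)"
proof (rule local_if_orthogonal)
  have YO [simp]: "Y \<in> Obj C" using Y by simp
  show "IHom C X Y \<in> Obj C" by simp
  fix N f assume N: "acyclic N" "N \<in> Obj C" and f: "f \<in> homset C N (IHom C X Y)"
  have "Ev C X Y \<cdot> (f \<diamondop> i X) = Zero C (N \<boxtimes> X) Y"
    by (rule acyclic_hom[OF acyclic_tensor(1)[OF N X] _ Y]) (use N f in auto)
  then have "Ev C X Y \<cdot> (f \<diamondop> i X) = Ev C X Y \<cdot> (Zero C N (IHom C X Y) \<diamondop> i X)" using N by simp
  then show "f = Zero C N (IHom C X Y)" by (rule transpose_unique) (use f N in auto)
qed

text \<open>Transposing removes the factor \<open>Z\<close>; as the internal hom into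
  \<open>Y\<close> is local, the transpose extends along \<open>\<eta> X\<close>.\<close>

lemma tensor_ext:
  assumes f: "f \<in> homset C (X \<boxtimes> Z) Y" and [simp]: "X \<in> Obj C" "Z \<in> Obj C" and Y: "local Y"
  shows "\<exists>g\<in>homset C (Lo X \<boxtimes> Z) Y. g \<cdot> (\<eta> X \<diamondop> i Z) = f"
proof -
  have YO [simp]: "Y \<in> Obj C" using Y by simp
  note t = transpose[of f X Z Y, OF f]
  obtain g where g: "g \<in> homset C (Lo X) (IHom C Z Y)" "g \<cdot> \<eta> X = hom_transpose C X Z Y f"
    using local_ext[of "hom_transpose C X Z Y f" X "IHom C Z Y"] t local_ihom[of Z Y] Y by auto
  have "(Ev C Z Y \<cdot> (g \<diamondop> i Z)) \<cdot> (\<eta> X \<diamondop> i Z) = Ev C Z Y \<cdot> ((g \<cdot> \<eta> X) \<diamondop> i Z)" using g(1) by (simp add: whisker_right)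
  also have "\<dots> = f" unfolding g(2) using t by simp
  finally show ?thesis using g(1) by (intro bexI[of _ "Ev C Z Y \<cdot> (g \<diamondop> i Z)"]) simp_all
qed

lemma tensor_ext_unique:
  assumes g: "g \<in> homset C (Lo X \<boxtimes> Z) Y" "g' \<in> homset C (Lo X \<boxtimes> Z) Y" and [simp]: "X \<in> Obj C" "Z \<in> Obj C"
    and Y: "local Y" and eq: "g \<cdot> (\<eta> X \<diamondop> i Z) = g' \<cdot> (\<eta> X \<diamondop> i Z)"
  shows "g = g'"
proof -
  have YO [simp]: "Y \<in> Obj C" using Y by simp
  note t = transpose[of g "Lo X" Z Y, OF g(1)] and t' = transpose[of g' "Lo X" Z Y, OF g(2)]
  let ?t = "hom_transpose C (Lo X) Z Y g" and ?t' = "hom_transpose C (Lo X) Z Y g'"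
  have h: "?t \<in> homset C (Lo X) (IHom C Z Y)" "?t' \<in> homset C (Lo X) (IHom C Z Y)"
    "Ev C Z Y \<cdot> (?t \<diamondop> i Z) = g" "Ev C Z Y \<cdot> (?t' \<diamondop> i Z) = g'" using t t' by auto
  have "?t = ?t'"
  proof (rule local_ext_unique[OF h(1,2) local_ihom[OF _ Y]])
    show "?t \<cdot> \<eta> X = ?t' \<cdot> \<eta> X"
    proof (rule transpose_unique[of Z Y _ _ X])
      have "(Ev C Z Y \<cdot> (?t \<diamondop> i Z)) \<cdot> (\<eta> X \<diamondop> i Z) = (Ev C Z Y \<cdot> (?t' \<diamondop> i Z)) \<cdot> (\<eta> X \<diamondop> i Z)"
        unfolding h(3,4) by (rule eq)
      then show "Ev C Z Y \<cdot> ((?t \<cdot> \<eta> X) \<diamondop> i Z) = Ev C Z Y \<cdot> ((?t' \<cdot> \<eta> X) \<diamondop> i Z)"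
        using h(1,2) by (simp add: whisker_right)
    qed (use h(1,2) in auto)
  qed simp_all
  then show ?thesis using h(3,4) by metis
qed

text \<open>\<open>\<eta> X \<diamondop> \<eta> Z\<close> is applied one factor at a time. The first
  factor is treated by \<open>tensor_ext\<close>; the second is tensored with the local object
  \<open>Lo X\<close> and is invertible.\<close>

lemma tensor_ext_both:
  assumes f: "f \<in> homset C (X \<boxtimes> Z) Y" and [simp]: "X \<in> Obj C" "Z \<in> Obj C" and Y: "local Y"
  shows "\<exists>g\<in>homset C (Lo X \<boxtimes> Lo Z) Y. g \<cdot> (\<eta> X \<diamondop> \<eta> Z) = f"
proof -
  have YO [simp]: "Y \<in> Obj C" using Y by simp
  obtain g where g: "g \<in> homset C (Lo X \<boxtimes> Z) Y" "g \<cdot> (\<eta> X \<diamondop> i Z) = f" using tensor_ext[OF f _ _ Y] by auto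
  have iso: "iso_arr C (i (Lo X) \<diamondop> \<eta> Z)" by (rule eta_tensor_iso(2)) auto
  let ?g = "g \<cdot> inv_arr C (i (Lo X) \<diamondop> \<eta> Z)"
  have "\<eta> X \<diamondop> \<eta> Z = (i (Lo X) \<diamondop> \<eta> Z) \<cdot> (\<eta> X \<diamondop> i Z)" by (simp add: interchange)
  then have "?g \<cdot> (\<eta> X \<diamondop> \<eta> Z) = f" using g iso by simp
  then show ?thesis using g(1) iso by (intro bexI[of _ ?g]) simp_all
qed

lemma tensor_ext_both_unique:
  assumes g: "g \<in> homset C (Lo X \<boxtimes> Lo Z) Y" "g' \<in> homset C (Lo X \<boxtimes> Lo Z) Y" and [simp]: "X \<in> Obj C" "Z \<in> Obj C"
    and Y: "local Y" and eq: "g \<cdot> (\<eta> X \<diamondop> \<eta> Z) = g' \<cdot> (\<eta> X \<diamondop> \<eta> Z)"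
  shows "g = g'"
proof -
  have iso: "iso_arr C (i (Lo X) \<diamondop> \<eta> Z)" by (rule eta_tensor_iso(2)) auto
  have e: "\<eta> X \<diamondop> \<eta> Z = (i (Lo X) \<diamondop> \<eta> Z) \<cdot> (\<eta> X \<diamondop> i Z)" by (simp add: interchange)
  have "g \<cdot> (i (Lo X) \<diamondop> \<eta> Z) = g' \<cdot> (i (Lo X) \<diamondop> \<eta> Z)"
    by (rule tensor_ext_unique[of _ X Z Y]) (use g Y eq in \<open>simp_all add: e\<close>)
  then show ?thesis by (rule iso_right_cancel[OF iso, rotated -1]) (use g in simp_all)
qed

end

section \<open>The category of local objects\<close>

context smashing_tt
begin

abbreviation LT where "LT \<equiv> local_category C L \<eta>"

lemma LT_simps [simp]:
  "Obj LT = {X. local X}" "Arr LT = {f \<in> Arr C. local (Dom C f) \<and> local (Cod C f)}"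
  "Dom LT = Dom C" "Cod LT = Cod C" "Id LT = Id C" "Comp LT = Comp C" "Add LT = Add C" "Zero LT = Zero C"
  "Susp LT = Susp C"
  "Tri LT = {(f, g, h) \<in> Tri C. local (Dom C f) \<and> local (Dom C g) \<and> local (Dom C h)}"
  "Tensor LT = Tensor C" "TensorArr LT = TensorArr C" "Unit LT = Lo e1" "Assoc LT = Assoc C" "Braid LT = Braid C"
  "IHom LT = IHom C" "Ev LT = Ev C"
  "LUnit LT X = l X \<cdot> inv_arr C (\<eta> e1 \<diamondop> i X)" "RUnit LT X = r X \<cdot> inv_arr C (i X \<diamondop> \<eta> e1)"
  by (simp_all add: local_category_def)

lemma homset_LT: "local X \<Longrightarrow> local Y \<Longrightarrow> homset LT X Y = homset C X Y"
  by (auto simp: homset_def)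

lemma hom_group_LT: "local X \<Longrightarrow> local Y \<Longrightarrow> hom_group LT X Y = hom_group C X Y"
  by (simp add: hom_group_def homset_LT)

lemma is_inverse_LT: "f \<in> Arr LT \<Longrightarrow> is_inverse LT f g \<longleftrightarrow> is_inverse C f g"
  by (simp add: is_inverse_def homset_LT del: in_homset_iff)

lemma iso_LT: "f \<in> Arr LT \<Longrightarrow> iso_arr LT f \<longleftrightarrow> iso_arr C f"
  using is_inverse_LT by (simp add: iso_arr_def)

lemma neg_LT: "f \<in> Arr LT \<Longrightarrow> neg_arr LT f = neg_arr C f"
  by (simp add: neg_arr_def hom_group_LT)

lemma zero_object_LT: "zero_object LT Z \<longleftrightarrow> zero_object C Z"
proof
  assume z: "zero_object LT Z"
  then have Z: "local Z" by (simp add: zero_object_def)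
  then have "homset LT Z Z = {Zero C Z Z}" using z by (simp add: zero_object_def)
  moreover have "i Z \<in> homset LT Z Z" using Z by simp
  ultimately have "i Z = Zero C Z Z" by blast
  then show "zero_object C Z" using Z by (intro zero_objectI) simp_all
next
  assume z: "zero_object C Z"
  then show "zero_object LT Z"
    using local_zero[OF z] unfolding zero_object_def by (simp add: homset_LT del: in_homset_iff)
qed

lemma coproduct_LT:
  assumes "is_coproduct C I Y P \<iota>" "\<And>j. j \<in> I \<Longrightarrow> local (Y j)" "local P"
  shows "is_coproduct LT I Y P \<iota>"
  using assms unfolding is_coproduct_def by (simp add: homset_LT del: in_homset_iff cong: ball_cong)

section \<open>Additive and triangulated structure on the local objects\<close>

lemma category_LT: "category LT"
proof unfold_locales
  show "h \<cdot>\<^bsub>LT\<^esub> g \<in> homset LT X Z" if "g \<in> homset LT X Y" "h \<in> homset LT Y Z" for g h X Y Z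
    using that by auto
qed (auto simp del: assoc intro: assoc)

lemma small_finite: "finite A \<Longrightarrow> small U A"
proof -
  assume "finite A"
  then have "|A| <o |UNIV :: nat set|" using finite_ordLess_infinite2 infinite_UNIV_nat by blast
  then show ?thesis using small_nat ordLess_transitive unfolding small_def by blast
qed

text \<open>Because \<open>L\<close> preserves coproducts, the coproduct formed in the ambient
  category is already local and need not be localised again.\<close>

lemma coproduct_LT_exists:
  assumes I: "small U I" and Y: "\<And>j. j \<in> I \<Longrightarrow> local (Y j)"
  obtains P \<iota> where "is_coproduct C I Y P \<iota>" "local P" "is_coproduct LT I Y P \<iota>"
proof -
  obtain P \<iota> where co: "is_coproduct C I Y P \<iota>" using small_coproduct[OF I, of Y] Y by auto
  have "local P" by (rule local_coproduct[OF I co Y])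
  then show thesis using that co coproduct_LT[OF co Y] by blast
qed

lemma additive_LT: "additive_category LT"
proof -
  interpret LT: category LT by (rule category_LT)
  show ?thesis
  proof (intro additive_category.intro additive_category_axioms.intro category_LT)
    show "comm_group (hom_group LT X Y)" if "X \<in> Obj LT" "Y \<in> Obj LT" for X Y
      using that hom_comm_group[of X Y] by (simp add: hom_group_LT)
    show "\<exists>Z. zero_object LT Z" using zero_object_exists zero_object_LT by blast
    show "\<exists>P \<iota>. is_coproduct LT (UNIV :: bool set) Xs P \<iota>" if "\<forall>b. Xs b \<in> Obj LT" for Xs
      by (rule coproduct_LT_exists[OF small_finite, of "UNIV :: bool set" Xs]) (use that in auto)
  qed auto
qed

text \<open>A full subcategory closed under isomorphisms, suspensions, desuspensions and cones
  inherits each axiom; the work lies in checking that the maps and objects provided by the ambient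
  axioms are local.\<close>

lemma triangulated_LT: "triangulated_category LT"
proof -
  interpret LT: additive_category LT by (rule additive_LT)
  have TM: "(f, g, h) \<in> Tri LT \<Longrightarrow> (f, g, h) \<in> Tri C" for f g h by simp
  have fnc: "is_functor LT LT (Susp C)"
    by (auto simp: is_functor_def local_susp_iff)
  show ?thesis
  proof unfold_locales
    show "additive_functor LT LT (Susp LT)"
      using fnc unfolding additive_functor_def by (auto simp: hom_def local_susp_iff)
    show "is_equivalence LT LT (Susp LT)"
      unfolding is_equivalence_def
    proof (intro conjI ballI)
      show "is_functor LT LT (Susp LT)" using fnc by simp
      show "bij_betw (farr (Susp LT)) (homset LT X Y) (homset LT (fobj (Susp LT) X) (fobj (Susp LT) Y))"
        if "X \<in> Obj LT" "Y \<in> Obj LT" for X Y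
        using that susp_equivalence unfolding is_equivalence_def by (simp add: homset_LT local_susp_iff)
      fix Z assume "Z \<in> Obj LT"
      then have Z: "local Z" by simp
      \<comment> \<open>Essential surjectivity of the suspension on local objects: a desuspension
        formed in the ambient category is local by \<open>local_susp_iff\<close>.\<close>
      obtain X k where k: "X \<in> Obj C" "k \<in> homset C (S X) Z" "iso_arr C k" using desusp[of Z] Z by auto
      have "local (S X)" using local_iso[OF Z, of "inv_arr C k"] k by auto
      then have X: "local X" using k local_susp_iff by simp
      then show "\<exists>X\<in>Obj LT. \<exists>f\<in>homset LT (fobj (Susp LT) X) Z. iso_arr LT f"
        using k Z by (intro bexI[of _ X] bexI[of _ k]) (auto simp: iso_LT local_susp_iff)
    qed
  next
    fix t assume t: "t \<in> Tri LT"
    obtain f g h where e: "t = (f, g, h)" by (cases t)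
    then have tC: "(f, g, h) \<in> Tri C" and loc: "local (Dom C f)" "local (Dom C g)" "local (Dom C h)" using t by auto
    note ts = tri_simps[OF tC]
    have loc': "local (Cod C f)" "local (Cod C g)" "local (Cod C h)"
      using loc ts by (auto simp: local_susp_iff)
    show "candidate_triangle LT t"
      unfolding e candidate_triangle_def using ts loc loc' by (simp add: homset_def)
  next
    fix t t' x y z
    assume t: "t \<in> Tri LT" and t': "candidate_triangle LT t'" and m: "triangle_map LT t t' x y z"
      and iso: "iso_arr LT x" "iso_arr LT y" "iso_arr LT z"
    obtain f g h f' g' h' where e: "t = (f, g, h)" "t' = (f', g', h')" by (cases t, cases t')
    have "t' \<in> Tri C"
    proof (rule tri_iso_closed)
      show "t \<in> Tri C" using t by auto
      show "candidate_triangle C t'" using t' unfolding e candidate_triangle_def homset_def LT_simps prod.case by blast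
      show "triangle_map C t t' x y z" using m unfolding e triangle_map_def homset_def by simp
      have "x \<in> Arr LT" "y \<in> Arr LT" "z \<in> Arr LT" using iso unfolding iso_arr_def by blast+
      then show "iso_arr C x" "iso_arr C y" "iso_arr C z" using iso iso_LT by blast+
    qed
    moreover have "local (Dom C f')" "local (Dom C g')" "local (Dom C h')"
      using t' unfolding e candidate_triangle_def homset_def LT_simps prod.case by blast+
    ultimately show "t' \<in> Tri LT" unfolding e by simp
  next
    fix X Z assume "X \<in> Obj LT" "zero_object LT Z"
    then show "(Id LT X, Zero LT X Z, Zero LT Z (fobj (Susp LT) X)) \<in> Tri LT"
      using tri_id[of X Z] local_zero[of Z] by (simp add: zero_object_LT local_susp_iff)
  next
    fix f assume f: "f \<in> Arr LT"
    then obtain g h where t: "(f, g, h) \<in> Tri C" using tri_exists[of f] by auto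
    have "local (Cod C g)" using local_cone[OF t] f by simp
    then show "\<exists>g h. (f, g, h) \<in> Tri LT" using t f tri_simps[OF t] by (intro exI[of _ g] exI[of _ h]) simp
  next
    fix f g h assume cM: "candidate_triangle LT (f, g, h)"
    then have cC: "candidate_triangle C (f, g, h)" unfolding candidate_triangle_def homset_def LT_simps prod.case by blast
    have loc: "local (Dom C f)" "local (Dom C g)" "local (Dom C h)" "f \<in> Arr C" "local (Cod C f)"
      using cM unfolding candidate_triangle_def homset_def LT_simps prod.case by blast+
    have "neg_arr LT (Sa f) = neg_arr C (Sa f)" by (rule neg_LT) (use loc in \<open>simp add: local_susp_iff\<close>)
    then show "(f, g, h) \<in> Tri LT \<longleftrightarrow> (g, h, neg_arr LT (farr (Susp LT) f)) \<in> Tri LT"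
      using tri_rotate[OF cC] loc by (simp add: local_susp_iff)
  next
    fix f g h f' g' h' x y
    assume t: "(f, g, h) \<in> Tri LT" "(f', g', h') \<in> Tri LT" and x: "x \<in> homset LT (Dom LT f) (Dom LT f')"
      and y: "y \<in> homset LT (Cod LT f) (Cod LT f')" and e: "y \<cdot>\<^bsub>LT\<^esub> f = f' \<cdot>\<^bsub>LT\<^esub> x"
    obtain z where z: "triangle_map C (f, g, h) (f', g', h') x y z"
      using tri_complete[OF TM[OF t(1)] TM[OF t(2)], of x y] x y e by auto
    then have "triangle_map LT (f, g, h) (f', g', h') x y z"
      using t unfolding triangle_map_def homset_def by simp
    then show "\<exists>z. triangle_map LT (f, g, h) (f', g', h') x y z" by blast
  next
    fix f g f1 f2 g1 g2 k1 k2
    assume fg: "Cod LT f = Dom LT g" and t: "(f, f1, f2) \<in> Tri LT" "(g, g1, g2) \<in> Tri LT" "(g \<cdot>\<^bsub>LT\<^esub> f, k1, k2) \<in> Tri LT"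
    have tk: "(g \<cdot> f, k1, k2) \<in> Tri C" using t(3) by simp
    obtain u v where uv: "u \<in> homset C (Cod C f1) (Cod C k1)" "v \<in> homset C (Cod C k1) (Cod C g1)"
      "(u, v, Sa f1 \<cdot> g2) \<in> Tri C" "u \<cdot> f1 = k1 \<cdot> g" "k2 \<cdot> u = f2" "v \<cdot> k1 = g1" "g2 \<cdot> v = Sa f \<cdot> k2"
      using octahedral[OF _ TM[OF t(1)] TM[OF t(2)] tk] fg by auto
    have loc: "local (Cod C f1)" "local (Cod C k1)" "local (Cod C g1)"
      using t tri_simps(5)[OF TM[OF t(1)]] tri_simps(5)[OF TM[OF t(2)]] tri_simps(5)[OF tk] by auto
    have g2: "Dom C (Sa f1 \<cdot> g2) = Cod C g1"
      using tri_simps[OF TM[OF t(1)]] tri_simps[OF TM[OF t(2)]] fg by simp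
    show "\<exists>u v. u \<in> homset LT (Cod LT f1) (Cod LT k1) \<and> v \<in> homset LT (Cod LT k1) (Cod LT g1) \<and>
        (u, v, farr (Susp LT) f1 \<cdot>\<^bsub>LT\<^esub> g2) \<in> Tri LT \<and> u \<cdot>\<^bsub>LT\<^esub> f1 = k1 \<cdot>\<^bsub>LT\<^esub> g \<and> k2 \<cdot>\<^bsub>LT\<^esub> u = f2 \<and>
        v \<cdot>\<^bsub>LT\<^esub> k1 = g1 \<and> g2 \<cdot>\<^bsub>LT\<^esub> v = farr (Susp LT) f \<cdot>\<^bsub>LT\<^esub> k2"
      by (intro exI[of _ u] exI[of _ v]) (use uv loc g2 in auto)
  qed
qed

text \<open>The family also has an ambient coproduct that is local, hence a coproduct in the local
  category as well. Uniqueness up to isomorphism transfers the ambient universal property.\<close>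

lemma coproduct_LT_D:
  assumes co: "is_coproduct LT I Y P \<iota>" and I: "small U I"
  shows "is_coproduct C I Y P \<iota>"
proof -
  interpret LT: additive_category LT by (rule additive_LT)
  note c = LT.coproduct_simps[OF co]
  obtain P' \<iota>' where co': "is_coproduct C I Y P' \<iota>'" "local P'" "is_coproduct LT I Y P' \<iota>'"
    using coproduct_LT_exists[OF I, of Y] c by auto
  obtain \<psi> where \<psi>: "\<psi> \<in> homset LT P' P" "iso_arr LT \<psi>" "\<And>j. j \<in> I \<Longrightarrow> \<psi> \<cdot>\<^bsub>LT\<^esub> \<iota>' j = \<iota> j"
    using LT.coproduct_iso[OF co'(3) co] by blast
  have \<psi>C: "\<psi> \<in> homset C P' P" "iso_arr C \<psi>" using \<psi>(1,2) iso_LT[of \<psi>] by auto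
  have "is_coproduct C I Y P (\<lambda>j. \<psi> \<cdot> \<iota>' j \<cdot> i (Y j))"
    by (rule coproduct_iso_transport[OF co'(1) _ _ \<psi>C]) (use coproduct_simps(5)[OF co'(1)] in auto)
  then show ?thesis
    by (rule coproduct_cong) (use \<psi>(3) coproduct_simps(2-5)[OF co'(1)] in auto)
qed

text \<open>Restriction along \<open>\<eta> A\<close> identifies maps from \<open>Lo A\<close> to a
  local object with maps from \<open>A\<close>, and coproducts of local objects are ambient
  coproducts, so finite support can be read off over \<open>A\<close>.\<close>

lemma compact_LT:
  assumes A: "compact_obj U C A"
  shows "compact_obj U LT (Lo A)"
proof -
  interpret LT: additive_category LT by (rule additive_LT)
  have AO [simp]: "A \<in> Obj C" using compact_obj_obj[OF A] .
  show ?thesis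
  proof (rule LT.compact_objI)
    show "Lo A \<in> Obj LT" by simp
    fix I :: "'u set" and Y P \<iota> q
    assume I: "small U I" and co: "is_coproduct LT I Y P \<iota>" and q: "q \<in> homset LT (Lo A) P"
    have coC: "is_coproduct C I Y P \<iota>" by (rule coproduct_LT_D[OF co I])
    have P: "local P" and Y: "\<And>j. j \<in> I \<Longrightarrow> local (Y j)" using LT.coproduct_simps[OF co] by auto
    have qC: "q \<in> homset C (Lo A) P" using q by auto
    have "q \<cdot> \<eta> A \<in> coprod_span C I Y P \<iota> A" by (rule compact_objD[OF A I coC]) (use qC in simp)
    \<comment> \<open>The decomposition is rebuilt over \<open>Lo A\<close> term by term: a map from
      \<open>A\<close> to a summand extends along \<open>\<eta> A\<close> because the summand is
      local.\<close>
    then have "\<exists>q'\<in>coprod_span LT I Y P \<iota> (Lo A). q' \<in> homset C (Lo A) P \<and> q' \<cdot> \<eta> A = q \<cdot> \<eta> A"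
    proof induction
      case zero
      have "Zero LT (Lo A) P \<in> coprod_span LT I Y P \<iota> (Lo A)" by (rule coprod_span.zero)
      then show ?case using P by (intro bexI[of _ "Zero C (Lo A) P"]) simp_all
    next
      case (inj j x)
      note c = coproduct_simps(2-5)[OF coC inj(1)]
      obtain x' where x': "x' \<in> homset C (Lo A) (Y j)" "x' \<cdot> \<eta> A = x" using local_ext[OF inj(2) Y[OF inj(1)]] by blast
      have "x' \<in> homset LT (Lo A) (Y j)" using x'(1) Y[OF inj(1)] by auto
      with inj(1) have "\<iota> j \<cdot>\<^bsub>LT\<^esub> x' \<in> coprod_span LT I Y P \<iota> (Lo A)" by (rule coprod_span.inj)
      then have "\<iota> j \<cdot> x' \<in> coprod_span LT I Y P \<iota> (Lo A)" by simp
      moreover have "(\<iota> j \<cdot> x') \<cdot> \<eta> A = \<iota> j \<cdot> x" using x' c by auto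
      ultimately show ?case using x'(1) c by (intro bexI[of _ "\<iota> j \<cdot> x'"]) simp_all
    next
      case (add s t)
      then obtain s' t' where s': "s' \<in> coprod_span LT I Y P \<iota> (Lo A)" "s' \<in> homset C (Lo A) P" "s' \<cdot> \<eta> A = s"
        and t': "t' \<in> coprod_span LT I Y P \<iota> (Lo A)" "t' \<in> homset C (Lo A) P" "t' \<cdot> \<eta> A = t" by blast
      have "s' \<boxplus> t' \<in> coprod_span LT I Y P \<iota> (Lo A)" using coprod_span.add[OF s'(1) t'(1)] by simp
      then show ?case using s' t' by (intro bexI[of _ "s' \<boxplus> t'"]) auto
    qed
    then obtain q' where q': "q' \<in> coprod_span LT I Y P \<iota> (Lo A)" "q' \<in> homset C (Lo A) P" "q' \<cdot> \<eta> A = q \<cdot> \<eta> A" by blast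
    have "q' = q" by (rule local_ext_unique[OF q'(2) qC P AO q'(3)])
    then show "q \<in> coprod_span LT I Y P \<iota> (Lo A)" using q'(1) by simp
  qed
qed

text \<open>A map from a generator \<open>A\<close> to a local object extends to
  \<open>Lo A\<close>. If all maps from \<open>Lo A\<close> vanish, so do the maps that they
  restrict to.\<close>

lemma compact_generators_LT:
  obtains G where "small U G" "\<And>A. A \<in> G \<Longrightarrow> compact_obj U C A"
    "\<And>X. local X \<Longrightarrow> (\<And>A. A \<in> Lo ` G \<Longrightarrow> homset LT A X = {Zero LT A X}) \<Longrightarrow> zero_object LT X"
proof -
  obtain G where G: "small U G" "\<And>A. A \<in> G \<Longrightarrow> compact_obj U C A"
    "\<And>X. X \<in> Obj C \<Longrightarrow> (\<And>A. A \<in> G \<Longrightarrow> homset C A X = {Zero C A X}) \<Longrightarrow> zero_object C X"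
    using generators by blast
  have "zero_object LT X" if X: "local X" and 0: "\<And>A. A \<in> Lo ` G \<Longrightarrow> homset LT A X = {Zero LT A X}" for X
    unfolding zero_object_LT
  proof (rule G(3))
    fix A assume A: "A \<in> G"
    have AO [simp]: "A \<in> Obj C" using compact_obj_obj[OF G(2)[OF A]] .
    have "f = Zero C A X" if f: "f \<in> homset C A X" for f
    proof -
      obtain g where g: "g \<in> homset C (Lo A) X" "g \<cdot> \<eta> A = f" using local_ext[OF f X] by blast
      have "g \<in> homset LT (Lo A) X" using g(1) X by auto
      then have "g = Zero C (Lo A) X" using 0[of "Lo A"] A by auto
      then show ?thesis using g(2) X by auto
    qed
    then show "homset C A X = {Zero C A X}" using X by auto
  qed (use X in simp)
  then show thesis using that[of G] G(1,2) by blast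
qed

lemma large_LT: "large_category U LT"
proof -
  interpret LT: triangulated_category LT by (rule triangulated_LT)
  show ?thesis
  proof unfold_locales
    show "small U (homset LT X Y)" if "X \<in> Obj LT" "Y \<in> Obj LT" for X Y
      using that locally_small by (simp add: homset_LT)
    show "\<exists>P \<iota>. is_coproduct LT I Xi P \<iota>" if "small U I" "Xi \<in> I \<rightarrow> Obj LT" for I :: "'u set" and Xi
      by (rule coproduct_LT_exists[OF that(1), of Xi]) (use that(2) in \<open>auto simp: Pi_iff\<close>)
    show "universe U" by (rule univ)
    obtain G where G: "small U G" "\<And>A. A \<in> G \<Longrightarrow> compact_obj U C A"
      "\<And>X. local X \<Longrightarrow> (\<And>A. A \<in> Lo ` G \<Longrightarrow> homset LT A X = {Zero LT A X}) \<Longrightarrow> zero_object LT X"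
      using compact_generators_LT by blast
    have "small U (Lo ` G)" using G(1) card_of_image ordLeq_ordLess_trans unfolding small_def by blast
    moreover have "\<forall>A\<in>Lo ` G. compact_obj U LT A" using G(2) compact_LT by blast
    ultimately show "\<exists>G. small U G \<and> (\<forall>A\<in>G. compact_obj U LT A) \<and>
        (\<forall>X\<in>Obj LT. (\<forall>A\<in>G. homset LT A X = {Zero LT A X}) \<longrightarrow> zero_object LT X)"
      using G(3) by (intro exI[of _ "Lo ` G"]) (simp only: LT_simps mem_Collect_eq Ball_def simp_thms, blast)
  qed
qed

text \<open>The unitors of the local category are characterised by their composites with these
  invertible maps. Identities that involve \<open>Lo e1\<close> are checked after composing with
  them, which replaces \<open>Lo e1\<close> by \<open>e1\<close>.\<close>

lemma lunit_LT:
  assumes X: "local X"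
  shows "iso_arr C (\<eta> e1 \<diamondop> i X)" "(l X \<cdot> inv_arr C (\<eta> e1 \<diamondop> i X)) \<cdot> (\<eta> e1 \<diamondop> i X) = l X"
    "iso_arr C (i X \<diamondop> \<eta> e1)" "(r X \<cdot> inv_arr C (i X \<diamondop> \<eta> e1)) \<cdot> (i X \<diamondop> \<eta> e1) = r X"
  using eta_tensor_iso[OF _ X, of e1] X by auto

text \<open>Local objects are closed under tensor products and internal homs, so axioms that do not
  mention the unit are inherited. The others are reduced to the ambient ones by cancelling the maps
  of \<open>lunit_LT\<close>.\<close>

lemma closed_LT: "closed_symmetric_monoidal LT"
proof -
  interpret LT: category LT by (rule category_LT)
  have [simp]: "local X \<Longrightarrow> local Y \<Longrightarrow> local (X \<boxtimes> Y)" "local X \<Longrightarrow> local Y \<Longrightarrow> local (IHom C X Y)" for X Y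
    using local_tensor[of X Y] local_ihom[of X Y] by auto
  show ?thesis
  proof unfold_locales
    show "Assoc LT X' Y' Z' \<cdot>\<^bsub>LT\<^esub> ((f \<diamondop>\<^bsub>LT\<^esub> g) \<diamondop>\<^bsub>LT\<^esub> h) = (f \<diamondop>\<^bsub>LT\<^esub> (g \<diamondop>\<^bsub>LT\<^esub> h)) \<cdot>\<^bsub>LT\<^esub> Assoc LT X Y Z"
      if "f \<in> homset LT X X'" "g \<in> homset LT Y Y'" "h \<in> homset LT Z Z'" for f g h X X' Y Y' Z Z'
      using assoc_nat[of f g h X' Y' Z'] that by simp
    show "Assoc LT X Y Z \<in> homset LT (X \<boxtimes>\<^bsub>LT\<^esub> Y \<boxtimes>\<^bsub>LT\<^esub> Z) (X \<boxtimes>\<^bsub>LT\<^esub> (Y \<boxtimes>\<^bsub>LT\<^esub> Z)) \<and> iso_arr LT (Assoc LT X Y Z)"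
      if "X \<in> Obj LT" "Y \<in> Obj LT" "Z \<in> Obj LT" for X Y Z
      using that iso_LT[of "a X Y Z"] by simp
    show "LUnit LT X \<in> homset LT (Unit LT \<boxtimes>\<^bsub>LT\<^esub> X) X \<and> iso_arr LT (LUnit LT X)" if "X \<in> Obj LT" for X
      using that lunit_LT[of X] iso_LT[of "l X \<cdot> inv_arr C (\<eta> e1 \<diamondop> i X)"] by simp
    show "RUnit LT X \<in> homset LT (X \<boxtimes>\<^bsub>LT\<^esub> Unit LT) X \<and> iso_arr LT (RUnit LT X)" if "X \<in> Obj LT" for X
      using that lunit_LT[of X] iso_LT[of "r X \<cdot> inv_arr C (i X \<diamondop> \<eta> e1)"] by simp
    show "LUnit LT Y \<cdot>\<^bsub>LT\<^esub> (Id LT (Unit LT) \<diamondop>\<^bsub>LT\<^esub> f) = f \<cdot>\<^bsub>LT\<^esub> LUnit LT X" if f: "f \<in> homset LT X Y" for f X Y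
    proof -
      have [simp]: "f \<in> Arr C" "Dom C f = X" "Cod C f = Y" "X \<in> Obj C" "Y \<in> Obj C" and loc: "local X" "local Y" using f by auto
      note u = lunit_LT[OF loc(1)] lunit_LT[OF loc(2)]
      let ?u = "l Y \<cdot> inv_arr C (\<eta> e1 \<diamondop> i Y)"
      have "(?u \<cdot> (i (Lo e1) \<diamondop> f)) \<cdot> (\<eta> e1 \<diamondop> i X) = ?u \<cdot> (\<eta> e1 \<diamondop> i Y) \<cdot> (i e1 \<diamondop> f)"
        using u by (simp add: interchange)
      also have "\<dots> = l Y \<cdot> (i e1 \<diamondop> f)" using u by simp
      also have "\<dots> = f \<cdot> l X" by (subst lunit_nat) auto
      also have "\<dots> = (f \<cdot> l X \<cdot> inv_arr C (\<eta> e1 \<diamondop> i X)) \<cdot> (\<eta> e1 \<diamondop> i X)" using u by simp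
      finally have "?u \<cdot> (i (Lo e1) \<diamondop> f) = f \<cdot> l X \<cdot> inv_arr C (\<eta> e1 \<diamondop> i X)"
        by (rule iso_right_cancel[OF u(1), rotated -1]) (use u in simp_all)
      then show ?thesis by simp
    qed
    show "RUnit LT Y \<cdot>\<^bsub>LT\<^esub> (f \<diamondop>\<^bsub>LT\<^esub> Id LT (Unit LT)) = f \<cdot>\<^bsub>LT\<^esub> RUnit LT X" if f: "f \<in> homset LT X Y" for f X Y
    proof -
      have [simp]: "f \<in> Arr C" "Dom C f = X" "Cod C f = Y" "X \<in> Obj C" "Y \<in> Obj C" and loc: "local X" "local Y" using f by auto
      note u = lunit_LT[OF loc(1)] lunit_LT[OF loc(2)]
      let ?u = "r Y \<cdot> inv_arr C (i Y \<diamondop> \<eta> e1)"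
      have "(?u \<cdot> (f \<diamondop> i (Lo e1))) \<cdot> (i X \<diamondop> \<eta> e1) = ?u \<cdot> (i Y \<diamondop> \<eta> e1) \<cdot> (f \<diamondop> i e1)"
        using u by (simp add: interchange)
      also have "\<dots> = r Y \<cdot> (f \<diamondop> i e1)" using u by simp
      also have "\<dots> = f \<cdot> r X" by (subst runit_nat) auto
      also have "\<dots> = (f \<cdot> r X \<cdot> inv_arr C (i X \<diamondop> \<eta> e1)) \<cdot> (i X \<diamondop> \<eta> e1)" using u by simp
      finally have "?u \<cdot> (f \<diamondop> i (Lo e1)) = f \<cdot> r X \<cdot> inv_arr C (i X \<diamondop> \<eta> e1)"
        by (rule iso_right_cancel[OF u(3), rotated -1]) (use u in simp_all)
      then show ?thesis by simp
    qed
    show "(Id LT X \<diamondop>\<^bsub>LT\<^esub> LUnit LT Y) \<cdot>\<^bsub>LT\<^esub> Assoc LT X (Unit LT) Y = RUnit LT X \<diamondop>\<^bsub>LT\<^esub> Id LT Y"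
      if X: "X \<in> Obj LT" and Y: "Y \<in> Obj LT" for X Y
    proof -
      have [simp]: "X \<in> Obj C" "Y \<in> Obj C" and loc: "local X" "local Y" using X Y by auto
      note u = lunit_LT[OF loc(1)] lunit_LT[OF loc(2)]
      let ?u = "l Y \<cdot> inv_arr C (\<eta> e1 \<diamondop> i Y)" and ?v = "r X \<cdot> inv_arr C (i X \<diamondop> \<eta> e1)"
      \<comment> \<open>The test map for the triangle identity. After composing with it the middle
        factor is \<open>e1\<close>, and the ambient identity applies.\<close>
      have iso: "iso_arr C ((i X \<diamondop> \<eta> e1) \<diamondop> i Y)" using u by simp
      have "((i X \<diamondop> ?u) \<cdot> a X (Lo e1) Y) \<cdot> ((i X \<diamondop> \<eta> e1) \<diamondop> i Y) = (i X \<diamondop> ?u) \<cdot> (i X \<diamondop> (\<eta> e1 \<diamondop> i Y)) \<cdot> a X e1 Y"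
        using u assoc_nat[of "i X" "\<eta> e1" "i Y" X "Lo e1" Y] by simp
      also have "\<dots> = ((i X \<diamondop> ?u) \<cdot> (i X \<diamondop> (\<eta> e1 \<diamondop> i Y))) \<cdot> a X e1 Y" using u by simp
      also have "(i X \<diamondop> ?u) \<cdot> (i X \<diamondop> (\<eta> e1 \<diamondop> i Y)) = i X \<diamondop> (?u \<cdot> (\<eta> e1 \<diamondop> i Y))" using u by (simp add: interchange)
      also have "\<dots> = i X \<diamondop> l Y" unfolding u(6) ..
      also have "(i X \<diamondop> l Y) \<cdot> a X e1 Y = r X \<diamondop> i Y" by (simp add: triangle)
      also have "\<dots> = (?v \<cdot> (i X \<diamondop> \<eta> e1)) \<diamondop> i Y" unfolding u(4) ..
      also have "\<dots> = (?v \<diamondop> i Y) \<cdot> ((i X \<diamondop> \<eta> e1) \<diamondop> i Y)" by (rule whisker_right) (use u in simp_all)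
      finally have "(i X \<diamondop> ?u) \<cdot> a X (Lo e1) Y = ?v \<diamondop> i Y"
        by (rule iso_right_cancel[OF iso, rotated -1]) (use u in simp_all)
      then show ?thesis by simp
    qed
    show "\<exists>!g. g \<in> homset LT Z (IHom LT X Y) \<and> Ev LT X Y \<cdot>\<^bsub>LT\<^esub> (g \<diamondop>\<^bsub>LT\<^esub> Id LT X) = f"
      if "X \<in> Obj LT" "Y \<in> Obj LT" "Z \<in> Obj LT" "f \<in> homset LT (Z \<boxtimes>\<^bsub>LT\<^esub> X) Y" for X Y Z f
      using ev_universal[of X Y Z f] that by (simp add: homset_LT del: in_homset_iff)
  qed (auto simp: pentagon hexagon braid_symmetric braid_nat interchange simp del: assoc)
qed

lemma tensor_LT: "tensor_tt U LT"
proof -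
  interpret A: large_category U LT by (rule large_LT)
  interpret B: closed_symmetric_monoidal LT by (rule closed_LT)
  show ?thesis
  proof unfold_locales
    show "compact_obj U LT (Unit LT)" using compact_LT[OF unit_compact] by simp
    show "\<exists>h'. (f \<diamondop>\<^bsub>LT\<^esub> Id LT Y, g \<diamondop>\<^bsub>LT\<^esub> Id LT Y, h') \<in> Tri LT" if t: "(f, g, h) \<in> Tri LT" and Y: "Y \<in> Obj LT" for f g h Y
    proof -
      have tC: "(f, g, h) \<in> Tri C" and loc: "local (Dom C f)" "local (Dom C g)" "local (Dom C h)" "local Y" using t Y by auto
      note ts = tri_simps[OF tC]
      obtain h' where t': "(f \<diamondop> i Y, g \<diamondop> i Y, h') \<in> Tri C" using tensor_tri[OF tC, of Y] loc by auto
      \<comment> \<open>\<open>h'\<close> is merely known to exist in the ambient category; its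
        domain is identified in order to place the triangle among the local ones.\<close>
      have "Dom C h' = Dom C h \<boxtimes> Y" using tri_simps(5)[OF t'] ts loc by simp
      then have "(f \<diamondop> i Y, g \<diamondop> i Y, h') \<in> Tri LT" using t' loc ts local_tensor[OF _ loc(4)] by simp
      then show ?thesis by auto
    qed
  qed auto
qed

text \<open>\<open>L\<close> is not treated as a monoidal functor. Evaluation and coevaluation of
  \<open>A\<close> are instead extended along the units \<open>\<eta>\<close>, and uniqueness of
  such extensions yields the triangle identity.\<close>

lemma dualizable_L:
  assumes A: "compact_obj U C A"
  shows "\<exists>V e c. closed_symmetric_monoidal.dual_pair LT V (Lo A) e c"
proof -
  interpret LT: tensor_tt U LT by (rule tensor_LT)
  have AO [simp]: "A \<in> Obj C" using compact_obj_obj[OF A] .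
  obtain c where dp: "dual_pair (dual A) A (ev A) c" using compact_dualizable[OF A] by blast
  let ?V = "dual A"
  have [simp]: "c \<in> Arr C" "Dom C c = e1" "Cod C c = A \<boxtimes> ?V"
    and z: "r A \<cdot> (i A \<diamondop> ev A) \<cdot> a A ?V A \<cdot> (c \<diamondop> i A) = l A" using dp by (auto simp: dual_pair_def)
  have loc: "local (Lo ?V \<boxtimes> Lo A)" "local (Lo A \<boxtimes> Lo ?V)" using local_tensor[of "Lo ?V" "Lo A"] local_tensor[of "Lo A" "Lo ?V"] by auto
  obtain eL where eL: "eL \<in> homset C (Lo ?V \<boxtimes> Lo A) (Lo e1)" "eL \<cdot> (\<eta> ?V \<diamondop> \<eta> A) = \<eta> e1 \<cdot> ev A"
    using tensor_ext_both[of "\<eta> e1 \<cdot> ev A" ?V A "Lo e1"] by auto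
  obtain cL where cL: "cL \<in> homset C (Lo e1) (Lo A \<boxtimes> Lo ?V)" "cL \<cdot> \<eta> e1 = (\<eta> A \<diamondop> \<eta> ?V) \<cdot> c"
    using local_ext[of "(\<eta> A \<diamondop> \<eta> ?V) \<cdot> c" e1 "Lo A \<boxtimes> Lo ?V"] loc by auto
  have [simp]: "eL \<in> Arr C" "Dom C eL = Lo ?V \<boxtimes> Lo A" "Cod C eL = Lo e1" "cL \<in> Arr C" "Dom C cL = Lo e1"
    "Cod C cL = Lo A \<boxtimes> Lo ?V" using eL(1) cL(1) by auto
  note u = lunit_LT[of "Lo A", OF local_L[OF AO]]
  let ?l = "l (Lo A) \<cdot> inv_arr C (\<eta> e1 \<diamondop> i (Lo A))" and ?r = "r (Lo A) \<cdot> inv_arr C (i (Lo A) \<diamondop> \<eta> e1)"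
  have 1: "a (Lo A) (Lo ?V) (Lo A) \<cdot> ((\<eta> A \<diamondop> \<eta> ?V) \<diamondop> \<eta> A) = (\<eta> A \<diamondop> (\<eta> ?V \<diamondop> \<eta> A)) \<cdot> a A ?V A"
    by (subst assoc_nat) auto
  \<comment> \<open>The identity is tested on \<open>\<eta> e1 \<diamondop> \<eta> A\<close>, where
    it becomes the triangle identity of \<open>A\<close>; \<open>tensor_ext_both_unique\<close>
    removes the test map.\<close>
  have "(?r \<cdot> (i (Lo A) \<diamondop> eL) \<cdot> a (Lo A) (Lo ?V) (Lo A) \<cdot> (cL \<diamondop> i (Lo A))) \<cdot> (\<eta> e1 \<diamondop> \<eta> A) =
     ?r \<cdot> (i (Lo A) \<diamondop> eL) \<cdot> a (Lo A) (Lo ?V) (Lo A) \<cdot> ((cL \<diamondop> i (Lo A)) \<cdot> (\<eta> e1 \<diamondop> \<eta> A))" using u by simp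
  also have "(cL \<diamondop> i (Lo A)) \<cdot> (\<eta> e1 \<diamondop> \<eta> A) = ((\<eta> A \<diamondop> \<eta> ?V) \<diamondop> \<eta> A) \<cdot> (c \<diamondop> i A)"
    using cL(2) by (simp add: interchange)
  also have "?r \<cdot> (i (Lo A) \<diamondop> eL) \<cdot> a (Lo A) (Lo ?V) (Lo A) \<cdot> (((\<eta> A \<diamondop> \<eta> ?V) \<diamondop> \<eta> A) \<cdot> (c \<diamondop> i A)) =
     ?r \<cdot> (i (Lo A) \<diamondop> eL) \<cdot> (a (Lo A) (Lo ?V) (Lo A) \<cdot> ((\<eta> A \<diamondop> \<eta> ?V) \<diamondop> \<eta> A)) \<cdot> (c \<diamondop> i A)" using u by simp
  also have "\<dots> = ?r \<cdot> ((i (Lo A) \<diamondop> eL) \<cdot> (\<eta> A \<diamondop> (\<eta> ?V \<diamondop> \<eta> A))) \<cdot> a A ?V A \<cdot> (c \<diamondop> i A)"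
    unfolding 1 using u by simp
  also have "(i (Lo A) \<diamondop> eL) \<cdot> (\<eta> A \<diamondop> (\<eta> ?V \<diamondop> \<eta> A)) = (i (Lo A) \<diamondop> \<eta> e1) \<cdot> (\<eta> A \<diamondop> i e1) \<cdot> (i A \<diamondop> ev A)"
    using eL(2) by (simp add: interchange)
  also have "?r \<cdot> ((i (Lo A) \<diamondop> \<eta> e1) \<cdot> (\<eta> A \<diamondop> i e1) \<cdot> (i A \<diamondop> ev A)) \<cdot> a A ?V A \<cdot> (c \<diamondop> i A) =
     (?r \<cdot> (i (Lo A) \<diamondop> \<eta> e1)) \<cdot> (\<eta> A \<diamondop> i e1) \<cdot> (i A \<diamondop> ev A) \<cdot> a A ?V A \<cdot> (c \<diamondop> i A)" using u by simp
  also have "?r \<cdot> (i (Lo A) \<diamondop> \<eta> e1) = r (Lo A)" by (rule u(4))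
  also have "r (Lo A) \<cdot> (\<eta> A \<diamondop> i e1) \<cdot> (i A \<diamondop> ev A) \<cdot> a A ?V A \<cdot> (c \<diamondop> i A) =
     (r (Lo A) \<cdot> (\<eta> A \<diamondop> i e1)) \<cdot> (i A \<diamondop> ev A) \<cdot> a A ?V A \<cdot> (c \<diamondop> i A)" by simp
  also have "r (Lo A) \<cdot> (\<eta> A \<diamondop> i e1) = \<eta> A \<cdot> r A" by (subst runit_nat) auto
  also have "(\<eta> A \<cdot> r A) \<cdot> (i A \<diamondop> ev A) \<cdot> a A ?V A \<cdot> (c \<diamondop> i A) = \<eta> A \<cdot> l A" unfolding z[symmetric] by simp
  also have "\<dots> = l (Lo A) \<cdot> (i e1 \<diamondop> \<eta> A)" by (subst lunit_nat) auto
  also have "\<dots> = (?l \<cdot> (\<eta> e1 \<diamondop> i (Lo A))) \<cdot> (i e1 \<diamondop> \<eta> A)" unfolding u(2) ..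
  also have "\<dots> = ?l \<cdot> ((\<eta> e1 \<diamondop> i (Lo A)) \<cdot> (i e1 \<diamondop> \<eta> A))" using u by simp
  also have "(\<eta> e1 \<diamondop> i (Lo A)) \<cdot> (i e1 \<diamondop> \<eta> A) = \<eta> e1 \<diamondop> \<eta> A" by (simp add: interchange)
  finally have "?r \<cdot> (i (Lo A) \<diamondop> eL) \<cdot> a (Lo A) (Lo ?V) (Lo A) \<cdot> (cL \<diamondop> i (Lo A)) = ?l"
    by (rule tensor_ext_both_unique[of _ e1 A "Lo A", rotated -1]) (use u in simp_all)
  then have "LT.dual_pair (Lo ?V) (Lo A) eL cL"
    unfolding LT.dual_pair_def using loc by simp
  then show ?thesis by blast
qed

lemma dualizable_LT: "dualizable_tt U LT"
proof -
  interpret LT: tensor_tt U LT by (rule tensor_LT)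
  obtain G where G: "small U G" "\<And>A. A \<in> G \<Longrightarrow> compact_obj U C A"
    "\<And>X. local X \<Longrightarrow> (\<And>A. A \<in> Lo ` G \<Longrightarrow> homset LT A X = {Zero LT A X}) \<Longrightarrow> zero_object LT X"
    using compact_generators_LT by blast
  have small: "small U (Lo ` G)" using G(1) card_of_image ordLeq_ordLess_trans unfolding small_def by blast
  \<comment> \<open>The suspension of a localised generator is isomorphic to
    \<open>Lo (S A)\<close>, which is dualizable because \<open>S A\<close> is compact; the duality
    is moved along the isomorphism.\<close>
  have shift: "\<exists>V e c. LT.dual_pair V (S (Lo A)) e c" if A: "A \<in> G" for A
  proof -
    have AO: "A \<in> Obj C" using compact_obj_obj[OF G(2)[OF A]] .
    obtain V e c where dp: "LT.dual_pair V (Lo (S A)) e c" using dualizable_L[OF compact_susp[OF G(2)[OF A]]] by blast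
    obtain k where k: "k \<in> homset C (Lo (S A)) (S (Lo A))" "iso_arr C k" using L_susp[OF AO] by blast
    have loc: "local (Lo (S A))" "local (S (Lo A))" using AO by (simp_all add: local_susp_iff)
    have "k \<in> homset LT (Lo (S A)) (S (Lo A))" using k(1) loc by auto
    moreover have "iso_arr LT k" using iso_LT[of k] k loc by auto
    ultimately show ?thesis using LT.dual_pair_iso[OF dp] by blast
  qed
  have "\<exists>c. LT.dual_pair (IHom LT W (Unit LT)) W (Ev LT W (Unit LT)) c" if W: "compact_obj U LT W" for W
  proof (rule LT.compact_dualizable_if[OF small _ _ _ _ W])
    show "zero_object LT X" if "X \<in> Obj LT" "\<And>A. A \<in> Lo ` G \<Longrightarrow> homset LT A X = {Zero LT A X}" for X
      using G(3)[of X] that by (simp del: in_homset_iff)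
  qed (use G(2) compact_LT dualizable_L shift in auto)
  then show ?thesis by unfold_locales
qed

text \<open>For local \<open>X\<close>, restriction along \<open>\<eta>\<close> identifies
  composition with \<open>La f\<close> and composition with \<open>f\<close>, so \<open>La f\<close>
  and \<open>f\<close> impose the same surjectivity condition on \<open>X\<close>.\<close>

lemma local_part_eq:
  assumes \<Phi>: "\<Phi> \<subseteq> Arr C"
  shows "local_part C \<eta> {X \<in> Obj C. \<forall>f\<in>\<Phi>. hom_image C f X = homset C (Dom C f) X} =
    {X \<in> Obj LT. \<forall>f\<in>La ` \<Phi>. hom_image LT f X = homset LT (Dom LT f) X}"
proof -
  have key: "hom_image C f X = homset C (Dom C f) X \<longleftrightarrow> hom_image LT (La f) X = homset LT (Dom LT (La f)) X"
    if X: "local X" and f [simp]: "f \<in> Arr C" for X f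
  proof -
    have hM: "hom_image LT (La f) X = hom_image C (La f) X" using X unfolding hom_image_def by (simp add: homset_LT)
    have dM: "homset LT (Dom LT (La f)) X = homset C (Lo (Dom C f)) X" using X by (simp add: homset_LT)
    have sub: "hom_image C f X \<subseteq> homset C (Dom C f) X" "hom_image C (La f) X \<subseteq> homset C (Lo (Dom C f)) X"
      using hom_image_homset[of f X] hom_image_homset[of "La f" X] by auto
    have nat: "La f \<cdot> \<eta> (Dom C f) = \<eta> (Cod C f) \<cdot> f" by (rule \<eta>_nat) simp
    have "homset C (Dom C f) X \<subseteq> hom_image C f X \<longleftrightarrow> homset C (Lo (Dom C f)) X \<subseteq> hom_image C (La f) X"
    proof
      assume s: "homset C (Dom C f) X \<subseteq> hom_image C f X"
      show "homset C (Lo (Dom C f)) X \<subseteq> hom_image C (La f) X"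
      proof
        fix x assume x: "x \<in> homset C (Lo (Dom C f)) X"
        then have "x \<cdot> \<eta> (Dom C f) \<in> homset C (Dom C f) X" by simp
        then obtain y where y: "y \<in> homset C (Cod C f) X" "x \<cdot> \<eta> (Dom C f) = y \<cdot> f" using s unfolding hom_image_def by blast
        obtain y' where y': "y' \<in> homset C (Lo (Cod C f)) X" "y' \<cdot> \<eta> (Cod C f) = y" using local_ext[OF y(1) X] by blast
        have "(y' \<cdot> La f) \<cdot> \<eta> (Dom C f) = y' \<cdot> \<eta> (Cod C f) \<cdot> f" using y'(1) nat by simp
        also have "\<dots> = (y' \<cdot> \<eta> (Cod C f)) \<cdot> f" using y'(1) by simp
        also have "\<dots> = x \<cdot> \<eta> (Dom C f)" unfolding y'(2) y(2) ..
        finally have "y' \<cdot> La f = x"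
          by (rule local_ext_unique[OF _ x X dom_obj[OF f], rotated -1]) (use y'(1) in simp_all)
        then show "x \<in> hom_image C (La f) X" unfolding hom_image_def using y'(1) by (intro image_eqI[of _ _ y']) auto
      qed
    next
      assume s: "homset C (Lo (Dom C f)) X \<subseteq> hom_image C (La f) X"
      show "homset C (Dom C f) X \<subseteq> hom_image C f X"
      proof
        fix x assume x: "x \<in> homset C (Dom C f) X"
        obtain x' where x': "x' \<in> homset C (Lo (Dom C f)) X" "x' \<cdot> \<eta> (Dom C f) = x" using local_ext[OF x X] by blast
        obtain y where y: "y \<in> homset C (Lo (Cod C f)) X" "x' = y \<cdot> La f" using subsetD[OF s x'(1)] unfolding hom_image_def by auto
        have "x = y \<cdot> La f \<cdot> \<eta> (Dom C f)" using x'(2) y by auto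
        then have "x = (y \<cdot> \<eta> (Cod C f)) \<cdot> f" unfolding nat using y(1) by auto
        then show "x \<in> hom_image C f X" unfolding hom_image_def using y(1) by (intro image_eqI[of _ _ "y \<cdot> \<eta> (Cod C f)"]) auto
      qed
    qed
    then show ?thesis unfolding hM dM using sub by blast
  qed
  show ?thesis
  proof (intro subset_antisym subsetI)
    fix X assume "X \<in> local_part C \<eta> {X \<in> Obj C. \<forall>f\<in>\<Phi>. hom_image C f X = homset C (Dom C f) X}"
    then show "X \<in> {X \<in> Obj LT. \<forall>f\<in>La ` \<Phi>. hom_image LT f X = homset LT (Dom LT f) X}"
      unfolding local_part_def LT_simps(1) using key \<Phi> by blast
  next
    fix X assume "X \<in> {X \<in> Obj LT. \<forall>f\<in>La ` \<Phi>. hom_image LT f X = homset LT (Dom LT f) X}"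
    then show "X \<in> local_part C \<eta> {X \<in> Obj C. \<forall>f\<in>\<Phi>. hom_image C f X = homset C (Dom C f) X}"
      unfolding local_part_def LT_simps(1) using key \<Phi> local_obj by blast
  qed
qed

lemma tensor_injective_LT:
  assumes f [simp]: "f \<in> Arr C" and Y: "local Y"
  shows "dualizable_tt.tensor_injective LT (La f) Y \<longleftrightarrow> tensor_injective f Y"
proof -
  interpret LT: dualizable_tt U LT by (rule dualizable_LT)
  have YO [simp]: "Y \<in> Obj C" using Y by simp
  let ?A = "Dom C f" and ?B = "Cod C f"
  have isoA: "iso_arr C (\<eta> ?A \<diamondop> i Y)" and isoB: "iso_arr C (\<eta> ?B \<diamondop> i Y)" using eta_tensor_iso(1)[OF _ Y] by simp_all
  have loc: "local (Lo ?A \<boxtimes> Y)" "local (Lo ?B \<boxtimes> Y)" using local_tensor[OF _ Y] by auto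
  have nat: "(La f \<diamondop> i Y) \<cdot> (\<eta> ?A \<diamondop> i Y) = (\<eta> ?B \<diamondop> i Y) \<cdot> (f \<diamondop> i Y)" using \<eta>_nat[OF f] by (simp add: interchange)
  \<comment> \<open>The correspondence is handled as a relation: \<open>t'\<close> extends
    \<open>(\<eta> ?A \<diamondop> i Y) \<cdot> t\<close> along \<open>\<eta> e1\<close>. Related
    maps vanish together, and applying \<open>La f\<close> and \<open>f\<close> preserves the
    relation.\<close>
  have rel: "((La f \<diamondop> i Y) \<cdot> t' = Zero C (Lo e1) (Lo ?B \<boxtimes> Y) \<longleftrightarrow> (f \<diamondop> i Y) \<cdot> t = Zero C e1 (?B \<boxtimes> Y)) \<and>
      (t' = Zero C (Lo e1) (Lo ?A \<boxtimes> Y) \<longleftrightarrow> t = Zero C e1 (?A \<boxtimes> Y))"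
    if t: "t \<in> homset C e1 (?A \<boxtimes> Y)" and t': "t' \<in> homset C (Lo e1) (Lo ?A \<boxtimes> Y)" and e: "t' \<cdot> \<eta> e1 = (\<eta> ?A \<diamondop> i Y) \<cdot> t"
    for t t'
  proof -
    have [simp]: "t \<in> Arr C" "Dom C t = e1" "Cod C t = ?A \<boxtimes> Y" "t' \<in> Arr C" "Dom C t' = Lo e1" "Cod C t' = Lo ?A \<boxtimes> Y"
      using t t' by auto
    have z: "x' = Zero C (Lo e1) (Lo W \<boxtimes> Y) \<longleftrightarrow> x = Zero C e1 (W \<boxtimes> Y)"
      if x: "x \<in> homset C e1 (W \<boxtimes> Y)" "x' \<in> homset C (Lo e1) (Lo W \<boxtimes> Y)" "x' \<cdot> \<eta> e1 = (\<eta> W \<diamondop> i Y) \<cdot> x" and W [simp]: "W \<in> Obj C"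
      for x x' W
    proof
      assume "x' = Zero C (Lo e1) (Lo W \<boxtimes> Y)"
      then have "(\<eta> W \<diamondop> i Y) \<cdot> x = (\<eta> W \<diamondop> i Y) \<cdot> Zero C e1 (W \<boxtimes> Y)" using x(3) by simp
      then show "x = Zero C e1 (W \<boxtimes> Y)"
        by (rule iso_left_cancel[OF eta_tensor_iso(1)[OF W Y], rotated -1]) (use x in simp_all)
    next
      assume "x = Zero C e1 (W \<boxtimes> Y)"
      then have "x' \<cdot> \<eta> e1 = Zero C (Lo e1) (Lo W \<boxtimes> Y) \<cdot> \<eta> e1" using x(3) by simp
      then show "x' = Zero C (Lo e1) (Lo W \<boxtimes> Y)"
        by (rule local_ext_unique[OF x(2) _ local_tensor[OF _ Y] unit_obj, rotated -1]) simp_all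
    qed
    have "((La f \<diamondop> i Y) \<cdot> t') \<cdot> \<eta> e1 = (La f \<diamondop> i Y) \<cdot> (\<eta> ?A \<diamondop> i Y) \<cdot> t" using e by simp
    also have "\<dots> = ((La f \<diamondop> i Y) \<cdot> (\<eta> ?A \<diamondop> i Y)) \<cdot> t" by (rule assoc[symmetric]) simp_all
    also have "\<dots> = (\<eta> ?B \<diamondop> i Y) \<cdot> (f \<diamondop> i Y) \<cdot> t" unfolding nat by simp
    finally have "((La f \<diamondop> i Y) \<cdot> t') \<cdot> \<eta> e1 = (\<eta> ?B \<diamondop> i Y) \<cdot> (f \<diamondop> i Y) \<cdot> t" .
    then show ?thesis using z[of "(f \<diamondop> i Y) \<cdot> t" ?B "(La f \<diamondop> i Y) \<cdot> t'"] z[OF t t' e] by simp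
  qed
  have ex1: "\<exists>t'\<in>homset C (Lo e1) (Lo ?A \<boxtimes> Y). t' \<cdot> \<eta> e1 = (\<eta> ?A \<diamondop> i Y) \<cdot> t" if "t \<in> homset C e1 (?A \<boxtimes> Y)" for t
    using local_ext[of "(\<eta> ?A \<diamondop> i Y) \<cdot> t" e1 "Lo ?A \<boxtimes> Y"] that loc by simp
  have ex2: "\<exists>t\<in>homset C e1 (?A \<boxtimes> Y). t' \<cdot> \<eta> e1 = (\<eta> ?A \<diamondop> i Y) \<cdot> t" if "t' \<in> homset C (Lo e1) (Lo ?A \<boxtimes> Y)" for t'
    using that isoA by (intro bexI[of _ "inv_arr C (\<eta> ?A \<diamondop> i Y) \<cdot> t' \<cdot> \<eta> e1"]) simp_all
  have "LT.tensor_injective (La f) Y \<longleftrightarrow> (\<forall>t'\<in>homset C (Lo e1) (Lo ?A \<boxtimes> Y).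
      (La f \<diamondop> i Y) \<cdot> t' = Zero C (Lo e1) (Lo ?B \<boxtimes> Y) \<longrightarrow> t' = Zero C (Lo e1) (Lo ?A \<boxtimes> Y))"
    unfolding LT.tensor_injective_def using loc by (simp add: homset_LT del: in_homset_iff)
  also have "\<dots> \<longleftrightarrow> tensor_injective f Y"
    unfolding tensor_injective_def
  proof (intro iffI ballI impI)
    fix t assume a1: "\<forall>t'\<in>homset C (Lo e1) (Lo ?A \<boxtimes> Y).
      (La f \<diamondop> i Y) \<cdot> t' = Zero C (Lo e1) (Lo ?B \<boxtimes> Y) \<longrightarrow> t' = Zero C (Lo e1) (Lo ?A \<boxtimes> Y)"
      and t: "t \<in> homset C e1 (?A \<boxtimes> Y)" and ft: "(f \<diamondop> i Y) \<cdot> t = Zero C e1 (?B \<boxtimes> Y)"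
    obtain t' where t': "t' \<in> homset C (Lo e1) (Lo ?A \<boxtimes> Y)" "t' \<cdot> \<eta> e1 = (\<eta> ?A \<diamondop> i Y) \<cdot> t" using ex1[OF t] by blast
    show "t = Zero C e1 (?A \<boxtimes> Y)" using rel[OF t t'] a1 t'(1) ft by blast
  next
    fix t' assume a2: "\<forall>t\<in>homset C e1 (?A \<boxtimes> Y). (f \<diamondop> i Y) \<cdot> t = Zero C e1 (?B \<boxtimes> Y) \<longrightarrow> t = Zero C e1 (?A \<boxtimes> Y)"
      and t': "t' \<in> homset C (Lo e1) (Lo ?A \<boxtimes> Y)" and ft: "(La f \<diamondop> i Y) \<cdot> t' = Zero C (Lo e1) (Lo ?B \<boxtimes> Y)"
    obtain t where t: "t \<in> homset C e1 (?A \<boxtimes> Y)" "t' \<cdot> \<eta> e1 = (\<eta> ?A \<diamondop> i Y) \<cdot> t" using ex2[OF t'] by blast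
    show "t' = Zero C (Lo e1) (Lo ?A \<boxtimes> Y)" using rel[OF t(1) t' t(2)] a2 t(1) ft by blast
  qed
  finally show ?thesis .
qed

theorem local_part_definable:
  assumes D: "definable U C D"
  shows "definable U LT (local_part C \<eta> D)"
    "dual_definable U LT (local_part C \<eta> D) = local_part C \<eta> (dual_definable U C D)"
proof -
  interpret LT: dualizable_tt U LT by (rule dualizable_LT)
  obtain \<Phi> where \<Phi>: "small U \<Phi>" "\<Phi> \<subseteq> compact_arrs U C"
    and D: "D = {X \<in> Obj C. \<forall>f\<in>\<Phi>. hom_image C f X = homset C (Dom C f) X}"
    using D unfolding definable_def by blast
  have \<Phi>A: "\<Phi> \<subseteq> Arr C" using \<Phi>(2) by (auto simp: compact_arrs_def)
  have small: "small U (La ` \<Phi>)" using \<Phi>(1) card_of_image ordLeq_ordLess_trans unfolding small_def by blast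
  have comp: "La ` \<Phi> \<subseteq> compact_arrs U LT"
  proof
    fix g assume "g \<in> La ` \<Phi>"
    then obtain f where f: "f \<in> \<Phi>" "g = La f" by blast
    have fA: "f \<in> Arr C" "compact_obj U C (Dom C f)" "compact_obj U C (Cod C f)" using f \<Phi>(2) by (auto simp: compact_arrs_def)
    then show "g \<in> compact_arrs U LT" unfolding f(2) compact_arrs_def using compact_LT[OF fA(2)] compact_LT[OF fA(3)] by simp
  qed
  note eq = local_part_eq[OF \<Phi>A, folded D]
  show "definable U LT (local_part C \<eta> D)" unfolding definable_def using small comp eq by blast
  have "dual_definable U LT (local_part C \<eta> D) = {Y \<in> Obj LT. \<forall>f\<in>La ` \<Phi>. LT.tensor_injective f Y}"
    by (rule LT.dual_definable_eq[OF small comp eq])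
  also have "\<dots> = {Y. local Y \<and> (\<forall>f\<in>\<Phi>. tensor_injective f Y)}" using tensor_injective_LT \<Phi>A by auto
  also have "\<dots> = local_part C \<eta> (dual_definable U C D)"
    unfolding dual_definable_eq[OF \<Phi> D] local_part_def by auto
  finally show "dual_definable U LT (local_part C \<eta> D) = local_part C \<eta> (dual_definable U C D)" .
qed

end

text \<open>Additivity and the triangles come from exactness of the tensor product; duals and
  compactness of the unit come from the coincidence of compact and rigid objects.\<close>

lemma big_tt_dualizable:
  assumes "universe U" "big_tt_category U C"
  shows "dualizable_tt U C"
proof -
  interpret big_tt_category U C by (rule assms(2))
  have add: "(f \<boxplus>\<^bsub>C\<^esub> g) \<diamondop>\<^bsub>C\<^esub> Id C Y = f \<diamondop>\<^bsub>C\<^esub> Id C Y \<boxplus>\<^bsub>C\<^esub> g \<diamondop>\<^bsub>C\<^esub> Id C Y"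
    "Id C Y \<diamondop>\<^bsub>C\<^esub> (f \<boxplus>\<^bsub>C\<^esub> g) = Id C Y \<diamondop>\<^bsub>C\<^esub> f \<boxplus>\<^bsub>C\<^esub> Id C Y \<diamondop>\<^bsub>C\<^esub> g"
    if f: "f \<in> homset C X X'" "g \<in> homset C X X'" and Y: "Y \<in> Obj C" for f g X X' Y
  proof -
    have X: "X \<in> Obj C" "X' \<in> Obj C" using f by auto
    have "(\<lambda>f. f \<diamondop>\<^bsub>C\<^esub> Id C Y) \<in> hom (hom_group C X X') (hom_group C (X \<boxtimes>\<^bsub>C\<^esub> Y) (X' \<boxtimes>\<^bsub>C\<^esub> Y))"
      "(\<lambda>f. Id C Y \<diamondop>\<^bsub>C\<^esub> f) \<in> hom (hom_group C X X') (hom_group C (Y \<boxtimes>\<^bsub>C\<^esub> X) (Y \<boxtimes>\<^bsub>C\<^esub> X'))"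
      using tensor_exact_left[OF Y] tensor_exact_right[OF Y] X
      unfolding exact_functor_def additive_functor_def by simp_all
    then show "(f \<boxplus>\<^bsub>C\<^esub> g) \<diamondop>\<^bsub>C\<^esub> Id C Y = f \<diamondop>\<^bsub>C\<^esub> Id C Y \<boxplus>\<^bsub>C\<^esub> g \<diamondop>\<^bsub>C\<^esub> Id C Y"
      "Id C Y \<diamondop>\<^bsub>C\<^esub> (f \<boxplus>\<^bsub>C\<^esub> g) = Id C Y \<diamondop>\<^bsub>C\<^esub> f \<boxplus>\<^bsub>C\<^esub> Id C Y \<diamondop>\<^bsub>C\<^esub> g"
      using f unfolding hom_def hom_group_def by (simp_all del: in_homset_iff)
  qed
  have tri: "\<exists>h'. (f \<diamondop>\<^bsub>C\<^esub> Id C Y, g \<diamondop>\<^bsub>C\<^esub> Id C Y, h') \<in> Tri C" if t: "(f, g, h) \<in> Tri C" and Y: "Y \<in> Obj C" for f g h Y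
    using tensor_exact_left[OF Y] t unfolding exact_functor_def by fastforce
  show ?thesis
    by unfold_locales
      (use assms(1) add tri compact_iff_rigid rigid_unit rigid_dual_pair in \<open>simp_all del: in_homset_iff\<close>)
qed

theorem corollary9p13:
  fixes U :: "'u itself"
    and T :: "('o, 'm) tt_category"
    and L :: "('o, 'm, 'o, 'm) cat_functor"
    and \<eta> :: "'o \<Rightarrow> 'm"
    and D :: "'o set"
  assumes "universe U"
    and "big_tt_category U T"
    and "smashing_localisation U T L \<eta>"
    and "definable U T D"
  shows "definable U (local_category T L \<eta>) (local_part T \<eta> D) \<and>
         dual_definable U (local_category T L \<eta>) (local_part T \<eta> D) =
           local_part T \<eta> (dual_definable U T D)"
proof -
  interpret smashing_tt U T L \<eta>
    using big_tt_dualizable[OF assms(1,2)] assms(3) by (rule smashing_tt.intro)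
  show ?thesis using local_part_definable[OF assms(4)] by blast
qed

end
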